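(* If $D$ is a $3$-dicritical oriented graph, then \[ m(D) \geq \frac{7\,n(D)+2}{3}. \]
   Context: Digraphs are finite, have no loops and no parallel arcs; two opposite arcs $xy$ and $yx$ are allowed. For a digraph $D$, $n(D)$ is its number of vertices and $m(D)$ its number of arcs. An oriented graph is a digraph with no pair of opposite arcs (no directed cycle of length $2$). A digraph $D'$ is a subdigraph of $D$ if $V(D')\subseteq V(D)$ and $A(D')\subseteq A(D)$; it is proper if $V(D')\neq V(D)$ or $A(D')\neq A(D)$. A $k$-dicolouring of a digraph is a colouring of its vertices with colours in $\{1,\dots,k\}$ such that each colour class induces an acyclic subdigraph (no directed cycle, where a pair of opposite arcs counts as a directed cycle of length $2$). The dichromatic number $\vec{\chi}(D)$ is the least $k$ such that $D$ has a $k$-dicolouring. A digraph $D$ is $k$-dicritical if $\vec{\chi}(D)=k$ and $\vec{\chi}(D')<k$ for every proper subdigraph $D'$ of $D$. *)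

theory Defs
  imports Complex_Main "Graph_Theory.Digraph_Component"
begin

locale oriented_graph = digraph +
  assumes no_opposite_arcs: "(u, v) \<in> arcs_ends G \<Longrightarrow> (v, u) \<notin> arcs_ends G"

text \<open>
  In \<^const>\<open>pre_digraph.cycle\<close> a cycle is a non-empty closed directed walk along arcs
  that repeats no vertex; its length may be 2, so a pair of opposite arcs is a cycle.
\<close>
definition acyclic_digraph :: "('a, 'b) pre_digraph \<Rightarrow> bool" where
  "acyclic_digraph G \<longleftrightarrow> (\<nexists>p. pre_digraph.cycle G p)"

definition dicolouring :: "nat \<Rightarrow> ('a, 'b) pre_digraph \<Rightarrow> ('a \<Rightarrow> nat) \<Rightarrow> bool" where
  "dicolouring k G c \<longleftrightarrow>
     (\<forall>v \<in> verts G. c v \<in> {1..k}) \<and>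
     (\<forall>i \<in> {1..k}. acyclic_digraph (G \<restriction> {v \<in> verts G. c v = i}))"

text \<open>
  The minimum is over a non-empty set whenever \<open>G\<close> is finite and loopfree, since
  assigning distinct colours to the vertices is then a dicolouring.
\<close>
definition dichromatic_number :: "('a, 'b) pre_digraph \<Rightarrow> nat" where
  "dichromatic_number G = (LEAST k. \<exists>c. dicolouring k G c)"

definition proper_subdigraph :: "('a, 'b) pre_digraph \<Rightarrow> ('a, 'b) pre_digraph \<Rightarrow> bool" where
  "proper_subdigraph H G \<longleftrightarrow> subgraph H G \<and> (verts H \<noteq> verts G \<or> arcs H \<noteq> arcs G)"

definition dicritical :: "nat \<Rightarrow> ('a, 'b) pre_digraph \<Rightarrow> bool" where
  "dicritical k G \<longleftrightarrow>
     dichromatic_number G = k \<and>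
     (\<forall>H. proper_subdigraph H G \<longrightarrow> dichromatic_number H < k)"

end

theory Submission
  imports Defs
begin

text \<open>
  The proof is by the potential method. For a digraph with \<open>n\<close> vertices, \<open>m\<close> arcs and a matching of \<open>s\<close>
  digons consider \<open>7 n - 3 m - 2 s\<close>. Every critical digraph has a matching of digons for which this is at
  most \<open>-2\<close>, unless it is an odd bidirected cycle (where the value is \<open>1\<close>) or an odd 3-wheel (where it is
  \<open>-1\<close>); oriented graphs contain no digon, so for them the bound is the theorem. Suppose that a smallest
  counterexample is given. Contracting the two colour classes of a proper set \<open>R\<close> of vertices to the ends of
  a new digon gives a smaller non-colourable digraph, so by minimality every proper set of vertices has
  potential at least \<open>4\<close>. This forbids almost every configuration around vertices of out-degree or
  in-degree two. Every arc from a vertex of out-degree two to a vertex of in-degree two is then either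
  isolated or comes with an exceptional digraph built on its neighbourhood, in which a vertex of large
  degree incident with a digon can pay for it. The resulting count of arcs leaves only digraphs without
  digons and with almost no excess degree, and these are coloured directly.
\<close>

section \<open>Digraphs as relations\<close>

text \<open>Contracting the colour classes of a set creates digons, so an induction confined to
  oriented graphs breaks at its first step; the bound has to be stated for all critical digraphs.
  For these \<open>7 n - 3 m\<close> alone fails: an odd bidirected cycle has
  \<open>m = 2 n\<close>, hence value \<open>n\<close>. Its largest matching has
  \<open>(n - 1) / 2\<close> digons, and the weight \<open>2\<close> brings the value down to the
  constant \<open>1\<close>. Replacing a digon by a path of three digons adds two vertices, four
  arcs and one matching digon, and \<open>14 - 12 - 2 = 0\<close>; so both exceptional families have
  constant value. The threshold \<open>4\<close> is \<open>-1 + 5\<close>: a contraction returning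
  an odd bidirected cycle through the new digon lowers the potential by \<open>5\<close>, since
  \<open>1 - 14 + 6 + 2 = -5\<close>, and every other outcome lowers it by at least
  \<open>6\<close>. The delicate case is therefore equality at \<open>4\<close>, which counting does
  not settle and structure must.\<close>

abbreviation outs :: "('a \<times> 'a) set \<Rightarrow> 'a \<Rightarrow> 'a set"
  where "outs A v \<equiv> A `` {v}"

abbreviation ins :: "('a \<times> 'a) set \<Rightarrow> 'a \<Rightarrow> 'a set"
  where "ins A v \<equiv> A\<inverse> `` {v}"

definition del :: "'a \<Rightarrow> ('a \<times> 'a) set \<Rightarrow> ('a \<times> 'a) set"
  where "del v A = {(a, b) \<in> A. a \<noteq> v \<and> b \<noteq> v}"

definition monochrom :: "('a \<Rightarrow> bool) \<Rightarrow> ('a \<times> 'a) set \<Rightarrow> ('a \<times> 'a) set"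
  where "monochrom c A = {(u, v) \<in> A. c u = c v}"

text \<open>Two colours are at stake throughout, so a colouring is a Boolean function, and both
  classes are tested at once through the monochromatic arcs.\<close>

definition colourable :: "('a \<times> 'a) set \<Rightarrow> bool"
  where "colourable A \<longleftrightarrow> (\<exists>c. acyclic (monochrom c A))"

text \<open>The 3-dicritical digraphs as arc relations, with \<open>Field A\<close> as vertex set,
  so that proper subdigraphs are proper subsets of arcs. Isolated vertices, which the relation
  cannot see, do not occur in dicritical digraphs.\<close>

definition critical :: "('a \<times> 'a) set \<Rightarrow> bool"
  where "critical A \<longleftrightarrow> finite A \<and> irrefl A \<and> \<not> colourable A \<and> (\<forall>B. B \<subset> A \<longrightarrow> colourable B)"

lemma monochrom_mono: "B \<subseteq> A \<Longrightarrow> monochrom c B \<subseteq> monochrom c A"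
  by (auto simp: monochrom_def)

lemma colourable_subset: "colourable A \<Longrightarrow> B \<subseteq> A \<Longrightarrow> colourable B"
  unfolding colourable_def by (meson acyclic_subset monochrom_mono)

lemma colourableI: "acyclic (monochrom c A) \<Longrightarrow> colourable A"
  by (auto simp: colourable_def)

text \<open>A closed walk in \<open>S\<close> either stays in one fibre of \<open>f\<close> or
  projects to a closed walk between distinct images. Colourings of contracted digraphs are lifted in
  this way.\<close>

lemma acyclic_contract:
  assumes fibre: "acyclic {(u, v) \<in> S. f u = f v}"
    and image: "acyclic {(f u, f v) | u v. (u, v) \<in> S \<and> f u \<noteq> f v}"
  shows "acyclic S"
proof -
  define I where "I = {(u, v) \<in> S. f u = f v}"
  define T where "T = {(f u, f v) | u v. (u, v) \<in> S \<and> f u \<noteq> f v}"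
  have I: "(u, v) \<in> I" if "(u, v) \<in> S" "f u = f v" for u v
    using that by (auto simp: I_def)
  have T: "(f u, f v) \<in> T" if "(u, v) \<in> S" "f u \<noteq> f v" for u v
    using that by (auto simp: T_def)
  have *: "(f u, f v) \<in> T\<^sup>+ \<or> (f u = f v \<and> (u, v) \<in> I\<^sup>+)" if "(u, v) \<in> S\<^sup>+" for u v
    using that
  proof (induction rule: trancl_induct)
    case (base y)
    then show ?case by (cases "f u = f y") (simp_all add: I T r_into_trancl)
  next
    case (step y z)
    show ?case
    proof (cases "f y = f z")
      case True
      then have "(y, z) \<in> I" using step I by simp
      then show ?thesis using step.IH True trancl_into_trancl[of u y I z] by auto
    next
      case False
      then have yz: "(f y, f z) \<in> T" using step T by simp
      show ?thesis using step.IH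
      proof
        assume "(f u, f y) \<in> T\<^sup>+"
        from trancl_into_trancl[OF this yz] show ?thesis by simp
      next
        assume "f u = f y \<and> (u, y) \<in> I\<^sup>+"
        then show ?thesis using yz by (simp add: r_into_trancl)
      qed
    qed
  qed
  have "(x, x) \<notin> I\<^sup>+" "(y, y) \<notin> T\<^sup>+" for x y
    using fibre image unfolding acyclic_def I_def[symmetric] T_def[symmetric] by simp_all
  then have "(x, x) \<notin> S\<^sup>+" for x using *[of x x] by auto
  then show ?thesis unfolding acyclic_def by simp
qed

lemma acyclic_sink:
  assumes "acyclic (del v S)" "outs S v = {}"
  shows "acyclic S"
proof -
  have v: "(v, b) \<notin> S" for b using assms(2) by auto
  have *: "(a, b) \<in> (del v S)\<^sup>+ \<or> b = v" if "(a, b) \<in> S\<^sup>+" for a b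
    using that
  proof (induction rule: trancl_induct)
    case (base y)
    then have "a \<noteq> v" using v by auto
    then have "(a, y) \<in> del v S \<or> y = v" using base by (simp add: del_def)
    then show ?case by (auto intro: r_into_trancl)
  next
    case (step y z)
    then have "y \<noteq> v" using v by auto
    then have "(y, z) \<in> del v S \<or> z = v" using step by (simp add: del_def)
    then show ?case using step.IH \<open>y \<noteq> v\<close> trancl_into_trancl[of a y "del v S" z] by auto
  qed
  have v': "(v, b) \<notin> S\<^sup>+" for b using v tranclD[of v b S] by auto
  have "(x, x) \<notin> S\<^sup>+" for x
    using assms(1) *[of x x] v'[of x] unfolding acyclic_def by auto
  then show ?thesis unfolding acyclic_def by simp
qed

lemma acyclic_source:
  assumes "acyclic (del v S)" "ins S v = {}"
  shows "acyclic S"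
proof -
  have "acyclic (S\<inverse>)"
  proof (rule acyclic_sink)
    have "del v (S\<inverse>) = (del v S)\<inverse>" by (auto simp: del_def)
    then show "acyclic (del v (S\<inverse>))" using assms(1) by simp
  qed (use assms(2) in auto)
  then show ?thesis by simp
qed

lemma monochrom_del_upd: "monochrom (c(v := b)) (del v A) = monochrom c (del v A)"
  by (auto simp: monochrom_def del_def)

lemma del_monochrom: "del v (monochrom c A) = monochrom c (del v A)"
  by (auto simp: monochrom_def del_def)

lemma del_Field: "Field (del v A) \<subseteq> Field A - {v}"
  by (auto simp: del_def Field_def)

lemma del_subset: "del v A \<subseteq> A"
  by (auto simp: del_def)

text \<open>A vertex that differs in colour from all its out-neighbours is a sink of its class,
  hence on no monochromatic cycle; it can be coloured last.\<close>

lemma colour_sink: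
  assumes "acyclic (monochrom c (del v A))" "\<And>w. (v, w) \<in> A \<Longrightarrow> c w \<noteq> c v"
  shows "acyclic (monochrom c A)"
proof (rule acyclic_sink[of v])
  show "acyclic (del v (monochrom c A))" using assms(1) by (simp only: del_monochrom)
  show "outs (monochrom c A) v = {}" using assms(2) unfolding monochrom_def by fastforce
qed

lemma colour_source:
  assumes "acyclic (monochrom c (del v A))" "\<And>w. (w, v) \<in> A \<Longrightarrow> c w \<noteq> c v"
  shows "acyclic (monochrom c A)"
proof (rule acyclic_source[of v])
  show "acyclic (del v (monochrom c A))" using assms(1) by (simp only: del_monochrom)
  show "ins (monochrom c A) v = {}" using assms(2) unfolding monochrom_def by fastforce
qed

lemma monochrom_converse: "monochrom c (A\<inverse>) = (monochrom c A)\<inverse>"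
  by (auto simp: monochrom_def)

lemma colourable_converse [simp]: "colourable (A\<inverse>) = colourable A"
  unfolding colourable_def monochrom_converse by simp

lemma critical_converse:
  assumes "critical A" shows "critical (A\<inverse>)"
proof -
  have "colourable B" if "B \<subset> A\<inverse>" for B
  proof -
  have "B \<subset> A\<inverse>" by fact
  then have "B\<inverse> \<subseteq> A \<and> B\<inverse> \<noteq> A" by (metis converse_converse converse_mono psubset_eq)
  then have "colourable (B\<inverse>)" using assms unfolding critical_def by blast
  then show "colourable B" by simp
  qed
  moreover have "finite (A\<inverse>)" "irrefl (A\<inverse>)" "\<not> colourable (A\<inverse>)"
    using assms unfolding critical_def irrefl_def by simp_all
  ultimately show ?thesis unfolding critical_def by blast
qed

lemma Field_converse' [simp]: "Field (A\<inverse>) = Field A"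
  by (auto simp: Field_def)

lemma critical_finite: "critical A \<Longrightarrow> finite A"
  by (auto simp: critical_def)

lemma critical_finite_Field: "critical A \<Longrightarrow> finite (Field A)"
  by (simp add: critical_finite finite_Field)

lemma critical_irrefl: "critical A \<Longrightarrow> (a, a) \<notin> A"
  by (auto simp: critical_def irrefl_def)

lemma critical_not_colourable: "critical A \<Longrightarrow> \<not> colourable A"
  by (auto simp: critical_def)

lemma critical_subset: "critical A \<Longrightarrow> B \<subseteq> A \<Longrightarrow> B \<noteq> A \<Longrightarrow> colourable B"
  by (auto simp: critical_def)

lemma critical_nonempty: "critical A \<Longrightarrow> A \<noteq> {}"
  using critical_not_colourable[of A]
  by (auto simp: colourable_def monochrom_def acyclic_def)

lemma ex_critical:
  assumes "finite A" "irrefl A" "\<not> colourable A"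
  obtains W where "W \<subseteq> A" "critical W"
proof -
  let ?P = "\<lambda>W. W \<subseteq> A \<and> \<not> colourable W"
  obtain W where W: "?P W" "\<And>W'. ?P W' \<Longrightarrow> card W \<le> card W'"
    using ex_has_least_nat[of ?P A card] assms(3) by auto
  have "finite W" using W(1) assms(1) finite_subset by blast
  have "critical W"
    unfolding critical_def
  proof (intro conjI allI impI)
    fix B assume "B \<subset> W"
    then have "card B < card W" using \<open>finite W\<close> by (simp add: psubset_card_mono)
    moreover have "B \<subseteq> A" using W(1) \<open>B \<subset> W\<close> by blast
    ultimately show "colourable B" using W(2)[of B] by linarith
    next
    show "irrefl W" using W assms(2) unfolding irrefl_def by blast
  qed (use W \<open>finite W\<close> in simp_all)
  then show ?thesis using that W by blast
qed

text \<open>A vertex with at most one out-neighbour could be coloured last, opposite to that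
  neighbour, after colouring the rest by minimality.\<close>

lemma critical_outdeg:
  assumes "critical A" "v \<in> Field A"
  shows "2 \<le> card (outs A v)"
proof (rule ccontr)
  assume "\<not> 2 \<le> card (outs A v)"
  moreover have fin: "finite (outs A v)" using critical_finite[OF assms(1)] by auto
  ultimately have "\<exists>w. w \<noteq> v \<and> outs A v \<subseteq> {w} \<or> outs A v = {}"
  proof -
    have "card (outs A v) = 0 \<or> card (outs A v) = 1" using \<open>\<not> 2 \<le> card (outs A v)\<close> by linarith
    then show ?thesis
    proof
      assume "card (outs A v) = 0"
      then show ?thesis using fin by auto
    next
      assume "card (outs A v) = 1"
      then obtain w where w: "outs A v = {w}" by (rule card_1_singletonE)
      then have "w \<noteq> v" using critical_irrefl[OF assms(1)] by auto
      then show ?thesis using w by auto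
    qed
  qed
  then obtain w where w: "\<And>x. x \<in> outs A v \<Longrightarrow> x = w \<and> w \<noteq> v" by blast
  have "del v A \<noteq> A" using assms(2) del_Field[of v A] by fastforce
  then obtain c where c: "acyclic (monochrom c (del v A))"
    using critical_subset[OF assms(1) del_subset] by (auto simp: colourable_def)
  have "acyclic (monochrom (c(v := \<not> c w)) A)"
    by (rule colour_sink[of _ v]) (use c w in \<open>auto simp: monochrom_del_upd\<close>)
  then show False using critical_not_colourable[OF assms(1)] colourableI by blast
qed

lemma critical_indeg:
  assumes "critical A" "v \<in> Field A"
  shows "2 \<le> card (ins A v)"
  using critical_outdeg[OF critical_converse[OF assms(1)]] assms(2) by simp

lemma critical_eq: "critical A \<Longrightarrow> critical B \<Longrightarrow> A \<subseteq> B \<Longrightarrow> A = B"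
  by (metis critical_not_colourable critical_subset)

section \<open>Matchings of digons\<close>

text \<open>A digon is represented in a matching by one of its two arcs.\<close>

definition matching :: "('a \<times> 'a) set \<Rightarrow> ('a \<times> 'a) set \<Rightarrow> bool"
  where "matching A M \<longleftrightarrow> M \<subseteq> A \<inter> A\<inverse> \<and>
    (\<forall>e \<in> M. \<forall>e' \<in> M. e \<noteq> e' \<longrightarrow> {fst e, snd e} \<inter> {fst e', snd e'} = {})"

lemma matching_empty [simp]: "matching A {}"
  by (simp add: matching_def)

lemma matching_sub: "matching A M \<Longrightarrow> M' \<subseteq> M \<Longrightarrow> matching A M'"
  unfolding matching_def by blast

lemma matching_transfer: "matching A M \<Longrightarrow> M \<subseteq> B \<inter> B\<inverse> \<Longrightarrow> matching B M"
  unfolding matching_def by blast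

lemma matching_Field: "matching A M \<Longrightarrow> Field M \<subseteq> Field A"
  unfolding matching_def Field_def by auto

lemma matching_finite: "matching A M \<Longrightarrow> finite A \<Longrightarrow> finite M"
  unfolding matching_def by (meson finite_Int finite_subset)

lemma matching_insert:
  assumes "matching A M" "(a, b) \<in> A" "(b, a) \<in> A" "a \<notin> Field M" "b \<notin> Field M"
  shows "matching A (insert (a, b) M)"
proof -
  have *: "a \<notin> {fst e, snd e} \<and> b \<notin> {fst e, snd e}" if "e \<in> M" for e
  proof -
    have "fst e \<in> Field M" "snd e \<in> Field M" using that by (cases e; auto simp: Field_def)+
    then show ?thesis using assms by auto
  qed
  have "{fst e, snd e} \<inter> {fst e', snd e'} = {}"
    if h: "e \<in> insert (a, b) M" "e' \<in> insert (a, b) M" "e \<noteq> e'" for e e'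
  proof -
    consider "e \<in> M" "e' \<in> M" | "e = (a, b)" "e' \<in> M" | "e \<in> M" "e' = (a, b)"
      using h by blast
    then show ?thesis
    proof cases
      case 1
      then show ?thesis using assms(1) h(3) unfolding matching_def by simp
    next
      case 2
      then show ?thesis using *[of e'] by auto
    next
      case 3
      then show ?thesis using *[of e] by auto
    qed
  qed
  moreover have "insert (a, b) M \<subseteq> A \<inter> A\<inverse>" using assms(1-3) unfolding matching_def by simp
  ultimately show ?thesis unfolding matching_def by blast
qed

lemma matching_insert_card:
  assumes "matching A M" "finite M" "a \<notin> Field M"
  shows "card (insert (a, b) M) = card M + 1"
proof -
  have "(a, b) \<notin> M" using assms by (auto simp: Field_def)
  then show ?thesis using assms by simp
qed

lemma matching_Un:
  assumes "matching A M" "matching A N" "Field M \<inter> Field N = {}"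
  shows "matching A (M \<union> N)"
proof -
  have *: "{fst e, snd e} \<inter> {fst e', snd e'} = {}" if "e \<in> M" "e' \<in> N" for e e'
  proof -
    have "fst e \<in> Field M" "snd e \<in> Field M" "fst e' \<in> Field N" "snd e' \<in> Field N"
      using that by (cases e; cases e'; auto simp: Field_def)+
    then show ?thesis using assms(3) by auto
  qed
  have "{fst e, snd e} \<inter> {fst e', snd e'} = {}" if h: "e \<in> M \<union> N" "e' \<in> M \<union> N" "e \<noteq> e'" for e e'
  proof -
    consider "e \<in> M" "e' \<in> M" | "e \<in> N" "e' \<in> N" | "e \<in> M" "e' \<in> N" | "e' \<in> M" "e \<in> N"
      using h(1,2) by blast
    then show ?thesis
    proof cases
      case 1
      then show ?thesis using assms(1) h(3) unfolding matching_def by simp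
    next
      case 2
      then show ?thesis using assms(2) h(3) unfolding matching_def by simp
    next
      case 3
      then show ?thesis by (rule *)
    next
      case 4
      then show ?thesis using *[of e' e] by (simp add: inf_commute)
    qed
  qed
  moreover have "M \<union> N \<subseteq> A \<inter> A\<inverse>" using assms(1,2) unfolding matching_def by simp
  ultimately show ?thesis unfolding matching_def by blast
qed

lemma matching_Un_card:
  assumes "finite M" "finite N" "Field M \<inter> Field N = {}"
  shows "card (M \<union> N) = card M + card N"
proof -
  have "M \<inter> N = {}" using assms(3) by (auto simp: Field_def)
  then show ?thesis using assms by (simp add: card_Un_disjoint)
qed

lemma matching_unique:
  assumes "matching A M" "(a, b) \<in> M" "(c, d) \<in> M" "{a, b} \<inter> {c, d} \<noteq> {}"
  shows "a = c \<and> b = d"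
proof (rule ccontr)
  assume "\<not> (a = c \<and> b = d)"
  then have "(a, b) \<noteq> (c, d)" by simp
  then have "{fst (a, b), snd (a, b)} \<inter> {fst (c, d), snd (c, d)} = {}"
    using assms(1-3) unfolding matching_def by blast
  then show False using assms(4) by simp
qed

definition mdel :: "'a \<Rightarrow> ('a \<times> 'a) set \<Rightarrow> ('a \<times> 'a) set"
  where "mdel x M = {e \<in> M. fst e \<noteq> x \<and> snd e \<noteq> x}"

lemma mdel_matching: "matching A M \<Longrightarrow> matching A (mdel x M)"
  by (rule matching_sub) (auto simp: mdel_def)

lemma mdel_Field: "Field (mdel x M) \<subseteq> Field M - {x}"
  by (auto simp: mdel_def Field_def)

text \<open>At most one edge of a matching meets \<open>x\<close>, so freeing a vertex costs at most
  \<open>2\<close> in the potential.\<close>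

lemma mdel_card:
  assumes "matching A M" "finite M"
  shows "card M \<le> card (mdel x M) + 1"
proof (cases "\<exists>e\<in>M. x \<in> {fst e, snd e}")
  case True
  then obtain e where e: "e \<in> M" "x \<in> {fst e, snd e}" by blast
  have "M \<subseteq> insert e (mdel x M)"
  proof
    fix e' assume "e' \<in> M"
    show "e' \<in> insert e (mdel x M)"
    proof (cases "e' = e")
      case False
      then have "{fst e, snd e} \<inter> {fst e', snd e'} = {}"
        using assms(1) e(1) \<open>e' \<in> M\<close> unfolding matching_def by metis
      then show ?thesis using e(2) \<open>e' \<in> M\<close> by (auto simp: mdel_def)
    qed simp
  qed
  then have "card M \<le> card (insert e (mdel x M))"
    using assms(2) by (intro card_mono) (auto simp: mdel_def)
  also have "\<dots> \<le> card (mdel x M) + 1" by (simp add: card_insert_le_m1 card_insert_if assms(2) mdel_def)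
  finally show ?thesis .
next
  case False
  then have "mdel x M = M" by (auto simp: mdel_def)
  then show ?thesis by simp
qed

lemma mdel_id: "x \<notin> Field M \<Longrightarrow> mdel x M = M"
  unfolding mdel_def Field_def by force

lemma mdel_finite: "finite M \<Longrightarrow> finite (mdel x M)"
  by (simp add: mdel_def)

lemma matching_converse: "matching A M \<Longrightarrow> matching (A\<inverse>) M"
  unfolding matching_def by blast

section \<open>Odd bidirected cycles and odd 3-wheels\<close>

text \<open>Starting from the bidirected triangle (kind \<open>1\<close>) or from a directed triangle with a vertex joined
  to it by three digons (kind \<open>-1\<close>), a digon may be replaced by a bidirected path with three digons.\<close>

inductive special :: "int \<Rightarrow> ('a \<times> 'a) set \<Rightarrow> bool" where
  triangle: "distinct [a, b, c] \<Longrightarrow> special 1 {(a, b), (b, a), (b, c), (c, b), (a, c), (c, a)}"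
| wheel: "distinct [z, a, b, c] \<Longrightarrow>
    special (-1) {(a, b), (b, c), (c, a), (z, a), (a, z), (z, b), (b, z), (z, c), (c, z)}"
| subdivide: "special k A \<Longrightarrow> (a, b) \<in> A \<Longrightarrow> (b, a) \<in> A \<Longrightarrow> p \<notin> Field A \<Longrightarrow> q \<notin> Field A \<Longrightarrow> p \<noteq> q \<Longrightarrow>
    special k (A - {(a, b), (b, a)} \<union> {(a, p), (p, a), (p, q), (q, p), (q, b), (b, q)})"

lemma special_kind: "special k A \<Longrightarrow> k = 1 \<or> k = -1"
  by (induction rule: special.induct) auto

lemma special_finite: "special k A \<Longrightarrow> finite A"
  by (induction rule: special.induct) auto

lemma special_irrefl: "special k A \<Longrightarrow> (x, x) \<notin> A"
  by (induction arbitrary: x rule: special.induct) (auto simp: Field_def)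

text \<open>A digon at \<open>x\<close> is kept out of an optimal matching by means of another
  out-arc of \<open>x\<close>: if that one lies in a digon, this digon is put into the matching,
  otherwise \<open>x\<close> is left uncovered.\<close>

lemma special_other_out: "special k A \<Longrightarrow> (x, y) \<in> A \<Longrightarrow> \<exists>y'. y' \<noteq> y \<and> (x, y') \<in> A"
proof (induction arbitrary: x y rule: special.induct)
  case (triangle a b c)
  then consider "x = a" | "x = b" | "x = c" by blast
  then show ?case
  proof cases
    case 1
    show ?thesis by (rule exI[of _ "if y = b then c else b"]) (use 1 triangle in auto)
  next
    case 2
    show ?thesis by (rule exI[of _ "if y = a then c else a"]) (use 2 triangle in auto)
  next
    case 3
    show ?thesis by (rule exI[of _ "if y = a then b else a"]) (use 3 triangle in auto)
  qed
next
  case (wheel z a b c)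
  then consider "x = z" | "x = a" | "x = b" | "x = c" by blast
  then show ?case
  proof cases
    case 1
    show ?thesis by (rule exI[of _ "if y = a then b else a"]) (use 1 wheel in auto)
  next
    case 2
    show ?thesis by (rule exI[of _ "if y = b then z else b"]) (use 2 wheel in auto)
  next
    case 3
    show ?thesis by (rule exI[of _ "if y = c then z else c"]) (use 3 wheel in auto)
  next
    case 4
    show ?thesis by (rule exI[of _ "if y = a then z else a"]) (use 4 wheel in auto)
  qed
next
  case (subdivide k A a b p q)
  let ?A' = "A - {(a, b), (b, a)} \<union> {(a, p), (p, a), (p, q), (q, p), (q, b), (b, q)}"
  have ab: "a \<in> Field A" "b \<in> Field A" using subdivide.hyps by (auto simp: Field_def)
  have ne: "a \<noteq> p" "a \<noteq> q" "b \<noteq> p" "b \<noteq> q" "p \<noteq> q" using ab subdivide.hyps by auto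
  have xy: "(x, y) \<in> A - {(a, b), (b, a)} \<or> (x, y) \<in> {(a, p), (p, a), (p, q), (q, p), (q, b), (b, q)}"
    using subdivide.prems by blast
  show ?case
  proof (cases "x = p \<or> x = q")
    case True
    have "x \<notin> Field A" using True subdivide.hyps by auto
    then have "(x, y) \<notin> A" by (auto simp: Field_def)
    then show ?thesis using xy True ne by auto
  next
    case xpq: False
    show ?thesis
    proof (cases "x = a \<or> x = b")
      case True
      \<comment> \<open>\<open>s\<close> is the old end of the subdivided digon seen from
        \<open>x\<close>, and \<open>t\<close> the new vertex that replaces it; all other out-arcs
        of \<open>x\<close> survive.\<close>
      define s where "s = (if x = a then b else a)"
      define t where "t = (if x = a then p else q)"
      have anb: "a \<noteq> b" using special_irrefl[OF subdivide.hyps(1)] subdivide.hyps(2) by auto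
      have xs: "(x, s) \<in> A" and xt: "(x, t) \<in> ?A'" using True subdivide.hyps anb by (auto simp: s_def t_def)
      obtain y' where y': "y' \<noteq> s" "(x, y') \<in> A" using subdivide.IH[OF xs] by blast
      have "(x, y') \<in> ?A'" using y' True anb by (auto simp: s_def split: if_splits)
      moreover have "y' \<noteq> t" using y' subdivide.hyps(4,5) by (auto simp: t_def Field_def)
      ultimately show ?thesis using xt by metis
    next
      case False
      then have "(x, y) \<in> A" using xy xpq by auto
      then obtain y' where "y' \<noteq> y" "(x, y') \<in> A" using subdivide.IH by blast
      then show ?thesis using False by auto
    qed
  qed
qed

lemma matching_single: "(u, v) \<in> A \<Longrightarrow> (v, u) \<in> A \<Longrightarrow> matching A {(u, v)}"
  by (simp add: matching_def)

text \<open>The last three conjuncts say how much freedom is left to a matching of the optimal size \<open>s\<close>: potential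
  is saved below whenever such a matching avoids an arc that has to be given up.\<close>

definition special_inv :: "int \<Rightarrow> ('a \<times> 'a) set \<Rightarrow> nat \<Rightarrow> bool"
  where "special_inv k A s \<longleftrightarrow> 7 * int (card (Field A)) - 3 * int (card A) - 2 * int s = k \<and>
    int (card (A \<inter> A\<inverse>)) + 1 - k = 2 * int (card (Field A)) \<and>
    (\<forall>u v. (u, v) \<in> A \<longrightarrow> (v, u) \<in> A \<longrightarrow> (\<exists>M. matching A M \<and> card M = s \<and> ((u, v) \<in> M \<or> (v, u) \<in> M))) \<and>
    (\<forall>u v. (u, v) \<in> A \<longrightarrow> (v, u) \<notin> A \<longrightarrow> (\<exists>M. matching A M \<and> card M = s \<and> u \<notin> Field M)) \<and>
    (k = 1 \<longrightarrow> (\<forall>u \<in> Field A. \<exists>M. matching A M \<and> card M = s \<and> u \<notin> Field M))"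

lemma special_invI:
  assumes "7 * int (card (Field A)) - 3 * int (card A) - 2 * int s = k"
    "int (card (A \<inter> A\<inverse>)) + 1 - k = 2 * int (card (Field A))"
    "\<And>u v. (u, v) \<in> A \<Longrightarrow> (v, u) \<in> A \<Longrightarrow> \<exists>M. matching A M \<and> card M = s \<and> ((u, v) \<in> M \<or> (v, u) \<in> M)"
    "\<And>u v. (u, v) \<in> A \<Longrightarrow> (v, u) \<notin> A \<Longrightarrow> \<exists>M. matching A M \<and> card M = s \<and> u \<notin> Field M"
    "\<And>u. k = 1 \<Longrightarrow> u \<in> Field A \<Longrightarrow> \<exists>M. matching A M \<and> card M = s \<and> u \<notin> Field M"
  shows "special_inv k A s"
  using assms unfolding special_inv_def by blast

lemma special_inv_triangle:
  assumes "distinct [a, b, c]"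
  shows "special_inv 1 {(a, b), (b, a), (b, c), (c, b), (a, c), (c, a)} 1"
proof -
  let ?A = "{(a, b), (b, a), (b, c), (c, b), (a, c), (c, a)}"
  have ne: "a \<noteq> b" "b \<noteq> a" "a \<noteq> c" "c \<noteq> a" "b \<noteq> c" "c \<noteq> b" using assms by auto
  have F: "Field ?A = {a, b, c}" by (auto simp: Field_def)
  have cF: "card (Field ?A) = 3" unfolding F using assms by simp
  have cA: "card ?A = 6" using ne by simp
  have sym: "?A\<inverse> = ?A" by auto
  have E: "\<exists>M. matching ?A M \<and> card M = 1 \<and> ((u, v) \<in> M \<or> (v, u) \<in> M)"
    if "(u, v) \<in> ?A" "(v, u) \<in> ?A" for u v
    by (rule exI[of _ "{(u, v)}"]) (use that in \<open>simp add: matching_single\<close>)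
  have X: "\<exists>M. matching ?A M \<and> card M = 1 \<and> u \<notin> Field M" if u: "u \<in> Field ?A" for u
  proof -
    have "u \<in> {a, b, c}" using u unfolding F .
    then consider "u = a" | "u = b" | "u = c" by blast
    then show ?thesis
    proof cases
      case 1
      show ?thesis by (rule exI[of _ "{(b, c)}"]) (use 1 ne in \<open>simp add: matching_single Field_def\<close>)
    next
      case 2
      show ?thesis by (rule exI[of _ "{(a, c)}"]) (use 2 ne in \<open>simp add: matching_single Field_def\<close>)
    next
      case 3
      show ?thesis by (rule exI[of _ "{(a, b)}"]) (use 3 ne in \<open>simp add: matching_single Field_def\<close>)
    qed
  qed
  have c1: "7 * int (card (Field ?A)) - 3 * int (card ?A) - 2 * int 1 = 1"
    unfolding cF cA by simp
  have c2: "int (card (?A \<inter> ?A\<inverse>)) + 1 - 1 = 2 * int (card (Field ?A))"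
    unfolding sym cF Int_absorb cA by simp
  have S: "(v, u) \<in> ?A" if "(u, v) \<in> ?A" for u v using that by blast
  show ?thesis
  proof (rule special_invI[OF c1 c2])
    show "\<exists>M. matching ?A M \<and> card M = 1 \<and> u \<notin> Field M" if "(u, v) \<in> ?A" "(v, u) \<notin> ?A" for u v
      using S[OF that(1)] that(2) by (rule notE[rotated])
  qed (rule E, assumption+, rule X, assumption)
qed

lemma special_inv_wheel:
  assumes "distinct [z, a, b, c]"
  shows "special_inv (-1) {(a, b), (b, c), (c, a), (z, a), (a, z), (z, b), (b, z), (z, c), (c, z)} 1"
proof -
  let ?A = "{(a, b), (b, c), (c, a), (z, a), (a, z), (z, b), (b, z), (z, c), (c, z)}"
  have ne: "a \<noteq> b" "b \<noteq> a" "a \<noteq> c" "c \<noteq> a" "b \<noteq> c" "c \<noteq> b"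
    "z \<noteq> a" "a \<noteq> z" "z \<noteq> b" "b \<noteq> z" "z \<noteq> c" "c \<noteq> z" using assms by auto
  have F: "Field ?A = {z, a, b, c}" by (auto simp: Field_def)
  have cF: "card (Field ?A) = 4" unfolding F using assms by simp
  have cA: "card ?A = 9" using ne by simp
  have D: "?A \<inter> ?A\<inverse> = {(z, a), (a, z), (z, b), (b, z), (z, c), (c, z)}"
  proof
    show "?A \<inter> ?A\<inverse> \<subseteq> {(z, a), (a, z), (z, b), (b, z), (z, c), (c, z)}"
    proof
      fix e assume e: "e \<in> ?A \<inter> ?A\<inverse>"
      obtain u v where uv: "e = (u, v)" by (cases e)
      have vu: "(v, u) \<in> ?A" using IntD2[OF e] unfolding uv by (rule converseD)
      have "(u, v) \<in> ?A" using IntD1[OF e] unfolding uv .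
      then consider "(u, v) = (a, b)" | "(u, v) = (b, c)" | "(u, v) = (c, a)"
        | "(u, v) \<in> {(z, a), (a, z), (z, b), (b, z), (z, c), (c, z)}"
        unfolding insert_iff by argo
      then show "e \<in> {(z, a), (a, z), (z, b), (b, z), (z, c), (c, z)}"
      proof cases
        case 1
        then show ?thesis using vu ne by simp
      next
        case 2
        then show ?thesis using vu ne by simp
      next
        case 3
        then show ?thesis using vu ne by simp
      next
        case 4
        then show ?thesis unfolding uv .
      qed
    qed
    show "{(z, a), (a, z), (z, b), (b, z), (z, c), (c, z)} \<subseteq> ?A \<inter> ?A\<inverse>" by simp
  qed
  have cD: "card (?A \<inter> ?A\<inverse>) = 6" unfolding D using ne by simp
  have E: "\<exists>M. matching ?A M \<and> card M = 1 \<and> ((u, v) \<in> M \<or> (v, u) \<in> M)"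
    if "(u, v) \<in> ?A" "(v, u) \<in> ?A" for u v
    by (rule exI[of _ "{(u, v)}"]) (use that in \<open>simp add: matching_single\<close>)
  \<comment> \<open>Only rim vertices start one-way arcs, and each of them is missed by the spoke to
    another rim vertex.\<close>
  have X: "\<exists>M. matching ?A M \<and> card M = 1 \<and> u \<notin> Field M" if uv: "(u, v) \<in> ?A" "(v, u) \<notin> ?A" for u v
  proof -
    have "(u, v) \<in> {(a, b), (b, c), (c, a)}" using uv by blast
    then consider "u = a" | "u = b" | "u = c" by blast
    then show ?thesis
    proof cases
      case 1
      show ?thesis by (rule exI[of _ "{(z, c)}"]) (use 1 ne in \<open>simp add: matching_single Field_def\<close>)
    next
      case 2
      show ?thesis by (rule exI[of _ "{(z, c)}"]) (use 2 ne in \<open>simp add: matching_single Field_def\<close>)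
    next
      case 3
      show ?thesis by (rule exI[of _ "{(z, b)}"]) (use 3 ne in \<open>simp add: matching_single Field_def\<close>)
    qed
  qed
  have c1: "7 * int (card (Field ?A)) - 3 * int (card ?A) - 2 * int 1 = -1"
    unfolding cF cA by simp
  have c2: "int (card (?A \<inter> ?A\<inverse>)) + 1 - (-1) = 2 * int (card (Field ?A))"
    unfolding cD cF by simp
  show ?thesis
    by (rule special_invI[OF c1 c2]) (rule E, assumption+, rule X, assumption+, simp)
qed

text \<open>Carries optimal matchings, one edge larger, from \<open>A\<close> to the digraph with
  the digon \<open>a b\<close> subdivided, so that the freedom recorded in
  \<open>special_inv\<close> survives every step of the inductive construction.\<close>

locale subdivision =
  fixes A :: "('a \<times> 'a) set" and a b p q :: 'a
  assumes finA: "finite A" and irr: "\<And>x. (x, x) \<notin> A"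
    and ab: "(a, b) \<in> A" and ba: "(b, a) \<in> A"
    and p: "p \<notin> Field A" and q: "q \<notin> Field A" and pq: "p \<noteq> q"
begin

definition A' :: "('a \<times> 'a) set"
  where "A' = A - {(a, b), (b, a)} \<union> {(a, p), (p, a), (p, q), (q, p), (q, b), (b, q)}"

lemma ne: "a \<noteq> b" "a \<noteq> p" "a \<noteq> q" "b \<noteq> p" "b \<noteq> q" "p \<noteq> q"
  using irr ab ba p q pq by (auto simp: Field_def)

lemma new_notin: "(p, x) \<notin> A" "(x, p) \<notin> A" "(q, x) \<notin> A" "(x, q) \<notin> A"
  using p q by (auto simp: Field_def)

lemma Field_A': "Field A' = Field A \<union> {p, q}"
proof
  show "Field A' \<subseteq> Field A \<union> {p, q}" using ab by (auto simp: A'_def Field_def)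
  have "x \<in> Field A'" if "(x, y) \<in> A \<or> (y, x) \<in> A" for x y
    using that by (cases "x = a \<or> x = b") (auto simp: A'_def Field_def)
  then show "Field A \<union> {p, q} \<subseteq> Field A'" by (auto simp: Field_def A'_def)
qed

lemma card_Field_A': "card (Field A') = card (Field A) + 2"
  unfolding Field_A' using p q pq finA by (simp add: finite_Field)

lemma card_A': "card A' = card A + 4"
proof -
  have "card (A - {(a, b), (b, a)}) = card A - 2" using ab ba ne by (simp add: card_Diff_subset)
  moreover have "2 \<le> card A"
    using card_mono[of A "{(a, b), (b, a)}"] finA ab ba ne by simp
  moreover have "card {(a, p), (p, a), (p, q), (q, p), (q, b), (b, q)} = 6" using ne by simp
  moreover have "(A - {(a, b), (b, a)}) \<inter> {(a, p), (p, a), (p, q), (q, p), (q, b), (b, q)} = {}"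
    using new_notin by auto
  ultimately have "card A' = (card A - 2) + 6" "2 \<le> card A"
    using card_Un_disjoint[of "A - {(a, b), (b, a)}" "{(a, p), (p, a), (p, q), (q, p), (q, b), (b, q)}"] finA
    unfolding A'_def by auto
  then show ?thesis by simp
qed

lemma card_digons_A': "card (A' \<inter> A'\<inverse>) = card (A \<inter> A\<inverse>) + 4"
proof -
  let ?N = "{(a, p), (p, a), (p, q), (q, p), (q, b), (b, q)}"
  have eq: "A' \<inter> A'\<inverse> = (A \<inter> A\<inverse>) - {(a, b), (b, a)} \<union> ?N"
    unfolding A'_def using new_notin by auto
  have sub: "{(a, b), (b, a)} \<subseteq> A \<inter> A\<inverse>" using ab ba by auto
  have "card ((A \<inter> A\<inverse>) - {(a, b), (b, a)}) = card (A \<inter> A\<inverse>) - 2"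
    using sub ne by (simp add: card_Diff_subset)
  moreover have "2 \<le> card (A \<inter> A\<inverse>)"
    using card_mono[OF _ sub] finA ne by simp
  moreover have "card ?N = 6" using ne by simp
  moreover have "((A \<inter> A\<inverse>) - {(a, b), (b, a)}) \<inter> ?N = {}" using new_notin by auto
  ultimately have "card (A' \<inter> A'\<inverse>) = (card (A \<inter> A\<inverse>) - 2) + 6" "2 \<le> card (A \<inter> A\<inverse>)"
    using card_Un_disjoint[of "(A \<inter> A\<inverse>) - {(a, b), (b, a)}" ?N] finA
    unfolding eq by auto
  then show ?thesis by simp
qed

lemma digon_A': "(u, v) \<in> A' \<Longrightarrow> (v, u) \<notin> A' \<Longrightarrow> (u, v) \<in> A \<and> (v, u) \<notin> A"
  unfolding A'_def by auto

lemma lift_avoid: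
  assumes M: "matching A M" and n: "(a, b) \<notin> M" "(b, a) \<notin> M"
  shows "matching A' M" "p \<notin> Field M" "q \<notin> Field M" "finite M"
proof -
  have sub: "M \<subseteq> A \<inter> A\<inverse>" using M by (auto simp: matching_def)
  have "M \<subseteq> A' \<inter> A'\<inverse>"
  proof
    fix e assume e: "e \<in> M"
    obtain u v where uv: "e = (u, v)" by (cases e)
    have "(u, v) \<in> A" "(v, u) \<in> A" using sub e uv by auto
    moreover have "(u, v) \<noteq> (a, b)" "(u, v) \<noteq> (b, a)" using n e uv by auto
    ultimately show "e \<in> A' \<inter> A'\<inverse>" unfolding A'_def uv by auto
  qed
  then show "matching A' M" using M by (rule matching_transfer[rotated])
  show "p \<notin> Field M" "q \<notin> Field M" using matching_Field[OF M] p q by auto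
  show "finite M" using matching_finite[OF M finA] .
qed

lemma lift_pq:
  assumes M: "matching A M" and n: "(a, b) \<notin> M" "(b, a) \<notin> M"
  shows "matching A' (insert (p, q) M)" "card (insert (p, q) M) = card M + 1"
proof -
  note l = lift_avoid[OF assms]
  show "matching A' (insert (p, q) M)"
    by (rule matching_insert[OF l(1)]) (use l in \<open>auto simp: A'_def\<close>)
  show "card (insert (p, q) M) = card M + 1"
    by (rule matching_insert_card[OF l(1,4,2)])
qed

text \<open>A matching through the old digon is rerouted through the two outer digons of the
  path.\<close>

lemma lift_ab:
  assumes M: "matching A M" and m: "(a, b) \<in> M \<or> (b, a) \<in> M"
  defines "N \<equiv> M - {(a, b), (b, a)}"
  shows "matching A' (insert (q, b) (insert (a, p) N))"
    "card (insert (q, b) (insert (a, p) N)) = card M + 1"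
    "a \<notin> Field N" "b \<notin> Field N"
proof -
  obtain e where e: "e \<in> M" "e = (a, b) \<or> e = (b, a)" using m by auto
  have finM: "finite M" using matching_finite[OF M finA] .
  have N: "N = M - {e}"
  proof -
    have "(b, a) \<notin> M" if "(a, b) \<in> M" using matching_unique[OF M that, of b a] ne by auto
    then show ?thesis using e unfolding N_def by auto
  qed
  have dis: "x \<noteq> a \<and> x \<noteq> b \<and> y \<noteq> a \<and> y \<noteq> b" if xy: "(x, y) \<in> N" for x y
  proof -
    have "(x, y) \<in> M" "(x, y) \<noteq> e" using xy N by auto
    then have "{x, y} \<inter> {fst e, snd e} = {}" using M e(1) unfolding matching_def by force
    then show ?thesis using e(2) by auto
  qed
  show aN: "a \<notin> Field N" and bN: "b \<notin> Field N" using dis by (auto simp: Field_def)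
  have MN: "matching A N" by (rule matching_sub[OF M]) (auto simp: N_def)
  have n: "(a, b) \<notin> N" "(b, a) \<notin> N" by (auto simp: N_def)
  note l = lift_avoid[OF MN n]
  have ap: "matching A' (insert (a, p) N)"
    by (rule matching_insert[OF l(1)]) (use l aN in \<open>auto simp: A'_def\<close>)
  have qF: "q \<notin> Field (insert (a, p) N)" and bF: "b \<notin> Field (insert (a, p) N)"
    using l(3) bN ne unfolding Field_insert by auto
  show "matching A' (insert (q, b) (insert (a, p) N))"
    by (rule matching_insert[OF ap _ _ qF bF]) (auto simp: A'_def)
  have "card (insert (q, b) (insert (a, p) N)) = card (insert (a, p) N) + 1"
    by (rule matching_insert_card[OF ap _ qF]) (use l in simp)
  moreover have "card (insert (a, p) N) = card N + 1"
    by (rule matching_insert_card[OF l(1,4) aN])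
  moreover have "card N + 1 = card M" using N e(1) finM by (metis Suc_eq_plus1 card_Suc_Diff1)
  ultimately show "card (insert (q, b) (insert (a, p) N)) = card M + 1" by simp
qed

lemma lift_missing:
  assumes M: "matching A M" and u: "u \<in> Field A" "u \<notin> Field M"
  shows "\<exists>M'. matching A' M' \<and> card M' = card M + 1 \<and> u \<notin> Field M'"
proof (cases "(a, b) \<in> M \<or> (b, a) \<in> M")
  case True
  have "u \<noteq> a" "u \<noteq> b" using True u(2) by (auto simp: Field_def)
  moreover have "u \<noteq> p" "u \<noteq> q" using u(1) p q by auto
  moreover have "Field (M - {(a, b), (b, a)}) \<subseteq> Field M" by (auto simp: Field_def)
  ultimately have "u \<notin> Field (insert (q, b) (insert (a, p) (M - {(a, b), (b, a)})))"
    using u(2) unfolding Field_insert by auto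
  then show ?thesis using lift_ab(1,2)[OF M True] by blast
next
  case False
  then have n: "(a, b) \<notin> M" "(b, a) \<notin> M" by auto
  have "u \<notin> Field (insert (p, q) M)" using u p q unfolding Field_insert by auto
  then show ?thesis using lift_pq[OF M n] by blast
qed

text \<open>If \<open>b\<close> is free, the last digon of the path is taken instead of the middle
  one, which leaves \<open>p\<close> uncovered.\<close>

lemma lift_end:
  assumes M: "matching A M" "card M = s" "b \<notin> Field M"
  shows "\<exists>M'. matching A' M' \<and> card M' = s + 1 \<and> p \<notin> Field M'"
proof -
  have n: "(a, b) \<notin> M" "(b, a) \<notin> M" using M(3) by (auto simp: Field_def)
  note l = lift_avoid[OF M(1) n]
  have "matching A' (insert (q, b) M)"
    by (rule matching_insert[OF l(1)]) (use l M in \<open>auto simp: A'_def\<close>)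
  moreover have "card (insert (q, b) M) = card M + 1"
    by (rule matching_insert_card[OF l(1,4,3)])
  moreover have "p \<notin> Field (insert (q, b) M)" using l ne unfolding Field_insert by auto
  ultimately show ?thesis using M(2) by auto
qed

lemma subdivision_swap: "subdivision A b a q p"
  by unfold_locales (use finA irr ab ba p q pq in auto)

lemma A'_swap: "subdivision.A' A b a q p = A'"
  unfolding A'_def subdivision.A'_def[OF subdivision_swap] by auto

lemma special_inv_A':
  assumes inv: "special_inv k A s" and other: "\<And>x y. (x, y) \<in> A \<Longrightarrow> \<exists>y'. y' \<noteq> y \<and> (x, y') \<in> A"
  shows "special_inv k A' (s + 1)"
proof -
  have E: "\<exists>M. matching A M \<and> card M = s \<and> ((u, v) \<in> M \<or> (v, u) \<in> M)" if "(u, v) \<in> A" "(v, u) \<in> A" for u v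
    using inv that unfolding special_inv_def by blast
  have H: "\<exists>M. matching A M \<and> card M = s \<and> u \<notin> Field M" if "(u, v) \<in> A" "(v, u) \<notin> A" for u v
    using inv that unfolding special_inv_def by blast
  have X: "\<exists>M. matching A M \<and> card M = s \<and> u \<notin> Field M" if "k = 1" "u \<in> Field A" for u
    using inv that unfolding special_inv_def by blast
  \<comment> \<open>Needed to put the middle digon into a matching; a second out-arc of
    \<open>a\<close> provides such a choice.\<close>
  have avoid_ab: "\<exists>M. matching A M \<and> card M = s \<and> (a, b) \<notin> M \<and> (b, a) \<notin> M"
  proof -
    obtain y where y: "y \<noteq> b" "(a, y) \<in> A" using other[OF ab] by blast
    show ?thesis
    proof (cases "(y, a) \<in> A")
      case True
      then obtain M where M: "matching A M" "card M = s" "(a, y) \<in> M \<or> (y, a) \<in> M" using E y by blast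
      have "(a, b) \<notin> M" "(b, a) \<notin> M"
        using M(3) matching_unique[OF M(1), of a y a b] matching_unique[OF M(1), of a y b a]
          matching_unique[OF M(1), of y a a b] matching_unique[OF M(1), of y a b a] y(1) ne by auto
      then show ?thesis using M by blast
    next
      case False
      then obtain M where M: "matching A M" "card M = s" "a \<notin> Field M" using H y by blast
      then have "(a, b) \<notin> M" "(b, a) \<notin> M" by (auto simp: Field_def)
      then show ?thesis using M by blast
    qed
  qed
  have E': "\<exists>M. matching A' M \<and> card M = s + 1 \<and> ((u, v) \<in> M \<or> (v, u) \<in> M)"
    if uv: "(u, v) \<in> A'" "(v, u) \<in> A'" for u v
  proof -
    consider (pq) "(u, v) = (p, q) \<or> (u, v) = (q, p)"
      | (ap) "(u, v) \<in> {(a, p), (p, a), (q, b), (b, q)}"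
      | (old) "(u, v) \<in> A" "(v, u) \<in> A" "(u, v) \<noteq> (a, b)" "(u, v) \<noteq> (b, a)"
    proof -
      have "(u, v) \<in> A - {(a, b), (b, a)} \<or> (u, v) \<in> {(a, p), (p, a), (p, q), (q, p), (q, b), (b, q)}"
        using uv(1) unfolding A'_def by blast
      moreover have "(v, u) \<in> A" if "(u, v) \<in> A - {(a, b), (b, a)}"
        using digon_A'[of v u] uv that new_notin unfolding A'_def by auto
      ultimately show thesis using pq ap old by blast
    qed
    then show ?thesis
    proof cases
      case pq
      obtain M where M: "matching A M" "card M = s" "(a, b) \<notin> M" "(b, a) \<notin> M" using avoid_ab by blast
      show ?thesis using lift_pq[OF M(1,3,4)] M(2) pq by auto
    next
      case ap
      obtain M where M: "matching A M" "card M = s" "(a, b) \<in> M \<or> (b, a) \<in> M" using E ab ba by blast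
      show ?thesis
        by (rule exI[of _ "insert (q, b) (insert (a, p) (M - {(a, b), (b, a)}))"])
          (use lift_ab(1,2)[OF M(1,3)] M(2) ap in auto)
    next
      case old
      obtain M where M: "matching A M" "card M = s" "(u, v) \<in> M \<or> (v, u) \<in> M" using E old by blast
      show ?thesis
      proof (cases "(a, b) \<in> M \<or> (b, a) \<in> M")
        case True
        show ?thesis
          by (rule exI[of _ "insert (q, b) (insert (a, p) (M - {(a, b), (b, a)}))"])
            (use lift_ab(1,2)[OF M(1) True] M(2,3) old in auto)
      next
        case False
        show ?thesis
          by (rule exI[of _ "insert (p, q) M"]) (use lift_pq[OF M(1)] False M(2,3) in auto)
      qed
    qed
  qed
  have H': "\<exists>M. matching A' M \<and> card M = s + 1 \<and> u \<notin> Field M" if uv: "(u, v) \<in> A'" "(v, u) \<notin> A'" for u v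
  proof -
    have uv': "(u, v) \<in> A" "(v, u) \<notin> A" using digon_A'[OF uv] by auto
    obtain M where "matching A M" "card M = s" "u \<notin> Field M" using H[OF uv'] by blast
    moreover have "u \<in> Field A" using uv' by (auto simp: Field_def)
    ultimately show ?thesis using lift_missing by blast
  qed
  have X': "\<exists>M. matching A' M \<and> card M = s + 1 \<and> u \<notin> Field M" if k: "k = 1" and u: "u \<in> Field A'" for u
  proof -
    consider "u \<in> Field A" | "u = p" | "u = q" using u Field_A' by auto
    then show ?thesis
    proof cases
      case 1
      then show ?thesis using X[OF k] lift_missing by metis
    next
      case 2
      obtain M where "matching A M" "card M = s" "b \<notin> Field M" using X[OF k, of b] ab by (auto simp: Field_def)
      then show ?thesis using lift_end 2 by blast
    next
      case 3
      obtain M where "matching A M" "card M = s" "a \<notin> Field M" using X[OF k, of a] ab by (auto simp: Field_def)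
      then show ?thesis using subdivision.lift_end[OF subdivision_swap] 3 unfolding A'_swap by blast
    qed
  qed
  show ?thesis
    using inv E' H' X' unfolding special_inv_def card_Field_A' card_A' card_digons_A' by auto
qed

end

lemma special_ex_inv: "special k A \<Longrightarrow> \<exists>s. special_inv k A s"
proof (induction rule: special.induct)
  case (triangle a b c)
  then show ?case using special_inv_triangle[of a b c] by (intro exI)
next
  case (wheel z a b c)
  then show ?case using special_inv_wheel[of z a b c] by (intro exI)
next
  case (subdivide k A a b p q)
  then obtain s where s: "special_inv k A s" by blast
  interpret subdivision A a b p q
    by unfold_locales
      (use subdivide.hyps special_finite[OF subdivide.hyps(1)] special_irrefl[OF subdivide.hyps(1)] in auto)
  show ?case
    using special_inv_A'[OF s special_other_out[OF subdivide.hyps(1)]] unfolding A'_def by blast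
qed

lemma special_converse: "special k A \<Longrightarrow> special k (A\<inverse>)"
proof (induction rule: special.induct)
  case (triangle a b c)
  have "{(a, b), (b, a), (b, c), (c, b), (a, c), (c, a)}\<inverse> = {(a, b), (b, a), (b, c), (c, b), (a, c), (c, a)}"
    by blast
  then show ?case using special.triangle[OF triangle] by simp
next
  case (wheel z a b c)
  have "distinct [z, a, c, b]" using wheel by auto
  moreover have "{(a, b), (b, c), (c, a), (z, a), (a, z), (z, b), (b, z), (z, c), (c, z)}\<inverse> =
    {(a, c), (c, b), (b, a), (z, a), (a, z), (z, c), (c, z), (z, b), (b, z)}" by blast
  ultimately show ?case using special.wheel by metis
next
  case (subdivide k A a b p q)
  have "(A - {(a, b), (b, a)} \<union> {(a, p), (p, a), (p, q), (q, p), (q, b), (b, q)})\<inverse> =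
    A\<inverse> - {(a, b), (b, a)} \<union> {(a, p), (p, a), (p, q), (q, p), (q, b), (b, q)}" by blast
  moreover have "special k (A\<inverse> - {(a, b), (b, a)} \<union> {(a, p), (p, a), (p, q), (q, p), (q, b), (b, q)})"
    by (rule special.subdivide[OF subdivide.IH]) (use subdivide.hyps in simp_all)
  ultimately show ?case by simp
qed

text \<open>The kind is an index of the inductive predicate, so \<open>k = 1\<close> is carried
  through the induction as a premise of the conclusion.\<close>

lemma special_sym_aux: "special k A \<Longrightarrow> k = 1 \<longrightarrow> (\<forall>x y. (x, y) \<in> A \<longrightarrow> (y, x) \<in> A)"
proof (induction rule: special.induct)
  case (triangle a b c)
  then show ?case by blast
next
  case (wheel z a b c)
  then show ?case by simp
next
  case (subdivide k A a b p q)
  then show ?case by blast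
qed

lemma special_sym: "special 1 A \<Longrightarrow> (x, y) \<in> A \<Longrightarrow> (y, x) \<in> A"
  using special_sym_aux by blast

lemma (in subdivision) outs_A':
  shows "outs A' p = {a, q}" "outs A' q = {p, b}"
    "outs A' a = insert p (outs A a - {b})" "outs A' b = insert q (outs A b - {a})"
    "v \<noteq> a \<Longrightarrow> v \<noteq> b \<Longrightarrow> v \<noteq> p \<Longrightarrow> v \<noteq> q \<Longrightarrow> outs A' v = outs A v"
  using ne new_notin unfolding A'_def by auto

lemma (in subdivision) card_outs_A':
  assumes "v \<in> Field A" shows "card (outs A' v) = card (outs A v)"
proof -
  have fin: "finite (outs A u)" for u using finA by auto
  have "v \<noteq> p" "v \<noteq> q" using assms p q by auto
  consider "v = a" | "v = b" | "v \<noteq> a" "v \<noteq> b" by blast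
  then show ?thesis
  proof cases
    case 1
    have "p \<notin> outs A a" "b \<in> outs A a" using new_notin ab by auto
    then show ?thesis unfolding 1 outs_A'(3) using fin[of a] card_Suc_Diff1[of "outs A a" b] by simp
  next
    case 2
    have "q \<notin> outs A b" "a \<in> outs A b" using new_notin ba by auto
    then show ?thesis unfolding 2 outs_A'(4) using fin[of b] card_Suc_Diff1[of "outs A b" a] by simp
  next
    case 3
    then show ?thesis using outs_A'(5) \<open>v \<noteq> p\<close> \<open>v \<noteq> q\<close> by metis
  qed
qed

lemma special_outdeg_aux: "special k A \<Longrightarrow> k = 1 \<longrightarrow> (\<forall>v \<in> Field A. card (outs A v) = 2)"
proof (induction rule: special.induct)
  case (triangle a b c)
  let ?A = "{(a, b), (b, a), (b, c), (c, b), (a, c), (c, a)}"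
  have ne: "a \<noteq> b" "b \<noteq> a" "a \<noteq> c" "c \<noteq> a" "b \<noteq> c" "c \<noteq> b" using triangle by auto
  have "outs ?A a = {b, c}" "outs ?A b = {a, c}" "outs ?A c = {a, b}" using ne by auto
  moreover have "Field ?A = {a, b, c}" by (auto simp: Field_def)
  ultimately show ?case using ne by (simp add: card_insert_if)
next
  case (wheel z a b c)
  then show ?case by simp
next
  case (subdivide k A a b p q)
  interpret subdivision A a b p q
    by unfold_locales
      (use subdivide.hyps special_finite[OF subdivide.hyps(1)] special_irrefl[OF subdivide.hyps(1)] in auto)
  have "card (outs A' v) = 2" if k: "k = 1" and v: "v \<in> Field A'" for v
  proof -
    consider "v \<in> Field A" | "v = p" | "v = q" using v Field_A' by auto
    then show ?thesis
    proof cases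
      case 1
      then show ?thesis using card_outs_A' subdivide.IH k by simp
    next
      case 2
      then show ?thesis using outs_A'(1) ne by simp
    next
      case 3
      then show ?thesis using outs_A'(2) ne by simp
    qed
  qed
  then show ?case unfolding A'_def by blast
qed

lemma special_outdeg: "special 1 A \<Longrightarrow> v \<in> Field A \<Longrightarrow> card (outs A v) = 2"
  using special_outdeg_aux by blast

definition wheel3 :: "'a \<Rightarrow> 'a \<Rightarrow> 'a \<Rightarrow> 'a \<Rightarrow> ('a \<times> 'a) set"
  where "wheel3 z a b c = {(a, b), (b, c), (c, a), (z, a), (a, z), (z, b), (b, z), (z, c), (c, z)}"

text \<open>Searches for two consecutive digons starting at \<open>z\<close>. The premise keeps
  \<open>z\<close> off the rim of a wheel, whose vertices start one-way arcs. The centre of an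
  unsubdivided 3-wheel fails because each rim vertex lies in a single digon; any subdivision repairs
  this. The middle vertex found here later becomes a server.\<close>

lemma special_server:
  "special k A \<Longrightarrow> z \<in> Field A \<Longrightarrow> (\<And>b. (z, b) \<in> A \<Longrightarrow> (b, z) \<in> A) \<Longrightarrow>
    (\<exists>w w'. (z, w) \<in> A \<and> (w, z) \<in> A \<and> (w, w') \<in> A \<and> (w', w) \<in> A \<and> w' \<noteq> z) \<or>
    (\<exists>a b c. distinct [z, a, b, c] \<and> A = wheel3 z a b c)"
proof (induction arbitrary: z rule: special.induct)
  case (triangle a b c)
  have ne: "a \<noteq> b" "b \<noteq> a" "a \<noteq> c" "c \<noteq> a" "b \<noteq> c" "c \<noteq> b" using triangle by auto
  have "z = a \<or> z = b \<or> z = c" using triangle.prems(1) by (auto simp: Field_def)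
  then show ?case
  proof (elim disjE)
    assume "z = a"
    then show ?thesis by (intro disjI1 exI[of _ b] exI[of _ c]) (use ne in simp)
  next
    assume "z = b"
    then show ?thesis by (intro disjI1 exI[of _ a] exI[of _ c]) (use ne in simp)
  next
    assume "z = c"
    then show ?thesis by (intro disjI1 exI[of _ a] exI[of _ b]) (use ne in simp)
  qed
next
  case (wheel z' a b c)
  have ne: "a \<noteq> b" "b \<noteq> a" "a \<noteq> c" "c \<noteq> a" "b \<noteq> c" "c \<noteq> b"
    "z' \<noteq> a" "a \<noteq> z'" "z' \<noteq> b" "b \<noteq> z'" "z' \<noteq> c" "c \<noteq> z'" using wheel by auto
  have "z = z' \<or> z = a \<or> z = b \<or> z = c" using wheel.prems(1) by (auto simp: Field_def)
  moreover have "z \<noteq> a" using wheel.prems(2)[of b] ne by fastforce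
  moreover have "z \<noteq> b" using wheel.prems(2)[of c] ne by fastforce
  moreover have "z \<noteq> c" using wheel.prems(2)[of a] ne by fastforce
  ultimately have "z = z'" by simp
  then show ?case
    by (intro disjI2 exI[of _ a] exI[of _ b] exI[of _ c]) (use wheel.hyps in \<open>simp add: wheel3_def\<close>)
next
  case (subdivide k A a b p q)
  interpret subdivision A a b p q
    by unfold_locales
      (use subdivide.hyps special_finite[OF subdivide.hyps(1)] special_irrefl[OF subdivide.hyps(1)] in auto)
  have six: "(a, p) \<in> A'" "(p, a) \<in> A'" "(p, q) \<in> A'" "(q, p) \<in> A'" "(q, b) \<in> A'" "(b, q) \<in> A'"
    unfolding A'_def by auto
  have "\<exists>w w'. (z, w) \<in> A' \<and> (w, z) \<in> A' \<and> (w, w') \<in> A' \<and> (w', w) \<in> A' \<and> w' \<noteq> z"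
  proof -
    consider "z = p" | "z = q" | "z = a" | "z = b" | "z \<in> Field A" "z \<noteq> a" "z \<noteq> b" "z \<noteq> p" "z \<noteq> q"
      using subdivide.prems(1) Field_A' unfolding A'_def[symmetric] by blast
    then show ?thesis
    proof cases
      case 1
      show ?thesis by (rule exI[of _ q], rule exI[of _ b]) (use 1 six ne in simp)
    next
      case 2
      show ?thesis by (rule exI[of _ p], rule exI[of _ a]) (use 2 six ne in simp)
    next
      case 3
      show ?thesis by (rule exI[of _ p], rule exI[of _ q]) (use 3 six ne in simp)
    next
      case 4
      show ?thesis by (rule exI[of _ q], rule exI[of _ p]) (use 4 six ne in simp)
    next
      case 5
      have zin: "(z, y) \<in> A' \<longleftrightarrow> (z, y) \<in> A" "(y, z) \<in> A' \<longleftrightarrow> (y, z) \<in> A" for y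
        using 5 unfolding A'_def by auto
      have "(y, z) \<in> A" if "(z, y) \<in> A" for y
        using subdivide.prems(2)[of y] that zin unfolding A'_def[symmetric] by simp
      from subdivide.IH[OF 5(1) this] show ?thesis
      proof
        assume "\<exists>w w'. (z, w) \<in> A \<and> (w, z) \<in> A \<and> (w, w') \<in> A \<and> (w', w) \<in> A \<and> w' \<noteq> z"
        then obtain w w' where w: "(z, w) \<in> A" "(w, z) \<in> A" "(w, w') \<in> A" "(w', w) \<in> A" "w' \<noteq> z" by blast
        have zw: "(z, w) \<in> A'" "(w, z) \<in> A'" using w zin by simp_all
        consider "w = a \<and> w' = b" | "w = b \<and> w' = a" | "(w, w') \<in> A'" "(w', w) \<in> A'"
          using w unfolding A'_def by auto
        then show ?thesis
        proof cases
          case 1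
          show ?thesis by (rule exI[of _ a], rule exI[of _ p]) (use 1 zw six 5 in simp)
        next
          case 2
          show ?thesis by (rule exI[of _ b], rule exI[of _ q]) (use 2 zw six 5 in simp)
        next
          case 3
          show ?thesis by (rule exI[of _ w], rule exI[of _ w']) (use 3 zw w(5) in simp)
        qed
      next
        assume "\<exists>a b c. distinct [z, a, b, c] \<and> A = wheel3 z a b c"
        then obtain a' b' c' where d: "distinct [z, a', b', c']" and A: "A = wheel3 z a' b' c'" by blast
        have ne': "a' \<noteq> b'" "b' \<noteq> a'" "a' \<noteq> c'" "c' \<noteq> a'" "b' \<noteq> c'" "c' \<noteq> b'"
          "z \<noteq> a'" "a' \<noteq> z" "z \<noteq> b'" "b' \<noteq> z" "z \<noteq> c'" "c' \<noteq> z" using d by auto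
        \<comment> \<open>Every digon of the wheel contains its centre, so the subdivided digon
          would contain \<open>z\<close>.\<close>
        have "(a, b) \<in> {(a', b'), (b', c'), (c', a')} \<or> a = z \<or> b = z"
          using ab unfolding A wheel3_def by blast
        moreover have "(a, b) \<notin> {(a', b'), (b', c'), (c', a')}"
        proof
          assume "(a, b) \<in> {(a', b'), (b', c'), (c', a')}"
          then consider "a = a'" "b = b'" | "a = b'" "b = c'" | "a = c'" "b = a'" by blast
          then show False using ba ne' unfolding A wheel3_def by cases simp_all
        qed
        ultimately have "a = z \<or> b = z" by blast
        then show ?thesis using 5 by simp
      qed
    qed
  qed
  then show ?case unfolding A'_def by blast
qed

section \<open>Contracting the colour classes of a subdigraph\<close>

text \<open>The statement proved by induction for every critical digraph.\<close>

definition good :: "('a \<times> 'a) set \<Rightarrow> bool"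
  where "good B \<longleftrightarrow> (\<exists>k. special k B) \<or>
    (\<exists>M. matching B M \<and> 7 * int (card (Field B)) - 3 * int (card B) - 2 * int (card M) \<le> -2)"

definition contr :: "'a set \<Rightarrow> ('a \<Rightarrow> bool) \<Rightarrow> 'a \<Rightarrow> 'a \<Rightarrow> 'a \<Rightarrow> 'a"
  where "contr R c x1 x2 v = (if v \<in> R then if c v then x1 else x2 else v)"

lemma mdel_partner:
  assumes "matching A M" "(a, b) \<in> M \<or> (b, a) \<in> M"
  shows "a \<notin> Field (mdel b M)"
proof
  assume "a \<in> Field (mdel b M)"
  then obtain y where y: "(a, y) \<in> mdel b M \<or> (y, a) \<in> mdel b M" by (auto simp: Field_def)
  then have yM: "(a, y) \<in> M \<or> (y, a) \<in> M" and yb: "y \<noteq> b" "a \<noteq> b" by (auto simp: mdel_def)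
  show False
    using assms(2) yM yb
      matching_unique[OF assms(1), of a b a y] matching_unique[OF assms(1), of a b y a]
      matching_unique[OF assms(1), of b a a y] matching_unique[OF assms(1), of b a y a] by auto
qed

text \<open>\<open>x1\<close> and \<open>x2\<close> only name the two contracted classes, whatever
  their own colours; taking them from \<open>R\<close> keeps the quotient on the same type and apart
  from the vertices outside \<open>R\<close>.\<close>

locale contraction =
  fixes A :: "('a \<times> 'a) set" and R :: "'a set" and \<phi> :: "'a \<Rightarrow> bool" and x1 x2 :: 'a
  assumes crit: "critical A" and RV: "R \<subseteq> Field A" "R \<noteq> Field A"
    and x: "x1 \<in> R" "x2 \<in> R" "x1 \<noteq> x2"
    and \<phi>: "acyclic (monochrom \<phi> (A \<inter> R \<times> R))"
begin

definition f :: "'a \<Rightarrow> 'a" where "f = contr R \<phi> x1 x2"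

definition B :: "('a \<times> 'a) set"
  where "B = {(f u, f v) | u v. (u, v) \<in> A \<and> f u \<noteq> f v} \<union> {(x1, x2), (x2, x1)}"

lemma f_in: "v \<in> R \<Longrightarrow> f v \<in> {x1, x2}" and f_out: "v \<notin> R \<Longrightarrow> f v = v"
  by (auto simp: f_def contr_def)

lemma f_notX: "f v \<notin> {x1, x2} \<Longrightarrow> v \<notin> R \<and> f v = v"
  using f_in f_out by blast

lemma f_X: "f v \<in> {x1, x2} \<longleftrightarrow> v \<in> R"
  using f_in f_out x by (metis empty_iff insert_iff)

lemma f_eq_in_R: "u \<in> R \<Longrightarrow> f u = f v \<Longrightarrow> v \<in> R \<and> \<phi> u = \<phi> v"
  using x by (auto simp: f_def contr_def split: if_splits)

text \<open>The digon forces the two contracted classes to receive different colours.\<close>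

lemma B_noncolourable: "\<not> colourable B"
proof
  assume "colourable B"
  then obtain c where c: "acyclic (monochrom c B)" by (auto simp: colourable_def)
  have "acyclic (monochrom (c \<circ> f) A)"
  proof (rule acyclic_contract[of _ f])
    have "{(u, v) \<in> monochrom (c \<circ> f) A. f u = f v} \<subseteq> monochrom \<phi> (A \<inter> R \<times> R)"
    proof
      fix e assume "e \<in> {(u, v) \<in> monochrom (c \<circ> f) A. f u = f v}"
      then obtain u v where e: "e = (u, v)" "(u, v) \<in> A" "f u = f v" by (auto simp: monochrom_def)
      have "u \<noteq> v" using e(2) critical_irrefl[OF crit] by auto
      have "u \<in> R"
      proof (rule ccontr)
        assume "u \<notin> R"
        then have "f v = u" using f_out e(3) by simp
        moreover have "v \<notin> R" using f_eq_in_R[of v u] e(3) \<open>u \<notin> R\<close> by auto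
        ultimately show False using f_out \<open>u \<noteq> v\<close> by simp
      qed
      then have "v \<in> R \<and> \<phi> u = \<phi> v" using f_eq_in_R e(3) by blast
      then show "e \<in> monochrom \<phi> (A \<inter> R \<times> R)" using e \<open>u \<in> R\<close> by (simp add: monochrom_def)
    qed
    then show "acyclic {(u, v) \<in> monochrom (c \<circ> f) A. f u = f v}" using \<phi> acyclic_subset by blast
    have "{(f u, f v) |u v. (u, v) \<in> monochrom (c \<circ> f) A \<and> f u \<noteq> f v} \<subseteq> monochrom c B"
      unfolding monochrom_def B_def by auto
    then show "acyclic {(f u, f v) |u v. (u, v) \<in> monochrom (c \<circ> f) A \<and> f u \<noteq> f v}"
      using c acyclic_subset by blast
  qed
  then show False using critical_not_colourable[OF crit] colourableI by blast
qed

lemma B_finite: "finite B"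
proof -
  have "{(f u, f v) | u v. (u, v) \<in> A \<and> f u \<noteq> f v} \<subseteq> (\<lambda>e. (f (fst e), f (snd e))) ` A" by force
  then have "finite {(f u, f v) | u v. (u, v) \<in> A \<and> f u \<noteq> f v}"
    by (rule finite_subset) (use critical_finite[OF crit] in simp)
  then show ?thesis unfolding B_def by simp
qed

lemma B_irrefl: "irrefl B"
  using x by (auto simp: B_def irrefl_def)

lemma ex_W: obtains W where "W \<subseteq> B" "critical W"
  using ex_critical[OF B_finite B_irrefl B_noncolourable] by blast

definition g :: "'a \<times> 'a \<Rightarrow> 'a \<times> 'a" where "g e = (f (fst e), f (snd e))"

definition X :: "'a set" where "X = {x1, x2}"

definition new :: "'a set \<Rightarrow> ('a \<times> 'a) set"
  where "new U = A \<inter> (R \<union> U) \<times> (R \<union> U) - R \<times> R"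

context
  fixes W assumes W: "W \<subseteq> B" "critical W"
begin

definition U :: "'a set" where "U = Field W - X"

lemma Field_W: "Field W \<subseteq> (Field A - R) \<union> X"
proof -
  have "Field B \<subseteq> (Field A - R) \<union> X"
  proof
    fix y assume "y \<in> Field B"
    then have "y \<in> X \<or> (\<exists>u \<in> Field A. y = f u)" unfolding B_def X_def Field_def by auto
    then show "y \<in> (Field A - R) \<union> X" using f_in f_out unfolding X_def by (metis DiffI UnI1 UnI2)
  qed
  moreover have "Field W \<subseteq> Field B" using W(1) by (auto simp: Field_def)
  ultimately show ?thesis by blast
qed

lemma U_sub: "U \<subseteq> Field A - R"
  using Field_W unfolding U_def by blast

lemma W_outside: "(u, v) \<in> W \<Longrightarrow> u \<notin> X \<Longrightarrow> v \<notin> X \<Longrightarrow> (u, v) \<in> A"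
proof -
  assume uv: "(u, v) \<in> W" "u \<notin> X" "v \<notin> X"
  then have "(u, v) \<in> B" "(u, v) \<notin> {(x1, x2), (x2, x1)}" using W(1) by (auto simp: X_def)
  then obtain a b where ab: "u = f a" "v = f b" "(a, b) \<in> A" unfolding B_def by blast
  then have "f a = a" "f b = b" using f_notX uv(2,3) unfolding X_def by blast+
  then show "(u, v) \<in> A" using ab by simp
qed

text \<open>Otherwise \<open>W\<close> would be a critical subdigraph of \<open>A\<close>, hence
  \<open>A\<close> itself, although it avoids \<open>x1\<close>.\<close>

lemma W_meets: "X \<inter> Field W \<noteq> {}"
proof
  assume *: "X \<inter> Field W = {}"
  have "W \<subseteq> A"
  proof
    fix e assume e: "e \<in> W"
    obtain u v where uv: "e = (u, v)" by (cases e)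
    have "u \<in> Field W" "v \<in> Field W" using e uv by (auto simp: Field_def)
    then show "e \<in> A" using W_outside e uv * by blast
  qed
  then have "W = A" using critical_eq[OF W(2) crit] by blast
  then have "Field A \<inter> X = {}" using * by auto
  then show False using x RV unfolding X_def by blast
qed

text \<open>The new digon alone is coloured by separating its ends.\<close>

lemma U_nonempty: "U \<noteq> {}"
proof
  assume "U = {}"
  then have "Field W \<subseteq> X" unfolding U_def by blast
  have "(u, v) \<in> {(x1, x2), (x2, x1)}" if "(u, v) \<in> W" for u v
  proof -
    have "u \<in> X" "v \<in> X" using that \<open>Field W \<subseteq> X\<close> by (auto simp: Field_def)
    moreover have "u \<noteq> v" using that critical_irrefl[OF W(2)] by auto
    ultimately show ?thesis unfolding X_def by auto
  qed
  then have "monochrom (\<lambda>v. v = x1) W = {}" using x by (fastforce simp: monochrom_def)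
  then have "acyclic (monochrom (\<lambda>v. v = x1) W)" by (simp add: acyclic_def)
  then show False using critical_not_colourable[OF W(2)] colourableI by blast
qed

text \<open>Every arc of \<open>W\<close> not joining the contracted vertices lifts to an arc of
  \<open>A\<close> gained with \<open>U\<close>, and distinct arcs have distinct lifts; so at least
  as many arcs are gained as \<open>W\<close> has outside \<open>X \<times> X\<close>.\<close>

lemma W_covered: "W - X \<times> X \<subseteq> g ` {e \<in> new U. g e \<in> W - X \<times> X}"
proof
  fix e assume e: "e \<in> W - X \<times> X"
  then have "e \<in> B" "e \<notin> {(x1, x2), (x2, x1)}" using W(1) by (auto simp: X_def)
  then obtain a b where ab: "e = (f a, f b)" "(a, b) \<in> A" unfolding B_def by blast
  have "f a \<in> Field W" "f b \<in> Field W" using e ab by (auto simp: Field_def)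
  have in_RU: "v \<in> R \<union> U" if "f v \<in> Field W" for v
    using that f_notX[of v] f_X[of v] unfolding U_def X_def by (metis DiffI UnI1 UnI2)
  have "\<not> (a \<in> R \<and> b \<in> R)" using e ab f_in unfolding X_def by blast
  then have "(a, b) \<in> new U"
    using ab in_RU \<open>f a \<in> Field W\<close> \<open>f b \<in> Field W\<close> unfolding new_def by blast
  moreover have "g (a, b) = e" using ab by (simp add: g_def)
  ultimately show "e \<in> g ` {e \<in> new U. g e \<in> W - X \<times> X}" using e by blast
qed

lemma new_finite: "finite (new U)"
  unfolding new_def using critical_finite[OF crit] by simp

lemma card_new: "card (W - X \<times> X) \<le> card (new U)"
proof -
  have "card (W - X \<times> X) \<le> card (g ` {e \<in> new U. g e \<in> W - X \<times> X})"
    by (rule card_mono[OF _ W_covered]) (use new_finite in simp)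
  also have "\<dots> \<le> card {e \<in> new U. g e \<in> W - X \<times> X}" by (rule card_image_le) (use new_finite in simp)
  also have "\<dots> \<le> card (new U)" by (rule card_mono[OF new_finite]) blast
  finally show ?thesis .
qed

text \<open>Equality of the two counts leaves no freedom in the lifting: contraction is then a
  bijection on the new arcs.\<close>

lemma tight_new:
  assumes "card (new U) \<le> card (W - X \<times> X)"
  shows "inj_on g (new U)" "g ` new U = W - X \<times> X"
proof -
  let ?N = "{e \<in> new U. g e \<in> W - X \<times> X}"
  have "card (W - X \<times> X) \<le> card (g ` ?N)"
    by (rule card_mono[OF _ W_covered]) (use new_finite in simp)
  moreover have "card (g ` ?N) \<le> card ?N" by (rule card_image_le) (use new_finite in simp)
  moreover have "card ?N \<le> card (new U)" by (rule card_mono[OF new_finite]) blast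
  ultimately have c: "card (g ` ?N) = card ?N" "card ?N = card (new U)" using assms by linarith+
  have N: "?N = new U" by (rule card_subset_eq[OF new_finite _ c(2)]) blast
  show "inj_on g (new U)" using eq_card_imp_inj_on[of ?N g] c new_finite N by simp
  show "g ` new U = W - X \<times> X"
  proof
    show "g ` new U \<subseteq> W - X \<times> X"
    proof (rule image_subsetI)
      fix e assume "e \<in> new U"
      then have "e \<in> ?N" unfolding N .
      then show "g e \<in> W - X \<times> X" by simp
    qed
    show "W - X \<times> X \<subseteq> g ` new U" using W_covered unfolding N .
  qed
qed

definition mU :: "('a \<times> 'a) set \<Rightarrow> ('a \<times> 'a) set" where "mU M = mdel x1 (mdel x2 M)"

text \<open>Matching edges at the contracted vertices have no counterpart in \<open>A\<close> and
  are dropped. Two may be lost, but only one if the matching uses the digon itself, because then one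
  edge covers both vertices.\<close>

lemma mU:
  assumes "matching W M"
  shows "matching A (mU M)" "Field (mU M) \<subseteq> U" "finite M" "finite (mU M)"
    "card M \<le> card (mU M) + 2"
    "x1 \<notin> Field M \<Longrightarrow> card M \<le> card (mU M) + 1" "x2 \<notin> Field M \<Longrightarrow> card M \<le> card (mU M) + 1"
    "x1 \<notin> Field M \<Longrightarrow> x2 \<notin> Field M \<Longrightarrow> mU M = M"
    "(x1, x2) \<in> M \<or> (x2, x1) \<in> M \<Longrightarrow> card M \<le> card (mU M) + 1"
proof -
  show fin: "finite M" using matching_finite[OF assms critical_finite[OF W(2)]] .
  have m2: "matching W (mdel x2 M)" by (rule mdel_matching[OF assms])
  have m1: "matching W (mU M)" unfolding mU_def by (rule mdel_matching[OF m2])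
  have fin2: "finite (mdel x2 M)" by (rule mdel_finite[OF fin])
  show "finite (mU M)" unfolding mU_def by (rule mdel_finite[OF fin2])
  have "Field (mU M) \<subseteq> Field M - X" unfolding mU_def X_def using mdel_Field[of x1] mdel_Field[of x2 M] by blast
  then show FU: "Field (mU M) \<subseteq> U" using matching_Field[OF assms] unfolding U_def by blast
  have "mU M \<subseteq> A \<inter> A\<inverse>"
  proof
    fix e assume e: "e \<in> mU M"
    obtain u v where uv: "e = (u, v)" by (cases e)
    have "u \<in> U" "v \<in> U" using FU e uv by (auto simp: Field_def)
    then have "u \<notin> X" "v \<notin> X" unfolding U_def by auto
    moreover have "(u, v) \<in> W" "(v, u) \<in> W" using m1 e uv unfolding matching_def by auto
    ultimately show "e \<in> A \<inter> A\<inverse>" using W_outside uv by auto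
  qed
  then show "matching A (mU M)" using m1 matching_transfer by blast
  have c2: "card M \<le> card (mdel x2 M) + 1" by (rule mdel_card[OF assms fin])
  have c1: "card (mdel x2 M) \<le> card (mU M) + 1" unfolding mU_def by (rule mdel_card[OF m2 fin2])
  show "card M \<le> card (mU M) + 2" using c1 c2 by linarith
  show "x2 \<notin> Field M \<Longrightarrow> card M \<le> card (mU M) + 1" using c1 mdel_id[of x2 M] by simp
  have id1: "mU M = mdel x2 M" if "x1 \<notin> Field (mdel x2 M)" unfolding mU_def by (rule mdel_id[OF that])
  show "x1 \<notin> Field M \<Longrightarrow> card M \<le> card (mU M) + 1" using id1 c2 mdel_Field[of x2 M] by (metis DiffD1 subsetD)
  show "x1 \<notin> Field M \<Longrightarrow> x2 \<notin> Field M \<Longrightarrow> mU M = M" using id1 mdel_id[of x2 M] by auto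
  show "(x1, x2) \<in> M \<or> (x2, x1) \<in> M \<Longrightarrow> card M \<le> card (mU M) + 1"
    using id1 c2 mdel_partner[OF assms, of x1 x2] by auto
qed

lemma cardinals:
  "int (card U) = int (card (Field W)) - int (card (X \<inter> Field W))"
  "int (card (W - X \<times> X)) = int (card W) - int (card (W \<inter> X \<times> X))"
  "card (W \<inter> X \<times> X) \<le> 2"
  "card (W \<inter> X \<times> X) = 2 \<Longrightarrow> (x1, x2) \<in> W \<and> (x2, x1) \<in> W"
  "W \<inter> X \<times> X \<noteq> {} \<Longrightarrow> card (X \<inter> Field W) = 2"
  "card (X \<inter> Field W) = 1 \<or> card (X \<inter> Field W) = 2"
proof -
  have finF: "finite (Field W)" using critical_finite_Field[OF W(2)] .
  have finW: "finite W" using critical_finite[OF W(2)] .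
  have finX: "finite X" "card X = 2" unfolding X_def using x(3) by simp_all
  have "card (Field W) = card U + card (X \<inter> Field W)"
    unfolding U_def using card_Diff_subset_Int[of "Field W" X] finF finX card_mono[of "Field W" "Field W \<inter> X"]
    by (simp add: Int_commute)
  then show "int (card U) = int (card (Field W)) - int (card (X \<inter> Field W))" by simp
  have "card W = card (W - X \<times> X) + card (W \<inter> X \<times> X)"
    using card_Diff_subset_Int[of W "X \<times> X"] finW card_mono[of W "W \<inter> X \<times> X"] by simp
  then show "int (card (W - X \<times> X)) = int (card W) - int (card (W \<inter> X \<times> X))" by simp
  have sub: "W \<inter> X \<times> X \<subseteq> {(x1, x2), (x2, x1)}"
    using critical_irrefl[OF W(2)] unfolding X_def by auto
  have c2: "card {(x1, x2), (x2, x1)} = 2" using x(3) by simp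
  show "card (W \<inter> X \<times> X) \<le> 2" using card_mono[OF _ sub] c2 by simp
  show "(x1, x2) \<in> W \<and> (x2, x1) \<in> W" if "card (W \<inter> X \<times> X) = 2"
    using card_subset_eq[OF _ sub] c2 that by auto
  have le: "card (X \<inter> Field W) \<le> 2" using card_mono[of X "X \<inter> Field W"] finX by simp
  show "card (X \<inter> Field W) = 2" if "W \<inter> X \<times> X \<noteq> {}"
  proof -
    have "(x1, x2) \<in> W \<or> (x2, x1) \<in> W" using that sub by blast
    then have "X \<inter> Field W = X" unfolding X_def by (auto simp: Field_def)
    then show ?thesis using finX by simp
  qed
  have "card (X \<inter> Field W) \<noteq> 0" using W_meets finX by auto
  then show "card (X \<inter> Field W) = 1 \<or> card (X \<inter> Field W) = 2" using le by linarith
qed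

text \<open>The change of the potential when the set \<open>R\<close> is enlarged by the part of \<open>W\<close> outside the contracted vertices.\<close>

definition cost :: "('a \<times> 'a) set \<Rightarrow> int"
  where "cost M = 7 * int (card U) - 3 * int (card (new U)) - 2 * int (card (mU M))"

text \<open>Relative to the potential of \<open>W\<close>, each contracted vertex occurring in
  \<open>W\<close> subtracts \<open>7\<close>, each arc of \<open>W\<close> between them adds
  \<open>3\<close>, each dropped matching edge adds \<open>2\<close>, and each gained arc of
  \<open>A\<close> beyond those of \<open>W\<close> subtracts \<open>3\<close>.\<close>

lemma cost_le:
  assumes "matching W M"
  shows "cost M \<le> (7 * int (card (Field W)) - 3 * int (card W) - 2 * int (card M))
    - 7 * int (card (X \<inter> Field W)) + 3 * int (card (W \<inter> X \<times> X)) + 2 * (int (card M) - int (card (mU M)))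
    - 3 * (int (card (new U)) - int (card (W - X \<times> X)))"
  using card_new cardinals(1,2) unfolding cost_def by simp

lemma card_X1:
  assumes "card (X \<inter> Field W) = 1"
  shows "x1 \<notin> Field W \<or> x2 \<notin> Field W" "card (W \<inter> X \<times> X) = 0"
proof -
  show "card (W \<inter> X \<times> X) = 0" using assms cardinals(5) by fastforce
  have "X \<inter> Field W \<noteq> X" using assms x(3) unfolding X_def by auto
  then show "x1 \<notin> Field W \<or> x2 \<notin> Field W" unfolding X_def by blast
qed

lemma cost_single:
  assumes "matching W M" "card (X \<inter> Field W) = 1"
  shows "card M \<le> card (mU M) + 1"
  using card_X1(1)[OF assms(2)] mU(6,7)[OF assms(1)] matching_Field[OF assms(1)] by blast

text \<open>With one contracted vertex in \<open>W\<close> the matching is chosen to miss it if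
  \<open>k = 1\<close>, giving \<open>1 - 7\<close>, and loses at most one edge if
  \<open>k = -1\<close>, giving \<open>-1 - 7 + 2\<close>. With the digon in \<open>W\<close> the
  matching is made to contain it: \<open>k - 14 + 6 + 2\<close>. With both vertices but no digon, at
  most one arc is returned and two edges are lost, \<open>k - 14 + 3 + 4\<close>; for
  \<open>k = 1\<close> symmetry excludes even that arc. So \<open>-5\<close> requires an odd
  bidirected cycle through the new digon.\<close>

lemma cost_special:
  assumes "special k W"
  obtains M where "matching W M" "cost M \<le> -5"
    "cost M \<le> -6 \<or> (k = 1 \<and> (x1, x2) \<in> W \<and> (x2, x1) \<in> W)"
    "k = 1 \<Longrightarrow> cost M \<le> -5 - 3 * (int (card (new U)) - int (card (W - X \<times> X)))"
    "k = 1 \<Longrightarrow> \<not> ((x1, x2) \<in> W \<and> (x2, x1) \<in> W) \<Longrightarrow>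
      cost M \<le> -6 - 3 * (int (card (new U)) - int (card (W - X \<times> X)))"
    "k = -1 \<Longrightarrow> cost M \<le> -6 - 3 * (int (card (new U)) - int (card (W - X \<times> X)))"
    "k = -1 \<Longrightarrow> card (X \<inter> Field W) = 2 \<Longrightarrow> cost M \<le> -7"
    "k = 1 \<Longrightarrow> card (X \<inter> Field W) = 2 \<Longrightarrow> \<not> ((x1, x2) \<in> W \<and> (x2, x1) \<in> W) \<Longrightarrow> cost M \<le> -7"
proof -
  obtain s where s: "special_inv k W s" using special_ex_inv[OF assms] by blast
  let ?d = "int (card (new U)) - int (card (W - X \<times> X))"
  have d: "?d \<ge> 0" using card_new by simp
  have kk: "k = 1 \<or> k = -1" using special_kind[OF assms] .
  have val: "7 * int (card (Field W)) - 3 * int (card W) - 2 * int s = k"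
    using s unfolding special_inv_def by blast
  have E: "\<exists>M. matching W M \<and> card M = s \<and> ((u, v) \<in> M \<or> (v, u) \<in> M)" if "(u, v) \<in> W" "(v, u) \<in> W" for u v
    using s that unfolding special_inv_def by blast
  have EX: "\<exists>M. matching W M \<and> card M = s \<and> u \<notin> Field M" if "k = 1" "u \<in> Field W" for u
    using s that unfolding special_inv_def by blast
  obtain M0 where M0: "matching W M0" "card M0 = s"
  proof -
    obtain u v where uv: "(u, v) \<in> W" using critical_nonempty[OF W(2)] by auto
    have H: "(v, u) \<notin> W \<Longrightarrow> \<exists>M. matching W M \<and> card M = s \<and> u \<notin> Field M"
      using s uv unfolding special_inv_def by blast
    show thesis using E[OF uv] H that by (cases "(v, u) \<in> W") blast+
  qed
  have q1: "card (W \<inter> X \<times> X) \<le> 1" if "\<not> ((x1, x2) \<in> W \<and> (x2, x1) \<in> W)"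
    using cardinals(3,4) that by fastforce
  consider (one) "card (X \<inter> Field W) = 1" | (dig) "card (X \<inter> Field W) = 2" "(x1, x2) \<in> W \<and> (x2, x1) \<in> W"
    | (nodig) "card (X \<inter> Field W) = 2" "\<not> ((x1, x2) \<in> W \<and> (x2, x1) \<in> W)"
    using cardinals(6) by blast
  then show thesis
  proof cases
    case one
    note q0 = card_X1(2)[OF one]
    have nd: "\<not> ((x1, x2) \<in> W \<and> (x2, x1) \<in> W)"
      using card_X1(1)[OF one] by (auto simp: Field_def)
    show thesis
    proof (cases "k = 1")
      case True
      obtain y where y: "X \<inter> Field W = {y}" using one card_1_singletonE by blast
      then obtain M where M: "matching W M" "card M = s" "y \<notin> Field M" using EX[OF True] by blast
      have "x1 \<notin> Field M" "x2 \<notin> Field M" using M(3) y matching_Field[OF M(1)] unfolding X_def by auto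
      then have "mU M = M" using mU(8)[OF M(1)] by simp
      then have "cost M \<le> -6 - 3 * ?d" using cost_le[OF M(1)] M(2) val one q0 True by simp
      then show thesis using that[OF M(1)] d True nd one by auto
    next
      case False
      then have k: "k = -1" using kk by simp
      have "cost M0 \<le> -6 - 3 * ?d" using cost_le[OF M0(1)] M0(2) val one q0 k cost_single[OF M0(1) one] by simp
      then show thesis using that[OF M0(1)] d k one by auto
    qed
  next
    case dig
    obtain M where M: "matching W M" "card M = s" "(x1, x2) \<in> M \<or> (x2, x1) \<in> M" using E dig by blast
    have "cost M \<le> k - 6 - 3 * ?d"
      using cost_le[OF M(1)] M(2) val dig(1) cardinals(3) mU(9)[OF M(1,3)] by simp
    then show thesis using that[OF M(1)] d kk dig by auto
  next
    case nodig
    have "cost M0 \<le> k - 7 - 3 * ?d"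
      using cost_le[OF M0(1)] M0(2) val nodig(1) q1[OF nodig(2)] mU(5)[OF M0(1)] by simp
    moreover have "cost M0 \<le> k - 8 - 3 * ?d" if "k = 1"
    proof -
      have "(x1, x2) \<notin> W \<and> (x2, x1) \<notin> W" using special_sym[of W x1 x2] special_sym[of W x2 x1] assms that nodig(2) by auto
      then have "W \<inter> X \<times> X = {}" using critical_irrefl[OF W(2)] unfolding X_def by auto
      then show ?thesis using cost_le[OF M0(1)] M0(2) val nodig(1) mU(5)[OF M0(1)] by simp
    qed
    ultimately show thesis using that[OF M0(1)] d kk nodig by auto
  qed
qed

text \<open>The worst case is \<open>-2 - 14 + 6 + 4 = -6\<close>. It needs the digon in
  \<open>W\<close> and two distinct matching edges at its ends; without either of these at least one
  unit is gained.\<close>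

lemma cost_generic:
  assumes "matching W M" "7 * int (card (Field W)) - 3 * int (card W) - 2 * int (card M) \<le> -2"
  shows "cost M \<le> -6 - 3 * (int (card (new U)) - int (card (W - X \<times> X)))"
    "card (X \<inter> Field W) = 1 \<Longrightarrow> cost M \<le> -7"
    "\<not> ((x1, x2) \<in> W \<and> (x2, x1) \<in> W) \<Longrightarrow> cost M \<le> -7"
    "card M \<le> card (mU M) + 1 \<Longrightarrow> cost M \<le> -7"
proof -
  have d: "int (card (new U)) - int (card (W - X \<times> X)) \<ge> 0" using card_new by simp
  have l: "card M \<le> card (mU M) + 2" using mU(5)[OF assms(1)] .
  note c = cost_le[OF assms(1)]
  show one: "card (X \<inter> Field W) = 1 \<Longrightarrow> cost M \<le> -7"
    using c assms(2) d card_X1(2) cost_single[OF assms(1)] by simp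
  have two: "card (X \<inter> Field W) = 2 \<Longrightarrow> cost M \<le> -6 - 3 * (int (card (new U)) - int (card (W - X \<times> X)))"
    using c assms(2) cardinals(3) l by simp
  have one': "card (X \<inter> Field W) = 1 \<Longrightarrow> cost M \<le> -7 - 3 * (int (card (new U)) - int (card (W - X \<times> X)))"
    using c assms(2) d card_X1(2) cost_single[OF assms(1)] by simp
  show "cost M \<le> -6 - 3 * (int (card (new U)) - int (card (W - X \<times> X)))"
    using one' two cardinals(6) by fastforce
  show "cost M \<le> -7" if nd: "\<not> ((x1, x2) \<in> W \<and> (x2, x1) \<in> W)"
  proof -
    have "card (W \<inter> X \<times> X) \<le> 1" using cardinals(3,4) nd by fastforce
    then have "card (X \<inter> Field W) = 2 \<Longrightarrow> cost M \<le> -7" using c assms(2) l d by simp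
    then show ?thesis using one cardinals(6) by blast
  qed
  show "cost M \<le> -7" if "card M \<le> card (mU M) + 1"
  proof -
    have "card (X \<inter> Field W) = 2 \<Longrightarrow> cost M \<le> -7" using c assms(2) that d cardinals(3) by simp
    then show ?thesis using one cardinals(6) by blast
  qed
qed

lemma cost_good:
  assumes "good W"
  obtains M where "matching W M" "cost M \<le> -5"
    "cost M \<le> -6 \<or> (special 1 W \<and> (x1, x2) \<in> W \<and> (x2, x1) \<in> W)"
proof -
  consider k where "special k W"
    | M where "matching W M" "7 * int (card (Field W)) - 3 * int (card W) - 2 * int (card M) \<le> -2"
    using assms unfolding good_def by blast
  then show thesis
  proof cases
    case (1 k)
    obtain M where M: "matching W M" "cost M \<le> -5"
      "cost M \<le> -6 \<or> (k = 1 \<and> (x1, x2) \<in> W \<and> (x2, x1) \<in> W)" using cost_special[OF 1] by metis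
    then show thesis using that 1 by blast
  next
    case (2 M)
    have "cost M \<le> -6" using cost_generic(1)[OF 2] card_new by simp
    then show thesis using that[OF 2(1)] by simp
  qed
qed

text \<open>Once \<open>R\<close> has three vertices, \<open>W\<close> has fewer vertices than
  \<open>A\<close>, which makes the induction hypothesis available.\<close>

lemma card_Field_W: "card (Field W) \<le> card (Field A) - card R + 2"
proof -
  have finF: "finite (Field A)" using critical_finite_Field[OF crit] .
  have "card (Field W) \<le> card ((Field A - R) \<union> X)"
    by (rule card_mono[OF _ Field_W]) (use finF in \<open>simp add: X_def\<close>)
  also have "\<dots> \<le> card (Field A - R) + card X" by (rule card_Un_le)
  also have "card (Field A - R) = card (Field A) - card R"
    by (rule card_Diff_subset) (use RV finF finite_subset in blast)+
  also have "card X = 2" unfolding X_def using x(3) by simp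
  finally show ?thesis .
qed

end

end

text \<open>The arcs \<open>C\<close> and the matching \<open>M\<close> are arguments of their own
  because the constructions below exhibit some arcs inside a set without knowing all of
  them.\<close>

definition val :: "'a set \<Rightarrow> ('a \<times> 'a) set \<Rightarrow> ('a \<times> 'a) set \<Rightarrow> int"
  where "val R C M = 7 * int (card R) - 3 * int (card C) - 2 * int (card M)"

lemma good_cases:
  assumes "good B"
  obtains k where "special k B" | M where "matching B M" "val (Field B) B M \<le> -2"
  using assms unfolding good_def val_def by blast

lemma ex_two:
  assumes "2 \<le> card R"
  obtains x1 x2 where "x1 \<in> R" "x2 \<in> R" "x1 \<noteq> x2"
proof -
  obtain T where "T \<subseteq> R" "card T = 2" using obtain_subset_with_card_n[OF assms] by metis
  then show ?thesis using that by (auto simp: card_2_iff)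
qed

lemma Field_edge: "e \<in> M \<Longrightarrow> fst e \<in> Field M \<and> snd e \<in> Field M"
  by (cases e) (auto simp: Field_def)

lemma special_at:
  assumes "special k W" "(x, b) \<in> W"
  obtains M where "matching W M" "val (Field W) W M = k" "\<And>y. (x, y) \<in> M \<or> (y, x) \<in> M \<Longrightarrow> y = b"
    "(b, x) \<notin> W \<Longrightarrow> x \<notin> Field M"
proof -
  obtain s where s: "special_inv k W s" using special_ex_inv[OF assms(1)] by blast
  have v: "val (Field W) W M = k" if "card M = s" for M
    using s that unfolding special_inv_def val_def by simp
  have xb: "x \<noteq> b" using special_irrefl[OF assms(1)] assms(2) by auto
  show thesis
  proof (cases "(b, x) \<in> W")
    case True
    then obtain M where M: "matching W M" "card M = s" "(x, b) \<in> M \<or> (b, x) \<in> M"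
      using s assms(2) unfolding special_inv_def by blast
    have "y = b" if h: "(x, y) \<in> M \<or> (y, x) \<in> M" for y
      using h M(3) xb
        matching_unique[OF M(1), of x y x b] matching_unique[OF M(1), of x y b x]
        matching_unique[OF M(1), of y x x b] matching_unique[OF M(1), of y x b x] by auto
    then show thesis using that[OF M(1)] v M(2) True by blast
  next
    case False
    then obtain M where M: "matching W M" "card M = s" "x \<notin> Field M"
      using s assms(2) unfolding special_inv_def by blast
    have "y = b" if "(x, y) \<in> M \<or> (y, x) \<in> M" for y
      using that M(3) by (auto simp: Field_def)
    then show thesis using that[OF M(1)] v M(2,3) by blast
  qed
qed

lemma special_avoid:
  assumes "special k W" "(u, w) \<in> W"
  obtains M where "matching W M" "val (Field W) W M = k" "(u, w) \<notin> M" "(w, u) \<notin> M"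
proof -
  obtain y where y: "y \<noteq> w" "(u, y) \<in> W" using special_other_out[OF assms] by blast
  obtain M where "matching W M" "val (Field W) W M = k" "\<And>v. (u, v) \<in> M \<or> (v, u) \<in> M \<Longrightarrow> v = y"
    using special_at[OF assms(1) y(2)] by metis
  then show thesis using that y(1) by blast
qed

lemma special_miss:
  assumes "special 1 W" "u \<in> Field W"
  obtains M where "matching W M" "val (Field W) W M = 1" "u \<notin> Field M"
proof -
  obtain s where s: "special_inv 1 W s" using special_ex_inv[OF assms(1)] by blast
  then obtain M where "matching W M" "card M = s" "u \<notin> Field M"
    using assms(2) unfolding special_inv_def by blast
  then show thesis using that s unfolding special_inv_def val_def by blast
qed

lemma special_ex_matching:
  assumes "special k W"
  obtains M where "matching W M" "val (Field W) W M = k"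
proof -
  have "W \<noteq> {}" using assms by (cases rule: special.cases) auto
  then obtain u w where "(u, w) \<in> W" by auto
  then show thesis using special_avoid[OF assms] that by metis
qed

lemma proper_colouring:
  assumes "critical A" "R \<subseteq> Field A" "R \<noteq> Field A"
  obtains \<phi> where "acyclic (monochrom \<phi> (A \<inter> R \<times> R))"
proof -
  have "Field (A \<inter> R \<times> R) \<subseteq> R" by (auto simp: Field_def)
  then have "A \<inter> R \<times> R \<noteq> A" using assms(2,3) by auto
  then have "colourable (A \<inter> R \<times> R)" using critical_subset[OF assms(1)] by auto
  then show thesis using that by (auto simp: colourable_def)
qed

context contraction
begin

lemma finite_R: "finite R"
  using RV critical_finite_Field[OF crit] finite_subset by metis

lemma extend:
  assumes W: "W \<subseteq> B" "critical W" and M: "matching A M" "Field M \<subseteq> R" and M': "matching W M'"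
  shows "matching A (M \<union> mU M')" "Field (M \<union> mU M') \<subseteq> R \<union> U W" "R \<union> U W \<subseteq> Field A"
    "val (R \<union> U W) (A \<inter> (R \<union> U W) \<times> (R \<union> U W)) (M \<union> mU M') = val R (A \<inter> R \<times> R) M + cost W M'"
proof -
  note m = mU[OF W M']
  have US: "U W \<subseteq> Field A - R" by (rule U_sub[OF W])
  have finU: "finite (U W)" using US critical_finite_Field[OF crit] by (meson finite_Diff finite_subset)
  have disj: "Field M \<inter> Field (mU M') = {}" using M(2) m(2) US by blast
  show "matching A (M \<union> mU M')" by (rule matching_Un[OF M(1) m(1) disj])
  show "Field (M \<union> mU M') \<subseteq> R \<union> U W" using M(2) m(2) by (auto simp: Field_def)
  show "R \<union> U W \<subseteq> Field A" using US RV by blast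
  have finM: "finite M" using matching_finite[OF M(1) critical_finite[OF crit]] .
  have c1: "card (M \<union> mU M') = card M + card (mU M')" by (rule matching_Un_card[OF finM m(4) disj])
  have c2: "card (R \<union> U W) = card R + card (U W)"
    by (rule card_Un_disjoint[OF finite_R finU]) (use US in blast)
  have eq: "A \<inter> (R \<union> U W) \<times> (R \<union> U W) = (A \<inter> R \<times> R) \<union> new (U W)" unfolding new_def by blast
  have c3: "card ((A \<inter> R \<times> R) \<union> new (U W)) = card (A \<inter> R \<times> R) + card (new (U W))"
    by (rule card_Un_disjoint) (use critical_finite[OF crit] new_finite[OF W] in \<open>auto simp: new_def\<close>)
  show "val (R \<union> U W) (A \<inter> (R \<union> U W) \<times> (R \<union> U W)) (M \<union> mU M') = val R (A \<inter> R \<times> R) M + cost W M'"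
    unfolding eq val_def c1 c2 c3 cost_def[OF W] by simp
qed

end

section \<open>The potential in a minimal counterexample\<close>

text \<open>The last two assumptions are the negation of \<open>good A\<close>.\<close>

locale counterexample =
  fixes A :: "('a \<times> 'a) set"
  assumes crit: "critical A"
    and IH: "\<And>B :: ('a \<times> 'a) set. critical B \<Longrightarrow> card (Field B) < card (Field A) \<Longrightarrow> good B"
    and not_special: "\<And>k. \<not> special k A"
    and val_ge: "\<And>M. matching A M \<Longrightarrow> -1 \<le> val (Field A) A M"
begin

abbreviation V :: "'a set" where "V \<equiv> Field A"

lemma fin: "finite A" "finite V" using critical_finite[OF crit] critical_finite_Field[OF crit] by auto

lemma irr: "(a, a) \<notin> A" using critical_irrefl[OF crit] .

lemma counterexample_converse: "counterexample (A\<inverse>)"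
proof
  show "critical (A\<inverse>)" by (rule critical_converse[OF crit])
  show "good B" if "critical B" "card (Field B) < card (Field (A\<inverse>))" for B :: "('a \<times> 'a) set"
    using IH that by simp
  show "\<not> special k (A\<inverse>)" for k using special_converse[of k "A\<inverse>"] not_special by auto
  show "-1 \<le> val (Field (A\<inverse>)) (A\<inverse>) M" if "matching (A\<inverse>) M" for M
    using val_ge[of M] matching_converse[OF that] by (simp add: val_def)
qed

lemma matching_ne: "matching A M \<Longrightarrow> e \<in> M \<Longrightarrow> fst e \<noteq> snd e"
  using irr unfolding matching_def by (metis IntD1 prod.collapse subsetD)

text \<open>The extreme case is a matched digon, \<open>14 - 6 - 2 = 6\<close>.\<close>

lemma val_small:
  assumes "R \<subseteq> V" "R \<noteq> {}" "matching A M" "Field M \<subseteq> R" "card R \<le> 2"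
  shows "6 \<le> val R (A \<inter> R \<times> R) M"
proof -
  have "finite R" using assms(1) fin finite_subset by metis
  then have "card R \<noteq> 0" using assms(2) by simp
  then consider "card R = 1" | "card R = 2" using assms(5) by linarith
  then show ?thesis
  proof cases
    case 1
    then obtain a where a: "R = {a}" by (rule card_1_singletonE)
    have "A \<inter> R \<times> R = {}" using irr a by auto
    moreover have "M = {}"
    proof (rule ccontr)
      assume "M \<noteq> {}"
      then obtain u v where uv: "(u, v) \<in> M" by auto
      then have "u \<in> R" "v \<in> R" using assms(4) by (auto simp: Field_def)
      moreover have "(u, v) \<in> A" using assms(3) uv by (auto simp: matching_def)
      ultimately show False using a irr by auto
    qed
    ultimately show ?thesis using 1 by (simp add: val_def)
  next
    case 2
    then obtain a b where ab: "R = {a, b}" "a \<noteq> b" by (meson card_2_iff)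
    have C: "A \<inter> R \<times> R \<subseteq> {(a, b), (b, a)}" using irr ab by auto
    have "card {(a, b), (b, a)} \<le> 2" using ab by simp
    then have "card (A \<inter> R \<times> R) \<le> 2" using card_mono[OF _ C] by simp
    moreover have "card M \<le> 1"
    proof (rule ccontr)
      assume "\<not> card M \<le> 1"
      then have "2 \<le> card M" by simp
      then obtain e e' where e: "e \<in> M" "e' \<in> M" "e \<noteq> e'" by (rule ex_two)
      have "fst e \<in> R" "fst e' \<in> R" "snd e \<in> R" "snd e' \<in> R"
        using Field_edge[OF e(1)] Field_edge[OF e(2)] assms(4) by (simp_all add: subset_iff)
      moreover have "{fst e, snd e} \<inter> {fst e', snd e'} = {}"
        using assms(3)[unfolded matching_def, THEN conjunct2, rule_format, OF e] .
      moreover have "fst e \<noteq> snd e" "fst e' \<noteq> snd e'"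
        using matching_ne[OF assms(3) e(1)] matching_ne[OF assms(3) e(2)] by auto
      ultimately show False unfolding ab(1) by auto
    qed
    ultimately show ?thesis using 2 by (simp add: val_def)
  qed
qed

text \<open>Extending \<open>R\<close> through the contraction lowers the potential by at least five, and repeating this ends with
  the whole digraph, whose potential is at least \<open>-1\<close>.\<close>

lemma bound_full:
  assumes "R \<subseteq> V" "R \<noteq> {}" "matching A M" "Field M \<subseteq> R"
  shows "-1 \<le> val R (A \<inter> R \<times> R) M \<and> (R \<noteq> V \<longrightarrow> 4 \<le> val R (A \<inter> R \<times> R) M)"
  using assms
proof (induction "card (V - R)" arbitrary: R M rule: less_induct)
  case less
  have finR: "finite R" using less.prems(1) fin finite_subset by metis
  have R0: "card R \<noteq> 0" using less.prems(2) finR by simp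
  show ?case
  proof (cases "R = V")
    case True
    have "A \<inter> V \<times> V = A" by (auto simp: Field_def)
    then show ?thesis using val_ge[OF less.prems(3)] True by simp
  next
    case False
    have "4 \<le> val R (A \<inter> R \<times> R) M"
    proof -
      \<comment> \<open>For at most two vertices the contraction might fail to be smaller, but there
        the potential is at least \<open>6\<close> anyway.\<close>
      consider "card R = 1" | "card R = 2" | "3 \<le> card R" using R0 by linarith
      then show ?thesis
      proof cases
        case 1
        then show ?thesis using val_small[OF less.prems] by simp
      next
        case 2
        then show ?thesis using val_small[OF less.prems] by simp
      next
        case 3
        obtain \<phi> where \<phi>: "acyclic (monochrom \<phi> (A \<inter> R \<times> R))"
          using proper_colouring[OF crit less.prems(1) False] .
        have "2 \<le> card R" using 3 by simp
        then obtain x1 x2 where x: "x1 \<in> R" "x2 \<in> R" "x1 \<noteq> x2" by (rule ex_two)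
        interpret c: contraction A R \<phi> x1 x2
          by (rule contraction.intro[OF crit less.prems(1) False x \<phi>])
        obtain W where W: "W \<subseteq> c.B" "critical W" using c.ex_W by blast
        have RA: "card R \<le> card V" using card_mono[OF fin(2) less.prems(1)] .
        then have "card (Field W) < card V" using c.card_Field_W[OF W] 3 by linarith
        then have "good W" using IH W(2) by blast
        then obtain M' where M': "matching W M'" "c.cost W M' \<le> -5" using c.cost_good[OF W] by metis
        note e = c.extend[OF W less.prems(3,4) M'(1)]
        let ?R = "R \<union> c.U W"
        have "V - ?R \<subset> V - R" using c.U_nonempty[OF W] c.U_sub[OF W] by blast
        then have "card (V - ?R) < card (V - R)" using fin(2) by (simp add: psubset_card_mono)
        then have "-1 \<le> val ?R (A \<inter> ?R \<times> ?R) (M \<union> c.mU M')"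
          using less.hyps[of ?R "M \<union> c.mU M'"] e(1-3) less.prems(2) by blast
        then show ?thesis using e(4) M'(2) by linarith
      qed
    qed
    then show ?thesis by simp
  qed
qed

lemma
  assumes "R \<subseteq> V" "R \<noteq> {}" "C \<subseteq> A \<inter> R \<times> R" "matching A M" "Field M \<subseteq> R"
  shows bound: "-1 \<le> val R C M" and bound_proper: "R \<noteq> V \<Longrightarrow> 4 \<le> val R C M"
proof -
  have "card C \<le> card (A \<inter> R \<times> R)" by (rule card_mono[OF _ assms(3)]) (use fin in simp)
  then have "val R (A \<inter> R \<times> R) M \<le> val R C M" by (simp add: val_def)
  then show "-1 \<le> val R C M" "R \<noteq> V \<Longrightarrow> 4 \<le> val R C M" using bound_full[OF assms(1,2,4,5)] by auto
qed

text \<open>All arcs are kept while a vertex is given away: \<open>-7\<close>, and \<open>+2\<close>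
  if a matching edge ended there.\<close>

lemma val_diff_vertex:
  fixes W :: "('a \<times> 'a) set"
  assumes "critical W" "matching W M" "t \<in> Field W"
  shows "val (Field W - {t}) (W - {t} \<times> {t}) (mdel t M) \<le> val (Field W) W M - 5"
    "t \<notin> Field M \<Longrightarrow> val (Field W - {t}) (W - {t} \<times> {t}) (mdel t M) \<le> val (Field W) W M - 7"
proof -
  have fW: "finite (Field W)" "finite M"
    using critical_finite_Field[OF assms(1)] matching_finite[OF assms(2) critical_finite[OF assms(1)]] by auto
  have "W - {t} \<times> {t} = W" using critical_irrefl[OF assms(1)] by auto
  moreover have "card (Field W) = card (Field W - {t}) + 1"
    using card_Suc_Diff1[OF fW(1) assms(3)] by simp
  moreover note mdel_card[OF assms(2) fW(2), of t] mdel_id[of t M]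
  ultimately show "val (Field W - {t}) (W - {t} \<times> {t}) (mdel t M) \<le> val (Field W) W M - 5"
    "t \<notin> Field M \<Longrightarrow> val (Field W - {t}) (W - {t} \<times> {t}) (mdel t M) \<le> val (Field W) W M - 7"
    unfolding val_def by simp_all
qed

text \<open>The part of a smaller critical digraph outside \<open>T\<close>, counted with all arcs
  not inside \<open>T\<close>, is as cheap as an extension by contraction. If \<open>T\<close> has
  two or more vertices, it is contracted inside \<open>W\<close>, and again after each enlargement;
  the pieces add up and each is at most \<open>-5\<close>. For a single vertex the potential of
  \<open>W\<close> is used directly. Serves to glue overlapping devices.\<close>

lemma cost_part:
  fixes W :: "('a \<times> 'a) set"
  assumes "critical W" "card (Field W) < card V" "T \<subseteq> Field W" "T \<noteq> {}" "T \<noteq> Field W"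
  shows "\<exists>M. matching W M \<and> Field M \<subseteq> Field W - T \<and> val (Field W - T) (W - T \<times> T) M \<le> -5"
  using assms(3-)
proof (induction "card (Field W - T)" arbitrary: T rule: less_induct)
  case less
  have finW: "finite (Field W)" using critical_finite_Field[OF assms(1)] .
  have finT: "finite T" using less.prems(1) finW finite_subset by metis
  have gW: "good W" using IH assms(1,2) by blast
  have T0: "card T \<noteq> 0" using less.prems(2) finT by simp
  then consider "card T = 1" | "2 \<le> card T" by linarith
  then show ?case
  proof cases
    case 1
    then obtain t where t: "T = {t}" by (rule card_1_singletonE)
    have tF: "t \<in> Field W" using t less.prems(1) by simp
    \<comment> \<open>Giving away \<open>t\<close> saves at least \<open>5\<close> net of its
      matching edge and \<open>7\<close> if it is uncovered, hence the two thresholds.\<close>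
    have *: ?thesis if M: "matching W M" "val (Field W) W M \<le> 0 \<or> (t \<notin> Field M \<and> val (Field W) W M \<le> 1)" for M
    proof (intro exI conjI)
      show "matching W (mdel t M)" by (rule mdel_matching[OF M(1)])
      show "Field (mdel t M) \<subseteq> Field W - T" using mdel_Field[of t M] matching_Field[OF M(1)] t by blast
      show "val (Field W - T) (W - T \<times> T) (mdel t M) \<le> -5"
        using val_diff_vertex[OF assms(1) M(1) tF] M(2) unfolding t by linarith
    qed
    from gW show ?thesis
    proof (cases rule: good_cases)
      case (1 k)
      consider "k = 1" | "k = -1" using special_kind[OF 1] by blast
      then show ?thesis
      proof cases
        assume "k = 1"
        with 1 have "special 1 W" by simp
        then obtain M where M: "matching W M" "val (Field W) W M = 1" "t \<notin> Field M" using tF by (rule special_miss)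
        show ?thesis by (rule *[OF M(1)]) (simp add: M(2,3))
      next
        assume "k = -1"
        with 1 have "special (-1) W" by simp
        then obtain M where M: "matching W M" "val (Field W) W M = -1" by (rule special_ex_matching)
        show ?thesis by (rule *[OF M(1)]) (simp add: M(2))
      qed
    next
      case (2 M)
      show ?thesis by (rule *[OF 2(1)]) (use 2(2) in linarith)
    qed
  next
    case 2
    obtain \<phi> where \<phi>: "acyclic (monochrom \<phi> (W \<inter> T \<times> T))"
      using proper_colouring[OF assms(1) less.prems(1,3)] .
    obtain x1 x2 where x: "x1 \<in> T" "x2 \<in> T" "x1 \<noteq> x2" using ex_two[OF 2] .
    interpret c: contraction W T \<phi> x1 x2
      by (rule contraction.intro[OF assms(1) less.prems(1,3) x \<phi>])
    obtain W' where W': "W' \<subseteq> c.B" "critical W'" using c.ex_W by blast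
    have "card T \<le> card (Field W)" using card_mono[OF finW less.prems(1)] .
    then have "card (Field W') < card V" using c.card_Field_W[OF W'] 2 assms(2) by linarith
    then have "good W'" using IH W'(2) by blast
    then obtain M' where M': "matching W' M'" "c.cost W' M' \<le> -5" using c.cost_good[OF W'] by metis
    note m = c.mU[OF W' M'(1)]
    let ?U = "c.U W'"
    have US: "?U \<subseteq> Field W - T" by (rule c.U_sub[OF W'])
    have cost: "val ?U (c.new ?U) (c.mU M') \<le> -5"
      using M'(2) unfolding c.cost_def[OF W'] val_def .
    show ?thesis
    proof (cases "T \<union> ?U = Field W")
      case True
      have "Field W - T = ?U" using True US by blast
      moreover have "c.new ?U = W - T \<times> T" unfolding c.new_def True by (auto simp: Field_def)
      ultimately show ?thesis using m(1,2) cost by auto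
    next
      case False
      let ?T = "T \<union> ?U"
      have "Field W - ?T \<subset> Field W - T" using c.U_nonempty[OF W'] US by blast
      then have "card (Field W - ?T) < card (Field W - T)" using finW by (simp add: psubset_card_mono)
      then obtain M where M: "matching W M" "Field M \<subseteq> Field W - ?T" "val (Field W - ?T) (W - ?T \<times> ?T) M \<le> -5"
        using less.hyps[of ?T] less.prems False US by blast
      have fM: "finite M" using matching_finite[OF M(1) critical_finite[OF assms(1)]] .
      have disj: "Field (c.mU M') \<inter> Field M = {}" using M(2) m(2) by blast
      have finU: "finite ?U" using US finW by (meson finite_Diff finite_subset)
      have "Field W - T = ?U \<union> (Field W - ?T)" using US by blast
      moreover have "card (?U \<union> (Field W - ?T)) = card ?U + card (Field W - ?T)"
        by (rule card_Un_disjoint[OF finU]) (use finW in auto)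
      moreover have "W - T \<times> T = c.new ?U \<union> (W - ?T \<times> ?T)" unfolding c.new_def by blast
      moreover have "card (c.new ?U \<union> (W - ?T \<times> ?T)) = card (c.new ?U) + card (W - ?T \<times> ?T)"
        by (rule card_Un_disjoint[OF c.new_finite[OF W']])
          (use critical_finite[OF assms(1)] in \<open>auto simp: c.new_def\<close>)
      moreover have "card (c.mU M' \<union> M) = card (c.mU M') + card M"
        by (rule matching_Un_card[OF m(4) fM disj])
      ultimately have "val (Field W - T) (W - T \<times> T) (c.mU M' \<union> M)
          = val ?U (c.new ?U) (c.mU M') + val (Field W - ?T) (W - ?T \<times> ?T) M"
        unfolding val_def by simp
      moreover have "matching W (c.mU M' \<union> M)" by (rule matching_Un[OF m(1) M(1) disj])
      moreover have "Field (c.mU M' \<union> M) \<subseteq> Field W - T" using M(2) m(2) US by (auto simp: Field_def)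
      ultimately show ?thesis using cost M(3) by (intro exI[of _ "c.mU M' \<union> M"]) simp
    qed
  qed
qed

end

section \<open>Reducible configurations\<close>

lemma card2_other:
  assumes "card X = 2" "w \<in> X"
  obtains r where "r \<noteq> w" "X = {w, r}"
proof -
  obtain p q where pq: "X = {p, q}" "p \<noteq> q" using assms(1) by (meson card_2_iff)
  show thesis
  proof (cases "w = p")
    case True
    then show ?thesis using that[of q] pq by simp
  next
    case False
    then have "w = q" using assms(2) pq by simp
    then show ?thesis using that[of p] pq by (simp add: insert_commute)
  qed
qed

lemma digon_colour:
  assumes "acyclic (monochrom c S)" "(a, b) \<in> S" "(b, a) \<in> S"
  shows "c a \<noteq> c b"
proof
  assume "c a = c b"
  then have "(a, b) \<in> monochrom c S" "(b, a) \<in> monochrom c S"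
    using assms by (simp_all add: monochrom_def)
  then have "(a, a) \<in> (monochrom c S)\<^sup>+" by (rule trancl.intros(2)[OF r_into_trancl])
  then show False using assms(1) by (simp add: acyclic_def)
qed

lemma monochrom_cong: "(\<And>v. v \<in> Field S \<Longrightarrow> c v = c' v) \<Longrightarrow> monochrom c S = monochrom c' S"
  by (auto simp: monochrom_def Field_def)

lemma triangle_not_colourable:
  assumes "(a, b) \<in> S" "(b, a) \<in> S" "(b, d) \<in> S" "(d, b) \<in> S" "(a, d) \<in> S" "(d, a) \<in> S"
  shows "\<not> colourable S"
proof
  assume "colourable S"
  then obtain c where c: "acyclic (monochrom c S)" by (auto simp: colourable_def)
  have "c a \<noteq> c b" "c b \<noteq> c d" "c a \<noteq> c d"
    by (rule digon_colour[OF c]; rule assms)+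
  then show False by simp
qed

lemma wheel_not_colourable:
  assumes "wheel3 z a b d \<subseteq> S"
  shows "\<not> colourable S"
proof
  assume "colourable S"
  then obtain c where c: "acyclic (monochrom c S)" by (auto simp: colourable_def)
  have *: "(a, b) \<in> S" "(b, d) \<in> S" "(d, a) \<in> S" "(z, a) \<in> S" "(a, z) \<in> S" "(z, b) \<in> S" "(b, z) \<in> S"
    "(z, d) \<in> S" "(d, z) \<in> S" using assms unfolding wheel3_def by simp_all
  have "c z \<noteq> c a" "c z \<noteq> c b" "c z \<noteq> c d" by (rule digon_colour[OF c]; rule *)+
  then have "c a = c b" "c b = c d" by simp_all
  then have "(a, b) \<in> monochrom c S" "(b, d) \<in> monochrom c S" "(d, a) \<in> monochrom c S"
    using * by (simp_all add: monochrom_def)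
  then have "(a, a) \<in> (monochrom c S)\<^sup>+" by (meson trancl.simps)
  then show False using c by (simp add: acyclic_def)
qed

lemma good_val:
  assumes "good W"
  obtains M where "matching W M" "val (Field W) W M \<le> 1"
  using assms
proof (cases rule: good_cases)
  case (1 k)
  obtain M where "matching W M" "val (Field W) W M = k" using special_ex_matching[OF 1] .
  then show ?thesis using that special_kind[OF 1] by auto
next
  case (2 M)
  then show ?thesis using that[of M] by simp
qed

lemma FieldI: "(a, b) \<in> S \<Longrightarrow> a \<in> Field S" "(a, b) \<in> S \<Longrightarrow> b \<in> Field S"
  by (auto simp: Field_def)

context counterexample
begin

lemma arc_verts: "(a, b) \<in> A \<Longrightarrow> a \<in> V" "(a, b) \<in> A \<Longrightarrow> b \<in> V" by (auto simp: Field_def)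

lemma not_sub: "\<not> colourable W \<Longrightarrow> W \<subseteq> A \<Longrightarrow> W = A"
  using critical_subset[OF crit] by blast

lemma sub_crit: "critical W \<Longrightarrow> W \<subseteq> A \<Longrightarrow> Field W = V"
  by (drule (1) not_sub[OF critical_not_colourable]) simp

lemma smaller: "F \<subseteq> V \<Longrightarrow> x \<in> V \<Longrightarrow> x \<notin> F \<Longrightarrow> card F < card V"
  by (rule psubset_card_mono[OF fin(2)]) blast

lemma good_smaller:
  fixes W :: "('a \<times> 'a) set"
  shows "critical W \<Longrightarrow> Field W \<subseteq> V \<Longrightarrow> x \<in> V \<Longrightarrow> x \<notin> Field W \<Longrightarrow> good W"
  by (rule IH[OF _ smaller])

lemma deleted_colour:
  assumes "acyclic (monochrom c S)" "\<And>v. v \<in> Field S \<Longrightarrow> c v = c' v"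
  shows "acyclic (monochrom c' S)"
  using assms monochrom_cong[of S c c'] by simp

lemma no_digon_path:
  assumes o: "outs A x = {y, y'}" and i: "ins A y = {x, z}" and ne: "y \<noteq> y'" "x \<noteq> z"
    and d: "(z, y) \<in> A" "(y, z) \<in> A" "(y, x) \<in> A" "(x, y) \<in> A" "(x, y') \<in> A" "(y', x) \<in> A"
  shows False
proof (cases "z = y'")
  case True
  have dis: "distinct [x, y, z]" using d irr ne True by auto
  have "{(x, y), (y, x), (y, z), (z, y), (x, z), (z, x)} = A"
    by (rule not_sub[OF triangle_not_colourable[of x y _ z]]) (use d True in simp_all)
  then show False using special.triangle[OF dis] not_special by simp
next
  case False
  have ne': "x \<noteq> y" "x \<noteq> y'" "y \<noteq> z" using d irr by auto
  define S where "S = del x (del y A)"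
  define B where "B = S \<union> {(z, y'), (y', z)}"
  have SA: "S \<subseteq> A" unfolding S_def using del_subset[of x "del y A"] del_subset[of y A] by blast
  have FS: "Field S \<subseteq> V - {x, y}" unfolding S_def using del_Field[of x "del y A"] del_Field[of y A] by blast
  have zy': "z \<in> V" "y' \<in> V" "x \<in> V" "y \<in> V" using d arc_verts by blast+
  have FB: "Field B \<subseteq> V - {x, y}"
    using FS zy' ne ne' unfolding B_def by (auto simp: Field_def)
  have nc: "\<not> colourable B"
  proof
    assume "colourable B"
    then obtain c where c: "acyclic (monochrom c B)" by (auto simp: colourable_def)
    have czy: "c z \<noteq> c y'" using digon_colour[OF c, of z y'] by (simp add: B_def)
    \<comment> \<open>The new digon makes these two colours different. Then \<open>y\<close> is a
      source of its class when inserted first, and \<open>x\<close> is a sink of its class when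
      inserted second.\<close>
    define c' where "c' = c(x := c z, y := c y')"
    have "acyclic (monochrom c S)" using c monochrom_mono[of S B c] acyclic_subset by (auto simp: B_def)
    then have 1: "acyclic (monochrom c' S)"
      by (rule deleted_colour) (use FS in \<open>auto simp: c'_def\<close>)
    have cv: "c' x = c z" "c' y = c y'" "c' z = c z" "c' y' = c y'" using ne ne' by (auto simp: c'_def)
    have 2: "acyclic (monochrom c' (del x A))"
    proof (rule colour_source[of _ y])
      have "del y (del x A) = S" by (auto simp: S_def del_def)
      then show "acyclic (monochrom c' (del y (del x A)))" using 1 by simp
      show "c' w \<noteq> c' y" if "(w, y) \<in> del x A" for w
      proof -
        have "w \<in> ins A y" "w \<noteq> x" using that by (auto simp: del_def)
        then have "w = z" using i by auto
        then show ?thesis using cv czy by simp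
      qed
    qed
    have "acyclic (monochrom c' A)"
    proof (rule colour_sink[OF 2])
      fix w assume "(x, w) \<in> A"
      then have "w \<in> outs A x" by simp
      then have "w = y \<or> w = y'" using o by auto
      then show "c' w \<noteq> c' x" using cv czy by auto
    qed
    then show False using critical_not_colourable[OF crit] colourableI by blast
  qed
  have finB: "finite B" using finite_subset[OF SA fin(1)] by (simp add: B_def)
  have irrB: "irrefl B" using SA irr False unfolding B_def irrefl_def by auto
  obtain W where W: "W \<subseteq> B" "critical W" using ex_critical[OF finB irrB nc] .
  have FW: "Field W \<subseteq> V - {x, y}" using FB mono_Field[OF W(1)] by simp
  have xyW: "x \<notin> Field W" "y \<notin> Field W" using FW by auto
  have gW: "good W" using good_smaller[OF W(2), of x] FW zy' by blast
  define D where "D = W \<inter> {(z, y'), (y', z)}"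
  have WD: "e \<in> A" if "e \<in> W" "e \<notin> D" for e using that W(1) SA unfolding B_def D_def by blast
  have D0: "D \<noteq> {}"
  proof
    assume "D = {}"
    then have "W \<subseteq> A" using WD by blast
    then have "Field W = V" by (rule sub_crit[OF W(2)])
    then show False using xyW zy' by simp
  qed
  have zyF: "z \<in> Field W" "y' \<in> Field W" using D0 unfolding D_def by (auto simp: Field_def)
  have cD: "1 \<le> card D" "card D \<le> 2" "card D = 2 \<Longrightarrow> D = {(z, y'), (y', z)}"
  proof -
    have Ds: "D \<subseteq> {(z, y'), (y', z)}" and c2: "card {(z, y'), (y', z)} = 2" using False by (auto simp: D_def)
    show "card D \<le> 2" using card_mono[OF _ Ds] c2 by simp
    show "1 \<le> card D" using D0 Ds by (simp add: Suc_le_eq card_gt_0_iff finite_subset[OF Ds])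
    show "card D = 2 \<Longrightarrow> D = {(z, y'), (y', z)}" using card_subset_eq[OF _ Ds] c2 by simp
  qed
  define N where "N = {(z, y), (y, z), (y, x), (x, y), (x, y'), (y', x)}"
  define C where "C = (W - D) \<union> N"
  define R where "R = Field W \<union> {x, y}"
  have fW: "finite W" "finite (Field W)" using critical_finite[OF W(2)] critical_finite_Field[OF W(2)] by auto
  have cR: "card R = card (Field W) + 2" unfolding R_def using xyW fW ne' by simp
  have cN: "card N = 6" unfolding N_def using ne ne' False by simp
  have WN: "(W - D) \<inter> N = {}"
  proof -
    have "e \<notin> N" if "e \<in> W" for e
    proof -
      have "fst e \<in> Field W" "snd e \<in> Field W" using Field_edge[OF that] by auto
      then have "fst e \<noteq> x" "fst e \<noteq> y" "snd e \<noteq> x" "snd e \<noteq> y" using xyW by auto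
      then show ?thesis unfolding N_def by auto
    qed
    then show ?thesis by blast
  qed
  have "card C = card (W - D) + card N"
    unfolding C_def by (rule card_Un_disjoint) (use fW WN in \<open>simp_all add: N_def\<close>)
  moreover have "card (W - D) + card D = card W"
    using card_Diff_subset[of D W] card_mono[OF fW(1), of D] fW(1) finite_subset[of D W]
    by (simp add: D_def)
  ultimately have cC: "card C + card D = card W + 6" using cN by simp
  have NA: "N \<subseteq> A" using d unfolding N_def by simp
  have CA: "C \<subseteq> A" using WD NA unfolding C_def by blast
  have CR: "C \<subseteq> A \<inter> R \<times> R"
  proof -
    have "N \<subseteq> R \<times> R" using zyF unfolding N_def R_def by simp
    moreover have "W \<subseteq> R \<times> R" unfolding R_def by (auto simp: Field_def)
    ultimately show ?thesis using CA unfolding C_def by blast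
  qed
  have RV: "R \<subseteq> V" using FW zy' unfolding R_def by blast
  have R0: "R \<noteq> {}" unfolding R_def by simp
  \<comment> \<open>The matching grows by one edge: \<open>z y'\<close> is replaced by
    \<open>z y\<close> and \<open>x y'\<close>, or else \<open>x y\<close> is added.\<close>
  have key: "\<exists>M'. matching A M' \<and> Field M' \<subseteq> R \<and> card M' = card M + 1" if M: "matching W M" for M
  proof -
    have fM: "finite M" using matching_finite[OF M fW(1)] .
    have FM: "Field M \<subseteq> Field W" by (rule matching_Field[OF M])
    have MW: "e \<in> W" "(snd e, fst e) \<in> W" if "e \<in> M" for e
      using M that unfolding matching_def by (cases e; auto)+
    show ?thesis
    proof (cases "(z, y') \<in> M \<or> (y', z) \<in> M")
      case True
      define N1 where "N1 = mdel z M"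
      have F1: "z \<notin> Field N1" "Field N1 \<subseteq> Field W" using mdel_Field[of z M] FM unfolding N1_def by auto
      have F2: "y' \<notin> Field N1"
        unfolding N1_def by (rule mdel_partner[OF M]) (use True in blast)
      have m1: "matching W N1" unfolding N1_def by (rule mdel_matching[OF M])
      have "N1 \<subseteq> A \<inter> A\<inverse>"
      proof
        fix e assume e: "e \<in> N1"
        then have "e \<in> M" "fst e \<noteq> z" "snd e \<noteq> z" by (auto simp: N1_def mdel_def)
        moreover obtain u v where "e = (u, v)" by (cases e)
        ultimately have "e \<in> A" "(snd e, fst e) \<in> A"
          using MW[of e] WD[of "(u, v)"] WD[of "(v, u)"] by (auto simp: D_def)
        then show "e \<in> A \<inter> A\<inverse>" by (cases e) simp
      qed
      then have m2: "matching A N1" by (rule matching_transfer[OF m1])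
      have f1: "finite N1" unfolding N1_def by (rule mdel_finite[OF fM])
      have yF: "y \<notin> Field N1" "x \<notin> Field N1" using F1 xyW by auto
      have m3: "matching A (insert (z, y) N1)" by (rule matching_insert[OF m2 d(1,2) F1(1) yF(1)])
      have F3: "Field (insert (z, y) N1) = insert z (insert y (Field N1))" by (auto simp: Field_def)
      have x3: "x \<notin> Field (insert (z, y) N1)" "y' \<notin> Field (insert (z, y) N1)"
        unfolding F3 using yF F2 ne ne' False by auto
      have m4: "matching A (insert (x, y') (insert (z, y) N1))"
        by (rule matching_insert[OF m3 d(5,6) x3])
      have cN1: "card M = card N1 + 1"
      proof -
        have "N1 \<subseteq> M" "(z, y') \<notin> N1" "(y', z) \<notin> N1" by (auto simp: N1_def mdel_def)
        then have "N1 \<subset> M" using True by blast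
        then have "card N1 < card M" by (rule psubset_card_mono[OF fM])
        then show ?thesis using mdel_card[OF M fM, of z] unfolding N1_def by simp
      qed
      have "card (insert (x, y') (insert (z, y) N1)) = card M + 1"
        using matching_insert_card[OF m3 _ x3(1)] matching_insert_card[OF m2 f1 F1(1)] f1 cN1 by simp
      moreover have "Field (insert (x, y') (insert (z, y) N1)) \<subseteq> R"
        using F1 zyF unfolding R_def by (auto simp: Field_def)
      ultimately show ?thesis using m4 by blast
    next
      case nD: False
      have "M \<subseteq> A \<inter> A\<inverse>"
      proof
        fix e assume e: "e \<in> M"
        then have "e \<noteq> (z, y')" "e \<noteq> (y', z)" using nD by auto
        then have "e \<in> A" "(snd e, fst e) \<in> A" using MW[OF e] WD by (cases e; auto simp: D_def)+
        then show "e \<in> A \<inter> A\<inverse>" by (cases e) simp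
      qed
      then have m2: "matching A M" by (rule matching_transfer[OF M])
      have nx: "x \<notin> Field M" "y \<notin> Field M" using FM xyW by auto
      have "matching A (insert (x, y) M)" by (rule matching_insert[OF m2 d(4,3) nx])
      moreover have "card (insert (x, y) M) = card M + 1" by (rule matching_insert_card[OF m2 fM nx(1)])
      moreover have "Field (insert (x, y) M) \<subseteq> R" using FM unfolding R_def by (auto simp: Field_def)
      ultimately show ?thesis by blast
    qed
  qed
  have vv: "\<exists>M'. matching A M' \<and> Field M' \<subseteq> R \<and> val R C M' = val (Field W) W M + 3 * int (card D) - 6"
    if M: "matching W M" for M
  proof -
    obtain M' where M': "matching A M'" "Field M' \<subseteq> R" "card M' = card M + 1" using key[OF M] by blast
    \<comment> \<open>Two vertices, six arcs less those of \<open>D\<close>, one matching edge: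
      \<open>14 - 18 + 3 * card D - 2\<close>.\<close>
    have "val R C M' = val (Field W) W M + 3 * int (card D) - 6"
      using cC M'(3) cR unfolding val_def by simp
    then show ?thesis using M' by blast
  qed
  have RVeq: "R = V"
  proof (rule ccontr)
    assume RV': "R \<noteq> V"
    obtain M where M: "matching W M" "val (Field W) W M \<le> 1" using good_val[OF gW] .
    obtain M' where M': "matching A M'" "Field M' \<subseteq> R" "val R C M' = val (Field W) W M + 3 * int (card D) - 6"
      using vv[OF M(1)] by blast
    show False using bound_proper[OF RV R0 CR M'(1,2) RV'] M'(3) M(2) cD(2) by linarith
  qed
  from gW show False
  proof (cases rule: good_cases)
    case (2 M)
    obtain M' where M': "matching A M'" "Field M' \<subseteq> R" "val R C M' = val (Field W) W M + 3 * int (card D) - 6"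
      using vv[OF 2(1)] by blast
    show False using bound[OF RV R0 CR M'(1,2)] M'(3) 2(2) cD(2) by linarith
  next
    case (1 k)
    obtain M where M: "matching W M" "val (Field W) W M = k" using special_ex_matching[OF 1] .
    obtain M' where M': "matching A M'" "Field M' \<subseteq> R" "val R C M' = val (Field W) W M + 3 * int (card D) - 6"
      using vv[OF M(1)] by blast
    have k1: "k \<le> 1" using special_kind[OF 1] by auto
    have D2: "card D = 2" using bound[OF RV R0 CR M'(1,2)] M'(3) M(2) k1 cD(1,2) by linarith
    have "C = A"
    proof (rule ccontr)
      assume "C \<noteq> A"
      then have "card C < card A" using CA by (intro psubset_card_mono[OF fin(1)]) blast
      then have "val R A M' \<le> val R C M' - 3" unfolding val_def by simp
      then show False using val_ge[OF M'(1)] M'(3) M(2) k1 D2 RVeq by simp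
    qed
    moreover have DD: "D = {(z, y'), (y', z)}" using cD(3)[OF D2] .
    have "(z, y') \<in> W" "(y', z) \<in> W" using DD unfolding D_def by auto
    then have "special k (W - {(z, y'), (y', z)} \<union> {(z, y), (y, z), (y, x), (x, y), (x, y'), (y', x)})"
      by (rule special.subdivide[OF 1]) (use xyW ne' in auto)
    ultimately show False using not_special unfolding C_def N_def DD by blast
  qed
qed

end

text \<open>When the value \<open>4\<close> is attained there is no slack: the critical subdigraph of the contraction is an odd
  bidirected cycle through the new digon, and its arcs lift uniquely to \<open>A\<close>.\<close>

locale tight = counterexample A + c: contraction A R \<phi> x1 x2 for A :: "('a \<times> 'a) set" and R \<phi> x1 x2 +
  fixes W M
  assumes W: "W \<subseteq> c.B" "critical W"
    and M: "matching A M" "Field M \<subseteq> R"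
    and val4: "val R (A \<inter> R \<times> R) M \<le> 4"
begin

lemma card_R: "3 \<le> card R"
proof (rule ccontr)
  assume "\<not> 3 \<le> card R"
  then have "6 \<le> val R (A \<inter> R \<times> R) M"
    by (intro val_small) (use c.RV c.x M in auto)
  then show False using val4 by linarith
qed

lemma good_W: "good W"
proof (rule IH[OF W(2)])
  have "card R \<le> card V" by (rule card_mono[OF fin(2) c.RV(1)])
  then show "card (Field W) < card V" using c.card_Field_W[OF W] card_R by linarith
qed

text \<open>There is no slack: a proper subset of \<open>V\<close> would need potential at least
  \<open>4\<close> after a loss of \<open>5\<close>, and a loss of more than \<open>5\<close> would
  end below \<open>-1\<close>.\<close>

lemma cost_full: "matching W M' \<Longrightarrow> c.cost W M' \<le> -5 \<Longrightarrow> R \<union> c.U W = V \<and> -5 \<le> c.cost W M'"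
proof -
  assume M': "matching W M'" "c.cost W M' \<le> -5"
  note e = c.extend[OF W M M'(1)]
  have ne: "R \<union> c.U W \<noteq> {}" using c.x by blast
  have b: "-1 \<le> val (R \<union> c.U W) (A \<inter> (R \<union> c.U W) \<times> (R \<union> c.U W)) (M \<union> c.mU M')"
    by (rule bound[OF e(3) ne subset_refl e(1,2)])
  have "R \<union> c.U W = V"
  proof (rule ccontr)
    assume "R \<union> c.U W \<noteq> V"
    then have "4 \<le> val (R \<union> c.U W) (A \<inter> (R \<union> c.U W) \<times> (R \<union> c.U W)) (M \<union> c.mU M')"
      by (rule bound_proper[OF e(3) ne subset_refl e(1,2)])
    then show False using e(4) M'(2) val4 by linarith
  qed
  then show ?thesis using b e(4) val4 by linarith
qed

lemma tight_special: "special 1 W" "(x1, x2) \<in> W" "(x2, x1) \<in> W" and full: "R \<union> c.U W = V"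
proof -
  obtain M' where M': "matching W M'" "c.cost W M' \<le> -5"
    "c.cost W M' \<le> -6 \<or> (special 1 W \<and> (x1, x2) \<in> W \<and> (x2, x1) \<in> W)" using c.cost_good[OF W good_W] .
  note f = cost_full[OF M'(1,2)]
  show "R \<union> c.U W = V" using f by blast
  show "special 1 W" "(x1, x2) \<in> W" "(x2, x1) \<in> W" using f M'(3) by auto
qed

lemma tight_arcs: "inj_on c.g (c.new (c.U W))" "c.g ` c.new (c.U W) = W - c.X \<times> c.X"
proof -
  obtain M' where M': "matching W M'" "c.cost W M' \<le> -5"
    "1 = (1::int) \<Longrightarrow> c.cost W M' \<le> -5 - 3 * (int (card (c.new (c.U W))) - int (card (W - c.X \<times> c.X)))"
    using c.cost_special[OF W tight_special(1)] by metis
  have *: "-5 \<le> t \<Longrightarrow> t \<le> -5 - 3 * (p - q) \<Longrightarrow> p \<le> q" for t p q :: int by simp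
  have "int (card (c.new (c.U W))) \<le> int (card (W - c.X \<times> c.X))"
    by (rule *[OF cost_full[OF M'(1,2), THEN conjunct2] M'(3)[OF refl]])
  then have "card (c.new (c.U W)) \<le> card (W - c.X \<times> c.X)" by simp
  then show "inj_on c.g (c.new (c.U W))" "c.g ` c.new (c.U W) = W - c.X \<times> c.X"
    using c.tight_new[OF W] by auto
qed

lemma U_eq: "c.U W = V - R" using full c.U_sub[OF W] by blast

lemma new_eq: "c.new (c.U W) = A - R \<times> R"
  unfolding c.new_def full by (auto simp: Field_def)

text \<open>Together with \<open>arc_up\<close> and \<open>arc_inj\<close>: contraction is a
  bijection between the arcs of \<open>A\<close> not inside \<open>R\<close> and the arcs of
  \<open>W\<close> other than those of the new digon.\<close>

lemma arc_down: "(a, b) \<in> A \<Longrightarrow> \<not> (a \<in> R \<and> b \<in> R) \<Longrightarrow> (c.f a, c.f b) \<in> W"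
proof -
  assume "(a, b) \<in> A" "\<not> (a \<in> R \<and> b \<in> R)"
  then have "(a, b) \<in> c.new (c.U W)" unfolding new_eq by blast
  then have "c.g (a, b) \<in> W - c.X \<times> c.X" unfolding tight_arcs(2)[symmetric] by (rule imageI)
  then show "(c.f a, c.f b) \<in> W" by (simp add: c.g_def)
qed

lemma arc_up:
  assumes "(p, q) \<in> W" "\<not> (p \<in> {x1, x2} \<and> q \<in> {x1, x2})"
  obtains a b where "(a, b) \<in> A" "\<not> (a \<in> R \<and> b \<in> R)" "c.f a = p" "c.f b = q"
proof -
  have "(p, q) \<in> W - c.X \<times> c.X" using assms unfolding c.X_def by blast
  then have "(p, q) \<in> c.g ` c.new (c.U W)" unfolding tight_arcs(2) .
  then obtain e where e: "e \<in> A - R \<times> R" "(p, q) = c.g e" unfolding new_eq by blast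
  obtain a b where ab: "e = (a, b)" by (cases e)
  show thesis by (rule that[of a b]) (use e ab in \<open>auto simp: c.g_def\<close>)
qed

lemma ex_arc_up:
  "(p, q) \<in> W \<Longrightarrow> p \<notin> {x1, x2} \<or> q \<notin> {x1, x2} \<Longrightarrow> \<exists>a b. (a, b) \<in> A \<and> c.f a = p \<and> c.f b = q"
  using arc_up[of p q] by metis

lemma arc_inj:
  assumes "(a, b) \<in> A" "\<not> (a \<in> R \<and> b \<in> R)" "(a', b') \<in> A" "\<not> (a' \<in> R \<and> b' \<in> R)"
    "c.f a = c.f a'" "c.f b = c.f b'"
  shows "a = a' \<and> b = b'"
proof -
  have "(a, b) = (a', b')"
    by (rule inj_onD[OF tight_arcs(1)]) (use assms in \<open>auto simp: c.g_def new_eq\<close>)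
  then show ?thesis by simp
qed

lemma W_sym: "(p, q) \<in> W \<Longrightarrow> (q, p) \<in> W"
  by (rule special_sym[OF tight_special(1)])

lemma W_deg: "p \<in> Field W \<Longrightarrow> card (outs W p) = 2"
  by (rule special_outdeg[OF tight_special(1)])

lemma W_outs: assumes "(p, q) \<in> W" obtains r where "r \<noteq> q" "outs W p = {q, r}"
  using card2_other[OF W_deg[OF FieldI(1)[OF assms]], of q] assms by auto

lemma W_in_A: "(p, q) \<in> W \<Longrightarrow> p \<notin> R \<Longrightarrow> q \<notin> R \<Longrightarrow> (p, q) \<in> A"
  by (rule c.W_outside[OF W]) (use c.x in \<open>auto simp: c.X_def\<close>)

lemma in_W_out: "p \<in> Field W \<Longrightarrow> p \<notin> {x1, x2} \<Longrightarrow> p \<notin> R"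
  using c.Field_W[OF W] unfolding c.X_def by blast

end

section \<open>Adding one arc to a proper subdigraph\<close>

context counterexample
begin

text \<open>Colouring \<open>W0\<close> without \<open>(u, w)\<close> puts \<open>u\<close> and \<open>w\<close> in one class, which therefore leaves \<open>W0\<close> only
  through \<open>u\<close> and is entered only through \<open>w\<close>; the other class has one exit \<open>s\<close> and one entrance \<open>t\<close>. So a digon of
  \<open>W0\<close> away from these vertices is reducible, and \<open>W0\<close> must be a triangle.\<close>

lemma add_arc_tight_contradiction:
  assumes W0: "critical W0" "special 1 W0" "Field W0 \<subseteq> V" "Field W0 \<noteq> V"
    and uw: "(u, w) \<in> W0" and exact: "A \<inter> Field W0 \<times> Field W0 = W0 - {(u, w)}"
    and M0: "matching A M0" "Field M0 \<subseteq> Field W0" "val (Field W0) (A \<inter> Field W0 \<times> Field W0) M0 \<le> 4"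
  shows False
proof -
  let ?R = "Field W0"
  have s0: "(q, p) \<in> W0" if "(p, q) \<in> W0" for p q by (rule special_sym[OF W0(2) that])
  have irr0: "p \<noteq> q" if "(p, q) \<in> W0" for p q using that critical_irrefl[OF W0(1)] by auto
  have o0: "\<exists>r. r \<noteq> q \<and> outs W0 p = {q, r}" if "(p, q) \<in> W0" for p q
    using card2_other[OF special_outdeg[OF W0(2) FieldI(1)[OF that]], of q] that by auto
  have inA: "(p, q) \<in> A" if "(p, q) \<in> W0" "(p, q) \<noteq> (u, w)" for p q
    using that exact by blast
  have inW: "(p, q) \<in> W0" "(p, q) \<noteq> (u, w)" if "(p, q) \<in> A" "p \<in> ?R" "q \<in> ?R" for p q
    using that exact by blast+
  obtain \<phi> where \<phi>: "acyclic (monochrom \<phi> (A \<inter> ?R \<times> ?R))"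
    using proper_colouring[OF crit W0(3,4)] .
  \<comment> \<open>Colours are renamed so that \<open>u\<close> receives
    \<open>True\<close>.\<close>
  define \<psi> where "\<psi> v = (\<phi> v = \<phi> u)" for v
  have "monochrom \<psi> S = monochrom \<phi> S" for S unfolding monochrom_def \<psi>_def by auto
  then have \<psi>: "acyclic (monochrom \<psi> (A \<inter> ?R \<times> ?R))" using \<phi> by simp
  have \<psi>u: "\<psi> u" by (simp add: \<psi>_def)
  \<comment> \<open>If \<open>u\<close> and \<open>w\<close> differed, the missing arc would not be
    monochromatic and all of \<open>W0\<close> would be coloured.\<close>
  have \<psi>w: "\<psi> w"
  proof (rule ccontr)
    assume "\<not> \<psi> w"
    have "monochrom \<psi> W0 \<subseteq> monochrom \<psi> (A \<inter> ?R \<times> ?R)"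
      unfolding exact monochrom_def using \<open>\<not> \<psi> w\<close> \<psi>u by auto
    then have "acyclic (monochrom \<psi> W0)" using \<psi> acyclic_subset by blast
    then show False using critical_not_colourable[OF W0(1)] colourableI by blast
  qed
  \<comment> \<open>All digons of \<open>W0\<close> except \<open>u w\<close> are digons of
    \<open>A\<close>, so the colours alternate along them.\<close>
  have alt: "\<psi> p \<noteq> \<psi> q" if pq: "(p, q) \<in> W0" "(p, q) \<noteq> (u, w)" "(q, p) \<noteq> (u, w)" for p q
  proof (rule digon_colour[OF \<psi>])
    show "(p, q) \<in> A \<inter> ?R \<times> ?R" using pq unfolding exact by blast
    show "(q, p) \<in> A \<inter> ?R \<times> ?R" using s0[OF pq(1)] pq unfolding exact by blast
  qed
  have wu: "(w, u) \<in> W0" using s0[OF uw] .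
  have unw: "u \<noteq> w" using irr0[OF uw] .
  obtain r1 where r1: "r1 \<noteq> w" "outs W0 u = {w, r1}" using o0[OF uw] by blast
  obtain r3 where r3: "r3 \<noteq> u" "outs W0 w = {u, r3}" using o0[OF wu] by blast
  have ur1: "(u, r1) \<in> W0" using r1 by auto
  have wr3: "(w, r3) \<in> W0" using r3 by auto
  have r1u: "r1 \<noteq> u" using irr0[OF ur1] by auto
  have r3w: "r3 \<noteq> w" using irr0[OF wr3] by auto
  have \<psi>r1: "\<not> \<psi> r1" using alt[OF ur1] r1(1) r1u \<psi>u by auto
  have \<psi>r3: "\<not> \<psi> r3" using alt[OF wr3] r3(1) r3w unw \<psi>w by auto
  have RR: "u \<in> ?R" "w \<in> ?R" "r1 \<in> ?R" "r3 \<in> ?R" using uw ur1 wr3 FieldI by metis+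
  interpret c: contraction A ?R \<psi> u r1
    by (rule contraction.intro[OF crit W0(3,4) RR(1,3) r1u[symmetric] \<psi>])
  obtain W where W: "W \<subseteq> c.B" "critical W" using c.ex_W by blast
  interpret t: tight A ?R \<psi> u r1 W M0
    by (intro tight.intro tight_axioms.intro counterexample_axioms c.contraction_axioms W M0)
  have f: "c.f v = (if v \<in> ?R then if \<psi> v then u else r1 else v)" for v
    by (simp add: c.f_def contr_def)
  have fR: "c.f v = v" if "v \<notin> ?R" for v using that f by simp
  have Wo: "\<exists>r. r \<noteq> q \<and> outs W p = {q, r}" if "(p, q) \<in> W" for p q
    using t.W_outs[OF that] by metis
  have irrW: "p \<noteq> q" if "(p, q) \<in> W" for p q using that critical_irrefl[OF W(2)] by auto
  \<comment> \<open>Inside \<open>W0\<close> the vertex \<open>u\<close> has two out-arcs, and the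
    one to \<open>w\<close> is absent from \<open>A\<close>; criticality of \<open>A\<close>
    provides another that leaves \<open>?R\<close>.\<close>
  obtain a where a: "(u, a) \<in> A" "a \<notin> ?R"
  proof -
    have "\<not> outs A u \<subseteq> {r1}"
    proof
      assume "outs A u \<subseteq> {r1}"
      then have "card (outs A u) \<le> 1" using card_mono[of "{r1}" "outs A u"] by simp
      then show False using critical_outdeg[OF crit arc_verts(1)[OF inA[OF ur1]]] r1(1) by simp
    qed
    then obtain a where a: "(u, a) \<in> A" "a \<noteq> r1" by auto
    have "a \<notin> ?R"
    proof
      assume "a \<in> ?R"
      note i = inW[OF a(1) RR(1) this]
      then have "a \<in> outs W0 u" by simp
      then show False using r1(2) a(2) i(2) by auto
    qed
    then show thesis using that a by blast
  qed
  have uaW: "(u, a) \<in> W" using t.arc_down[OF a(1)] a(2) f[of u] fR[OF a(2)] RR \<psi>u by simp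
  have r1W: "(u, r1) \<in> W" "(r1, u) \<in> W" using t.tight_special by auto
  have ar1: "a \<noteq> r1" using a RR by auto
  have oWu: "outs W u = {r1, a}"
  proof -
    obtain r where r: "r \<noteq> r1" "outs W u = {r1, r}" using Wo[OF r1W(1)] by blast
    have "a \<in> outs W u" using uaW by simp
    then show ?thesis using r ar1 by auto
  qed
  obtain a' where a': "(a', w) \<in> A" "a' \<notin> ?R"
  proof -
    have wV: "w \<in> V" using W0(3) RR by blast
    have "\<not> ins A w \<subseteq> {r3}"
    proof
      assume "ins A w \<subseteq> {r3}"
      then have "card (ins A w) \<le> 1" using card_mono[of "{r3}" "ins A w"] by simp
      then show False using critical_indeg[OF crit wV] by simp
    qed
    then obtain a' where a': "(a', w) \<in> A" "a' \<noteq> r3" by auto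
    have "a' \<notin> ?R"
    proof
      assume "a' \<in> ?R"
      note i = inW[OF a'(1) this RR(2)]
      then have "a' \<in> outs W0 w" using s0 by simp
      then show False using r3(2) a'(2) i(2) by auto
    qed
    then show thesis using that a' by blast
  qed
  \<comment> \<open>In \<open>W\<close> the contracted vertex \<open>u\<close> has only the
    neighbours \<open>r1\<close> and \<open>a\<close>, and arcs lift uniquely, so the class of
    \<open>u\<close> is left only along \<open>u a\<close>.\<close>
  have out1: "b = a \<and> v = u" if v: "(v, b) \<in> A" "v \<in> ?R" "\<psi> v" "b \<notin> ?R" for v b
  proof -
    have "(u, b) \<in> W" using t.arc_down[OF v(1)] v f[of v] fR[OF v(4)] by simp
    then have "b \<in> outs W u" by simp
    then have b: "b = a" using oWu v(4) RR by auto
    then show ?thesis using t.arc_inj[OF v(1) _ a(1)] v a(2) f RR \<psi>u by auto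
  qed
  have a'a: "a' = a"
  proof -
    have "(a', u) \<in> W" using t.arc_down[OF a'(1)] a'(2) f[of w] fR[OF a'(2)] RR \<psi>w by simp
    then have "a' \<in> outs W u" using t.W_sym by simp
    then show ?thesis using oWu a'(2) RR by auto
  qed
  have in1: "b = a \<and> v = w" if v: "(b, v) \<in> A" "v \<in> ?R" "\<psi> v" "b \<notin> ?R" for v b
  proof -
    have "(b, u) \<in> W" using t.arc_down[OF v(1)] v f[of v] fR[OF v(4)] by simp
    then have "b \<in> outs W u" using t.W_sym by simp
    then have b: "b = a" using oWu v(4) RR by auto
    then show ?thesis using t.arc_inj[OF v(1) _ a'(1)] v a'(2) f RR \<psi>w a'a by auto
  qed
  obtain b0 where b0: "b0 \<noteq> u" "outs W r1 = {u, b0}" using Wo[OF r1W(2)] by blast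
  have rb: "(r1, b0) \<in> W" "(b0, r1) \<in> W" using b0(2) t.W_sym by auto
  have b0r1: "b0 \<noteq> r1" using irrW[OF rb(1)] by auto
  have b0R: "b0 \<notin> ?R" using t.in_W_out[OF FieldI(1)[OF rb(2)]] b0(1) b0r1 by simp
  obtain s where s: "(s, b0) \<in> A" "s \<in> ?R" "\<not> \<psi> s"
  proof -
    obtain p q where pq: "(p, q) \<in> A" "c.f p = r1" "c.f q = b0"
      using t.ex_arc_up[OF rb(1)] b0(1) b0r1 by auto
    have "q = b0" using pq(3) f[of q] b0(1) b0r1 by (auto split: if_splits)
    moreover have "p \<in> ?R" "\<not> \<psi> p" using pq(2) f[of p] r1u RR by (auto split: if_splits)
    ultimately show thesis using that pq(1) by blast
  qed
  obtain t where t: "(b0, t) \<in> A" "t \<in> ?R" "\<not> \<psi> t"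
  proof -
    obtain p q where pq: "(p, q) \<in> A" "c.f p = b0" "c.f q = r1"
      using t.ex_arc_up[OF rb(2)] b0(1) b0r1 by auto
    have "p = b0" using pq(2) f[of p] b0(1) b0r1 by (auto split: if_splits)
    moreover have "q \<in> ?R" "\<not> \<psi> q" using pq(3) f[of q] r1u RR by (auto split: if_splits)
    ultimately show thesis using that pq(1) by blast
  qed
  have out2: "b = b0 \<and> v = s" if v: "(v, b) \<in> A" "v \<in> ?R" "\<not> \<psi> v" "b \<notin> ?R" for v b
  proof -
    have "(r1, b) \<in> W" using t.arc_down[OF v(1)] v f[of v] fR[OF v(4)] by simp
    then have "b \<in> outs W r1" by simp
    then have b: "b = b0" using b0(2) v(4) RR by auto
    then show ?thesis using t.arc_inj[OF v(1) _ s(1)] v s b0R f by auto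
  qed
  have in2: "b = b0 \<and> v = t" if v: "(b, v) \<in> A" "v \<in> ?R" "\<not> \<psi> v" "b \<notin> ?R" for v b
  proof -
    have "(b, r1) \<in> W" using t.arc_down[OF v(1)] v f[of v] fR[OF v(4)] by simp
    then have "b \<in> outs W r1" using t.W_sym by simp
    then have b: "b = b0" using b0(2) v(4) RR by auto
    then show ?thesis using t.arc_inj[OF v(1) _ t(1)] v t b0R f by auto
  qed
  \<comment> \<open>Unless \<open>g\<close> is the exit or \<open>h\<close> the entrance of the
    second class, \<open>g\<close> has out-degree two and \<open>h\<close> in-degree two in
    \<open>A\<close>, and the digons around them are excluded by
    \<open>no_digon_path\<close>.\<close>
  have claim: "g = s \<or> h = t" if gh: "(g, h) \<in> W0" "g \<noteq> u" "g \<noteq> w" "h \<noteq> u" "h \<noteq> w" for g h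
  proof (rule ccontr)
    assume n: "\<not> (g = s \<or> h = t)"
    have ghR: "g \<in> ?R" "h \<in> ?R" using gh(1) FieldI by metis+
    obtain g' where g': "g' \<noteq> h" "outs W0 g = {h, g'}" using o0[OF gh(1)] by blast
    obtain h' where h': "h' \<noteq> g" "outs W0 h = {g, h'}" using o0[OF s0[OF gh(1)]] by blast
    have gg': "(g, g') \<in> W0" "(g', g) \<in> W0" using g'(2) s0 by auto
    have hh': "(h, h') \<in> W0" "(h', h) \<in> W0" using h'(2) s0 by auto
    have "outs A g = {h, g'}"
    proof
      show "outs A g \<subseteq> {h, g'}"
      proof
        fix b assume "b \<in> outs A g"
        then have b: "(g, b) \<in> A" by simp
        have "b \<in> ?R" using out1[OF b ghR(1)] out2[OF b ghR(1)] gh(2) n by blast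
        then have "b \<in> outs W0 g" using inW(1)[OF b ghR(1)] by simp
        then show "b \<in> {h, g'}" using g'(2) by simp
      qed
      show "{h, g'} \<subseteq> outs A g" using inA[OF gh(1)] inA[OF gg'(1)] gh by simp
    qed
    moreover have "ins A h = {g, h'}"
    proof
      show "ins A h \<subseteq> {g, h'}"
      proof
        fix b assume "b \<in> ins A h"
        then have b: "(b, h) \<in> A" by simp
        have "b \<in> ?R" using in1[OF b ghR(2)] in2[OF b ghR(2)] gh(5) n by blast
        then have "b \<in> outs W0 h" using inW(1)[OF b _ ghR(2)] s0 by simp
        then show "b \<in> {g, h'}" using h'(2) by simp
      qed
      show "{g, h'} \<subseteq> ins A h" using inA[OF gh(1)] inA[OF hh'(2)] gh by simp
    qed
    ultimately show False
      by (rule no_digon_path) (use g' h' inA hh' gg' gh s0[OF gh(1)] in auto)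
  qed
  obtain q1 where q1: "q1 \<noteq> u" "outs W0 r1 = {u, q1}" using o0[OF s0[OF ur1]] by blast
  obtain q3 where q3: "q3 \<noteq> w" "outs W0 r3 = {w, q3}" using o0[OF s0[OF wr3]] by blast
  have rq1: "(r1, q1) \<in> W0" "(q1, r1) \<in> W0" using q1(2) s0 by auto
  have rq3: "(r3, q3) \<in> W0" "(q3, r3) \<in> W0" using q3(2) s0 by auto
  have sr: "s = r1" if "q1 \<noteq> w"
  proof -
    have "\<psi> q1" using alt[OF rq1(1)] \<psi>r1 r1u r1(1) by auto
    then have "s \<noteq> q1" "t \<noteq> q1" using s(3) t(3) by auto
    then show ?thesis using claim[OF rq1(1)] claim[OF rq1(2)] r1u r1(1) q1(1) that by auto
  qed
  have sr3: "s = r3" if "q3 \<noteq> u"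
  proof -
    have "\<psi> q3" using alt[OF rq3(1)] \<psi>r3 r3w r3(1) by auto
    then have "s \<noteq> q3" "t \<noteq> q3" using s(3) t(3) by auto
    then show ?thesis using claim[OF rq3(1)] claim[OF rq3(2)] r3w r3(1) q3(1) that by auto
  qed
  \<comment> \<open>The second class has a single exit, which cannot be both \<open>r1\<close> and
    \<open>r3\<close>. So the cycle closes up after three vertices.\<close>
  have q1w: "q1 = w"
  proof (rule ccontr)
    assume q: "q1 \<noteq> w"
    have r13: "r1 \<noteq> r3"
    proof
      assume "r1 = r3"
      then have "w \<in> outs W0 r1" using s0[OF wr3] by simp
      then show False using q1 q unw by auto
    qed
    have "q3 \<noteq> u"
    proof
      assume "q3 = u"
      then have "r3 \<in> outs W0 u" using rq3 by simp
      then show False using r1 r3w r13 by auto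
    qed
    then show False using sr[OF q] sr3 r13 by simp
  qed
  have rw: "(r1, w) \<in> W0" "(w, r1) \<in> W0" using rq1 q1w by auto
  define T where "T = {(u, w), (w, u), (w, r1), (r1, w), (u, r1), (r1, u)}"
  have "T = W0"
  proof (rule ccontr)
    assume "T \<noteq> W0"
    moreover have "T \<subseteq> W0" unfolding T_def using uw wu rw ur1 s0[OF ur1] by simp
    ultimately have "colourable T" using critical_subset[OF W0(1)] by blast
    moreover have "\<not> colourable T" by (rule triangle_not_colourable[of u w _ r1]) (simp_all add: T_def)
    ultimately show False by simp
  qed
  then have "?R = Field T" by simp
  also have "\<dots> = {u, w, r1}" unfolding T_def Field_def by auto
  finally have R3: "?R = {u, w, r1}" .
  have sr1: "s = r1" "t = r1" using s(2,3) t(2,3) R3 \<psi>u \<psi>w by auto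
  have A1: "(w, u) \<in> A" "(w, r1) \<in> A" "(r1, w) \<in> A" "(u, r1) \<in> A" "(r1, u) \<in> A"
    using inA[OF wu] inA[OF rw(1)] inA[OF rw(2)] inA[OF ur1] inA[OF s0[OF ur1]] unw r1(1) r1u by auto
  show False
  proof (cases "b0 = a")
    case True
    \<comment> \<open>The triangle \<open>w u a\<close> is directed, and \<open>r1\<close> is joined
      to its vertices by digons.\<close>
    have "wheel3 r1 w u a \<subseteq> A"
      unfolding wheel3_def using A1 a a' a'a s t sr1 True by simp
    then have "wheel3 r1 w u a = A" by (intro not_sub wheel_not_colourable[OF subset_refl])
    moreover have "distinct [r1, w, u, a]" using r1u r1(1) unw a(2) R3 by auto
    ultimately show False using special.wheel[of r1 w u a] not_special unfolding wheel3_def by metis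
  next
    case False
    obtain b' where b': "b' \<noteq> r1" "outs W b0 = {r1, b'}" using Wo[OF rb(2)] by blast
    have bb': "(b0, b') \<in> W" "(b', b0) \<in> W" using b'(2) t.W_sym by auto
    have b'u: "b' \<noteq> u"
    proof
      assume "b' = u"
      then have "b0 \<in> outs W u" using bb' by simp
      then show False using oWu b0r1 False by auto
    qed
    have b'R: "b' \<notin> ?R" using t.in_W_out[OF FieldI(1)[OF bb'(2)]] b'u b'(1) by simp
    have bbA: "(b0, b') \<in> A" "(b', b0) \<in> A"
      using t.W_in_A[OF bb'(1) b0R b'R] t.W_in_A[OF bb'(2) b'R b0R] by auto
    have bb: "b0 \<noteq> b'" using irrW[OF bb'(1)] .
    have ob0: "outs A b0 = {b', r1}"
    proof
      show "outs A b0 \<subseteq> {b', r1}"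
      proof
        fix q assume "q \<in> outs A b0"
        then have q: "(b0, q) \<in> A" by simp
        have "(b0, c.f q) \<in> W" using t.arc_down[OF q] b0R fR[OF b0R] by simp
        then have "c.f q \<in> outs W b0" by simp
        then have "c.f q = r1 \<or> c.f q = b'" using b'(2) by auto
        then show "q \<in> {b', r1}"
        proof
          assume "c.f q = r1"
          then have "q \<in> ?R" "\<not> \<psi> q" using f[of q] r1u RR by (auto split: if_splits)
          then show ?thesis using R3 \<psi>u \<psi>w by auto
        next
          assume "c.f q = b'"
          then show ?thesis using f[of q] b'(1) b'u by (auto split: if_splits)
        qed
      qed
      show "{b', r1} \<subseteq> outs A b0" using bbA t(1) sr1 by simp
    qed
    obtain z' where z': "z' \<noteq> b0" "outs W b' = {b0, z'}" using Wo[OF bb'(2)] by blast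
    have bz: "(b', z') \<in> W" "(z', b') \<in> W" using z'(2) t.W_sym by auto
    have z'r: "z' \<noteq> r1"
    proof
      assume "z' = r1"
      then have "b' \<in> outs W r1" using bz by simp
      then show False using b0(2) b'u bb by auto
    qed
    show False
    proof (cases "z' = u")
      case False
      have z'R: "z' \<notin> ?R" using t.in_W_out[OF FieldI(1)[OF bz(2)]] False z'r by simp
      have ib': "ins A b' = {b0, z'}"
      proof
        show "ins A b' \<subseteq> {b0, z'}"
        proof
          fix q assume "q \<in> ins A b'"
          then have q: "(q, b') \<in> A" by simp
          have "(c.f q, b') \<in> W" using t.arc_down[OF q] b'R fR[OF b'R] by simp
          then have "c.f q \<in> outs W b'" using t.W_sym by simp
          then have "c.f q \<notin> {u, r1} \<and> c.f q \<in> {b0, z'}" using z'(2) False z'r b0(1) b0r1 by auto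
          then show "q \<in> {b0, z'}" using f[of q] by (auto split: if_splits)
        qed
        show "{b0, z'} \<subseteq> ins A b'" using bbA t.W_in_A[OF bz(2) z'R b'R] by simp
      qed
      show False
        by (rule no_digon_path[OF ob0 ib' b'(1) z'(1)[symmetric]])
          (use t.W_in_A[OF bz(2) z'R b'R] t.W_in_A[OF bz(1) b'R z'R] bbA s t sr1 in auto)
    next
      case True
      then have "b' \<in> outs W u" using bz by simp
      then have b'a: "b' = a" using oWu b'(1) by auto
      \<comment> \<open>The digons of \<open>W\<close> would close up to a bidirected 4-cycle on
        \<open>K\<close> that no arc of \<open>W\<close> leaves; alternating two colours on it
        extends a colouring of the rest.\<close>
      define K where "K = {u, r1, b0, a}"
      have oK: "q \<in> K \<and> ((p = u \<or> p = b0) \<noteq> (q = u \<or> q = b0))" if pq: "(p, q) \<in> W" "p \<in> K" for p q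
      proof -
        have q: "q \<in> outs W p" using pq(1) by simp
        have ne: "u \<noteq> r1" "a \<noteq> u" "a \<noteq> b0" "a \<noteq> r1" "b0 \<noteq> u" "b0 \<noteq> r1"
          using r1u a(2) RR False b0 b0r1 ar1 bb b'a by auto
        from pq(2) consider "p = u" | "p = r1" | "p = b0" | "p = a" unfolding K_def by blast
        then show ?thesis
        proof cases
          case 1
          then show ?thesis using q oWu ne unfolding K_def by auto
        next
          case 2
          then show ?thesis using q b0(2) ne unfolding K_def by auto
        next
          case 3
          then show ?thesis using q b'(2) b'a ne unfolding K_def by auto
        next
          case 4
          then show ?thesis using q z'(2) b'a True ne unfolding K_def by auto
        qed
      qed
      have uK: "u \<in> K" "r1 \<in> K" unfolding K_def by auto
      have "W - K \<times> K \<noteq> W" using r1W(1) uK by blast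
      then have "colourable (W - K \<times> K)" using critical_subset[OF W(2), of "W - K \<times> K"] by blast
      then obtain c where c: "acyclic (monochrom c (W - K \<times> K))" by (auto simp: colourable_def)
      define c' where "c' v = (if v \<in> K then v = u \<or> v = b0 else c v)" for v
      have "monochrom c' W \<subseteq> monochrom c (W - K \<times> K)"
      proof
        fix e assume "e \<in> monochrom c' W"
        then obtain p q where e: "e = (p, q)" "(p, q) \<in> W" "c' p = c' q" by (auto simp: monochrom_def)
        have pK: "p \<notin> K"
        proof
          assume p: "p \<in> K"
          have "q \<in> K" "(p = u \<or> p = b0) \<noteq> (q = u \<or> q = b0)" using oK[OF e(2) p] by blast+
          moreover have "c' p = (p = u \<or> p = b0)" "q \<in> K \<Longrightarrow> c' q = (q = u \<or> q = b0)"
            using p by (simp_all add: c'_def)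
          ultimately show False using e(3) by blast
        qed
        have qK: "q \<notin> K"
        proof
          assume q: "q \<in> K"
          then show False using oK[OF t.W_sym[OF e(2)] q] pK by simp
        qed
        show "e \<in> monochrom c (W - K \<times> K)" using e pK qK unfolding c'_def monochrom_def by simp
      qed
      then have "acyclic (monochrom c' W)" using c acyclic_subset by metis
      then show False using critical_not_colourable[OF W(2)] colourableI by metis
    qed
  qed
qed

text \<open>A critical subdigraph using the extra arc loses one arc in \<open>A\<close>, which
  raises its potential by \<open>3\<close>. The bound \<open>4\<close> then forces value
  \<open>1\<close>, so it is an odd bidirected cycle and \<open>A\<close> has no further arc on its
  vertices; \<open>add_arc_tight_contradiction\<close> handles that. Minimality is often used in
  this form: one arc may be added before colouring.\<close>

lemma add_arc_colourable:
  assumes R: "R \<subseteq> V" "R \<noteq> V" and uw: "u \<in> R" "w \<in> R" "u \<noteq> w"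
  shows "colourable (A \<inter> R \<times> R \<union> {(u, w)})"
proof (rule ccontr)
  let ?B = "A \<inter> R \<times> R \<union> {(u, w)}"
  assume nc: "\<not> colourable ?B"
  have "finite ?B" using fin by simp
  moreover have "irrefl ?B" using irr uw(3) unfolding irrefl_def by auto
  ultimately obtain W where W: "W \<subseteq> ?B" "critical W" using ex_critical[OF _ _ nc] by metis
  have FW: "Field W \<subseteq> R"
  proof -
    have "?B \<subseteq> R \<times> R" using uw by blast
    then have "W \<subseteq> R \<times> R" using W(1) by (rule subset_trans[rotated])
    then show ?thesis by (auto simp: Field_def)
  qed
  obtain v where v: "v \<in> V" "v \<notin> R" using R by blast
  have FV: "Field W \<subseteq> V" "Field W \<noteq> V" using FW R(1) v by auto
  have gW: "good W" using good_smaller[OF W(2) FV(1) v(1)] v(2) FW by blast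
  have nsub: "\<not> W \<subseteq> A" using sub_crit[OF W(2)] FV(2) by blast
  then have uwW: "(u, w) \<in> W" "(u, w) \<notin> A" using W(1) by blast+
  have WA: "e \<in> A" if "e \<in> W" "e \<noteq> (u, w)" for e using W(1) that by blast
  define C where "C = W - {(u, w)}"
  have CA: "C \<subseteq> A \<inter> Field W \<times> Field W" unfolding C_def using WA FieldI by fastforce
  have cC: "card W = card C + 1"
    unfolding C_def using card_Suc_Diff1[OF critical_finite[OF W(2)] uwW(1)] by simp
  have F0: "Field W \<noteq> {}" using uwW(1) by (auto simp: Field_def)
  have vC: "val (Field W) C M = val (Field W) W M + 3" for M unfolding val_def using cC by simp
  have av: "matching A M \<and> Field M \<subseteq> Field W" if M: "matching W M" "(u, w) \<notin> M" "(w, u) \<notin> M" for M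
  proof
    show "Field M \<subseteq> Field W" by (rule matching_Field[OF M(1)])
    have "M \<subseteq> A \<inter> A\<inverse>"
    proof
      fix e assume e: "e \<in> M"
      obtain p q where pq: "e = (p, q)" by (cases e)
      have "(p, q) \<in> W" "(q, p) \<in> W" using M(1) e pq unfolding matching_def by auto
      moreover have "(p, q) \<noteq> (u, w)" "(q, p) \<noteq> (u, w)" using e pq M(2,3) by auto
      ultimately show "e \<in> A \<inter> A\<inverse>" using WA pq by simp
    qed
    then show "matching A M" by (rule matching_transfer[OF M(1)])
  qed
  have ge1: "1 \<le> val (Field W) W M" if M: "matching W M" "(u, w) \<notin> M" "(w, u) \<notin> M" for M
  proof -
    have "4 \<le> val (Field W) C M"
      using bound_proper[OF FV(1) F0 CA _ _ FV(2)] av[OF M] by blast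
    then show ?thesis using vC[of M] by linarith
  qed
  obtain M0 where sp: "special 1 W" and M0: "matching W M0" "val (Field W) W M0 = 1" "(u, w) \<notin> M0" "(w, u) \<notin> M0"
    using gW
  proof (cases rule: good_cases)
    case (1 k)
    obtain M where M: "matching W M" "val (Field W) W M = k" "(u, w) \<notin> M" "(w, u) \<notin> M"
      using special_avoid[OF 1 uwW(1)] .
    have "k = 1" using special_kind[OF 1] ge1[OF M(1,3,4)] M(2) by auto
    then show thesis using that[OF _ M(1) _ M(3,4)] M(2) 1 by simp
  next
    case (2 M)
    have "finite M" by (rule matching_finite[OF 2(1) critical_finite[OF W(2)]])
    \<comment> \<open>Dropping the edge at \<open>u\<close> keeps the digon \<open>u w\<close> out
      of the matching and raises \<open>-2\<close> to at most \<open>0\<close>, still below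
      \<open>1\<close>.\<close>
    then have "val (Field W) W (mdel u M) \<le> 0" using mdel_card[OF 2(1), of u] 2(2) unfolding val_def by simp
    moreover have "(u, w) \<notin> mdel u M" "(w, u) \<notin> mdel u M" by (auto simp: mdel_def)
    ultimately show thesis using ge1[OF mdel_matching[OF 2(1), of u]] by simp
  qed
  have exact: "A \<inter> Field W \<times> Field W = C"
  proof (rule ccontr)
    assume "A \<inter> Field W \<times> Field W \<noteq> C"
    then have "card C < card (A \<inter> Field W \<times> Field W)" using CA fin by (intro psubset_card_mono) auto
    then have "val (Field W) (A \<inter> Field W \<times> Field W) M0 \<le> val (Field W) C M0 - 3" unfolding val_def by simp
    moreover have "4 \<le> val (Field W) (A \<inter> Field W \<times> Field W) M0"
      using bound_proper[OF FV(1) F0 subset_refl _ _ FV(2)] av[OF M0(1,3,4)] by blast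
    ultimately show False using vC[of M0] M0(2) by linarith
  qed
  show False
    by (rule add_arc_tight_contradiction[OF W(2) sp FV uwW(1) exact[unfolded C_def], of M0])
      (use av[OF M0(1,3,4)] vC[of M0] M0(2) exact in auto)
qed

text \<open>Delete \<open>v\<close>, add the arc \<open>a b\<close>, and colour; \<open>v\<close>
  gets the colour opposite to \<open>g\<close>. If \<open>a\<close> has the colour of
  \<open>g\<close>, then \<open>v\<close> is a source of its class. Otherwise \<open>v\<close> can
  only prolong a monochromatic walk from \<open>a\<close> to \<open>b\<close>, for which the added
  arc stands.\<close>

lemma no_single_digon_vertex:
  assumes o: "outs A v = {g, b}" and i: "ins A v = {g, a}" and ne: "a \<noteq> b" "g \<noteq> a" "g \<noteq> b"
  shows False
proof -
  let ?R = "V - {v}"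
  have arcs: "(v, g) \<in> A" "(v, b) \<in> A" "(g, v) \<in> A" "(a, v) \<in> A" using o i by auto
  have neq: "v \<noteq> g" "v \<noteq> b" "v \<noteq> a" using arcs irr by auto
  have "colourable (A \<inter> ?R \<times> ?R \<union> {(a, b)})"
    by (rule add_arc_colourable) (use arcs neq ne arc_verts in auto)
  moreover have "A \<inter> ?R \<times> ?R = del v A" by (auto simp: del_def Field_def)
  ultimately obtain c where c: "acyclic (monochrom c (del v A \<union> {(a, b)}))" by (auto simp: colourable_def)
  have c0: "acyclic (monochrom c (del v A))"
    using c monochrom_mono[of "del v A" "del v A \<union> {(a, b)}" c] acyclic_subset by blast
  define c' where "c' = c(v := \<not> c g)"
  have c1: "acyclic (monochrom c' (del v A))" unfolding c'_def monochrom_del_upd using c0 .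
  have "acyclic (monochrom c' A)"
  proof (cases "c a = c g")
    case True
    show ?thesis
    proof (rule colour_source[OF c1])
      fix w assume "(w, v) \<in> A"
      then have "w \<in> ins A v" by simp
      then show "c' w \<noteq> c' v" using i True neq unfolding c'_def by auto
    qed
  next
    case False
    define f where "f x = (if x = v then a else x)" for x
    have vout: "x = g \<or> x = b" if "(v, x) \<in> A" for x
    proof -
      have "x \<in> outs A v" using that by simp
      then show ?thesis using o by auto
    qed
    have vin: "x = g \<or> x = a" if "(x, v) \<in> A" for x
    proof -
      have "x \<in> ins A v" using that by simp
      then show ?thesis using i by auto
    qed
    show ?thesis
    proof (rule acyclic_contract[of _ f])
      have "{(x, y) \<in> monochrom c' A. f x = f y} \<subseteq> {(a, v)}"
      proof
        fix e assume "e \<in> {(x, y) \<in> monochrom c' A. f x = f y}"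
        then obtain x y where e: "e = (x, y)" "(x, y) \<in> A" "f x = f y" by (auto simp: monochrom_def)
        have "x \<noteq> y" using e(2) irr by auto
        then have "(x = a \<and> y = v) \<or> (x = v \<and> y = a)" using e(3) by (auto simp: f_def split: if_splits)
        then show "e \<in> {(a, v)}" using vout[of a] e ne by auto
      qed
      moreover have "acyclic {(a, v)}"
      proof (rule acyclic_sink[of v])
        have "del v {(a, v)} = {}" by (auto simp: del_def)
        then show "acyclic (del v {(a, v)})" by (simp add: acyclic_def)
      qed (use neq in auto)
      ultimately show "acyclic {(x, y) \<in> monochrom c' A. f x = f y}" using acyclic_subset by blast
      have "{(f x, f y) |x y. (x, y) \<in> monochrom c' A \<and> f x \<noteq> f y} \<subseteq> monochrom c (del v A \<union> {(a, b)})"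
      proof
        fix e assume "e \<in> {(f x, f y) |x y. (x, y) \<in> monochrom c' A \<and> f x \<noteq> f y}"
        then obtain x y where e: "e = (f x, f y)" "(x, y) \<in> A" "c' x = c' y" "f x \<noteq> f y"
          by (auto simp: monochrom_def)
        have "x \<noteq> y" using e(2) irr by auto
        consider "x = v" | "y = v" | "x \<noteq> v" "y \<noteq> v" by blast
        then show "e \<in> monochrom c (del v A \<union> {(a, b)})"
        proof cases
          case 1
          then have "y = b" using vout[of y] e(2,3) neq unfolding c'_def by auto
          then show ?thesis using e(1,3) 1 False neq by (auto simp: f_def c'_def monochrom_def)
        next
          case 2
          then have "x = a" using vin[of x] e(2,3) neq unfolding c'_def by auto
          then show ?thesis using e(4) 2 by (simp add: f_def)
        next
          case 3
          then show ?thesis using e by (simp add: f_def c'_def monochrom_def del_def)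
        qed
      qed
      then show "acyclic {(f x, f y) |x y. (x, y) \<in> monochrom c' A \<and> f x \<noteq> f y}"
        using c acyclic_subset by blast
    qed
  qed
  then show False using critical_not_colourable[OF crit] colourableI by blast
qed

end

section \<open>Sets of potential four miss a single vertex\<close>

context tight
begin

lemma f_eq: "c.f v = (if v \<in> R then if \<phi> v then x1 else x2 else v)"
  by (simp add: c.f_def contr_def)

lemma outs_up:
  assumes u: "u \<notin> R" "u \<in> Field W"
  shows "bij_betw c.f (outs A u) (outs W u)" "bij_betw c.f (ins A u) (outs W u)"
proof -
  have fu: "c.f u = u" using u f_eq by simp
  have fz: "z = u" if "c.f z = u" for z
    using that u c.x f_eq[of z] by (auto split: if_splits)
  have uX: "u \<notin> {x1, x2}" using u c.x by auto
  have up: "\<exists>a b. (a, b) \<in> A \<and> c.f a = p \<and> c.f b = q" if "(p, q) \<in> W" "p = u \<or> q = u" for p q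
    using ex_arc_up[OF that(1)] that(2) uX by blast
  show "bij_betw c.f (outs A u) (outs W u)"
    unfolding bij_betw_def
  proof
    show "inj_on c.f (outs A u)"
    proof (rule inj_onI)
      fix y y' assume h: "y \<in> outs A u" "y' \<in> outs A u" "c.f y = c.f y'"
      then show "y = y'" using arc_inj[of u y u y'] u by simp
    qed
    show "c.f ` outs A u = outs W u"
    proof
      show "c.f ` outs A u \<subseteq> outs W u"
      proof
        fix q assume "q \<in> c.f ` outs A u"
        then obtain b where b: "(u, b) \<in> A" "q = c.f b" by auto
        then have "(u, q) \<in> W" using arc_down[of u b] u fu by simp
        then show "q \<in> outs W u" by simp
      qed
      show "outs W u \<subseteq> c.f ` outs A u"
      proof
        fix q assume "q \<in> outs W u"
        then have q: "(u, q) \<in> W" by simp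
        obtain a b where ab: "(a, b) \<in> A" "c.f a = u" "c.f b = q" using up[OF q] by auto
        then have "b \<in> outs A u" using fz[OF ab(2)] by simp
        then show "q \<in> c.f ` outs A u" using ab(3) by (rule image_eqI[OF sym, rotated])
      qed
    qed
  qed
  show "bij_betw c.f (ins A u) (outs W u)"
    unfolding bij_betw_def
  proof
    show "inj_on c.f (ins A u)"
    proof (rule inj_onI)
      fix y y' assume h: "y \<in> ins A u" "y' \<in> ins A u" "c.f y = c.f y'"
      then show "y = y'" using arc_inj[of y u y' u] u by simp
    qed
    show "c.f ` ins A u = outs W u"
    proof
      show "c.f ` ins A u \<subseteq> outs W u"
      proof
        fix q assume "q \<in> c.f ` ins A u"
        then obtain b where b: "(b, u) \<in> A" "q = c.f b" by auto
        then have "(q, u) \<in> W" using arc_down[of b u] u fu by simp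
        then show "q \<in> outs W u" using W_sym by simp
      qed
      show "outs W u \<subseteq> c.f ` ins A u"
      proof
        fix q assume "q \<in> outs W u"
        then have q: "(q, u) \<in> W" using W_sym by simp
        obtain a b where ab: "(a, b) \<in> A" "c.f a = q" "c.f b = u" using up[OF q] by auto
        then have "a \<in> ins A u" using fz[OF ab(3)] by simp
        then show "q \<in> c.f ` ins A u" using ab(2) by (rule image_eqI[OF sym, rotated])
      qed
    qed
  qed
qed

lemma deg_out: "u \<notin> R \<Longrightarrow> u \<in> Field W \<Longrightarrow> card (outs A u) = 2 \<and> card (ins A u) = 2"
  using outs_up[of u] W_deg[of u] bij_betw_same_card by metis

text \<open>Outside \<open>R\<close> the degrees in \<open>A\<close> agree with those in
  \<open>W\<close>, so the digon \<open>u p\<close> forces a second one by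
  \<open>no_single_digon_vertex\<close>.\<close>

lemma bidirected_at:
  assumes u: "u \<notin> R" "outs W u = {p, q}" "p \<noteq> q" and p: "p \<notin> R"
  shows "\<exists>q'. q' \<noteq> p \<and> c.f q' = q \<and> outs A u = {p, q'} \<and> ins A u = {p, q'}"
proof -
  have uW: "u \<in> Field W" using u(2) FieldI(1)[of u p W] by auto
  have pW: "(u, p) \<in> W" using u(2) by auto
  have pA: "p \<in> outs A u" "p \<in> ins A u"
    using W_in_A[OF pW u(1) p] W_in_A[OF W_sym[OF pW] p u(1)] by auto
  obtain s where s: "s \<noteq> p" "outs A u = {p, s}" using card2_other[OF _ pA(1)] deg_out[OF u(1) uW] by metis
  obtain t where t: "t \<noteq> p" "ins A u = {p, t}" using card2_other[OF _ pA(2)] deg_out[OF u(1) uW] by metis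
  have "t = s"
    using no_single_digon_vertex[OF s(2) t(2)] s(1) t(1) by auto
  moreover have "c.f s = q"
  proof -
    have "c.f ` {p, s} = {p, q}" using outs_up(1)[OF u(1) uW] s(2) u(2) by (simp add: bij_betw_def)
    moreover have "c.f p = p" using p f_eq by simp
    moreover have "c.f s \<noteq> c.f p"
      using outs_up(1)[OF u(1) uW] s unfolding bij_betw_def by (auto dest: inj_onD)
    ultimately show ?thesis by auto
  qed
  ultimately show ?thesis using s t by blast
qed

text \<open>Let \<open>a\<close> be the other neighbour of \<open>x1\<close> in \<open>W\<close>. If
  the second neighbour of \<open>a\<close> were not \<open>x2\<close>, two consecutive vertices
  outside \<open>R\<close> would lie on a digon path excluded by \<open>no_digon_path\<close>. So
  \<open>W\<close> is a triangle with one vertex outside \<open>R\<close>.\<close>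

lemma single_outside: "\<exists>v. V - R = {v} \<and> card (outs A v) = 2 \<and> card (ins A v) = 2"
proof -
  obtain a where a: "a \<noteq> x2" "outs W x1 = {x2, a}" using W_outs[OF tight_special(2)] by metis
  have aW: "(x1, a) \<in> W" "(a, x1) \<in> W" using a(2) W_sym by auto
  have ax: "a \<noteq> x1" using aW critical_irrefl[OF W(2)] by auto
  have aF: "a \<in> Field W" using aW FieldI by metis
  have aR: "a \<notin> R" by (rule in_W_out[OF aF]) (use a(1) ax in simp)
  obtain a' where a': "a' \<noteq> x1" "outs W a = {x1, a'}" using W_outs[OF aW(2)] by metis
  have aa': "(a, a') \<in> W" "(a', a) \<in> W" using a'(2) W_sym by auto
  have "a' = x2"
  proof (rule ccontr)
    assume x2: "a' \<noteq> x2"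
    have a'R: "a' \<notin> R" by (rule in_W_out[OF FieldI(1)[OF aa'(2)]]) (use x2 a'(1) in simp)
    obtain s where s: "s \<noteq> a'" "outs A a = {a', s}" "ins A a = {a', s}"
      using bidirected_at[of a a' x1] aR a' a'R by (auto simp: insert_commute)
    obtain a'' where a'': "a'' \<noteq> a" "outs W a' = {a, a''}" using W_outs[OF aa'(2)] by metis
    obtain z where z: "z \<noteq> a" "outs A a' = {a, z}" "ins A a' = {a, z}"
      using bidirected_at[of a' a a''] a'R a'' aR by metis
    show False
    proof (rule no_digon_path[OF s(2) z(3)])
      show "a' \<noteq> s" "a \<noteq> z" using s z by auto
      show "(z, a') \<in> A" "(a', z) \<in> A" "(a', a) \<in> A" "(a, a') \<in> A" "(a, s) \<in> A" "(s, a) \<in> A"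
        using s z by auto
    qed
  qed
  define T where "T = {(x1, x2), (x2, x1), (x2, a), (a, x2), (x1, a), (a, x1)}"
  have "T = W"
  proof (rule ccontr)
    assume "T \<noteq> W"
    moreover have "T \<subseteq> W" unfolding T_def using aW aa' tight_special \<open>a' = x2\<close> by simp
    ultimately have "colourable T" using critical_subset[OF W(2)] by blast
    moreover have "\<not> colourable T" by (rule triangle_not_colourable[of x1 x2 _ a]) (simp_all add: T_def)
    ultimately show False by simp
  qed
  then have "Field W = {x1, x2, a}" unfolding T_def Field_def by auto
  then have "c.U W = {a}" unfolding c.U_def[OF W] c.X_def using a(1) ax by auto
  then have "V - R = {a}" using U_eq by simp
  then show ?thesis using deg_out[OF aR aF] by blast
qed

end

context counterexample
begin

lemma single_outside_if_val_le_4: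
  assumes "R \<subseteq> V" "R \<noteq> {}" "R \<noteq> V" "C \<subseteq> A \<inter> R \<times> R" "matching A M" "Field M \<subseteq> R" "val R C M \<le> 4"
  shows "\<exists>v. V - R = {v} \<and> card (outs A v) = 2 \<and> card (ins A v) = 2"
proof -
  have "card C \<le> card (A \<inter> R \<times> R)" by (rule card_mono[OF _ assms(4)]) (use fin in simp)
  then have v: "val R (A \<inter> R \<times> R) M \<le> 4" using assms(7) by (simp add: val_def)
  have "\<not> card R \<le> 2" using val_small[OF assms(1,2,5,6)] v by linarith
  then have "2 \<le> card R" by simp
  then obtain x1 x2 where x: "x1 \<in> R" "x2 \<in> R" "x1 \<noteq> x2" by (rule ex_two)
  obtain \<phi> where \<phi>: "acyclic (monochrom \<phi> (A \<inter> R \<times> R))" using proper_colouring[OF crit assms(1,3)] .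
  interpret c: contraction A R \<phi> x1 x2
    by (rule contraction.intro[OF crit assms(1,3) x \<phi>])
  obtain W where W: "W \<subseteq> c.B" "critical W" using c.ex_W by blast
  interpret t: tight A R \<phi> x1 x2 W M
    by (intro tight.intro tight_axioms.intro counterexample_axioms c.contraction_axioms W assms v)
  show ?thesis by (rule t.single_outside)
qed

end

section \<open>Arcs from out-degree two to in-degree two\<close>

text \<open>Transferring the star \<open>{x} \<times> N\<close> to a vertex outside \<open>W\<close>
  leaves the number of arcs unchanged.\<close>

lemma card_star:
  assumes "finite W" "{x} \<times> N \<subseteq> W" "y \<notin> Field W" "finite P" "P \<inter> W = {}" "P \<inter> {y} \<times> N = {}"
  shows "card ((W - {x} \<times> N) \<union> {y} \<times> N \<union> P) = card W + card P"
proof -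
  have fN: "finite ({x} \<times> N)" using assms(1,2) finite_subset by metis
  then have fN': "finite N" by (auto dest: finite_cartesian_productD2)
  have yW: "(y, b) \<notin> W" for b using assms(3) by (auto simp: Field_def)
  have "card ((W - {x} \<times> N) \<union> {y} \<times> N \<union> P) = card ((W - {x} \<times> N) \<union> {y} \<times> N) + card P"
    by (rule card_Un_disjoint) (use assms fN' in auto)
  also have "card ((W - {x} \<times> N) \<union> {y} \<times> N) = card (W - {x} \<times> N) + card ({y} \<times> N)"
    by (rule card_Un_disjoint) (use assms(1) fN' yW in auto)
  also have "card (W - {x} \<times> N) = card W - card ({x} \<times> N)" by (rule card_Diff_subset[OF fN assms(2)])
  finally show ?thesis using card_mono[OF assms(1,2)] by (simp add: card_cartesian_product)
qed

lemma sub_sq: "S \<subseteq> A \<Longrightarrow> Field S \<subseteq> R \<Longrightarrow> S \<subseteq> A \<inter> R \<times> R"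
  by (auto simp: Field_def)

lemma acyclic_subset_arc: "S \<subseteq> {(a, b)} \<Longrightarrow> a \<noteq> b \<Longrightarrow> acyclic S"
proof -
  assume S: "S \<subseteq> {(a, b)}" "a \<noteq> b"
  have "del b {(a, b)} = {}" by (auto simp: del_def)
  then have "acyclic (del b {(a, b)})" by (simp add: acyclic_def)
  then have "acyclic {(a, b)}" by (rule acyclic_sink) (use S(2) in auto)
  then show ?thesis using S(1) acyclic_subset by blast
qed

text \<open>Let \<open>y\<close> and some \<open>y'\<close> be the only out-neighbours of \<open>x\<close>, and \<open>x\<close>, \<open>z\<close> the only in-neighbours of \<open>y\<close>. If \<open>x\<close> and \<open>y\<close>
  are deleted and \<open>z\<close> inherits the out-arcs of \<open>y\<close>, the digraph stays non-colourable. A device is an exceptional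
  critical subdigraph of the result whose arcs from \<open>z\<close> are all inherited.\<close>

definition device :: "('a \<times> 'a) set \<Rightarrow> 'a \<Rightarrow> 'a \<Rightarrow> 'a \<Rightarrow> ('a \<times> 'a) set \<Rightarrow> ('a \<times> 'a) set \<Rightarrow> bool"
  where "device A x y z W M \<longleftrightarrow> critical W \<and> W \<subseteq> del x (del y A) \<union> {z} \<times> outs A y \<and> (\<exists>k. special k W) \<and>
    z \<in> Field W \<and> (\<forall>b. (z, b) \<in> W \<longrightarrow> (z, b) \<notin> A \<and> (b, z) \<in> W) \<and> 2 \<le> card (outs W z) \<and>
    matching W M \<and> z \<notin> Field M \<and> val (Field W) W M \<le> 1"

text \<open>No other arc at \<open>x\<close> runs from out-degree two to in-degree two, so the arc
  \<open>x y\<close> can be charged to \<open>x\<close> alone.\<close>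

definition isolated_tail :: "('a \<times> 'a) set \<Rightarrow> 'a \<Rightarrow> 'a \<Rightarrow> bool"
  where "isolated_tail A x y \<longleftrightarrow> card (ins A x) = 2 \<and> (\<forall>e \<in> ins A x. card (outs A e) \<noteq> 2) \<and>
    (\<forall>y' \<in> outs A x. y' \<noteq> y \<longrightarrow> card (ins A y') \<noteq> 2)"

section \<open>Digons at vertices of in-degree two\<close>

context counterexample
begin

text \<open>With no inherited arc, \<open>W\<close> would be a critical subdigraph of
  \<open>A\<close> missing \<open>y\<close>; with a single one it would be colourable by
  \<open>add_arc_colourable\<close>.\<close>

lemma new_arcs:
  fixes W :: "('a \<times> 'a) set"
  assumes W: "critical W" "Field W \<subseteq> V" "y \<in> V" "y \<notin> Field W"
    and new: "\<And>p q. (p, q) \<in> W \<Longrightarrow> p = x \<or> (p, q) \<in> A"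
  shows "2 \<le> card {b. (x, b) \<in> W \<and> (x, b) \<notin> A}" "x \<in> Field W" "finite {b. (x, b) \<in> W \<and> (x, b) \<notin> A}"
proof -
  let ?N = "{b. (x, b) \<in> W \<and> (x, b) \<notin> A}"
  have "?N \<subseteq> outs W x" by auto
  moreover have "finite (outs W x)" using critical_finite[OF W(1)] by auto
  ultimately show fN: "finite ?N" by (rule finite_subset)
  have "?N \<noteq> {}"
  proof
    assume "?N = {}"
    then have "W \<subseteq> A" using new by auto
    then show False using sub_crit[OF W(1)] W(3,4) by blast
  qed
  then obtain b where b: "(x, b) \<in> W" "(x, b) \<notin> A" by auto
  then show "x \<in> Field W" using FieldI by metis
  show "2 \<le> card ?N"
  proof (rule ccontr)
    assume "\<not> 2 \<le> card ?N"
    moreover have "card ?N \<noteq> 0" using \<open>?N \<noteq> {}\<close> fN by simp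
    ultimately have "card ?N = 1" by linarith
    then obtain b' where "?N = {b'}" by (rule card_1_singletonE)
    then have N: "?N = {b}" using b by auto
    have xb: "x \<noteq> b" using b critical_irrefl[OF W(1)] by auto
    have "colourable (A \<inter> Field W \<times> Field W \<union> {(x, b)})"
      by (rule add_arc_colourable) (use W b FieldI[OF b(1)] xb in auto)
    moreover have "W \<subseteq> A \<inter> Field W \<times> Field W \<union> {(x, b)}"
    proof
      fix e assume e: "e \<in> W"
      obtain p q where pq: "e = (p, q)" by (cases e)
      show "e \<in> A \<inter> Field W \<times> Field W \<union> {(x, b)}"
      proof (cases "(p, q) \<in> A")
        case True
        then show ?thesis using e pq FieldI[of p q W] by simp
      next
        case False
        then have "p = x" using new e pq by blast
        then have "q \<in> ?N" using False e pq by simp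
        then show ?thesis using N pq \<open>p = x\<close> by simp
      qed
    qed
    ultimately have "colourable W" by (rule colourable_subset)
    then show False using critical_not_colourable[OF W(1)] by simp
  qed
qed

lemma star_matching:
  fixes W :: "('a \<times> 'a) set"
  assumes M: "matching W M" and new: "\<And>p q. (p, q) \<in> W \<Longrightarrow> p = x \<or> (p, q) \<in> A"
  shows "matching A (mdel x M)"
    "(\<And>b. (x, b) \<in> M \<or> (b, x) \<in> M \<Longrightarrow> (x, b) \<in> A) \<Longrightarrow> matching A M"
proof -
  have MW: "(p, q) \<in> W \<and> (q, p) \<in> W" if "(p, q) \<in> M" for p q
    using that M unfolding matching_def by auto
  have m: "matching W (mdel x M)" by (rule mdel_matching[OF M])
  show "matching A (mdel x M)"
  proof (rule matching_transfer[OF m])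
    show "mdel x M \<subseteq> A \<inter> A\<inverse>"
    proof
      fix e assume e: "e \<in> mdel x M"
      obtain p q where pq: "e = (p, q)" by (cases e)
      have "(p, q) \<in> M" "p \<noteq> x" "q \<noteq> x" using e pq by (auto simp: mdel_def)
      then show "e \<in> A \<inter> A\<inverse>" using MW new pq by blast
    qed
  qed
  assume h: "\<And>b. (x, b) \<in> M \<or> (b, x) \<in> M \<Longrightarrow> (x, b) \<in> A"
  show "matching A M"
  proof (rule matching_transfer[OF M])
    show "M \<subseteq> A \<inter> A\<inverse>"
    proof
      fix e assume e: "e \<in> M"
      obtain p q where pq: "e = (p, q)" by (cases e)
      have "(p, q) \<in> M" using e pq by simp
      then have "(p, q) \<in> A" "(q, p) \<in> A" using MW[of p q] new[of p q] new[of q p] h[of p] h[of q] by blast+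
      then show "e \<in> A \<inter> A\<inverse>" using pq by simp
    qed
  qed
qed

text \<open>The vertices \<open>x\<close> and \<open>z\<close> are identified after deleting \<open>y\<close>, which can be coloured last.\<close>

lemma in_digon_symmetric_nonadjacent:
  assumes i: "ins A y = {x, z}" "x \<noteq> z" and yz: "(y, z) \<in> A" and yx: "(y, x) \<notin> A"
    and nd: "\<not> ((x, z) \<in> A \<and> (z, x) \<in> A)"
  shows False
proof -
  have xy: "(x, y) \<in> A" "(z, y) \<in> A" using i by auto
  have ne: "x \<noteq> y" "z \<noteq> y" using xy irr by auto
  have yin: "w = x \<or> w = z" if "(w, y) \<in> A" for w
  proof -
    have "w \<in> ins A y" using that by simp
    then show ?thesis using i(1) by auto
  qed
  have inV: "x \<in> V" "y \<in> V" "z \<in> V" using xy arc_verts by blast+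
  define f where "f v = (if v = z then x else v)" for v
  define g where "g e = (f (fst e), f (snd e))" for e
  define S where "S = {(a, b) \<in> del y A. f a \<noteq> f b}"
  define B where "B = g ` S"
  have fv: "f z = x" "v \<noteq> z \<Longrightarrow> f v = v" "f v \<noteq> z" for v using i by (auto simp: f_def)
  have SA: "S \<subseteq> A" unfolding S_def using del_subset[of y A] by blast
  have finS: "finite S" using SA fin finite_subset by metis
  have Sy: "a \<noteq> y \<and> b \<noteq> y \<and> f a \<noteq> f b" if "(a, b) \<in> S" for a b using that by (simp add: S_def del_def)
  have Be: "\<exists>a b. (a, b) \<in> S \<and> p = f a \<and> q = f b" if "(p, q) \<in> B" for p q
  proof -
    from that[unfolded B_def] obtain e where "(p, q) = g e" "e \<in> S" by (rule imageE)
    then show ?thesis by (cases e) (auto simp: g_def)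
  qed
  have nc: "\<not> colourable B"
  proof
    assume "colourable B"
    then obtain c where c: "acyclic (monochrom c B)" by (auto simp: colourable_def)
    \<comment> \<open>\<open>y\<close> avoids the common colour of its two in-neighbours, so it is a
      source of its class.\<close>
    define c' where "c' = (\<lambda>v. c (f v))(y := \<not> c x)"
    have cx: "c' x = c x" "c' z = c x" "c' y = (\<not> c x)" using ne fv by (auto simp: c'_def f_def)
    have "acyclic (monochrom c' (del y A))"
    proof (rule acyclic_contract[of _ f])
      have "{(u, v) \<in> monochrom c' (del y A). f u = f v} \<subseteq> (if (x, z) \<in> A then {(x, z)} else {(z, x)})"
      proof
        fix e assume "e \<in> {(u, v) \<in> monochrom c' (del y A). f u = f v}"
        then obtain u v where e: "e = (u, v)" "(u, v) \<in> A" "f u = f v" by (auto simp: monochrom_def del_def)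
        have "u \<noteq> v" using e irr by auto
        then have "(u = x \<and> v = z) \<or> (u = z \<and> v = x)" using e(3) by (auto simp: f_def split: if_splits)
        then show "e \<in> (if (x, z) \<in> A then {(x, z)} else {(z, x)})" using e nd by auto
      qed
      then show "acyclic {(u, v) \<in> monochrom c' (del y A). f u = f v}"
        using i(2) by (auto intro: acyclic_subset_arc split: if_splits)
      have "{(f u, f v) |u v. (u, v) \<in> monochrom c' (del y A) \<and> f u \<noteq> f v} \<subseteq> monochrom c B"
      proof
        fix e assume "e \<in> {(f u, f v) |u v. (u, v) \<in> monochrom c' (del y A) \<and> f u \<noteq> f v}"
        then obtain u v where e: "e = (f u, f v)" "(u, v) \<in> del y A" "c' u = c' v" "f u \<noteq> f v"
          by (auto simp: monochrom_def)
        have "u \<noteq> y" "v \<noteq> y" using e(2) by (auto simp: del_def)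
        then have "c (f u) = c (f v)" using e(3) by (simp add: c'_def)
        moreover have "e \<in> B" unfolding B_def using e by (intro image_eqI[of _ _ "(u, v)"]) (auto simp: g_def S_def)
        ultimately show "e \<in> monochrom c B" using e(1) by (simp add: monochrom_def)
      qed
      then show "acyclic {(f u, f v) |u v. (u, v) \<in> monochrom c' (del y A) \<and> f u \<noteq> f v}"
        using c acyclic_subset by blast
    qed
    then have "acyclic (monochrom c' A)"
    proof (rule colour_source)
      fix w assume "(w, y) \<in> A"
      then show "c' w \<noteq> c' y" using yin[of w] cx by auto
    qed
    then show False using critical_not_colourable[OF crit] colourableI by blast
  qed
  have irrB: "irrefl B" unfolding irrefl_def using Be Sy by metis
  obtain W where W: "W \<subseteq> B" "critical W" using ex_critical[OF _ irrB nc] finS by (auto simp: B_def)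
  \<comment> \<open>One arc of \<open>A\<close> is selected above each arc of \<open>W\<close>; a
    lift may use \<open>z\<close> in place of \<open>x\<close>.\<close>
  obtain L where L: "L \<subseteq> S" "inj_on g L" "W = g ` L" using W(1) unfolding B_def subset_image_inj by blast
  have cL: "card L = card W" using L card_image by metis
  have lift: "(p, q) \<in> A" if pq: "(p, q) \<in> W" "p \<noteq> x" "q \<noteq> x" for p q
  proof -
    obtain a b where ab: "(a, b) \<in> S" "p = f a" "q = f b" using Be[of p q] W(1) pq(1) by blast
    then have "a \<noteq> z" "b \<noteq> z" using pq fv by auto
    then show ?thesis using ab fv SA by auto
  qed
  have FW: "v \<in> V \<and> v \<noteq> y \<and> v \<noteq> z" if v: "v \<in> Field W" for v
  proof -
    obtain p where "(p, v) \<in> W \<or> (v, p) \<in> W" using v by (auto simp: Field_def)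
    then obtain a b where ab: "(a, b) \<in> S" "v = f a \<or> v = f b" using Be[of p v] Be[of v p] W(1) by blast
    have "a \<in> V" "b \<in> V" using ab(1) SA arc_verts by blast+
    moreover have "f t \<in> V \<and> f t \<noteq> y \<and> f t \<noteq> z" if "t \<in> V" "t \<noteq> y" for t
      using that inV ne i(2) by (simp add: f_def)
    ultimately show ?thesis using ab(2) Sy[OF ab(1)] by blast
  qed
  have FL: "Field L \<subseteq> Field W \<union> {z}"
  proof
    fix v assume "v \<in> Field L"
    then obtain p where "(p, v) \<in> L \<or> (v, p) \<in> L" by (auto simp: Field_def)
    then have "f v \<in> Field W"
      using L(3) FieldI[of "f p" "f v" W] FieldI[of "f v" "f p" W] by (auto simp: g_def image_iff) (metis fst_conv snd_conv)+
    then show "v \<in> Field W \<union> {z}" by (cases "v = z") (simp_all add: f_def)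
  qed
  have yzW: "y \<notin> Field W" "z \<notin> Field W" using FW by auto
  have FV: "Field W \<subseteq> V" using FW by blast
  have xW: "x \<in> Field W"
  proof (rule ccontr)
    assume x: "x \<notin> Field W"
    have "W \<subseteq> A"
    proof
      fix e assume e: "e \<in> W"
      obtain p q where pq: "e = (p, q)" by (cases e)
      have "p \<noteq> x" "q \<noteq> x" using x FieldI[of p q W] e pq by auto
      then show "e \<in> A" using lift e pq by simp
    qed
    then show False using sub_crit[OF W(2)] yzW inV by blast
  qed
  have gW: "good W" by (rule good_smaller[OF W(2) FV inV(2) yzW(1)])
  define Ou where "Ou = outs A y - {z}"
  have finOu: "finite Ou" "finite (outs A y)" unfolding Ou_def using fin by auto
  \<comment> \<open>Otherwise \<open>y\<close> would lie in the digon \<open>y z\<close> with one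
    further in-neighbour \<open>x\<close> and one further out-neighbour \<open>b\<close>, against
    \<open>no_single_digon_vertex\<close>.\<close>
  have O2: "2 \<le> card Ou"
  proof (rule ccontr)
    assume "\<not> 2 \<le> card Ou"
    moreover have "card (outs A y) = card Ou + 1"
      unfolding Ou_def using card_Suc_Diff1[OF finOu(2), of z] yz by simp
    ultimately have "card (outs A y) = 2" using critical_outdeg[OF crit inV(2)] by linarith
    then obtain b where b: "b \<noteq> z" "outs A y = {z, b}" using card2_other[of "outs A y" z] yz by auto
    have "b \<noteq> x" using b yx by auto
    then show False using no_single_digon_vertex[OF b(2), of x] i b(1) by (auto simp: insert_commute)
  qed
  define N where "N = Ou \<inter> Field W"
  define R where "R = Field W \<union> {y, z}"
  define C where "C = L \<union> ({(x, y), (y, z), (z, y)} \<union> {y} \<times> N)"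
  have fW: "finite W" "finite (Field W)" using critical_finite[OF W(2)] critical_finite_Field[OF W(2)] by auto
  have finN: "finite N" unfolding N_def using finOu by simp
  have cR: "card R = card (Field W) + 2" unfolding R_def using yzW fW ne by simp
  have xN: "x \<notin> N" "z \<notin> N" "y \<notin> N" unfolding N_def Ou_def using yx irr by auto
  have finL: "finite L" using L(1) finS finite_subset by metis
  have Ly: "a \<noteq> y \<and> b \<noteq> y" if "(a, b) \<in> L" for a b using Sy L(1) that by blast
  have cC: "card C = card W + 3 + card N"
  proof -
    have "card ({(x, y), (y, z), (z, y)} \<union> {y} \<times> N) = card {(x, y), (y, z), (z, y)} + card ({y} \<times> N)"
      by (rule card_Un_disjoint) (use finN xN ne in auto)
    also have "\<dots> = 3 + card N" using ne i(2) by (simp add: card_cartesian_product)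
    finally have "card ({(x, y), (y, z), (z, y)} \<union> {y} \<times> N) = 3 + card N" .
    moreover have "card C = card L + card ({(x, y), (y, z), (z, y)} \<union> {y} \<times> N)"
      unfolding C_def by (rule card_Un_disjoint) (use finL finN Ly in auto)
    ultimately show ?thesis using cL by simp
  qed
  have CR: "C \<subseteq> A \<inter> R \<times> R"
  proof -
    have "L \<subseteq> A \<inter> R \<times> R"
    proof (rule sub_sq)
      show "L \<subseteq> A" using L(1) SA by blast
      show "Field L \<subseteq> R" using FL unfolding R_def by blast
    qed
    moreover have "{(x, y), (y, z), (z, y)} \<subseteq> A \<inter> R \<times> R" using xy yz xW unfolding R_def by auto
    moreover have "{y} \<times> N \<subseteq> A \<inter> R \<times> R" unfolding R_def N_def Ou_def by auto
    ultimately show ?thesis unfolding C_def by blast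
  qed
  have RV: "R \<subseteq> V" "R \<noteq> {}" unfolding R_def using FV inV by auto
  \<comment> \<open>Two vertices, \<open>3 + card N\<close> arcs and the matching edge
    \<open>y z\<close> change the potential by \<open>14 - 9 - 2 = 3\<close> less
    \<open>3 * card N\<close>; an edge lost at \<open>x\<close> adds \<open>2\<close>.\<close>
  have key: "\<exists>M'. matching A M' \<and> Field M' \<subseteq> R \<and> val R C M' \<le> val (Field W) W M + 5 - 3 * int (card N)
      \<and> (x \<notin> Field M \<longrightarrow> val R C M' \<le> val (Field W) W M + 3 - 3 * int (card N))" if M: "matching W M" for M
  proof -
    have fM: "finite M" by (rule matching_finite[OF M fW(1)])
    have m: "matching W (mdel x M)" by (rule mdel_matching[OF M])
    have mA: "matching A (mdel x M)"
    proof (rule matching_transfer[OF m])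
      show "mdel x M \<subseteq> A \<inter> A\<inverse>"
      proof
        fix e assume e: "e \<in> mdel x M"
        obtain p q where pq: "e = (p, q)" by (cases e)
        have "(p, q) \<in> W" "(q, p) \<in> W" using m e pq unfolding matching_def by auto
        moreover have "p \<noteq> x" "q \<noteq> x" using e pq by (auto simp: mdel_def)
        ultimately show "e \<in> A \<inter> A\<inverse>" using lift pq by simp
      qed
    qed
    have F: "Field (mdel x M) \<subseteq> Field W" using mdel_Field[of x M] matching_Field[OF M] by blast
    have nF: "y \<notin> Field (mdel x M)" "z \<notin> Field (mdel x M)" using F yzW by auto
    let ?M = "insert (y, z) (mdel x M)"
    have "matching A ?M" by (rule matching_insert[OF mA yz xy(2) nF])
    moreover have "Field ?M \<subseteq> R" using F unfolding R_def by (auto simp: Field_def)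
    moreover have c: "card ?M = card (mdel x M) + 1"
      by (rule matching_insert_card[OF mA mdel_finite[OF fM] nF(1)])
    moreover have "val R C ?M \<le> val (Field W) W M + 5 - 3 * int (card N)"
      using c cR cC mdel_card[OF M fM, of x] unfolding val_def by simp
    moreover have "val R C ?M \<le> val (Field W) W M + 3 - 3 * int (card N)" if "x \<notin> Field M"
      using c cR cC mdel_id[OF that] unfolding val_def by simp
    ultimately show ?thesis by blast
  qed
  obtain M where M: "matching A M" "Field M \<subseteq> R" "val R C M \<le> 4 - 3 * int (card N)"
    using gW
  proof (cases rule: good_cases)
    case (1 k)
    show thesis
    proof (cases "k = 1")
      case True
      obtain M where M: "matching W M" "val (Field W) W M = 1" "x \<notin> Field M"
        using special_miss[of W x] 1 True xW by metis
      obtain M' where "matching A M'" "Field M' \<subseteq> R" "val R C M' \<le> val (Field W) W M + 3 - 3 * int (card N)"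
        using key[OF M(1)] M(3) by blast
      then show thesis using that[of M'] M(2) by simp
    next
      case False
      then have k: "k = -1" using special_kind[OF 1] by simp
      obtain M where M: "matching W M" "val (Field W) W M = k" using special_ex_matching[OF 1] .
      obtain M' where "matching A M'" "Field M' \<subseteq> R" "val R C M' \<le> val (Field W) W M + 5 - 3 * int (card N)"
        using key[OF M(1)] by blast
      then show thesis using that[of M'] M(2) k by simp
    qed
  next
    case (2 M)
    obtain M' where "matching A M'" "Field M' \<subseteq> R" "val R C M' \<le> val (Field W) W M + 5 - 3 * int (card N)"
      using key[OF 2(1)] by blast
    then show thesis using that[of M'] 2(2) by simp
  qed
  \<comment> \<open>If \<open>R = V\<close>, then \<open>N\<close> contains the at least two
    elements of \<open>Ou\<close>, and \<open>4 - 6 < -1\<close>. Otherwise \<open>N\<close> must be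
    empty and the bound \<open>4\<close> is attained, but the single vertex outside \<open>R\<close>
    cannot hold all of \<open>Ou\<close>.\<close>
  show False
  proof (cases "R = V")
    case True
    have "Ou \<subseteq> N"
    proof
      fix b assume b: "b \<in> Ou"
      then have "(y, b) \<in> A" "b \<noteq> z" by (auto simp: Ou_def)
      then have "b \<in> R" "b \<noteq> y" using True arc_verts irr by auto
      then show "b \<in> N" using b \<open>b \<noteq> z\<close> by (auto simp: R_def N_def)
    qed
    then have "card Ou \<le> card N" by (rule card_mono[OF finN])
    then have "2 \<le> card N" using O2 by linarith
    then show False using bound[OF RV CR M(1,2)] M(3) by linarith
  next
    case False
    show False
    proof (cases "card N = 0")
      case True
      then have N0: "N = {}" using finN by simp
      obtain v where v: "V - R = {v}" using single_outside_if_val_le_4[OF RV False CR M(1,2)] M(3) True by auto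
      have "Ou \<subseteq> {v}"
      proof
        fix b assume b: "b \<in> Ou"
        then have "(y, b) \<in> A" "b \<noteq> z" by (auto simp: Ou_def)
        then have "b \<in> V" "b \<noteq> y" using arc_verts irr by auto
        moreover have "b \<notin> Field W" using N0 b by (auto simp: N_def)
        ultimately show "b \<in> {v}" using v \<open>b \<noteq> z\<close> by (auto simp: R_def)
      qed
      then have "card Ou \<le> 1" using card_mono[of "{v}" Ou] by simp
      then show False using O2 by simp
    next
      case nz: False
      then show False using bound_proper[OF RV CR M(1,2) False] M(3) by linarith
    qed
  qed
qed

text \<open>Here \<open>x\<close> inherits the out-arcs of the deleted vertex \<open>y\<close>.\<close>

lemma in_digon_symmetric_adjacent:
  assumes i: "ins A y = {x, z}" "x \<noteq> z" and yz: "(y, z) \<in> A" and yx: "(y, x) \<notin> A"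
    and d: "(x, z) \<in> A" "(z, x) \<in> A"
  shows False
proof -
  have xy: "(x, y) \<in> A" "(z, y) \<in> A" using i by auto
  have ne: "x \<noteq> y" "z \<noteq> y" using xy irr by auto
  have yin: "w = x \<or> w = z" if "(w, y) \<in> A" for w
  proof -
    have "w \<in> ins A y" using that by simp
    then show ?thesis using i(1) by auto
  qed
  have inV: "x \<in> V" "y \<in> V" "z \<in> V" using xy arc_verts by blast+
  define Ou where "Ou = outs A y - {z}"
  have Oy: "b \<in> Ou \<Longrightarrow> (y, b) \<in> A" "(y, b) \<in> A \<Longrightarrow> b \<noteq> z \<Longrightarrow> b \<in> Ou" for b by (auto simp: Ou_def)
  have finOu: "finite Ou" unfolding Ou_def using fin by auto
  have xyO: "x \<notin> Ou" "y \<notin> Ou" "z \<notin> Ou" using yx irr by (auto simp: Ou_def)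
  define B where "B = del y A \<union> {x} \<times> Ou"
  have nc: "\<not> colourable B"
  proof
    assume "colourable B"
    then obtain c where c: "acyclic (monochrom c B)" by (auto simp: colourable_def)
    \<comment> \<open>The digon separates \<open>x\<close> from \<open>z\<close>, so
      \<open>y\<close> may take the colour of \<open>x\<close>: its only in-neighbour in the class
      is then \<open>x\<close>, which has inherited its out-arcs.\<close>
    have cxz: "c x \<noteq> c z" by (rule digon_colour[OF c]) (use d ne in \<open>auto simp: B_def del_def\<close>)
    define c' where "c' = c(y := c x)"
    have cv: "c' y = c x" "v \<noteq> y \<Longrightarrow> c' v = c v" for v by (auto simp: c'_def)
    define f where "f v = (if v = y then x else v)" for v
    have "acyclic (monochrom c' A)"
    proof (rule acyclic_contract[of _ f])
      have "{(u, v) \<in> monochrom c' A. f u = f v} \<subseteq> {(x, y)}"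
      proof
        fix e assume "e \<in> {(u, v) \<in> monochrom c' A. f u = f v}"
        then obtain u v where e: "e = (u, v)" "(u, v) \<in> A" "f u = f v" by (auto simp: monochrom_def)
        have "u \<noteq> v" using e irr by auto
        then have "(u = x \<and> v = y) \<or> (u = y \<and> v = x)" using e(3) by (auto simp: f_def split: if_splits)
        then show "e \<in> {(x, y)}" using e yx by auto
      qed
      then show "acyclic {(u, v) \<in> monochrom c' A. f u = f v}" using ne(1) by (rule acyclic_subset_arc)
      have "{(f u, f v) |u v. (u, v) \<in> monochrom c' A \<and> f u \<noteq> f v} \<subseteq> monochrom c B"
      proof
        fix e assume "e \<in> {(f u, f v) |u v. (u, v) \<in> monochrom c' A \<and> f u \<noteq> f v}"
        then obtain u v where e: "e = (f u, f v)" "(u, v) \<in> A" "c' u = c' v" "f u \<noteq> f v"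
          by (auto simp: monochrom_def)
        have "u \<noteq> v" using e irr by auto
        consider "u = y" | "v = y" | "u \<noteq> y" "v \<noteq> y" by blast
        then show "e \<in> monochrom c B"
        proof cases
          case 1
          then have "v \<noteq> y" using \<open>u \<noteq> v\<close> by simp
          then have "v \<noteq> z" using e(3) cv(1) cv(2)[of v] cxz 1 by auto
          then have "v \<in> Ou" using e(2) 1 Oy by simp
          then show ?thesis using e 1 \<open>v \<noteq> y\<close> cv by (simp add: f_def monochrom_def B_def)
        next
          case 2
          then have "u = x \<or> u = z" using yin e(2) by simp
          moreover have "u \<noteq> x" using e(4) 2 by (auto simp: f_def)
          moreover have "u \<noteq> z" using e(3) 2 cv(1) cv(2)[of u] cxz ne by auto
          ultimately show ?thesis by simp
        next
          case 3
          then show ?thesis using e cv by (simp add: f_def monochrom_def B_def del_def)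
        qed
      qed
      then show "acyclic {(f u, f v) |u v. (u, v) \<in> monochrom c' A \<and> f u \<noteq> f v}"
        using c acyclic_subset by blast
    qed
    then show False using critical_not_colourable[OF crit] colourableI by blast
  qed
  have "finite B" unfolding B_def using finite_subset[OF del_subset fin(1)] finOu by simp
  moreover have "irrefl B" unfolding B_def irrefl_def del_def using irr xyO by auto
  ultimately obtain W where W: "W \<subseteq> B" "critical W" using ex_critical[OF _ _ nc] by metis
  have new: "p = x \<or> (p, q) \<in> A" if "(p, q) \<in> W" for p q
    using W(1) that unfolding B_def del_def by auto
  have FW: "v \<in> V \<and> v \<noteq> y" if "v \<in> Field W" for v
  proof -
    have "v \<in> Field B" using that mono_Field[OF W(1)] by blast
    then obtain p where "(p, v) \<in> B \<or> (v, p) \<in> B" by (auto simp: Field_def)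
    then show ?thesis using Oy[of v] xyO inV ne arc_verts unfolding B_def del_def by auto
  qed
  have FV: "Field W \<subseteq> V" and yW: "y \<notin> Field W" using FW by auto
  define N where "N = {b. (x, b) \<in> W \<and> (x, b) \<notin> A}"
  have N2: "2 \<le> card N" and xW: "x \<in> Field W" and finN: "finite N"
    using new_arcs[OF W(2) FV inV(2) yW new] unfolding N_def by auto
  have NO: "N \<subseteq> Ou"
  proof
    fix b assume "b \<in> N"
    then have "(x, b) \<in> B" "(x, b) \<notin> A" using W(1) by (auto simp: N_def)
    then show "b \<in> Ou" unfolding B_def del_def by auto
  qed
  have zN: "z \<notin> N" unfolding N_def using d by simp
  have NW: "{x} \<times> N \<subseteq> W" unfolding N_def by auto
  have NF: "N \<subseteq> Field W" unfolding N_def Field_def by auto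
  have WA: "W - {x} \<times> N \<subseteq> A" unfolding N_def using new by auto
  have gW: "good W" by (rule good_smaller[OF W(2) FV inV(2) yW])
  have fW: "finite W" "finite (Field W)" using critical_finite[OF W(2)] critical_finite_Field[OF W(2)] by auto
  have dels: "matching A (mdel x M)" "finite M" "Field M \<subseteq> Field W" "Field (mdel x M) \<subseteq> Field W"
    "int (card M) \<le> int (card (mdel x M)) + 1" if M: "matching W M" for M
    using star_matching(1)[OF M new] matching_finite[OF M fW(1)] matching_Field[OF M] mdel_Field[of x M]
      mdel_card[OF M, of x] by auto
  show False
  proof (cases "z \<in> Field W")
    case True
    define P where "P = {(x, y), (y, z), (z, y)} \<union> (if (x, z) \<in> W then {} else {(x, z)})"
    define C where "C = (W - {x} \<times> N) \<union> {y} \<times> N \<union> P"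
    define R where "R = Field W \<union> {y}"
    have notW: "(x, y) \<notin> W" "(y, z) \<notin> W" "(z, y) \<notin> W" using yW FieldI[of _ _ W] by auto
    have cP: "card P = (if (x, z) \<in> W then 3 else 4)" unfolding P_def using ne i(2) by simp
    have cC: "card C = card W + card P"
      unfolding C_def by (rule card_star[OF fW(1) NW yW])
        (use notW zN ne in \<open>auto simp: P_def split: if_splits\<close>)
    have cR: "card R = card (Field W) + 1" unfolding R_def using yW fW by simp
    have PR: "P \<subseteq> A \<inter> R \<times> R" unfolding P_def R_def using xy yz d xW True by auto
    have CR: "C \<subseteq> A \<inter> R \<times> R"
    proof -
      have "W - {x} \<times> N \<subseteq> A \<inter> R \<times> R"
        by (rule sub_sq[OF WA]) (use mono_Field[of "W - {x} \<times> N" W] in \<open>auto simp: R_def\<close>)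
      moreover have "{y} \<times> N \<subseteq> A \<inter> R \<times> R" using NO Oy NF unfolding R_def by auto
      ultimately show ?thesis using PR unfolding C_def by blast
    qed
    have RV: "R \<subseteq> V" "R \<noteq> {}" unfolding R_def using FV inV by auto
    \<comment> \<open>Moving the star is free; there remain one vertex and the arcs of
      \<open>P\<close>, that is \<open>7 - 3 * card P\<close>.\<close>
    have vl: "val R C M = val (Field W) W M' + 7 - 3 * int (card P) + 2 * (int (card M') - int (card M))" for M M'
      unfolding val_def using cC cR by simp
    have ge: "-1 \<le> val R C M" if "matching A M" "Field M \<subseteq> Field W" for M
      by (rule bound[OF RV CR that(1)]) (use that(2) in \<open>auto simp: R_def\<close>)
    show False
    proof (cases "(x, z) \<in> W")
      case xzW: True
      from gW show False
      proof (cases rule: good_cases)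
        case (1 k)
        \<comment> \<open>An odd bidirected cycle has out-degree two, too small for \<open>z\<close>
          and at least two vertices of \<open>N\<close>.\<close>
        have "k = -1"
        proof (rule ccontr)
          assume "k \<noteq> -1"
          then have "k = 1" using special_kind[OF 1] by simp
          then have "card (outs W x) = 2" using special_outdeg[of W x] 1 xW by simp
          moreover have "insert z N \<subseteq> outs W x" using NW xzW by auto
          then have "card (insert z N) \<le> card (outs W x)"
            using fW(1) by (intro card_mono) auto
          ultimately show False using N2 zN finN by simp
        qed
        \<comment> \<open>The edge at \<open>x\<close>, if any, is the digon \<open>x z\<close> of
          \<open>A\<close>, so nothing is dropped and the value is
          \<open>-1 + 7 - 9 = -3\<close>.\<close>
        obtain M where M: "matching W M" "val (Field W) W M = k" "\<And>b. (x, b) \<in> M \<or> (b, x) \<in> M \<Longrightarrow> b = z"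
          using special_at[OF 1 xzW] by metis
        have "matching A M" by (rule star_matching(2)[OF M(1) new]) (use M(3) d in auto)
        then have "-1 \<le> val R C M" using ge dels(3)[OF M(1)] by blast
        then show False using vl[of M M] M(2) \<open>k = -1\<close> cP xzW by simp
      next
        case (2 M)
        have "-1 \<le> val R C (mdel x M)" using ge dels[OF 2(1)] by blast
        then show False using vl[of "mdel x M" M] 2(2) dels(5)[OF 2(1)] cP xzW by simp
      qed
    next
      case False
      obtain M where M: "matching W M" "val (Field W) W M \<le> 1" using good_val[OF gW] .
      have "-1 \<le> val R C (mdel x M)" using ge dels[OF M(1)] by blast
      then show False using vl[of "mdel x M" M] M(2) dels(5)[OF M(1)] cP False by simp
    qed
  next
    case False
    define P where "P = {(x, y), (y, z), (z, y), (x, z), (z, x)}"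
    define C where "C = (W - {x} \<times> N) \<union> {y} \<times> N \<union> P"
    define R where "R = Field W \<union> {y, z}"
    have notW: "(x, y) \<notin> W" "(y, z) \<notin> W" "(z, y) \<notin> W" "(x, z) \<notin> W" "(z, x) \<notin> W"
      using yW False FieldI[of _ _ W] by auto
    have cP: "card P = 5" unfolding P_def using ne i(2) by simp
    have cC: "card C = card W + card P"
      unfolding C_def by (rule card_star[OF fW(1) NW yW])
        (use notW zN ne in \<open>auto simp: P_def split: if_splits\<close>)
    have cR: "card R = card (Field W) + 2" unfolding R_def using yW False fW ne by simp
    have PR: "P \<subseteq> A \<inter> R \<times> R" unfolding P_def R_def using xy yz d xW by auto
    have CR: "C \<subseteq> A \<inter> R \<times> R"
    proof -
      have "W - {x} \<times> N \<subseteq> A \<inter> R \<times> R"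
        by (rule sub_sq[OF WA]) (use mono_Field[of "W - {x} \<times> N" W] in \<open>auto simp: R_def\<close>)
      moreover have "{y} \<times> N \<subseteq> A \<inter> R \<times> R" using NO Oy NF unfolding R_def by auto
      ultimately show ?thesis using PR unfolding C_def by blast
    qed
    have RV: "R \<subseteq> V" "R \<noteq> {}" unfolding R_def using FV inV by auto
    \<comment> \<open>Two vertices, five arcs and the matching edge \<open>y z\<close>:
      \<open>14 - 15 - 2 = -3\<close>.\<close>
    have ge: "-1 \<le> val (Field W) W M' - 3 + 2 * (int (card M') - int (card M))"
      if M: "matching A M" "Field M \<subseteq> Field W" for M M'
    proof -
      have nF: "y \<notin> Field M" "z \<notin> Field M" using M(2) yW False by auto
      have m: "matching A (insert (y, z) M)" by (rule matching_insert[OF M(1) yz xy(2) nF])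
      have c: "card (insert (y, z) M) = card M + 1"
        by (rule matching_insert_card[OF M(1) matching_finite[OF M(1) fin(1)] nF(1)])
      have "-1 \<le> val R C (insert (y, z) M)"
        by (rule bound[OF RV CR m]) (use M(2) in \<open>auto simp: R_def Field_def\<close>)
      then show ?thesis unfolding val_def using cC cR cP c by simp
    qed
    from gW show False
    proof (cases rule: good_cases)
      case (1 k)
      show False
      proof (cases "k = 1")
        case True
        obtain M where M: "matching W M" "val (Field W) W M = 1" "x \<notin> Field M"
          using special_miss[of W x] 1 True xW by metis
        have "mdel x M = M" by (rule mdel_id[OF M(3)])
        then show False using ge[of M M] dels[OF M(1)] M(2) by simp
      next
        case nk: False
        then have k: "k = -1" using special_kind[OF 1] by simp
        obtain M where M: "matching W M" "val (Field W) W M = k" using special_ex_matching[OF 1] .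
        then show False using ge[of "mdel x M" M] dels[OF M(1)] M(2) k by simp
      qed
    next
      case (2 M)
      then show False using ge[of "mdel x M" M] dels[OF 2(1)] 2(2) by simp
    qed
  qed
qed

lemma in_digon_symmetric: "ins A y = {x, z} \<Longrightarrow> x \<noteq> z \<Longrightarrow> (y, z) \<in> A \<Longrightarrow> (y, x) \<in> A"
  using in_digon_symmetric_adjacent[of y x z] in_digon_symmetric_nonadjacent[of y x z] by blast

end

section \<open>Bad arcs and their devices\<close>

lemma acyclic_rank: "(\<And>u v. (u, v) \<in> S \<Longrightarrow> h v < (h u :: nat)) \<Longrightarrow> acyclic S"
  by (rule acyclicI_order[of S h]) blast

context counterexample
begin

lemma out_digon_symmetric: "outs A y = {x, z} \<Longrightarrow> x \<noteq> z \<Longrightarrow> (z, y) \<in> A \<Longrightarrow> (x, y) \<in> A"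
  using counterexample.in_digon_symmetric[OF counterexample_converse, of y x z] by simp

text \<open>Any digon here would spread by the two symmetry lemmas to all of \<open>z y\<close>,
  \<open>y x\<close> and \<open>x y'\<close>, which \<open>no_digon_path\<close> forbids.\<close>

lemma bad_simple:
  assumes o: "outs A x = {y, y'}" "y \<noteq> y'" and i: "ins A y = {x, z}" "x \<noteq> z"
  shows "(y, x) \<notin> A" "(y, z) \<notin> A" "(y', x) \<notin> A"
proof -
  have arcs: "(x, y) \<in> A" "(x, y') \<in> A" "(z, y) \<in> A" using o i by auto
  show yx: "(y, x) \<notin> A"
  proof
    assume yx: "(y, x) \<in> A"
    have "(y, z) \<in> A" by (rule in_digon_symmetric[of y z x]) (use i yx in auto)
    moreover have "(y', x) \<in> A" by (rule out_digon_symmetric[of x y' y]) (use o yx in auto)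
    ultimately show False using no_digon_path[OF o(1) i(1) o(2) i(2)] arcs yx by blast
  qed
  show "(y, z) \<notin> A" using in_digon_symmetric[OF i] yx by blast
  show "(y', x) \<notin> A" using out_digon_symmetric[OF o] yx by blast
qed

text \<open>Give \<open>y\<close> the colour of \<open>y'\<close> and \<open>x\<close> the other
  one, so that \<open>x\<close> is a sink of its class. If \<open>z\<close> differs from
  \<open>y'\<close>, then \<open>y\<close> is a source of its class; otherwise \<open>y\<close> can
  be entered within its class only from \<open>z\<close>, which has inherited its out-arcs.\<close>

lemma bad_arc_not_colourable:
  assumes o: "outs A x = {y, y'}" "y \<noteq> y'" and i: "ins A y = {x, z}" "x \<noteq> z"
  shows "\<not> colourable (del x (del y A) \<union> {z} \<times> outs A y)" (is "\<not> colourable ?B")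
proof
  have arcs: "(x, y) \<in> A" "(x, y') \<in> A" "(z, y) \<in> A" using o i by auto
  note s = bad_simple[OF o i]
  have ne: "x \<noteq> y" "y' \<noteq> x" "z \<noteq> y" "z \<noteq> x" using arcs irr i by auto
  have yin: "w = x \<or> w = z" if "(w, y) \<in> A" for w
  proof -
    have "w \<in> ins A y" using that by simp
    then show ?thesis using i(1) by auto
  qed
  have xout: "w = y \<or> w = y'" if "(x, w) \<in> A" for w
  proof -
    have "w \<in> outs A x" using that by simp
    then show ?thesis using o(1) by auto
  qed
  assume "colourable ?B"
  then obtain c where c: "acyclic (monochrom c ?B)" by (auto simp: colourable_def)
  \<comment> \<open>In either case \<open>t\<close> equals \<open>c y'\<close>.\<close>
  define t where "t = (if c y' = c z then c z else (\<not> c z))"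
  define c' where "c' = c(x := \<not> t, y := t)"
  have cv: "c' x = (\<not> t)" "c' y = t" "v \<noteq> x \<Longrightarrow> v \<noteq> y \<Longrightarrow> c' v = c v" for v using ne by (auto simp: c'_def)
  have cy': "c' y' = t" using cv(3)[of y'] ne o(2) by (auto simp: t_def)
  have cz: "c' z = c z" using cv(3)[of z] ne by simp
  have "acyclic (monochrom c' (del x A))"
  proof (cases "c y' = c z")
    case False
    show ?thesis
    proof (rule colour_source[of _ y])
      have "acyclic (monochrom c (del x (del y A)))"
        using c monochrom_mono[of "del x (del y A)" ?B c] acyclic_subset by blast
      then have "acyclic (monochrom c' (del x (del y A)))"
        by (rule deleted_colour) (use del_Field[of x "del y A"] del_Field[of y A] cv in auto)
      moreover have "del y (del x A) = del x (del y A)" by (auto simp: del_def)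
      ultimately show "acyclic (monochrom c' (del y (del x A)))" by simp
      fix w assume "(w, y) \<in> del x A"
      then have "w = z" using yin[of w] by (auto simp: del_def)
      then show "c' w \<noteq> c' y" using cz cv(2) False by (simp add: t_def)
    qed
  next
    case True
    then have tz: "t = c z" by (simp add: t_def)
    define f where "f v = (if v = y then z else v)" for v
    show ?thesis
    proof (rule acyclic_contract[of _ f])
      have "{(u, v) \<in> monochrom c' (del x A). f u = f v} \<subseteq> {(z, y)}"
      proof
        fix e assume "e \<in> {(u, v) \<in> monochrom c' (del x A). f u = f v}"
        then obtain u v where e: "e = (u, v)" "(u, v) \<in> A" "f u = f v" by (auto simp: monochrom_def del_def)
        have "u \<noteq> v" using e irr by auto
        then have "(u = z \<and> v = y) \<or> (u = y \<and> v = z)" using e(3) by (auto simp: f_def split: if_splits)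
        then show "e \<in> {(z, y)}" using e s by auto
      qed
      then show "acyclic {(u, v) \<in> monochrom c' (del x A). f u = f v}" using ne(3) by (rule acyclic_subset_arc)
      have "{(f u, f v) |u v. (u, v) \<in> monochrom c' (del x A) \<and> f u \<noteq> f v} \<subseteq> monochrom c ?B"
      proof
        fix e assume "e \<in> {(f u, f v) |u v. (u, v) \<in> monochrom c' (del x A) \<and> f u \<noteq> f v}"
        then obtain u v where e: "e = (f u, f v)" "(u, v) \<in> A" "u \<noteq> x" "v \<noteq> x" "c' u = c' v" "f u \<noteq> f v"
          by (auto simp: monochrom_def del_def)
        have "u \<noteq> v" using e irr by auto
        consider "u = y" | "v = y" | "u \<noteq> y" "v \<noteq> y" by blast
        then show "e \<in> monochrom c ?B"
        proof cases
          case 1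
          then have "v \<noteq> y" using \<open>u \<noteq> v\<close> by simp
          then have "c v = c z" using e(4,5) 1 cv tz by simp
          then show ?thesis using e 1 \<open>v \<noteq> y\<close> by (simp add: f_def monochrom_def)
        next
          case 2
          then have "u = z" using yin[of u] e(2,3) by simp
          then show ?thesis using e(6) 2 by (simp add: f_def)
        next
          case 3
          then show ?thesis using e cv by (simp add: f_def monochrom_def del_def)
        qed
      qed
      then show "acyclic {(f u, f v) |u v. (u, v) \<in> monochrom c' (del x A) \<and> f u \<noteq> f v}"
        using c acyclic_subset by blast
    qed
  qed
  then have "acyclic (monochrom c' A)"
  proof (rule colour_sink)
    fix w assume "(x, w) \<in> A"
    then show "c' w \<noteq> c' x" using xout[of w] cv cy' by auto
  qed
  then show False using critical_not_colourable[OF crit] colourableI by blast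
qed

text \<open>An in-neighbour of \<open>x\<close> of out-degree two loses its arc to \<open>x\<close>
  and keeps at most one arc in \<open>W\<close>, too few for a critical digraph; only
  \<open>z\<close> escapes, and then \<open>x\<close>, \<open>y\<close>, \<open>z\<close> are
  coloured by hand. If \<open>y'\<close> had in-degree two, its lost in-arc would have to be
  replaced by an inherited one from \<open>z\<close>; then \<open>y\<close> would be its second
  in-neighbour in \<open>A\<close> and would have to lie in \<open>W\<close>, which it does
  not.\<close>

lemma isolated_tail_if_tight:
  fixes W :: "('a \<times> 'a) set"
  assumes o: "outs A x = {y, y'}" "y \<noteq> y'" and i: "ins A y = {x, z}" "x \<noteq> z"
    and W: "critical W" "W \<subseteq> del x (del y A) \<union> {z} \<times> outs A y" "\<And>b. (z, b) \<in> W \<Longrightarrow> (z, b) \<notin> A \<Longrightarrow> b \<in> outs A y"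
    and FW: "Field W = V - {x, y}" and d: "card (outs A x) = 2" "card (ins A x) = 2"
  shows "isolated_tail A x y"
proof -
  have arcs: "(x, y) \<in> A" "(x, y') \<in> A" "(z, y) \<in> A" using o i by auto
  note s = bad_simple[OF o i]
  have ne: "x \<noteq> y" "y' \<noteq> x" "z \<noteq> y" "z \<noteq> x" using arcs irr i by auto
  have WA: "(p, q) \<in> A \<and> p \<noteq> x \<and> q \<noteq> x \<and> p \<noteq> y \<and> q \<noteq> y" if "(p, q) \<in> W" "p \<noteq> z" for p q
    using W(2) that by (auto simp: del_def)
  have 1: "card (outs A e) \<noteq> 2" if e: "(e, x) \<in> A" for e
  proof
    assume c2: "card (outs A e) = 2"
    obtain q where q: "q \<noteq> x" "outs A e = {x, q}" using card2_other[OF c2, of x] e by auto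
    have ene: "e \<noteq> x" "e \<noteq> y" using e irr s(1) by auto
    have eV: "e \<in> V" using arc_verts e by blast
    show False
    proof (cases "e = z")
      case False
      have "outs W e \<subseteq> {q}"
      proof
        fix b assume "b \<in> outs W e"
        then have "b \<in> outs A e" "b \<noteq> x" using WA[of e b] False by auto
        then show "b \<in> {q}" using q by auto
      qed
      then have "card (outs W e) \<le> 1" using card_mono[of "{q}" "outs W e"] by simp
      moreover have "e \<in> Field W" using FW eV ene by simp
      ultimately show False using critical_outdeg[OF W(1)] by fastforce
    next
      case True
      have "y \<in> outs A e" using arcs True by simp
      then have oz: "outs A z = {x, y}" using q ne True by auto
      have y'z: "y' \<noteq> z" using s(3) e True by auto
      define S where "S = del z (del y (del x A))"
      have SA: "S \<subseteq> A" unfolding S_def del_def by auto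
      have FS: "Field S \<subseteq> V - {x, y, z}"
        unfolding S_def using del_Field[of z "del y (del x A)"] del_Field[of y "del x A"] del_Field[of x A] by blast
      have "S \<noteq> A" using FS arc_verts(1)[OF arcs(1)] FieldI(1)[OF arcs(1)] by blast
      then obtain c where c: "acyclic (monochrom c S)"
        using critical_subset[OF crit SA] by (auto simp: colourable_def)
      \<comment> \<open>Reinserted in the order \<open>z\<close>, \<open>y\<close>,
        \<open>x\<close>, the vertices are a sink, a source and a sink of their classes.\<close>
      define c' where "c' = c(x := \<not> c y', y := c y', z := \<not> c y')"
      have cv: "c' x = (\<not> c y')" "c' y = c y'" "c' z = (\<not> c y')" "c' y' = c y'"
        using ne o(2) y'z by (auto simp: c'_def)
      have c3: "acyclic (monochrom c' S)"
        by (rule deleted_colour[OF c]) (use FS in \<open>auto simp: c'_def\<close>)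
      have "acyclic (monochrom c' (del y (del x A)))"
      proof (rule colour_sink[of _ z])
        show "acyclic (monochrom c' (del z (del y (del x A))))" using c3 unfolding S_def .
        fix w assume w: "(z, w) \<in> del y (del x A)"
        then have "w \<in> outs A z" "w \<noteq> x" "w \<noteq> y" by (auto simp: del_def)
        then show "c' w \<noteq> c' z" using oz by simp
      qed
      then have "acyclic (monochrom c' (del x A))"
      proof (rule colour_source)
        fix w assume w: "(w, y) \<in> del x A"
        then have "w \<in> ins A y" "w \<noteq> x" by (auto simp: del_def)
        then have "w = z" using i by auto
        then show "c' w \<noteq> c' y" using cv by simp
      qed
      then have "acyclic (monochrom c' A)"
      proof (rule colour_sink)
        fix w assume "(x, w) \<in> A"
        then have "w \<in> outs A x" by simp
        then show "c' w \<noteq> c' x" using o cv by auto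
      qed
      then show False using critical_not_colourable[OF crit] colourableI by blast
    qed
  qed
  have 2: "card (ins A w) \<noteq> 2" if w: "(x, w) \<in> A" "w \<noteq> y" for w
  proof
    assume c2: "card (ins A w) = 2"
    have "w \<in> outs A x" using w by simp
    then have wy: "w = y'" using o w by auto
    obtain q where q: "q \<noteq> x" "ins A w = {x, q}" using card2_other[OF c2, of x] w by auto
    have wF: "w \<in> Field W" using FW arc_verts(2)[OF w(1)] wy ne o(2) by auto
    have sub: "b = q \<or> b = z" if b: "(b, w) \<in> W" for b
    proof (cases "b = z")
      case False
      then have "b \<in> ins A w" "b \<noteq> x" using WA[OF b] by auto
      then show ?thesis using q by auto
    qed simp
    have in2: "2 \<le> card (ins W w)" by (rule critical_indeg[OF W(1) wF])
    have "(q, w) \<in> W \<and> (z, w) \<in> W \<and> q \<noteq> z"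
    proof (rule ccontr)
      assume n: "\<not> ((q, w) \<in> W \<and> (z, w) \<in> W \<and> q \<noteq> z)"
      have "\<exists>t. ins W w \<subseteq> {t}"
      proof (cases "(q, w) \<in> W \<and> q \<noteq> z")
        case True
        then show ?thesis using n sub by (intro exI[of _ q]) auto
      next
        case False
        then show ?thesis using n sub by (intro exI[of _ z]) auto
      qed
      then obtain t where "ins W w \<subseteq> {t}" by blast
      then have "card (ins W w) \<le> 1" using card_mono[of "{t}" "ins W w"] by simp
      then show False using in2 by simp
    qed
    then have qz: "(q, w) \<in> W" "(z, w) \<in> W" "q \<noteq> z" by auto
    have "(z, w) \<notin> A"
    proof
      assume "(z, w) \<in> A"
      then have "z \<in> ins A w" by simp
      then show False using q ne qz by auto
    qed
    then have "(y, w) \<in> A" using W(3)[OF qz(2)] by simp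
    then have "y \<in> ins A w" by simp
    then have "y = q" using q ne by auto
    then have "y \<in> Field W" using FieldI(1)[OF qz(1)] by simp
    then show False using FW by simp
  qed
  show ?thesis unfolding isolated_tail_def using 1 2 d by auto
qed

text \<open>Giving the inherited arcs back to \<open>y\<close> and adding \<open>z y\<close> changes
  the potential by \<open>7 - 3 = 4\<close>. A generic \<open>W\<close>, after dropping an edge at
  \<open>z\<close>, comes to at most \<open>-2 + 4 + 2 = 4\<close>; then only \<open>x\<close> is
  left outside and the arc is isolated. An exceptional \<open>W\<close> that keeps an original arc
  at \<open>z\<close>, or has an arc from \<open>z\<close> without its reverse, would stay below
  \<open>4\<close>; so it is a device.\<close>

lemma bad_arc_cases:
  assumes o: "outs A x = {y, y'}" "y \<noteq> y'" and i: "ins A y = {x, z}" "x \<noteq> z"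
  shows "isolated_tail A x y \<or> (\<exists>W M. device A x y z W M)"
proof -
  let ?B = "del x (del y A) \<union> {z} \<times> outs A y"
  have arcs: "(x, y) \<in> A" "(x, y') \<in> A" "(z, y) \<in> A" using o i by auto
  note s = bad_simple[OF o i]
  have ne: "x \<noteq> y" "y' \<noteq> x" "z \<noteq> y" "z \<noteq> x" using arcs irr i by auto
  have inV: "x \<in> V" "y \<in> V" "z \<in> V" using arc_verts arcs by blast+
  have yo: "x \<notin> outs A y" "y \<notin> outs A y" "z \<notin> outs A y" using s irr by auto
  have finB: "finite ?B" using fin finite_subset[OF del_subset[of y A] fin(1)]
    finite_subset[OF del_subset[of x "del y A"]] by auto
  have irrB: "irrefl ?B" using irr yo by (auto simp: irrefl_def del_def)
  obtain W where W: "W \<subseteq> ?B" "critical W"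
    using ex_critical[OF finB irrB bad_arc_not_colourable[OF o i]] .
  have WA: "p = z \<or> (p, q) \<in> A" "(p, q) \<notin> A \<Longrightarrow> q \<in> outs A y" if "(p, q) \<in> W" for p q
    using W(1) that by (auto simp: del_def)
  have FW: "v \<in> V \<and> v \<noteq> x \<and> v \<noteq> y" if "v \<in> Field W" for v
  proof -
    have "v \<in> Field ?B" using that mono_Field[OF W(1)] by blast
    then obtain p where "(p, v) \<in> ?B \<or> (v, p) \<in> ?B" by (auto simp: Field_def)
    then show ?thesis using yo inV ne arc_verts by (auto simp: del_def)
  qed
  have FV: "Field W \<subseteq> V" and xyW: "x \<notin> Field W" "y \<notin> Field W" using FW by auto
  define N where "N = {b. (z, b) \<in> W \<and> (z, b) \<notin> A}"
  have N2: "2 \<le> card N" and zW: "z \<in> Field W" and finN: "finite N"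
    using new_arcs[OF W(2) FV inV(2) xyW(2) WA(1)] unfolding N_def by auto
  have NO: "N \<subseteq> outs A y" using WA(2) unfolding N_def by auto
  have NW: "{z} \<times> N \<subseteq> W" unfolding N_def by auto
  have NF: "N \<subseteq> Field W" unfolding N_def Field_def by auto
  have WN: "W - {z} \<times> N \<subseteq> A" unfolding N_def using WA(1) by auto
  have gW: "good W" by (rule good_smaller[OF W(2) FV inV(1) xyW(1)])
  have fW: "finite W" "finite (Field W)" using critical_finite[OF W(2)] critical_finite_Field[OF W(2)] by auto
  define C where "C = (W - {z} \<times> N) \<union> {y} \<times> N \<union> {(z, y)}"
  define R where "R = Field W \<union> {y}"
  have zyW: "(z, y) \<notin> W" using xyW FieldI[of z y W] by auto
  have cC: "card C = card W + 1"
    unfolding C_def using card_star[OF fW(1) NW xyW(2), of "{(z, y)}"] zyW ne by simp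
  have cR: "card R = card (Field W) + 1" unfolding R_def using xyW fW by simp
  have CR: "C \<subseteq> A \<inter> R \<times> R"
  proof -
    have "W - {z} \<times> N \<subseteq> A \<inter> R \<times> R"
      by (rule sub_sq[OF WN]) (use mono_Field[of "W - {z} \<times> N" W] in \<open>auto simp: R_def\<close>)
    moreover have "{y} \<times> N \<subseteq> A \<inter> R \<times> R" using NO NF unfolding R_def by auto
    moreover have "(z, y) \<in> A \<inter> R \<times> R" using arcs zW unfolding R_def by simp
    ultimately show ?thesis unfolding C_def by blast
  qed
  have RV: "R \<subseteq> V" "R \<noteq> {}" "R \<noteq> V" unfolding R_def using FV inV xyW ne by auto
  have vl: "val R C M = val (Field W) W M' + 4 + 2 * (int (card M') - int (card M))" for M M'
    unfolding val_def using cC cR by simp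
  have ge: "4 \<le> val R C M" if "matching A M" "Field M \<subseteq> Field W" for M
    by (rule bound_proper[OF RV(1,2) CR that(1) _ RV(3)]) (use that(2) in \<open>auto simp: R_def\<close>)
  have dels: "matching A (mdel z M)" "Field M \<subseteq> Field W" "Field (mdel z M) \<subseteq> Field W"
    "int (card M) \<le> int (card (mdel z M)) + 1" if M: "matching W M" for M
    using star_matching(1)[OF M WA(1)] matching_finite[OF M fW(1)] matching_Field[OF M] mdel_Field[of z M]
      mdel_card[OF M, of z] by auto
  from gW show ?thesis
  proof (cases rule: good_cases)
    case (2 M)
    have v4: "val R C (mdel z M) \<le> 4" using vl[of "mdel z M" M] 2(2) dels(4)[OF 2(1)] by simp
    have "Field (mdel z M) \<subseteq> R" using dels(3)[OF 2(1)] by (auto simp: R_def)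
    then obtain v where v: "V - R = {v}" "card (outs A v) = 2" "card (ins A v) = 2"
      using single_outside_if_val_le_4[OF RV CR dels(1)[OF 2(1)] _ v4] by blast
    have "x \<in> V - R" using inV xyW ne by (simp add: R_def)
    then have vx: "v = x" using v(1) by auto
    have "Field W = V - {x, y}" using v(1) vx FV xyW inV unfolding R_def by auto
    then have "isolated_tail A x y"
      using isolated_tail_if_tight[OF o i W(2,1)] WA(2) v(2,3) vx by blast
    then show ?thesis by blast
  next
    case (1 k)
    have k: "k = 1 \<or> k = -1" by (rule special_kind[OF 1])
    have new: "(z, b) \<notin> A" if b: "(z, b) \<in> W" for b
    proof
      assume bA: "(z, b) \<in> A"
      have "k \<noteq> 1"
      proof
        assume "k = 1"
        then have "card (outs W z) = 2" using special_outdeg[of W z] 1 zW by simp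
        moreover have "insert b N \<subseteq> outs W z" using NW b by auto
        then have "card (insert b N) \<le> card (outs W z)" using fW(1) by (intro card_mono) auto
        ultimately show False using N2 bA finN by (simp add: N_def)
      qed
      obtain M where M: "matching W M" "val (Field W) W M = k" "\<And>q. (z, q) \<in> M \<or> (q, z) \<in> M \<Longrightarrow> q = b"
        using special_at[OF 1 b] by metis
      have "matching A M" by (rule star_matching(2)[OF M(1) WA(1)]) (use M(3) bA in auto)
      then show False using ge[of M] dels(2)[OF M(1)] vl[of M M] M(2) k \<open>k \<noteq> 1\<close> by simp
    qed
    have dig: "(b, z) \<in> W" if b: "(z, b) \<in> W" for b
    proof (rule ccontr)
      assume n: "(b, z) \<notin> W"
      have k1: "k = -1" using k special_sym[of W z b] 1 b n by auto
      obtain M where M: "matching W M" "val (Field W) W M = k" "z \<notin> Field M"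
        using special_at[OF 1 b] n by metis
      have "mdel z M = M" by (rule mdel_id[OF M(3)])
      then show False using ge[of M] dels[OF M(1)] vl[of M M] M(2) k1 by simp
    qed
    have "\<exists>M. matching W M \<and> z \<notin> Field M \<and> val (Field W) W M \<le> 1"
    proof (cases "k = 1")
      case True
      then show ?thesis using special_miss[of W z] 1 zW by (metis order_refl)
    next
      case False
      obtain M where M: "matching W M" "val (Field W) W M = k" using special_ex_matching[OF 1] .
      have "val (Field W) W (mdel z M) \<le> 1"
        using dels(4)[OF M(1)] M(2) False k unfolding val_def by simp
      moreover have "z \<notin> Field (mdel z M)" using mdel_Field[of z M] by blast
      ultimately show ?thesis using mdel_matching[OF M(1)] by blast
    qed
    then obtain M where M: "matching W M" "z \<notin> Field M" "val (Field W) W M \<le> 1" by blast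
    have "N = outs W z" unfolding N_def using new by auto
    then have "device A x y z W M"
      unfolding device_def using W 1 zW new dig N2 M by blast
    then show ?thesis by blast
  qed
qed

lemma deviceD:
  assumes "device A x y z W M" and i: "ins A y = {x, z}" "x \<noteq> z" and yx: "(y, x) \<notin> A" "(y, z) \<notin> A"
  shows "critical W" "z \<in> Field W" "x \<notin> Field W" "y \<notin> Field W" "Field W \<subseteq> V"
    "W - {z} \<times> outs W z \<subseteq> A" "outs W z \<subseteq> outs A y" "outs W z \<subseteq> Field W"
    "\<And>b. b \<in> outs W z \<Longrightarrow> (b, z) \<in> W \<and> (b, z) \<in> A" "2 \<le> card (outs W z)"
    "matching W M" "matching A M" "z \<notin> Field M" "Field M \<subseteq> Field W" "val (Field W) W M \<le> 1"
    "finite W" "finite (Field W)"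
proof -
  show critW: "critical W" and zW: "z \<in> Field W" and M: "matching W M" "z \<notin> Field M" "val (Field W) W M \<le> 1"
    and "2 \<le> card (outs W z)"
    using assms(1) unfolding device_def by blast+
  have Wsub: "W \<subseteq> del x (del y A) \<union> {z} \<times> outs A y" using assms(1) unfolding device_def by blast
  have arcs: "(x, y) \<in> A" "(z, y) \<in> A" using i by auto
  have inV: "x \<in> V" "y \<in> V" "z \<in> V" using arc_verts arcs by blast+
  have ne: "x \<noteq> y" "z \<noteq> y" using arcs irr by auto
  have FW: "v \<in> V \<and> v \<noteq> x \<and> v \<noteq> y" if "v \<in> Field W" for v
  proof -
    have "v \<in> Field (del x (del y A) \<union> {z} \<times> outs A y)" using that mono_Field[OF Wsub] by blast
    then obtain p where "(p, v) \<in> del x (del y A) \<union> {z} \<times> outs A y \<or> (v, p) \<in> del x (del y A) \<union> {z} \<times> outs A y"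
      by (auto simp: Field_def)
    then show ?thesis using yx irr inV ne i(2) arc_verts by (auto simp: del_def)
  qed
  show "x \<notin> Field W" "y \<notin> Field W" "Field W \<subseteq> V" using FW by auto
  have new: "(z, b) \<notin> A" "(b, z) \<in> W" if "(z, b) \<in> W" for b using assms(1) that unfolding device_def by blast+
  have WA: "p = z \<or> (p, q) \<in> A" if "(p, q) \<in> W" for p q using Wsub that by (auto simp: del_def)
  show "W - {z} \<times> outs W z \<subseteq> A" using WA by auto
  show "outs W z \<subseteq> outs A y" using Wsub new(1) by (fastforce simp: del_def)
  show "outs W z \<subseteq> Field W" by (auto simp: Field_def)
  show "(b, z) \<in> W \<and> (b, z) \<in> A" if "b \<in> outs W z" for b
  proof -
    have b: "(b, z) \<in> W" using new(2) that by simp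
    then have "b \<noteq> z" using critical_irrefl[OF critW] by auto
    then show ?thesis using b WA[OF b] by simp
  qed
  show "Field M \<subseteq> Field W" by (rule matching_Field[OF M(1)])
  have "mdel z M = M" by (rule mdel_id[OF M(2)])
  then show "matching A M" using star_matching(1)[OF M(1) WA] by simp
  show "finite W" "finite (Field W)" using critical_finite[OF critW] critical_finite_Field[OF critW] by auto
qed

text \<open>The union of both devices, in which \<open>y\<close> takes back the inherited arcs, has potential at most \<open>3\<close>.\<close>

lemma no_two_devices:
  assumes i: "ins A y = {x, z}" "x \<noteq> z" and ox: "outs A x = {y, x'}" "y \<noteq> x'" and oz: "outs A z = {y, z'}" "y \<noteq> z'"
    and d1: "device A x y z W1 M1" and d2: "device A z y x W2 M2"
  shows False
proof -
  have i': "ins A y = {z, x}" "z \<noteq> x" using i by auto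
  note s1 = bad_simple[OF ox i] and s2 = bad_simple[OF oz i']
  note D1 = deviceD[OF d1 i s1(1,2)] and D2 = deviceD[OF d2 i' s2(1,2)]
  have arcs: "(x, y) \<in> A" "(z, y) \<in> A" "(x, x') \<in> A" "(z, z') \<in> A" using i ox oz by auto
  have inV: "x \<in> V" "y \<in> V" "z \<in> V" using arc_verts arcs by blast+
  have ne: "x \<noteq> y" "z \<noteq> y" using arcs irr by auto
  let ?F1 = "Field W1" and ?F2 = "Field W2" and ?N1 = "outs W1 z" and ?N2 = "outs W2 x"
  define T where "T = ?F1 \<inter> ?F2"
  \<comment> \<open>The first device with the inherited arcs moved back to \<open>y\<close>. Its
    potential is at most \<open>1 + 4\<close>, because \<open>M1\<close> misses \<open>z\<close> and
    nothing is dropped.\<close>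
  define C1 where "C1 = (W1 - {z} \<times> ?N1) \<union> {y} \<times> ?N1 \<union> {(z, y)}"
  have zN: "{z} \<times> ?N1 \<subseteq> W1" "{x} \<times> ?N2 \<subseteq> W2" by auto
  have zy: "(z, y) \<notin> W1" using D1(4) FieldI[of z y W1] by auto
  have cC1: "card C1 = card W1 + 1"
    unfolding C1_def using card_star[OF D1(16) zN(1) D1(4), of "{(z, y)}"] zy ne by simp
  have C1A: "C1 \<subseteq> A" unfolding C1_def using D1(6,7) arcs by auto
  have xT: "x \<notin> T" "z \<notin> T" "y \<notin> T" using D1 D2 unfolding T_def by auto
  have finN2: "finite ?N2" using D2(16) by auto
  define Q0 where "Q0 = W2 - T \<times> T - {x} \<times> ?N2"
  \<comment> \<open>The part of the second device outside the overlap \<open>T\<close>. Arcs from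
    \<open>y\<close> into \<open>T\<close> may already occur in \<open>C1\<close> and are left
    out.\<close>
  define Q where "Q = Q0 \<union> {y} \<times> (?N2 - T) \<union> {(x, y)}"
  have WT: "{x} \<times> ?N2 \<subseteq> W2 - T \<times> T" using xT by auto
  have y2: "(y, q) \<notin> W2" "(q, y) \<notin> W2" for q using D2(4) FieldI[of y q W2] FieldI[of q y W2] by auto
  have cQ: "int (card Q) = int (card (W2 - T \<times> T)) - int (card (?N2 \<inter> T)) + 1"
  proof -
    have "card Q0 = card (W2 - T \<times> T) - card ({x} \<times> ?N2)"
      unfolding Q0_def by (rule card_Diff_subset) (use WT finN2 in auto)
    moreover have "card ({x} \<times> ?N2) \<le> card (W2 - T \<times> T)" by (rule card_mono[OF _ WT]) (use D2(16) in simp)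
    moreover have "card ({x} \<times> ?N2) = card ?N2" by (simp add: card_cartesian_product)
    moreover have "card ({y} \<times> (?N2 - T)) = card (?N2 - T)" by (simp add: card_cartesian_product)
    moreover have "card ?N2 = card (?N2 - T) + card (?N2 \<inter> T)"
    proof -
      have "(?N2 - T) \<inter> (?N2 \<inter> T) = {}" by blast
      then show ?thesis using card_Un_disjoint[of "?N2 - T" "?N2 \<inter> T"] finN2 by (simp add: Un_Diff_Int)
    qed
    moreover have "card (Q0 \<union> {y} \<times> (?N2 - T)) = card Q0 + card ({y} \<times> (?N2 - T))"
      by (rule card_Un_disjoint) (use D2(16) finN2 y2 in \<open>auto simp: Q0_def\<close>)
    moreover have "card Q = card (Q0 \<union> {y} \<times> (?N2 - T)) + card {(x, y)}"
      unfolding Q_def by (rule card_Un_disjoint) (use D2(16) finN2 y2 ne in \<open>auto simp: Q0_def\<close>)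
    ultimately show ?thesis by simp
  qed
  have QA: "Q \<subseteq> A"
  proof -
    have "Q0 \<subseteq> A" unfolding Q0_def using D2(6) by blast
    then show ?thesis unfolding Q_def using D2(7) arcs by auto
  qed
  \<comment> \<open>The second part is worth at most \<open>-2\<close>, so the union is worth at
    most \<open>5 - 2 = 3\<close>.\<close>
  have "\<exists>Mq. matching A Mq \<and> Field Mq \<subseteq> ?F2 - T \<and> val (?F2 - T) Q Mq \<le> -2"
  proof -
    have newx: "p = x \<or> (p, q) \<in> A" if "(p, q) \<in> W2" for p q using D2(6) that by auto
    have vQ: "val (?F2 - T) Q Mq = val (?F2 - T) (W2 - T \<times> T) Mq + 3 * int (card (?N2 \<inter> T)) - 3" for Mq
      unfolding val_def using cQ by simp
    have cardF: "card ?F2 < card V" by (rule smaller[OF D2(5) inV(3) D2(3)])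
    have TF: "T \<subseteq> ?F2" "T \<noteq> ?F2" unfolding T_def using D1(3) D2(2) by auto
    consider (empty) "T = {}" | (zero) "T \<noteq> {}" "?N2 \<inter> T = {}" | (pos) "?N2 \<inter> T \<noteq> {}" by blast
    then show ?thesis
    proof cases
      case empty
      show ?thesis
        by (rule exI[of _ M2]) (use vQ[of M2] D2 empty in \<open>simp add: Diff_triv\<close>)
    next
      case zero
      obtain M where M: "matching W2 M" "Field M \<subseteq> ?F2 - T" "val (?F2 - T) (W2 - T \<times> T) M \<le> -5"
        using cost_part[OF D2(1) cardF TF(1) zero(1) TF(2)] by blast
      have "matching A (mdel x M)" by (rule star_matching(1)[OF M(1) newx])
      moreover have "Field (mdel x M) \<subseteq> ?F2 - T" using mdel_Field[of x M] M(2) by blast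
      moreover have "val (?F2 - T) Q (mdel x M) \<le> -2"
        using vQ[of "mdel x M"] M(3) zero(2) mdel_card[OF M(1) matching_finite[OF M(1) D2(16)], of x]
        unfolding val_def by simp
      ultimately show ?thesis by blast
    next
      case pos
      \<comment> \<open>The \<open>?d\<close> omitted arcs into \<open>T\<close> are compensated by
        the digons joining \<open>x\<close> to \<open>T\<close>: setting \<open>x\<close> aside as
        well removes one vertex and at least \<open>2 * ?d\<close> arcs, which changes the potential
        by at most \<open>7 - 6 * ?d + 3 * ?d - 3\<close>.\<close>
      let ?T = "T \<union> {x}" and ?d = "card (?N2 \<inter> T)"
      have d1: "1 \<le> ?d" using pos finN2 by (simp add: Suc_le_eq card_gt_0_iff)
      define E where "E = W2 \<inter> ?T \<times> ?T - T \<times> T"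
      have cE: "2 * ?d \<le> card E"
      proof -
        have "{x} \<times> (?N2 \<inter> T) \<union> (?N2 \<inter> T) \<times> {x} \<subseteq> E" unfolding E_def using xT D2(9) by auto
        then have "card ({x} \<times> (?N2 \<inter> T) \<union> (?N2 \<inter> T) \<times> {x}) \<le> card E"
          by (rule card_mono[rotated]) (use D2(16) in \<open>simp add: E_def\<close>)
        moreover have "card ({x} \<times> (?N2 \<inter> T) \<union> (?N2 \<inter> T) \<times> {x}) = 2 * ?d"
          using xT finN2 by (subst card_Un_disjoint) (auto simp: card_cartesian_product)
        ultimately show ?thesis by simp
      qed
      have cW: "card (W2 - T \<times> T) = card (W2 - ?T \<times> ?T) + card E"
      proof -
        have eq: "W2 - T \<times> T = (W2 - ?T \<times> ?T) \<union> E" unfolding E_def by blast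
        show ?thesis unfolding eq
          by (rule card_Un_disjoint) (use D2(16) in \<open>auto simp: E_def\<close>)
      qed
      have cF: "card (?F2 - T) = card (?F2 - ?T) + 1"
      proof -
        have "?F2 - ?T = (?F2 - T) - {x}" by blast
        then show ?thesis using card_Suc_Diff1[of "?F2 - T" x] D2(2,17) xT by simp
      qed
      have vT: "val (?F2 - T) Q Mq \<le> val (?F2 - ?T) (W2 - ?T \<times> ?T) Mq + 4 - 3 * int ?d" for Mq
        using vQ[of Mq] cE cW cF unfolding val_def by simp
      show ?thesis
      proof (cases "?T = ?F2")
        case True
        have "?N2 \<subseteq> T"
        proof
          fix b assume b: "b \<in> ?N2"
          then have "b \<in> ?F2" "b \<noteq> x" using D2(8) critical_irrefl[OF D2(1)] by auto
          then show "b \<in> T" using True by auto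
        qed
        then have "?N2 \<inter> T = ?N2" by blast
        then have "2 \<le> ?d" using D2(10) by simp
        moreover have "val (?F2 - ?T) (W2 - ?T \<times> ?T) {} = 0"
        proof -
          have e: "W2 - ?F2 \<times> ?F2 = {}" by (auto simp: Field_def)
          show ?thesis unfolding True val_def e by simp
        qed
        ultimately show ?thesis using vT[of "{}"] by (intro exI[of _ "{}"]) simp
      next
        case False
        have "?T \<subseteq> ?F2" using TF D2(2) by blast
        then obtain M where M: "matching W2 M" "Field M \<subseteq> ?F2 - ?T" "val (?F2 - ?T) (W2 - ?T \<times> ?T) M \<le> -5"
          using cost_part[OF D2(1) cardF _ _ False] by blast
        have "mdel x M = M" by (rule mdel_id) (use M(2) in blast)
        then have "matching A M" using star_matching(1)[OF M(1) newx] by simp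
        moreover have "Field M \<subseteq> ?F2 - T" using M(2) by blast
        moreover have "val (?F2 - T) Q M \<le> -2" using vT[of M] M(3) d1 by linarith
        ultimately show ?thesis by blast
      qed
    qed
  qed
  then obtain Mq where Mq: "matching A Mq" "Field Mq \<subseteq> ?F2 - T" "val (?F2 - T) Q Mq \<le> -2" by blast
  define R where "R = (?F1 \<union> {y}) \<union> (?F2 - T)"
  define C where "C = C1 \<union> Q"
  define M where "M = M1 \<union> Mq"
  have dF: "(?F1 \<union> {y}) \<inter> (?F2 - T) = {}" using D2(4) unfolding T_def by blast
  have cR: "card R = card ?F1 + 1 + card (?F2 - T)"
    unfolding R_def using card_Un_disjoint[OF _ _ dF] D1(4,17) D2(17) by simp
  have finC: "finite C1" "finite Q" using finite_subset[OF C1A fin(1)] finite_subset[OF QA fin(1)] by auto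
  have C1F: "p \<in> ?F1 \<and> q \<in> ?F1 \<or> p = y \<and> q \<in> ?F1 \<or> p = z \<and> q = y" if "(p, q) \<in> C1" for p q
    using that FieldI[of p q W1] FieldI[of z q W1] unfolding C1_def by blast
  have QF: "p \<in> ?F2 \<and> q \<in> ?F2 \<and> \<not> (p \<in> T \<and> q \<in> T) \<or> p = y \<and> q \<in> ?F2 - T \<or> p = x \<and> q = y" if "(p, q) \<in> Q" for p q
    using that FieldI[of p q W2] FieldI[of x q W2] unfolding Q_def Q0_def by blast
  have dC: "C1 \<inter> Q = {}"
  proof -
    have False if "(p, q) \<in> C1" "(p, q) \<in> Q" for p q
      using C1F[OF that(1)] QF[OF that(2)] ne i(2) D1(3,4) D2(3,4) unfolding T_def by blast
    then show ?thesis by auto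
  qed
  have cC: "card C = card C1 + card Q" unfolding C_def by (rule card_Un_disjoint[OF finC dC])
  have dM: "Field M1 \<inter> Field Mq = {}" using D1(14) Mq(2) unfolding T_def by blast
  have mM: "matching A M" unfolding M_def by (rule matching_Un[OF D1(12) Mq(1) dM])
  have cM: "card M = card M1 + card Mq"
    unfolding M_def
    by (rule matching_Un_card[OF matching_finite[OF D1(12) fin(1)] matching_finite[OF Mq(1) fin(1)] dM])
  have v3: "val R C M \<le> 3"
    using cR cC cM cC1 D1(15) Mq(3) unfolding val_def by simp
  have F2T: "q \<in> R" if "q \<in> ?F2" for q using that unfolding R_def T_def by blast
  have CR: "C \<subseteq> A \<inter> R \<times> R"
  proof -
    have "e \<in> A \<inter> R \<times> R" if e: "e \<in> C" for e
    proof -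
      obtain p q where pq: "e = (p, q)" by (cases e)
      have "p \<in> R \<and> q \<in> R"
        using C1F[of p q] QF[of p q] e pq F2T D1(2) D2(2) unfolding C_def by (auto simp: R_def)
      then show ?thesis using e pq C1A QA unfolding C_def by blast
    qed
    then show ?thesis by blast
  qed
  have RV: "R \<subseteq> V" "R \<noteq> {}" unfolding R_def using D1(5) D2(5) inV by auto
  have FM: "Field M \<subseteq> R" unfolding M_def R_def using D1(14) Mq(2) by (auto simp: Field_def)
  show False
  proof (cases "R = V")
    case False
    then show False using bound_proper[OF RV CR mM FM] v3 by simp
  next
    case True
    \<comment> \<open>If the union is all of \<open>V\<close>, the second out-arcs of
      \<open>x\<close> and \<open>z\<close> have not been counted; they lower \<open>3\<close> to
      \<open>-3\<close>.\<close>
    have n: "(x, x') \<notin> C" "(z, z') \<notin> C"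
    proof -
      have "(x, x') \<notin> Q" unfolding Q_def Q0_def using ox(2) ne by auto
      moreover have "(x, x') \<notin> C1" using C1F[of x x'] D1(3) ne i(2) by blast
      ultimately show "(x, x') \<notin> C" unfolding C_def by blast
      have "(z, z') \<notin> C1" unfolding C1_def using oz(2) ne by auto
      moreover have "(z, z') \<notin> Q" using QF[of z z'] D2(3) ne i(2) by blast
      ultimately show "(z, z') \<notin> C" unfolding C_def by blast
    qed
    define C' where "C' = insert (x, x') (insert (z, z') C)"
    have cC': "card C' = card C + 2" unfolding C'_def using n i(2) finC by (simp add: C_def)
    have "C' \<subseteq> A \<inter> R \<times> R" unfolding C'_def True using CR arcs arc_verts True by auto
    then have "-1 \<le> val R C' M" using bound[OF RV _ mM FM] by blast
    then show False using v3 cC' unfolding val_def by simp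
  qed
qed

end

section \<open>The 3-wheel as a device\<close>

lemma wheel3_outs: "distinct [z, a, b, d] \<Longrightarrow> outs (wheel3 z a b d) z = {a, b, d}"
  unfolding wheel3_def by auto

text \<open>The device \<open>wheel3 z a b d\<close> as it appears in \<open>A\<close>: the arcs
  inherited by \<open>z\<close> start again at \<open>y\<close>, and \<open>z y\<close> is
  added.\<close>

definition centre :: "'a \<Rightarrow> 'a \<Rightarrow> 'a \<Rightarrow> 'a \<Rightarrow> 'a \<Rightarrow> ('a \<times> 'a) set"
  where "centre y z a b d = {(a, z), (b, z), (d, z), (a, b), (b, d), (d, a), (y, a), (y, b), (y, d), (z, y)}"

lemma centre_rotate: "centre y z a b d = centre y z b d a"
  unfolding centre_def by auto

text \<open>When the device is the 3-wheel on four vertices centred at \<open>z\<close>, its union with \<open>y\<close> has potential \<open>5\<close> and can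
  be coloured with each rim vertex in turn in the class of \<open>y\<close>; all three contractions are almost tight.\<close>

locale wheel_device = counterexample +
  fixes x y z y' a b d
  assumes dis: "distinct [y, z, a, b, d]"
    and o: "outs A x = {y, y'}" "y \<noteq> y'" and i: "ins A y = {x, z}" "x \<noteq> z"
    and xR: "x \<notin> {y, z, a, b, d}"
    and CA: "centre y z a b d \<subseteq> A"
begin

definition R where "R = {y, z, a, b, d}"

lemma card_R: "card R = 5" unfolding R_def using dis by simp

lemma card_centre: "card (centre y z a b d) = 10"
proof -
  have "y \<noteq> z" "y \<noteq> a" "y \<noteq> b" "y \<noteq> d" "z \<noteq> y" "a \<noteq> y" "b \<noteq> y" "d \<noteq> y"
    "z \<noteq> a" "z \<noteq> b" "z \<noteq> d" "a \<noteq> z" "b \<noteq> z" "d \<noteq> z" "a \<noteq> b" "b \<noteq> a" "a \<noteq> d" "d \<noteq> a" "b \<noteq> d" "d \<noteq> b"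
    using dis by auto
  then show ?thesis unfolding centre_def by simp
qed

lemma R_sub: "R \<subseteq> V" "R \<noteq> {}" "R \<noteq> V" "x \<in> V" "x \<notin> R" "finite R"
proof -
  have c: "(a, z) \<in> A" "(b, z) \<in> A" "(d, z) \<in> A" "(z, y) \<in> A" using CA unfolding centre_def by auto
  show "R \<subseteq> V" unfolding R_def using arc_verts[OF c(1)] arc_verts[OF c(2)] arc_verts[OF c(3)] arc_verts[OF c(4)] by simp
  have "(x, y) \<in> A" using i by auto
  then show xV: "x \<in> V" by (rule arc_verts)
  show xR': "x \<notin> R" using xR unfolding R_def .
  then show "R \<noteq> V" using xV by blast
  show "R \<noteq> {}" "finite R" unfolding R_def by auto
qed

lemma centre_R: "centre y z a b d \<subseteq> A \<inter> R \<times> R"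
  using CA unfolding centre_def R_def by simp

text \<open>One more arc would bring \<open>35 - 30 = 5\<close> down to \<open>2\<close>.\<close>

lemma exact: "A \<inter> R \<times> R = centre y z a b d"
proof (rule ccontr)
  assume "A \<inter> R \<times> R \<noteq> centre y z a b d"
  then have "card (centre y z a b d) < card (A \<inter> R \<times> R)"
    using centre_R fin(1) by (intro psubset_card_mono) auto
  then have "val R (A \<inter> R \<times> R) {} \<le> 2" unfolding val_def card_R card_centre by simp
  moreover have "4 \<le> val R (A \<inter> R \<times> R) {}"
    by (rule bound_proper[OF R_sub(1,2) subset_refl _ _ R_sub(3)]) auto
  ultimately show False by simp
qed

lemma val5: "val R (A \<inter> R \<times> R) {} = 5"
  unfolding exact val_def card_R card_centre by simp

lemma leave: obtains g where "(z, g) \<in> A" "g \<notin> R"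
proof -
  have "z \<in> V" using R_sub(1) by (auto simp: R_def)
  then have "2 \<le> card (outs A z)" by (rule critical_outdeg[OF crit])
  then obtain p q where pq: "p \<in> outs A z" "q \<in> outs A z" "p \<noteq> q" by (rule ex_two)
  obtain g where g: "(z, g) \<in> A" "g \<noteq> y" using pq by (cases "p = y") auto
  have "g \<notin> R"
  proof
    assume "g \<in> R"
    moreover have "z \<in> R" by (simp add: R_def)
    ultimately have "(z, g) \<in> centre y z a b d" unfolding exact[symmetric] using g by simp
    then show False using g(2) dis unfolding centre_def by auto
  qed
  then show thesis using that g by blast
qed

lemma yin: "(w, y) \<in> A \<Longrightarrow> w = x \<or> w = z"
  using i by blast

text \<open>Three arcs to a sixth vertex give \<open>42 - 39 = 3\<close>, which is allowed only for
  the whole vertex set, and that contains \<open>x\<close>.\<close>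

lemma add_vertex:
  assumes u: "u \<in> V" "u \<notin> R" and P: "P \<subseteq> A" "card P = 3" "P \<subseteq> R \<times> {u} \<union> {u} \<times> R"
  shows "u = x \<and> R \<union> {u} = V"
proof -
  let ?R = "R \<union> {u}" and ?C = "centre y z a b d \<union> P"
  have fP: "finite P" using P(2) card_ge_0_finite[of P] by simp
  have uc: "centre y z a b d \<inter> P = {}" using P(3) u(2) centre_R by blast
  have cC: "card ?C = 13"
    using card_Un_disjoint[OF _ fP uc] P(2) card_centre finite_subset[OF CA fin(1)] by simp
  have cR: "card ?R = 6" using u(2) R_sub(6) card_R by simp
  have RV: "?R \<subseteq> V" using R_sub(1) u by blast
  have CR: "?C \<subseteq> A \<inter> ?R \<times> ?R" using centre_R P by blast
  have "val ?R ?C {} = 3" unfolding val_def cC cR by simp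
  then have eq: "?R = V" using bound_proper[OF RV _ CR, of "{}"] by fastforce
  have "x \<in> R \<union> {u}" using eq R_sub(4) by simp
  then show ?thesis using eq R_sub(5) by simp
qed

text \<open>With \<open>x y\<close> these are three arcs, so \<open>V\<close> is \<open>R\<close>
  together with \<open>x\<close>. Then \<open>z\<close> must send an arc to \<open>x\<close>, and
  \<open>x y'\<close> is a further arc: \<open>42 - 45 = -3\<close>.\<close>

lemma not_two_x:
  assumes r: "r \<in> {a, b, d}" "r' \<in> {a, b, d}" "r \<noteq> r'" and arcs: "(r, x) \<in> A" "(r', x) \<in> A"
  shows False
proof -
  have xy: "(x, y) \<in> A" "(x, y') \<in> A" using o by auto
  have rR: "r \<in> R" "r' \<in> R" "y \<in> R" "z \<in> R" using r(1,2) by (auto simp: R_def)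
  let ?P = "{(r, x), (r', x), (x, y)}"
  have rx: "r \<noteq> x" "r' \<noteq> x" using R_sub(5) rR by auto
  have cP: "card ?P = 3" using r(3) rx by simp
  have eq: "R \<union> {x} = V"
    using add_vertex[OF R_sub(4,5), of ?P] arcs xy cP rR by simp
  obtain g where g: "(z, g) \<in> A" "g \<notin> R" by (rule leave)
  have gx: "g = x" using g arc_verts(2)[OF g(1)] eq by blast
  have zr: "z \<noteq> r" "z \<noteq> r'" using r dis by auto
  let ?Q = "{(z, x), (r, x), (r', x), (x, y), (x, y')}"
  have xne: "x \<noteq> z" "z \<noteq> x" "x \<noteq> y" "y \<noteq> x" "x \<noteq> r" "x \<noteq> r'" using R_sub(5) rR by auto
  have cQ: "card ?Q = 5" using r(3) rx zr o(2) xne by simp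
  have uc: "centre y z a b d \<inter> ?Q = {}" using R_sub(5) centre_R by auto
  have cC: "card (centre y z a b d \<union> ?Q) = 15"
    using card_Un_disjoint[OF _ _ uc] cQ card_centre finite_subset[OF CA fin(1)] by simp
  have cV: "card V = 6" using R_sub(5,6) card_R unfolding eq[symmetric] by simp
  have sub: "centre y z a b d \<union> ?Q \<subseteq> A \<inter> V \<times> V" using CA arcs xy g gx arc_verts by auto
  have "-1 \<le> val V (centre y z a b d \<union> ?Q) {}"
    by (rule bound[OF subset_refl _ sub]) (use R_sub(4) in auto)
  then show False unfolding val_def cC cV by simp
qed

lemma not_common:
  assumes r: "r \<in> {a, b, d}" "r' \<in> {a, b, d}" "r \<noteq> r'" and arcs: "(y, u) \<in> A" "(u, r) \<in> A" "(u, r') \<in> A"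
    and u: "u \<notin> R"
  shows False
proof -
  have rR: "r \<in> R" "r' \<in> R" "y \<in> R" using r(1,2) by (auto simp: R_def)
  have yr: "u \<noteq> y" "u \<noteq> r" "u \<noteq> r'" using u rR by auto
  let ?P = "{(y, u), (u, r), (u, r')}"
  have cP: "card ?P = 3" using r(3) yr by auto
  have "u = x" using add_vertex[OF arc_verts(2)[OF arcs(1)] u, of ?P] arcs cP rR by simp
  then show False using arcs(1) bad_simple(1)[OF o i] by simp
qed

text \<open>The class of \<open>y\<close> is \<open>{a, y}\<close>, so arcs at the contracted vertex
  \<open>a\<close> come from \<open>a\<close> or \<open>y\<close>. As \<open>R\<close> has potential
  \<open>5\<close>, the cost is at least \<open>-6\<close>. For an exceptional \<open>W\<close> this
  is tight enough that \<open>x y\<close> survives as \<open>x a\<close>, and symmetry returns an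
  arc \<open>a x\<close>. For a generic \<open>W\<close> it forces two distinct matching edges at
  the contracted vertices; the one at \<open>a\<close> goes to some \<open>u\<close>, and its two
  arcs lift to one of the alternatives or to a digon \<open>a u\<close>, whose edge could be kept
  and would give \<open>5 - 6 - 2 = -3\<close>.\<close>

lemma rim_vertex: "(a, x) \<in> A \<or> (\<exists>u. u \<notin> R \<and> (y, u) \<in> A \<and> (u, a) \<in> A)"
proof -
  define \<phi> where "\<phi> v = (v = a \<or> v = y)" for v
  have ne: "y \<noteq> z" "y \<noteq> a" "y \<noteq> b" "y \<noteq> d" "z \<noteq> y" "a \<noteq> y" "b \<noteq> y" "d \<noteq> y"
    "z \<noteq> a" "z \<noteq> b" "z \<noteq> d" "a \<noteq> z" "b \<noteq> z" "d \<noteq> z" "a \<noteq> b" "b \<noteq> a" "a \<noteq> d" "d \<noteq> a" "b \<noteq> d" "d \<noteq> b"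
    using dis by auto
  \<comment> \<open>Decreases along \<open>y a\<close> and along \<open>b d z\<close>, the arcs
    inside the two classes \<open>{a, y}\<close> and \<open>{z, b, d}\<close>.\<close>
  define h where "h v = (if v = y then 1 else if v = b then 2 else if v = d then 1 else (0::nat))" for v
  have \<phi>: "acyclic (monochrom \<phi> (A \<inter> R \<times> R))"
  proof (rule acyclic_rank[of _ h])
    fix u v assume "(u, v) \<in> monochrom \<phi> (A \<inter> R \<times> R)"
    then have "(u, v) \<in> centre y z a b d" "\<phi> u = \<phi> v" unfolding exact by (auto simp: monochrom_def)
    then show "h v < h u" using ne unfolding centre_def by (auto simp: \<phi>_def h_def)
  qed
  have azR: "a \<in> R" "z \<in> R" "y \<in> R" by (auto simp: R_def)
  interpret c: contraction A R \<phi> a z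
    by (rule contraction.intro[OF crit R_sub(1,3) azR(1,2) ne(12) \<phi>])
  obtain W where W: "W \<subseteq> c.B" "critical W" using c.ex_W by blast
  have f: "c.f v = (if v \<in> R then if \<phi> v then a else z else v)" for v
    by (simp add: c.f_def contr_def)
  have "card R \<le> card V" by (rule card_mono[OF fin(2) R_sub(1)])
  then have "card (Field W) < card V" using c.card_Field_W[OF W] card_R by linarith
  then have gW: "good W" using IH W(2) by blast
  have full: "R \<union> c.U W = V \<and> -6 \<le> c.cost W M'" if M': "matching W M'" "c.cost W M' \<le> -5" for M'
  proof -
    have e: "matching A ({} \<union> c.mU M')" "Field ({} \<union> c.mU M') \<subseteq> R \<union> c.U W" "R \<union> c.U W \<subseteq> V"
      "val (R \<union> c.U W) (A \<inter> (R \<union> c.U W) \<times> (R \<union> c.U W)) ({} \<union> c.mU M') = val R (A \<inter> R \<times> R) {} + c.cost W M'"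
      using c.extend[OF W matching_empty _ M'(1)] by simp_all
    have ne': "R \<union> c.U W \<noteq> {}" using azR by blast
    have "-1 \<le> val (R \<union> c.U W) (A \<inter> (R \<union> c.U W) \<times> (R \<union> c.U W)) ({} \<union> c.mU M')"
      by (rule bound[OF e(3) ne' subset_refl e(1,2)])
    moreover have "R \<union> c.U W = V"
    proof (rule ccontr)
      assume "R \<union> c.U W \<noteq> V"
      then have "4 \<le> val (R \<union> c.U W) (A \<inter> (R \<union> c.U W) \<times> (R \<union> c.U W)) ({} \<union> c.mU M')"
        by (rule bound_proper[OF e(3) ne' subset_refl e(1,2)])
      then show False using e(4) M'(2) val5 by linarith
    qed
    ultimately show ?thesis using e(4) val5 by linarith
  qed
  obtain M0 where M0: "matching W M0" "c.cost W M0 \<le> -5" by (rule c.cost_good[OF W gW])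
  have RU: "R \<union> c.U W = V" using full[OF M0] by blast
  have new_eq: "c.new (c.U W) = A - R \<times> R" unfolding c.new_def RU by (auto simp: Field_def)
  let ?\<delta> = "int (card (c.new (c.U W))) - int (card (W - c.X \<times> c.X))"
  obtain g where g: "(z, g) \<in> A" "g \<notin> R" by (rule leave)
  have xy: "(x, y) \<in> A" using i by auto
  have arcW: "(c.f p, c.f q) \<in> W" if d0: "?\<delta> \<le> 0" and pq: "(p, q) \<in> A" "\<not> (p \<in> R \<and> q \<in> R)" for p q
  proof -
    have "card (c.new (c.U W)) \<le> card (W - c.X \<times> c.X)" using d0 by simp
    then have "c.g ` c.new (c.U W) = W - c.X \<times> c.X" by (rule c.tight_new(2)[OF W])
    moreover have "(p, q) \<in> c.new (c.U W)" unfolding new_eq using pq by blast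
    then have "c.g (p, q) \<in> c.g ` c.new (c.U W)" by (rule imageI)
    ultimately have "c.g (p, q) \<in> W - c.X \<times> c.X" by simp
    then show ?thesis by (simp add: c.g_def)
  qed
  have xaW: "(x, a) \<in> W" "card (c.X \<inter> Field W) = 2" if d0: "?\<delta> \<le> 0"
  proof -
    have "(c.f x, c.f y) \<in> W" using arcW[OF d0 xy] R_sub(5) by blast
    then show xa: "(x, a) \<in> W" using f R_sub(5) azR by (simp add: \<phi>_def)
    have "(c.f z, c.f g) \<in> W" using arcW[OF d0 g(1)] g(2) by blast
    then have "(z, g) \<in> W" using f g(2) azR ne by (simp add: \<phi>_def)
    then have "c.X \<inter> Field W = {a, z}" using FieldI[OF xa] FieldI[of z g W] unfolding c.X_def by auto
    then show "card (c.X \<inter> Field W) = 2" using ne by simp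
  qed
  have up: "\<exists>p q. (p, q) \<in> A \<and> \<not> (p \<in> R \<and> q \<in> R) \<and> c.f p = s \<and> c.f q = t"
    if st: "(s, t) \<in> W" "s \<notin> c.X \<or> t \<notin> c.X" for s t
  proof -
    have "(s, t) \<in> W - c.X \<times> c.X" using st by blast
    then have "(s, t) \<in> c.g ` {e \<in> c.new (c.U W). c.g e \<in> W - c.X \<times> c.X}" using c.W_covered[OF W] by blast
    then obtain e where e: "e \<in> A - R \<times> R" "(s, t) = c.g e" unfolding new_eq by blast
    obtain p q where "e = (p, q)" by (cases e)
    then show ?thesis using e by (auto simp: c.g_def)
  qed
  have fa: "p = a \<or> p = y" if "c.f p = a" for p
    using that f[of p] ne azR by (auto simp: \<phi>_def split: if_splits)
  have fu: "p = u" if "c.f p = u" "u \<notin> R" for p u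
    using that f[of p] azR by (auto split: if_splits)
  note s = bad_simple[OF o i]
  have yx: "(y, x) \<notin> A" by (rule s(1))
  from gW show ?thesis
  proof (cases rule: good_cases)
    case (1 k)
    obtain M' where M': "matching W M'" "c.cost W M' \<le> -5"
      "k = 1 \<Longrightarrow> c.cost W M' \<le> -5 - 3 * ?\<delta>"
      "k = 1 \<Longrightarrow> \<not> ((a, z) \<in> W \<and> (z, a) \<in> W) \<Longrightarrow> c.cost W M' \<le> -6 - 3 * ?\<delta>"
      "k = -1 \<Longrightarrow> c.cost W M' \<le> -6 - 3 * ?\<delta>"
      "k = -1 \<Longrightarrow> card (c.X \<inter> Field W) = 2 \<Longrightarrow> c.cost W M' \<le> -7"
      "k = 1 \<Longrightarrow> card (c.X \<inter> Field W) = 2 \<Longrightarrow> \<not> ((a, z) \<in> W \<and> (z, a) \<in> W) \<Longrightarrow> c.cost W M' \<le> -7"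
      by (rule c.cost_special[OF W 1]) blast
    note lo = full[OF M'(1,2), THEN conjunct2]
    have ar: "-6 \<le> t \<Longrightarrow> t \<le> -5 - 3 * p \<Longrightarrow> p \<le> 0" "-6 \<le> t \<Longrightarrow> t \<le> -6 - 3 * p \<Longrightarrow> p \<le> 0" for t p :: int
      by simp_all
    have k: "k = 1 \<or> k = -1" by (rule special_kind[OF 1])
    have d0: "?\<delta> \<le> 0" using k ar(1)[OF lo M'(3)] ar(2)[OF lo M'(5)] by blast
    note xa = xaW[OF d0]
    have "k \<noteq> -1" using M'(6) xa(2) lo by linarith
    then have "k = 1" using k by blast
    then have "(a, x) \<in> W" using special_sym[of W x a] 1 xa by simp
    then obtain p q where pq: "(p, q) \<in> A" "c.f p = a" "c.f q = x"
      using up[of a x] R_sub(5) azR unfolding c.X_def by blast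
    have "q = x" by (rule fu[OF pq(3) R_sub(5)])
    then show ?thesis using fa[OF pq(2)] pq(1) yx by auto
  next
    case (2 M')
    have g2: "7 * int (card (Field W)) - 3 * int (card W) - 2 * int (card M') \<le> -2"
      using 2(2) unfolding val_def .
    note cg = c.cost_generic[OF W 2(1) g2]
    have d00: "0 \<le> ?\<delta>" using c.card_new[OF W] by simp
    have ar: "t \<le> -6 - 3 * p \<Longrightarrow> 0 \<le> p \<Longrightarrow> t \<le> -6" for t p :: int by simp
    have c6: "c.cost W M' \<le> -6" by (rule ar[OF cg(1) d00])
    then have c5: "c.cost W M' \<le> -5" by linarith
    note lo = full[OF 2(1) c5, THEN conjunct2]
    have nd: "\<not> card M' \<le> card (c.mU M') + 1" using cg(4) lo by linarith
    note m = c.mU[OF W 2(1)]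
    have "a \<in> Field M'" using m(6) nd by blast
    have nX: "\<not> ((a, z) \<in> M' \<or> (z, a) \<in> M')" using m(9) nd by blast
    obtain u where u: "(a, u) \<in> M' \<or> (u, a) \<in> M'" using \<open>a \<in> Field M'\<close> by (auto simp: Field_def)
    have uW: "(a, u) \<in> W" "(u, a) \<in> W" using u 2(1) unfolding matching_def by auto
    have uz: "u \<noteq> z" using u nX by blast
    have ua: "u \<noteq> a" using uW critical_irrefl[OF W(2)] by auto
    have uR: "u \<notin> R"
    proof -
      have "u \<in> c.U W" using FieldI(2)[OF uW(1)] uz ua unfolding c.U_def[OF W] c.X_def by simp
      then show ?thesis using c.U_sub[OF W] by blast
    qed
    have uX: "u \<notin> c.X" using uz ua unfolding c.X_def by simp
    obtain p where p: "(p, u) \<in> A" "p = a \<or> p = y"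
    proof -
      have "\<exists>p q. (p, q) \<in> A \<and> \<not> (p \<in> R \<and> q \<in> R) \<and> c.f p = a \<and> c.f q = u"
        by (rule up[OF uW(1)]) (simp add: uX)
      then obtain p v where pv: "(p, v) \<in> A" "c.f p = a" "c.f v = u" by blast
      have "v = u" by (rule fu[OF pv(3) uR])
      then show thesis using that pv(1) fa[OF pv(2)] by simp
    qed
    obtain q where q: "(u, q) \<in> A" "q = a \<or> q = y"
    proof -
      have "\<exists>p q. (p, q) \<in> A \<and> \<not> (p \<in> R \<and> q \<in> R) \<and> c.f p = u \<and> c.f q = a"
        by (rule up[OF uW(2)]) (simp add: uX)
      then obtain v q where pv: "(v, q) \<in> A" "c.f v = u" "c.f q = a" by blast
      have "v = u" by (rule fu[OF pv(2) uR])
      then show thesis using that pv(1) fa[OF pv(3)] by simp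
    qed
    show ?thesis
    proof (cases "q = y")
      case True
      then have "u = x" using yin[of u] q(1) uR azR by auto
      then show ?thesis using p yx by auto
    next
      case False
      then have qa: "(u, a) \<in> A" using q by auto
      show ?thesis
      proof (cases "p = y")
        case True
        then show ?thesis using p(1) qa uR by blast
      next
        case False
        then have pa: "(a, u) \<in> A" using p by auto
        have au: "a \<notin> Field (c.mU M')" "u \<notin> Field (c.mU M')"
        proof -
          show "a \<notin> Field (c.mU M')" using m(2) c.U_sub[OF W] azR by blast
          have mz: "matching W (mdel z M')" by (rule mdel_matching[OF 2(1)])
          have "(u, a) \<in> mdel z M' \<or> (a, u) \<in> mdel z M'" using u uz ne by (auto simp: mdel_def)
          then show "u \<notin> Field (c.mU M')" unfolding c.mU_def[OF W] by (rule mdel_partner[OF mz])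
        qed
        have m2: "matching A (insert (a, u) (c.mU M'))" by (rule matching_insert[OF m(1) pa qa au])
        have cm: "card (insert (a, u) (c.mU M')) = card (c.mU M') + 1"
          by (rule matching_insert_card[OF m(1,4) au(1)])
        have e4: "val (R \<union> c.U W) (A \<inter> (R \<union> c.U W) \<times> (R \<union> c.U W)) ({} \<union> c.mU M') = val R (A \<inter> R \<times> R) {} + c.cost W M'"
          using c.extend(4)[OF W matching_empty _ 2(1)] by simp
        have "-1 \<le> val V (A \<inter> V \<times> V) (insert (a, u) (c.mU M'))"
        proof (rule bound[OF subset_refl _ subset_refl m2])
          show "Field (insert (a, u) (c.mU M')) \<subseteq> V" using matching_Field[OF m2] .
        qed (use R_sub(4) in auto)
        moreover have "val V (A \<inter> V \<times> V) (insert (a, u) (c.mU M')) = val V (A \<inter> V \<times> V) (c.mU M') - 2"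
          unfolding val_def cm by simp
        ultimately have False using c6 e4 val5 unfolding RU by simp
        then show ?thesis ..
      qed
    qed
  qed
qed

end

context counterexample
begin

text \<open>By \<open>not_two_x\<close> at most one rim vertex has an arc to \<open>x\<close>. The
  other two are entered from out-neighbours of \<open>y\<close> outside \<open>R\<close>, distinct
  by \<open>not_common\<close>; with the rim this makes five.\<close>

lemma wheel_device_outdeg:
  assumes o: "outs A x = {y, y'}" "y \<noteq> y'" and i: "ins A y = {x, z}" "x \<noteq> z"
    and dev: "device A x y z (wheel3 z a b d) M" and dis: "distinct [z, a, b, d]"
  shows "5 \<le> card (outs A y)"
proof -
  let ?W = "wheel3 z a b d"
  note s = bad_simple[OF o i]
  note D = deviceD[OF dev i s(1,2)]
  have F: "Field ?W = {z, a, b, d}" unfolding wheel3_def Field_def by auto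
  have oz: "outs ?W z = {a, b, d}" by (rule wheel3_outs[OF dis])
  have ya: "(y, a) \<in> A" "(y, b) \<in> A" "(y, d) \<in> A" using D(7) unfolding oz by auto
  have az: "(a, z) \<in> A" "(b, z) \<in> A" "(d, z) \<in> A" using D(9) unfolding oz by auto
  have W0: "(a, b) \<in> ?W - {z} \<times> outs ?W z" "(b, d) \<in> ?W - {z} \<times> outs ?W z" "(d, a) \<in> ?W - {z} \<times> outs ?W z"
    using dis unfolding wheel3_def by auto
  have abd: "(a, b) \<in> A" "(b, d) \<in> A" "(d, a) \<in> A" using W0 D(6) by blast+
  have zy: "(z, y) \<in> A" using i by auto
  have xyn: "x \<notin> {z, a, b, d}" "y \<notin> {z, a, b, d}" using D(3,4) unfolding F .
  have xy: "x \<noteq> y" using i irr by auto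
  have CA: "centre y z a b d \<subseteq> A" unfolding centre_def using ya az abd zy by simp
  have CA': "centre y z b d a \<subseteq> A" "centre y z d a b \<subseteq> A"
    using CA centre_rotate[of y z a b d] centre_rotate[of y z d a b] by simp_all
  have ds: "distinct [y, z, a, b, d]" "distinct [y, z, b, d, a]" "distinct [y, z, d, a, b]"
    using dis xyn(2) by auto
  have xs: "x \<notin> {y, z, a, b, d}" "x \<notin> {y, z, b, d, a}" "x \<notin> {y, z, d, a, b}" using xyn xy by auto
  interpret wa: wheel_device A x y z y' a b d
    by (intro wheel_device.intro wheel_device_axioms.intro counterexample_axioms o i ds xs CA)
  interpret wb: wheel_device A x y z y' b d a
    by (intro wheel_device.intro wheel_device_axioms.intro counterexample_axioms o i ds xs CA')
  interpret wd: wheel_device A x y z y' d a b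
    by (intro wheel_device.intro wheel_device_axioms.intro counterexample_axioms o i ds xs CA')
  have Rb: "wb.R = wa.R" and Rd: "wd.R = wa.R" unfolding wa.R_def wb.R_def wd.R_def by auto
  define X where "X r \<longleftrightarrow> (r, x) \<in> A" for r
  have st: "X r \<or> (\<exists>u. u \<notin> wa.R \<and> (y, u) \<in> A \<and> (u, r) \<in> A)" if "r \<in> {a, b, d}" for r
    using that wa.rim_vertex wb.rim_vertex[unfolded Rb] wd.rim_vertex[unfolded Rd] unfolding X_def by blast
  have two: "\<exists>r r'. r \<in> {a, b, d} \<and> r' \<in> {a, b, d} \<and> r \<noteq> r' \<and> \<not> X r \<and> \<not> X r'"
  proof -
    have ne: "a \<noteq> b" "b \<noteq> d" "a \<noteq> d" using dis by auto
    have n: "\<not> (X a \<and> X b)" "\<not> (X b \<and> X d)" "\<not> (X a \<and> X d)"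
      using wa.not_two_x[of a b] wa.not_two_x[of b d] wa.not_two_x[of a d] ne unfolding X_def by blast+
    show ?thesis
    proof (cases "X a")
      case True
      then show ?thesis using n ne by blast
    next
      case False
      then show ?thesis using n ne by blast
    qed
  qed
  then obtain r r' where r: "r \<in> {a, b, d}" "r' \<in> {a, b, d}" "r \<noteq> r'" "\<not> X r" "\<not> X r'" by blast
  obtain u where u: "u \<notin> wa.R" "(y, u) \<in> A" "(u, r) \<in> A" using st r by blast
  obtain u' where u': "u' \<notin> wa.R" "(y, u') \<in> A" "(u', r') \<in> A" using st r by blast
  have uu: "u \<noteq> u'" using wa.not_common[OF r(1-3) u(2,3) _ u(1)] u'(3) by blast
  have "{a, b, d, u, u'} \<subseteq> outs A y" using ya u u' by auto
  moreover have "finite (outs A y)" using fin by auto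
  ultimately have "card {a, b, d, u, u'} \<le> card (outs A y)" by (rule card_mono[rotated])
  moreover have "card {a, b, d, u, u'} = 5" using dis uu u(1) u'(1) unfolding wa.R_def by auto
  ultimately show ?thesis by simp
qed

text \<open>A vertex of large degree that can be charged for \<open>y\<close>: its digon occupies an
  in-arc and an out-arc that no charge uses.\<close>

definition server :: "'a \<Rightarrow> 'a \<Rightarrow> 'a \<Rightarrow> bool"
  where "server y z w \<longleftrightarrow> (y, w) \<in> A \<and> (w, y) \<notin> A \<and> (w, z) \<in> A \<and> (z, w) \<notin> A \<and>
    card (outs A w) \<noteq> 2 \<and> card (ins A w) \<noteq> 2 \<and> (\<exists>w'. (w, w') \<in> A \<and> (w', w) \<in> A)"

text \<open>The second digon at \<open>w\<close> excludes degree two: by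
  \<open>out_digon_symmetric\<close> or \<open>in_digon_symmetric\<close> it would spread to the
  one-way arc \<open>w z\<close> or \<open>y w\<close>. If no such \<open>w\<close> exists, the
  device is a 3-wheel centred at \<open>z\<close>.\<close>

lemma device_server:
  assumes o: "outs A x = {y, y'}" "y \<noteq> y'" and i: "ins A y = {x, z}" "x \<noteq> z"
    and dev: "device A x y z W M"
  shows "5 \<le> card (outs A y) \<or>
    (\<exists>w w'. server y z w \<and> (z, w) \<in> W \<and> (w, w') \<in> W \<and> (w', w) \<in> W \<and> w' \<noteq> z \<and> (w, w') \<in> A \<and> (w', w) \<in> A)"
proof -
  note s = bad_simple[OF o i]
  note D = deviceD[OF dev i s(1,2)]
  obtain k where k: "special k W" using dev unfolding device_def by blast
  have dig: "(b, z) \<in> W" if "(z, b) \<in> W" for b using D(9) that by simp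
  from special_server[OF k D(2) dig] show ?thesis
  proof
    assume "\<exists>a b c. distinct [z, a, b, c] \<and> W = wheel3 z a b c"
    then obtain a b d where "distinct [z, a, b, d]" "W = wheel3 z a b d" by blast
    then show ?thesis using wheel_device_outdeg[OF o i, of a b d M] dev by simp
  next
    assume "\<exists>w w'. (z, w) \<in> W \<and> (w, z) \<in> W \<and> (w, w') \<in> W \<and> (w', w) \<in> W \<and> w' \<noteq> z"
    then obtain w w' where w: "(z, w) \<in> W" "(w, z) \<in> W" "(w, w') \<in> W" "(w', w) \<in> W" "w' \<noteq> z" by blast
    have wne: "w \<noteq> z" "w \<noteq> x" "w \<noteq> y" "w' \<noteq> y"
      using w critical_irrefl[OF D(1)] D(3,4) FieldI[OF w(1)] FieldI[OF w(3)] by auto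
    have yw: "(y, w) \<in> A" using D(7) w(1) by auto
    have wz: "(w, z) \<in> A" using D(9) w(1) by auto
    have ww: "(w, w') \<in> A" "(w', w) \<in> A" using D(6) w wne by auto
    have nwy: "(w, y) \<notin> A"
    proof
      assume "(w, y) \<in> A"
      then have "w \<in> ins A y" by simp
      then show False using i wne by auto
    qed
    have nzw: "(z, w) \<notin> A" using dev w(1) unfolding device_def by blast
    have "card (outs A w) \<noteq> 2"
    proof
      assume "card (outs A w) = 2"
      then obtain q where q: "q \<noteq> z" "outs A w = {z, q}" using card2_other[of "outs A w" z] wz by auto
      have "w' \<in> outs A w" using ww by simp
      then have "outs A w = {z, w'}" using q w(5) by auto
      then have "(z, w) \<in> A" by (rule out_digon_symmetric) (use w(5) ww in auto)
      then show False using nzw by simp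
    qed
    moreover have "card (ins A w) \<noteq> 2"
    proof
      assume "card (ins A w) = 2"
      then obtain q where q: "q \<noteq> y" "ins A w = {y, q}" using card2_other[of "ins A w" y] yw by auto
      have "w' \<in> ins A w" using ww by simp
      then have "ins A w = {y, w'}" using q wne by auto
      then have "(w, y) \<in> A" by (rule in_digon_symmetric) (use wne ww in auto)
      then show False using nwy by simp
    qed
    ultimately have "server y z w" unfolding server_def using yw wz nwy nzw ww by blast
    then show ?thesis using w ww by blast
  qed
qed

end

section \<open>Counting arcs\<close>

definition outdeg2 :: "('a \<times> 'a) set \<Rightarrow> 'a set"
  where "outdeg2 A = {v \<in> Field A. card (outs A v) = 2}"

definition bad :: "('a \<times> 'a) set \<Rightarrow> ('a \<times> 'a) set"
  where "bad A = A \<inter> outdeg2 A \<times> outdeg2 (A\<inverse>)"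

definition isolated_bad :: "('a \<times> 'a) set \<Rightarrow> ('a \<times> 'a) set"
  where "isolated_bad A = {(x, y) \<in> bad A. isolated_tail A x y}"

text \<open>A bad arc is charged to its tail if it is isolated and to its head otherwise. Both
  choices are injective, so bad arcs can be counted by vertices.\<close>

definition heads :: "('a \<times> 'a) set \<Rightarrow> 'a set"
  where "heads A = snd ` (bad A - isolated_bad A)"

definition tails :: "('a \<times> 'a) set \<Rightarrow> 'a set"
  where "tails A = fst ` isolated_bad A"

text \<open>The subtraction does not truncate for a critical digraph, where vertices outside
  \<open>outdeg2 A\<close> have out-degree at least three.\<close>

definition excess :: "('a \<times> 'a) set \<Rightarrow> nat"
  where "excess A = (\<Sum>v \<in> Field A - outdeg2 A. card (outs A v) - 3)"

definition rest :: "('a \<times> 'a) set \<Rightarrow> ('a \<times> 'a) set"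
  where "rest A = {(u, v) \<in> A. u \<notin> outdeg2 A \<and> v \<notin> outdeg2 (A\<inverse>)}"

definition bidirected2 :: "('a \<times> 'a) set \<Rightarrow> 'a set"
  where "bidirected2 A = {v \<in> outdeg2 A \<inter> outdeg2 (A\<inverse>). outs A v = ins A v}"

text \<open>The device is recorded together with its server, because its structure around
  \<open>w\<close> is needed again in \<open>star_contradiction\<close>.\<close>

definition dev_server :: "('a \<times> 'a) set \<Rightarrow> 'a \<Rightarrow> 'a \<Rightarrow> 'a \<Rightarrow> bool"
  where "dev_server A y z w \<longleftrightarrow> (\<exists>x y' W M w'. outs A x = {y, y'} \<and> y \<noteq> y' \<and> ins A y = {x, z} \<and> x \<noteq> z \<and>
    device A x y z W M \<and> counterexample.server A y z w \<and> (z, w) \<in> W \<and> (w, w') \<in> W \<and> (w', w) \<in> W \<and> w' \<noteq> z \<and>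
    (w, w') \<in> A \<and> (w', w) \<in> A)"

lemma bad_converse: "bad (A\<inverse>) = (bad A)\<inverse>"
  by (auto simp: bad_def)

lemma card_converse: "card (S\<inverse>) = card S"
  by (rule card_inverse)

context counterexample
begin

lemma outdeg2D: "v \<in> outdeg2 A \<Longrightarrow> card (outs A v) = 2" "v \<in> outdeg2 (A\<inverse>) \<Longrightarrow> card (ins A v) = 2"
  "v \<in> outdeg2 A \<Longrightarrow> v \<in> V" "v \<in> outdeg2 (A\<inverse>) \<Longrightarrow> v \<in> V"
  by (auto simp: outdeg2_def)

lemma outdeg2I: "v \<in> V \<Longrightarrow> card (outs A v) = 2 \<Longrightarrow> v \<in> outdeg2 A" "v \<in> V \<Longrightarrow> card (ins A v) = 2 \<Longrightarrow> v \<in> outdeg2 (A\<inverse>)"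
  by (auto simp: outdeg2_def)

lemma outdeg2_finite: "finite (outdeg2 A)" "finite (outdeg2 (A\<inverse>))"
  using fin(2) by (auto simp: outdeg2_def)

lemma deg3: "v \<in> V \<Longrightarrow> v \<notin> outdeg2 A \<Longrightarrow> 3 \<le> card (outs A v)" "v \<in> V \<Longrightarrow> v \<notin> outdeg2 (A\<inverse>) \<Longrightarrow> 3 \<le> card (ins A v)"
  using critical_outdeg[OF crit, of v] critical_indeg[OF crit, of v] outdeg2I[of v] by fastforce+

lemma badE:
  assumes "(x, y) \<in> bad A"
  obtains y' z where "outs A x = {y, y'}" "y \<noteq> y'" "ins A y = {x, z}" "x \<noteq> z"
proof -
  have xy: "(x, y) \<in> A" "x \<in> outdeg2 A" "y \<in> outdeg2 (A\<inverse>)" using assms by (auto simp: bad_def)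
  obtain y' where y': "y' \<noteq> y" "outs A x = {y, y'}"
    by (rule card2_other[OF outdeg2D(1)[OF xy(2)], of y]) (use xy in auto)
  obtain z where z: "z \<noteq> x" "ins A y = {x, z}"
    by (rule card2_other[OF outdeg2D(2)[OF xy(3)], of x]) (use xy in auto)
  show thesis using that[OF y'(2) _ z(2)] y'(1) z(1) by simp
qed

lemma bad_one_way: "(x, y) \<in> bad A \<Longrightarrow> (y, x) \<notin> A"
proof -
  assume "(x, y) \<in> bad A"
  then obtain y' z where h: "outs A x = {y, y'}" "y \<noteq> y'" "ins A y = {x, z}" "x \<noteq> z" by (rule badE)
  show ?thesis by (rule bad_simple(1)[OF h])
qed

lemma bad_finite: "finite (bad A)"
  using fin(1) by (simp add: bad_def)

lemma isolated_badD:
  assumes "(x, y) \<in> isolated_bad A"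
  shows "x \<in> outdeg2 A" "x \<in> outdeg2 (A\<inverse>)" "(x, y) \<in> A" "y \<in> outdeg2 (A\<inverse>)"
    "(e, x) \<in> A \<Longrightarrow> e \<notin> outdeg2 A" "(x, w) \<in> A \<Longrightarrow> w \<in> outdeg2 (A\<inverse>) \<Longrightarrow> w = y"
proof -
  have b: "(x, y) \<in> A" "x \<in> outdeg2 A" "y \<in> outdeg2 (A\<inverse>)" and isolated_tail: "isolated_tail A x y"
    using assms by (auto simp: isolated_bad_def bad_def)
  show "x \<in> outdeg2 A" "(x, y) \<in> A" "y \<in> outdeg2 (A\<inverse>)" by (fact b)+
  show "x \<in> outdeg2 (A\<inverse>)" by (rule outdeg2I(2)) (use isolated_tail b arc_verts in \<open>auto simp: isolated_tail_def\<close>)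
  show "e \<notin> outdeg2 A" if "(e, x) \<in> A" using isolated_tail that outdeg2D(1)[of e] unfolding isolated_tail_def by auto
  show "w = y" if "(x, w) \<in> A" "w \<in> outdeg2 (A\<inverse>)" using isolated_tail that outdeg2D(2)[of w] unfolding isolated_tail_def by auto
qed

lemma isolated_bad_subset: "isolated_bad A \<subseteq> bad A" by (auto simp: isolated_bad_def)

text \<open>Two such arcs into \<open>y\<close> would each carry a device, against
  \<open>no_two_devices\<close>.\<close>

lemma heads_inj: "inj_on snd (bad A - isolated_bad A)"
proof (rule inj_onI)
  fix e e' assume e: "e \<in> bad A - isolated_bad A" "e' \<in> bad A - isolated_bad A" "snd e = snd e'"
  obtain x y where xy: "e = (x, y)" by (cases e)
  obtain z where zy: "e' = (z, y)" using e(3) xy by (cases e') auto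
  have b: "(x, y) \<in> bad A" "(z, y) \<in> bad A" "\<not> isolated_tail A x y" "\<not> isolated_tail A z y" using e xy zy by (auto simp: isolated_bad_def)
  show "e = e'"
  proof (rule ccontr)
    assume "e \<noteq> e'"
    then have xz: "x \<noteq> z" using xy zy by simp
    obtain x' z0 where h: "outs A x = {y, x'}" "y \<noteq> x'" "ins A y = {x, z0}" "x \<noteq> z0" using b(1) by (rule badE)
    obtain z' x0 where h': "outs A z = {y, z'}" "y \<noteq> z'" "ins A y = {z, x0}" "z \<noteq> x0" using b(2) by (rule badE)
    have i: "ins A y = {x, z}" "ins A y = {z, x}" using h(3,4) h'(3,4) xz by auto
    obtain W1 M1 where d1: "device A x y z W1 M1" using bad_arc_cases[OF h(1,2) i(1) xz] b(3) by metis
    obtain W2 M2 where d2: "device A z y x W2 M2" using bad_arc_cases[OF h'(1,2) i(2) xz[symmetric]] b(4) by blast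
    show False by (rule no_two_devices[OF i(1) xz h(1,2) h'(1,2) d1 d2])
  qed
qed

lemma bad_card: "card (bad A) = card (tails A) + card (heads A)"
proof -
  have "inj_on fst (isolated_bad A)"
  proof (rule inj_onI)
    fix e e' assume e: "e \<in> isolated_bad A" "e' \<in> isolated_bad A" "fst e = fst e'"
    obtain x y where xy: "e = (x, y)" by (cases e)
    obtain y' where xy': "e' = (x, y')" using e(3) xy by (cases e') auto
    have o: "(x, y) \<in> isolated_bad A" "(x, y') \<in> isolated_bad A" using e xy xy' by auto
    have "y' = y" by (rule isolated_badD(6)[OF o(1) isolated_badD(3,4)[OF o(2)]])
    then show "e = e'" using xy xy' by simp
  qed
  then have "card (tails A) = card (isolated_bad A)" unfolding tails_def by (rule card_image)
  moreover have "card (heads A) = card (bad A - isolated_bad A)" unfolding heads_def by (rule card_image[OF heads_inj])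
  moreover have "card (bad A - isolated_bad A) = card (bad A) - card (isolated_bad A)"
    by (rule card_Diff_subset[OF finite_subset[OF isolated_bad_subset bad_finite] isolated_bad_subset])
  moreover have "card (isolated_bad A) \<le> card (bad A)" by (rule card_mono[OF bad_finite isolated_bad_subset])
  ultimately show ?thesis by simp
qed

lemma tailsE: assumes "x \<in> tails A" obtains y where "(x, y) \<in> isolated_bad A"
  using assms that unfolding tails_def by auto

lemma headsE: assumes "y \<in> heads A" obtains x where "(x, y) \<in> bad A" "\<not> isolated_tail A x y"
proof -
  obtain e where e: "e \<in> bad A - isolated_bad A" "y = snd e" using assms unfolding heads_def by blast
  obtain x where x: "e = (x, y)" using e(2) by (cases e) auto
  have "(x, y) \<in> bad A - isolated_bad A" using e(1) unfolding x .
  then show thesis using that[of x] by (simp add: isolated_bad_def)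
qed

lemma heads_outdeg2: "heads A \<subseteq> outdeg2 (A\<inverse>)"
  by (auto simp: heads_def bad_def)

lemma tails_outdeg2: "tails A \<subseteq> outdeg2 A \<inter> outdeg2 (A\<inverse>)"
  using isolated_badD(1,2) by (auto elim!: tailsE)

lemma tails_heads: "tails A \<inter> heads A = {}"
proof -
  have False if x: "x \<in> tails A" "x \<in> heads A" for x
  proof -
    obtain y where y: "(x, y) \<in> isolated_bad A" using x(1) by (rule tailsE)
    obtain u where u: "(u, x) \<in> bad A" using x(2) by (rule headsE)
    then show False using isolated_badD(5)[OF y, of u] by (auto simp: bad_def)
  qed
  then show ?thesis by blast
qed

text \<open>A tail isolated in both directions would have a bad out-arc and a bad in-arc, which
  isolation excludes.\<close>

lemma tails_tails: "tails A \<inter> tails (A\<inverse>) = {}"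
proof -
  have False if x: "x \<in> tails A" "x \<in> tails (A\<inverse>)" for x
  proof -
    obtain y where y: "(x, y) \<in> isolated_bad A" using x(1) by (rule tailsE)
    obtain u where u: "(x, u) \<in> isolated_bad (A\<inverse>)" using x(2) by (rule counterexample.tailsE[OF counterexample_converse])
    show False using counterexample.isolated_badD(5)[OF counterexample_converse u, of y] isolated_badD(3,4)[OF y] by simp
  qed
  then show ?thesis by blast
qed

lemma heads_cases:
  assumes "y \<in> heads A"
  shows "5 \<le> card (outs A y) \<or> (\<exists>z w. dev_server A y z w)"
proof -
  obtain x where b: "(x, y) \<in> bad A" "\<not> isolated_tail A x y" using assms by (rule headsE)
  obtain y' z where h: "outs A x = {y, y'}" "y \<noteq> y'" "ins A y = {x, z}" "x \<noteq> z" using b(1) by (rule badE)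
  obtain W M where d: "device A x y z W M" using bad_arc_cases[OF h] b(2) by blast
  from device_server[OF h d] show ?thesis
  proof
    assume "\<exists>w w'. server y z w \<and> (z, w) \<in> W \<and> (w, w') \<in> W \<and> (w', w) \<in> W \<and> w' \<noteq> z \<and> (w, w') \<in> A \<and> (w', w) \<in> A"
    then obtain w w' where "server y z w" "(z, w) \<in> W" "(w, w') \<in> W" "(w', w) \<in> W" "w' \<noteq> z" "(w, w') \<in> A" "(w', w) \<in> A"
      by blast
    then have "dev_server A y z w" unfolding dev_server_def using h d by blast
    then show ?thesis by blast
  qed simp
qed

lemma dev_serverD:
  assumes "dev_server A y z w"
  shows "(y, w) \<in> A" "(w, y) \<notin> A" "(w, z) \<in> A" "(z, w) \<notin> A" "w \<notin> outdeg2 A" "w \<notin> outdeg2 (A\<inverse>)" "w \<in> V"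
    "\<exists>w'. (w, w') \<in> A \<and> (w', w) \<in> A" "\<exists>x. ins A y = {x, z} \<and> x \<noteq> z \<and> x \<in> outdeg2 A"
proof -
  have s: "server y z w" using assms unfolding dev_server_def by blast
  show "(y, w) \<in> A" "(w, y) \<notin> A" "(w, z) \<in> A" "(z, w) \<notin> A" "\<exists>w'. (w, w') \<in> A \<and> (w', w) \<in> A"
    using s unfolding server_def by blast+
  show "w \<notin> outdeg2 A" "w \<notin> outdeg2 (A\<inverse>)" using s outdeg2D[of w] unfolding server_def by blast+
  show "w \<in> V" using s arc_verts unfolding server_def by blast
  obtain x y' where x: "outs A x = {y, y'}" "y \<noteq> y'" "ins A y = {x, z}" "x \<noteq> z"
    using assms unfolding dev_server_def by blast
  have "(x, y) \<in> A" using x(1) by auto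
  then have "x \<in> outdeg2 A" by (intro outdeg2I(1)) (use x arc_verts in auto)
  then show "\<exists>x. ins A y = {x, z} \<and> x \<noteq> z \<and> x \<in> outdeg2 A" using x by blast
qed

lemma card_out_arcs: "finite X \<Longrightarrow> card {(u, v) \<in> A. u \<in> X} = (\<Sum>v \<in> X. card (outs A v))"
proof -
  assume X: "finite X"
  have "{(u, v) \<in> A. u \<in> X} = Sigma X (\<lambda>v. outs A v)" by auto
  then show ?thesis using card_SigmaI[OF X, of "\<lambda>v. outs A v"] fin(1) by auto
qed

text \<open>Out-degrees are compared with three: vertices of out-degree two fall short by one, the
  others contribute to the excess.\<close>

lemma card_arcs: "card A + card (outdeg2 A) = 3 * card V + excess A"
proof -
  have "card A = card {(u, v) \<in> A. u \<in> V}" using arc_verts by (intro arg_cong[of _ _ card]) auto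
  also have "\<dots> = (\<Sum>v \<in> V. card (outs A v))" by (rule card_out_arcs[OF fin(2)])
  also have "\<dots> = (\<Sum>v \<in> V - outdeg2 A. card (outs A v)) + (\<Sum>v \<in> outdeg2 A. card (outs A v))"
    by (rule sum.subset_diff) (use fin outdeg2D in auto)
  also have "(\<Sum>v \<in> outdeg2 A. card (outs A v)) = 2 * card (outdeg2 A)" using outdeg2D(1) by simp
  also have "(\<Sum>v \<in> V - outdeg2 A. card (outs A v)) = (\<Sum>v \<in> V - outdeg2 A. (card (outs A v) - 3) + 3)"
    by (rule sum.cong[OF refl]) (use deg3(1) in auto)
  also have "\<dots> = excess A + 3 * card (V - outdeg2 A)" unfolding excess_def by (simp add: sum.distrib)
  finally have 1: "card A = excess A + 3 * card (V - outdeg2 A) + 2 * card (outdeg2 A)" .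
  have PV: "outdeg2 A \<subseteq> V" by (auto simp: outdeg2_def)
  have "card (V - outdeg2 A) + card (outdeg2 A) = card V"
    using card_Diff_subset[OF outdeg2_finite(1) PV] card_mono[OF fin(2) PV] by simp
  then show ?thesis using 1 by simp
qed

text \<open>The arcs leaving \<open>outdeg2 A\<close> and the arcs entering
  \<open>outdeg2 (A\<inverse>)\<close> overlap in the bad arcs and miss exactly
  \<open>rest A\<close>.\<close>

lemma card_arcs_split: "card A + card (bad A) = 2 * card (outdeg2 A) + 2 * card (outdeg2 (A\<inverse>)) + card (rest A)"
proof -
  define O1 where "O1 = {(u, v) \<in> A. u \<in> outdeg2 A}"
  define I1 where "I1 = {(u, v) \<in> A. v \<in> outdeg2 (A\<inverse>)}"
  have f: "finite O1" "finite I1" "finite (rest A)"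
    using fin(1) by (auto simp: O1_def I1_def rest_def intro: finite_subset[of _ A])
  have "card O1 = (\<Sum>v \<in> outdeg2 A. card (outs A v))" unfolding O1_def by (rule card_out_arcs[OF outdeg2_finite(1)])
  then have 1: "card O1 = 2 * card (outdeg2 A)" using outdeg2D(1) by simp
  have "I1\<inverse> = {(u, v) \<in> A\<inverse>. u \<in> outdeg2 (A\<inverse>)}" unfolding I1_def by auto
  then have "card (I1\<inverse>) = (\<Sum>v \<in> outdeg2 (A\<inverse>). card (ins A v))"
    using counterexample.card_out_arcs[OF counterexample_converse outdeg2_finite(2)] by simp
  then have 2: "card I1 = 2 * card (outdeg2 (A\<inverse>))" using outdeg2D(2) by (simp add: card_converse)
  have 3: "card (O1 \<union> I1) + card (O1 \<inter> I1) = card O1 + card I1" using card_Un_Int[OF f(1,2)] by simp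
  have 4: "O1 \<inter> I1 = bad A" unfolding O1_def I1_def bad_def by auto
  have eq: "A = (O1 \<union> I1) \<union> rest A" unfolding O1_def I1_def rest_def by auto
  have "card ((O1 \<union> I1) \<union> rest A) = card (O1 \<union> I1) + card (rest A)"
    by (rule card_Un_disjoint) (use f in \<open>auto simp: O1_def I1_def rest_def\<close>)
  then have "card A = card (O1 \<union> I1) + card (rest A)" using eq by simp
  then show ?thesis using 1 2 3 4 by simp
qed

lemma digon_in_S:
  assumes c: "c \<in> outdeg2 A" "c \<in> outdeg2 (A\<inverse>)" and d: "(w, c) \<in> A" "(c, w) \<in> A"
  shows "c \<in> bidirected2 A"
proof -
  obtain p where p: "p \<noteq> w" "outs A c = {w, p}" by (rule card2_other[OF outdeg2D(1)[OF c(1)], of w]) (use d in auto)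
  obtain q where q: "q \<noteq> w" "ins A c = {w, q}" by (rule card2_other[OF outdeg2D(2)[OF c(2)], of w]) (use d in auto)
  have "q = p" using no_single_digon_vertex[OF p(2) q(2)] p(1) q(1) by auto
  then show ?thesis using c p q unfolding bidirected2_def by simp
qed

lemma bidirected2_not_bad:
  assumes "c \<in> bidirected2 A" shows "(c, y) \<notin> bad A" "(y, c) \<notin> bad A"
proof -
  have e: "outs A c = ins A c" using assms by (simp add: bidirected2_def)
  show "(c, y) \<notin> bad A"
  proof
    assume b: "(c, y) \<in> bad A"
    then have "y \<in> outs A c" by (auto simp: bad_def)
    then show False using bad_one_way[OF b] e by auto
  qed
  show "(y, c) \<notin> bad A"
  proof
    assume b: "(y, c) \<in> bad A"
    then have "y \<in> ins A c" by (auto simp: bad_def)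
    then have "y \<in> outs A c" using e by simp
    then show False using bad_one_way[OF b] by auto
  qed
qed

end

section \<open>Charging bad arcs to servers\<close>

lemma sum_fibres:
  assumes "finite X" "finite Z" "h ` X \<subseteq> Z"
  shows "(\<Sum>w \<in> Z. card {x \<in> X. h x = w}) = card X"
  using sum.group[OF assms, of "\<lambda>_. 1 :: nat"] by simp

context counterexample
begin

lemma server_choice:
  obtains z w where "\<And>y. y \<in> heads A \<Longrightarrow> \<not> 5 \<le> card (outs A y) \<Longrightarrow> dev_server A y (z y) (w y)"
proof -
  have "\<forall>y. \<exists>zw. y \<in> heads A \<longrightarrow> \<not> 5 \<le> card (outs A y) \<longrightarrow> dev_server A y (fst zw) (snd zw)"
    using heads_cases by (metis fst_conv snd_conv)
  then obtain zw where "\<forall>y. y \<in> heads A \<longrightarrow> \<not> 5 \<le> card (outs A y) \<longrightarrow> dev_server A y (fst (zw y)) (snd (zw y))"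
    by metis
  then show thesis using that[of "\<lambda>y. fst (zw y)" "\<lambda>y. snd (zw y)"] by blast
qed

lemma excess_ge:
  assumes "Y5 \<subseteq> V" "Zs \<subseteq> V" "\<And>y. y \<in> Y5 \<Longrightarrow> 5 \<le> card (outs A y)" "\<And>w. w \<in> Zs \<Longrightarrow> w \<notin> outdeg2 A" "Y5 \<inter> Zs = {}"
  shows "card Y5 + (\<Sum>w \<in> Zs. card (outs A w) - 3) \<le> excess A"
proof -
  have fin': "finite Y5" "finite Zs" using assms(1,2) fin(2) finite_subset by metis+
  have YV: "Y5 \<subseteq> V - outdeg2 A"
  proof
    fix y assume y: "y \<in> Y5"
    have "y \<notin> outdeg2 A" using assms(3)[OF y] outdeg2D(1)[of y] by auto
    then show "y \<in> V - outdeg2 A" using y assms(1) by blast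
  qed
  have "card Y5 = (\<Sum>y \<in> Y5. 1)" by simp
  also have "\<dots> \<le> (\<Sum>y \<in> Y5. card (outs A y) - 3)"
    by (rule sum_mono) (use assms(3) in fastforce)
  finally have "card Y5 + (\<Sum>w \<in> Zs. card (outs A w) - 3) \<le> (\<Sum>w \<in> Y5 \<union> Zs. card (outs A w) - 3)"
    using sum.union_disjoint[OF fin' assms(5), of "\<lambda>w. card (outs A w) - 3"] by simp
  also have "\<dots> \<le> excess A"
    unfolding excess_def by (rule sum_mono2) (use fin YV assms(2,4) in auto)
  finally show ?thesis .
qed

text \<open>The digon partner \<open>w'\<close> takes an in-arc and an out-arc that are not charged.
  If some \<open>y\<close> is charged, the out-arc to \<open>z y\<close> is another uncharged one,
  because \<open>z y\<close> is not of out-degree two; dually for \<open>Xw\<close>. Where a side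
  has no charge, degree three supplies the missing units.\<close>

lemma server_slots:
  assumes w: "w \<in> V" "w \<notin> outdeg2 A" "w \<notin> outdeg2 (A\<inverse>)" and dig: "(w, w') \<in> A" "(w', w) \<in> A"
    and Y: "\<And>y. y \<in> Yw \<Longrightarrow> (y, w) \<in> A \<and> (w, y) \<notin> A \<and> y \<in> outdeg2 (A\<inverse>)"
      "\<And>y. y \<in> Yw \<Longrightarrow> (w, z y) \<in> A \<and> (z y, w) \<notin> A \<and> z y \<notin> outdeg2 A"
    and X: "\<And>x. x \<in> Xw \<Longrightarrow> (w, x) \<in> A \<and> (x, w) \<notin> A \<and> x \<in> outdeg2 A"
      "\<And>x. x \<in> Xw \<Longrightarrow> (z' x, w) \<in> A \<and> (w, z' x) \<notin> A \<and> z' x \<notin> outdeg2 (A\<inverse>)"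
  shows "card Yw + card Xw + 4 \<le> card (outs A w) + card (ins A w)"
proof -
  have f: "finite (outs A w)" "finite (ins A w)" using fin(1) by auto
  have Xs: "Xw \<subseteq> outs A w" and Ys: "Yw \<subseteq> ins A w" using X(1) Y(1) by auto
  have fX: "finite Xw" "finite Yw" using Xs Ys f finite_subset by metis+
  have w'X: "w' \<notin> Xw" and w'Y: "w' \<notin> Yw" using X(1) Y(1) dig by blast+
  have o1: "card Xw + 1 \<le> card (outs A w)"
    using card_mono[OF f(1), of "insert w' Xw"] Xs dig w'X fX by simp
  have i1: "card Yw + 1 \<le> card (ins A w)"
    using card_mono[OF f(2), of "insert w' Yw"] Ys dig w'Y fX by simp
  have o2: "card Xw + 2 \<le> card (outs A w)" if ne: "Yw \<noteq> {}"
  proof -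
    obtain y where y: "y \<in> Yw" using ne by blast
    have n: "z y \<notin> insert w' Xw" using Y(2)[OF y] X(1) dig by blast
    have "insert (z y) (insert w' Xw) \<subseteq> outs A w" using Y(2)[OF y] Xs dig by auto
    then have "card (insert (z y) (insert w' Xw)) \<le> card (outs A w)" by (rule card_mono[OF f(1)])
    then show ?thesis using n w'X fX by simp
  qed
  have i2: "card Yw + 2 \<le> card (ins A w)" if ne: "Xw \<noteq> {}"
  proof -
    obtain x where x: "x \<in> Xw" using ne by blast
    have n: "z' x \<notin> insert w' Yw" using X(2)[OF x] Y(1) dig by blast
    have "insert (z' x) (insert w' Yw) \<subseteq> ins A w" using X(2)[OF x] Ys dig by auto
    then have "card (insert (z' x) (insert w' Yw)) \<le> card (ins A w)" by (rule card_mono[OF f(2)])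
    then show ?thesis using n w'Y fX by simp
  qed
  have d: "3 \<le> card (outs A w)" "3 \<le> card (ins A w)" using deg3 w by blast+
  show ?thesis
  proof (cases "Yw = {}")
    case True
    then show ?thesis using i2 o1 d by (cases "Xw = {}") auto
  next
    case False
    then show ?thesis using o2 i2 i1 d by (cases "Xw = {}") auto
  qed
qed

text \<open>A bad arc is counted once at its tail and once at its head. Isolated ends and ends of degree two with no
  other charge pay for themselves; an end with five or more arcs pays by its excess, an end of degree three or
  four on that side by the arc joining it to its server, and the remaining ends are paid for by the degree of
  their servers, whose digons in turn use arcs counted by \<open>rest\<close>, unless they lead to bidirected vertices.\<close>

lemma counting:
  "\<exists>Z c. finite Z \<and>
    2 * card (bad A) + card (c ` Z) \<le> card (outdeg2 A \<inter> outdeg2 (A\<inverse>)) + excess A + excess (A\<inverse>) + 2 * card (rest A) + 2 * card Z \<and>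
    (\<forall>w \<in> Z. c w \<in> bidirected2 A \<and> (w, c w) \<in> A \<and> (c w, w) \<in> A \<and> w \<notin> outdeg2 A \<and>
      ((\<exists>y z. y \<in> outdeg2 A \<and> dev_server A y z w) \<or> (\<exists>x z. x \<in> outdeg2 (A\<inverse>) \<and> dev_server (A\<inverse>) x z w)))"
proof -
  note conv = counterexample_converse
  have AA: "(A\<inverse>)\<inverse> = A" by simp
  define P Q where "P = outdeg2 A" and "Q = outdeg2 (A\<inverse>)"
  define Y X where "Y = heads A" and "X = heads (A\<inverse>)"
  define T1 T2 where "T1 = tails A" and "T2 = tails (A\<inverse>)"
  define S where "S = P \<inter> Q"
  obtain z1 w1 where "\<And>y. y \<in> heads A \<Longrightarrow> \<not> 5 \<le> card (outs A y) \<Longrightarrow> dev_server A y (z1 y) (w1 y)"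
    using server_choice by metis
  then have s1: "dev_server A y (z1 y) (w1 y)" if "y \<in> Y" "\<not> 5 \<le> card (outs A y)" for y using that by (simp add: Y_def)
  obtain z2 w2 where "\<And>y. y \<in> heads (A\<inverse>) \<Longrightarrow> \<not> 5 \<le> card (outs (A\<inverse>) y) \<Longrightarrow> dev_server (A\<inverse>) y (z2 y) (w2 y)"
    using counterexample.server_choice[OF conv] by metis
  then have s2: "dev_server (A\<inverse>) x (z2 x) (w2 x)" if "x \<in> X" "\<not> 5 \<le> card (ins A x)" for x using that by (simp add: X_def)
  have d1: "(y, w1 y) \<in> A" "(w1 y, y) \<notin> A" "(w1 y, z1 y) \<in> A" "(z1 y, w1 y) \<notin> A" "w1 y \<notin> P" "w1 y \<notin> Q" "w1 y \<in> V"
    "\<exists>w'. (w1 y, w') \<in> A \<and> (w', w1 y) \<in> A" "\<exists>x. ins A y = {x, z1 y} \<and> x \<noteq> z1 y \<and> x \<in> P"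
    if "y \<in> Y" "\<not> 5 \<le> card (outs A y)" for y
    using dev_serverD[OF s1[OF that]] unfolding P_def Q_def by blast+
  have d2: "(w2 x, x) \<in> A" "(x, w2 x) \<notin> A" "(z2 x, w2 x) \<in> A" "(w2 x, z2 x) \<notin> A" "w2 x \<notin> P" "w2 x \<notin> Q" "w2 x \<in> V"
    "\<exists>w'. (w2 x, w') \<in> A \<and> (w', w2 x) \<in> A" "\<exists>y. outs A x = {y, z2 x} \<and> y \<noteq> z2 x \<and> y \<in> Q"
    if "x \<in> X" "\<not> 5 \<le> card (ins A x)" for x
    using counterexample.dev_serverD[OF conv s2[OF that]] unfolding P_def Q_def AA Field_converse' by blast+
  have YQ: "Y \<subseteq> Q" unfolding Y_def Q_def by (rule heads_outdeg2)
  have XP: "X \<subseteq> P" unfolding X_def P_def using counterexample.heads_outdeg2[OF conv] unfolding AA .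
  have TS: "T1 \<subseteq> S" "T2 \<subseteq> S"
    using tails_outdeg2 counterexample.tails_outdeg2[OF conv] unfolding T1_def T2_def S_def P_def Q_def AA by blast+
  have TY: "T1 \<inter> Y = {}" "T2 \<inter> X = {}" "T1 \<inter> T2 = {}"
    using tails_heads counterexample.tails_heads[OF conv] tails_tails unfolding T1_def T2_def Y_def X_def by blast+
  have PQV: "P \<subseteq> V" "Q \<subseteq> V" unfolding P_def Q_def by (auto simp: outdeg2_def)
  have finP: "finite P" "finite Q" unfolding P_def Q_def by (rule outdeg2_finite)+
  have finYX: "finite Y" "finite X" "finite T1" "finite T2" "finite S"
    using finite_subset[OF YQ finP(2)] finite_subset[OF XP finP(1)] finP TS finite_subset[of _ S] unfolding S_def by auto
  have B1: "card (bad A) = card T1 + card Y" unfolding T1_def Y_def by (rule bad_card)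
  have B2: "card (bad A) = card T2 + card X"
    using counterexample.bad_card[OF conv] unfolding T2_def X_def bad_converse card_converse by simp
  have P2o: "card (outs A v) = 2" if "v \<in> P" for v using that outdeg2D unfolding P_def by blast
  have Q2i: "card (ins A v) = 2" if "v \<in> Q" for v using that outdeg2D unfolding Q_def by blast
  define G where "G = T1 \<union> T2"
  \<comment> \<open>\<open>Ya\<close> and \<open>Xa\<close> are the ends of degree two that already
    carry another charge and need a server. A vertex in both \<open>X\<close> and \<open>Y\<close>
    may pay for itself only once, which is why membership in \<open>Y\<close> occurs in
    \<open>Xa\<close>.\<close>
  define Ya where "Ya = {y \<in> Y. y \<in> P \<and> y \<in> G}"
  define Y0 where "Y0 = {y \<in> Y. y \<in> P \<and> y \<notin> G}"
  define Y5 where "Y5 = {y \<in> Y. 5 \<le> card (outs A y)}"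
  define Yb where "Yb = {y \<in> Y. y \<notin> P \<and> \<not> 5 \<le> card (outs A y)}"
  define Xa where "Xa = {x \<in> X. x \<in> Q \<and> (x \<in> G \<or> x \<in> Y)}"
  define X0 where "X0 = {x \<in> X. x \<in> Q \<and> x \<notin> G \<and> x \<notin> Y}"
  define X5 where "X5 = {x \<in> X. 5 \<le> card (ins A x)}"
  define Xb where "Xb = {x \<in> X. x \<notin> Q \<and> \<not> 5 \<le> card (ins A x)}"
  have finYs: "finite Ya" "finite Y0" "finite Y5" "finite Yb" "finite Xa" "finite X0" "finite X5" "finite Xb"
    unfolding Ya_def Y0_def Y5_def Yb_def Xa_def X0_def X5_def Xb_def using finYX by simp_all
  have cY: "card Y \<le> card Ya + card Y0 + card Y5 + card Yb"
  proof -
    have "Y \<subseteq> ((Ya \<union> Y0) \<union> Y5) \<union> Yb" unfolding Ya_def Y0_def Y5_def Yb_def by blast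
    then have "card Y \<le> card (((Ya \<union> Y0) \<union> Y5) \<union> Yb)" by (rule card_mono[rotated]) (use finYs in simp)
    also have "\<dots> \<le> card Ya + card Y0 + card Y5 + card Yb"
      using card_Un_le[of "(Ya \<union> Y0) \<union> Y5" Yb] card_Un_le[of "Ya \<union> Y0" Y5] card_Un_le[of Ya Y0] by linarith
    finally show ?thesis .
  qed
  have cX: "card X \<le> card Xa + card X0 + card X5 + card Xb"
  proof -
    have "X \<subseteq> ((Xa \<union> X0) \<union> X5) \<union> Xb" unfolding Xa_def X0_def X5_def Xb_def by blast
    then have "card X \<le> card (((Xa \<union> X0) \<union> X5) \<union> Xb)" by (rule card_mono[rotated]) (use finYs in simp)
    also have "\<dots> \<le> card Xa + card X0 + card X5 + card Xb"
      using card_Un_le[of "(Xa \<union> X0) \<union> X5" Xb] card_Un_le[of "Xa \<union> X0" X5] card_Un_le[of Xa X0] by linarith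
    finally show ?thesis .
  qed
  have Yn5: "\<not> 5 \<le> card (outs A y)" if "y \<in> P" for y using P2o[OF that] by simp
  have Xn5: "\<not> 5 \<le> card (ins A x)" if "x \<in> Q" for x using Q2i[OF that] by simp
  have Ya: "y \<in> Y" "y \<in> P" "y \<in> G" "\<not> 5 \<le> card (outs A y)" "y \<in> Q" if "y \<in> Ya" for y
    using that Yn5[of y] YQ unfolding Ya_def by auto
  have Xa: "x \<in> X" "x \<in> Q" "x \<in> G \<or> x \<in> Y" "\<not> 5 \<le> card (ins A x)" "x \<in> P" if "x \<in> Xa" for x
    using that Xn5[of x] XP unfolding Xa_def by auto
  define V2 where "V2 = bidirected2 A"
  have V2S: "V2 \<subseteq> S" unfolding V2_def S_def P_def Q_def bidirected2_def by blast
  have V2d: "V2 \<inter> (G \<union> Y \<union> X) = {}"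
  proof -
    have False if v: "v \<in> V2" "v \<in> G \<union> Y \<union> X" for v
    proof -
      have nb: "(v, u) \<notin> bad A" "(u, v) \<notin> bad A" for u
        using bidirected2_not_bad[of v u] v(1) unfolding V2_def by auto
      consider "v \<in> T1" | "v \<in> T2" | "v \<in> Y" | "v \<in> X" using v(2) unfolding G_def by blast
      then show False
      proof cases
        case 1
        then obtain u where "(v, u) \<in> isolated_bad A" unfolding T1_def by (rule tailsE)
        then show False using isolated_bad_subset nb by blast
      next
        case 2
        then obtain u where "(v, u) \<in> isolated_bad (A\<inverse>)" unfolding T2_def by (rule counterexample.tailsE[OF conv])
        then have "(v, u) \<in> bad (A\<inverse>)" using counterexample.isolated_bad_subset[OF conv] by blast
        then show False using nb unfolding bad_converse by simp
      next
        case 3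
        then obtain u where "(u, v) \<in> bad A" unfolding Y_def by (rule headsE)
        then show False using nb by blast
      next
        case 4
        then obtain u where "(u, v) \<in> bad (A\<inverse>)" unfolding X_def by (rule counterexample.headsE[OF conv])
        then show False using nb unfolding bad_converse by simp
      qed
    qed
    then show ?thesis by blast
  qed
  have A1: "card T1 + card T2 + card Y0 + card X0 + card V2 \<le> card S"
  proof -
    have fV2: "finite V2" by (rule finite_subset[OF V2S finYX(5)])
    have "card (T1 \<union> T2) = card T1 + card T2" by (rule card_Un_disjoint[OF finYX(3,4) TY(3)])
    moreover have "card ((T1 \<union> T2) \<union> Y0) = card (T1 \<union> T2) + card Y0"
      by (rule card_Un_disjoint) (use finYX finYs in \<open>auto simp: Y0_def G_def\<close>)
    moreover have "card (((T1 \<union> T2) \<union> Y0) \<union> X0) = card ((T1 \<union> T2) \<union> Y0) + card X0"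
      by (rule card_Un_disjoint) (use finYX finYs in \<open>auto simp: Y0_def X0_def G_def\<close>)
    moreover have "card ((((T1 \<union> T2) \<union> Y0) \<union> X0) \<union> V2) = card (((T1 \<union> T2) \<union> Y0) \<union> X0) + card V2"
    proof (rule card_Un_disjoint)
      show "(((T1 \<union> T2) \<union> Y0) \<union> X0) \<inter> V2 = {}" using V2d unfolding Y0_def X0_def G_def by blast
    qed (use finYX finYs fV2 in auto)
    moreover have "card ((((T1 \<union> T2) \<union> Y0) \<union> X0) \<union> V2) \<le> card S"
    proof (rule card_mono[OF finYX(5)])
      have "Y0 \<subseteq> S" "X0 \<subseteq> S" using YQ XP unfolding Y0_def X0_def S_def by auto
      then show "(((T1 \<union> T2) \<union> Y0) \<union> X0) \<union> V2 \<subseteq> S" using TS V2S by blast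
    qed
    ultimately show ?thesis by linarith
  qed
  \<comment> \<open>Such a \<open>y\<close> is an isolated tail in the converse, so only one of its
    in-neighbours has out-degree two, and that is the tail of the bad arc.\<close>
  have zP: "z1 y \<notin> P" if y: "y \<in> Ya" for y
  proof
    assume zy: "z1 y \<in> P"
    have "y \<in> T2" using Ya(1,3)[OF y] TY(1) unfolding G_def by blast
    then obtain u where u: "(y, u) \<in> isolated_bad (A\<inverse>)" unfolding T2_def by (rule counterexample.tailsE[OF conv])
    obtain x where x: "ins A y = {x, z1 y}" "x \<noteq> z1 y" "x \<in> P" using d1(9)[OF Ya(1,4)[OF y]] by blast
    have e: "(y, x) \<in> A\<inverse>" "(y, z1 y) \<in> A\<inverse>" using x(1) by blast+
    have "x = u" by (rule counterexample.isolated_badD(6)[OF conv u e(1)]) (use x(3) in \<open>simp add: P_def\<close>)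
    moreover have "z1 y = u" by (rule counterexample.isolated_badD(6)[OF conv u e(2)]) (use zy in \<open>simp add: P_def\<close>)
    ultimately show False using x(2) by simp
  qed
  \<comment> \<open>Dually if \<open>x\<close> is an isolated tail. If \<open>x\<close> is charged
    as a head instead, one of its two out-neighbours is the server \<open>w1 x\<close>, which has
    in-degree at least three; as \<open>y\<close> has in-degree two, the server is
    \<open>z2 x\<close>.\<close>
  have zQ: "z2 x \<notin> Q" if x: "x \<in> Xa" for x
  proof
    assume zx: "z2 x \<in> Q"
    obtain y where y: "outs A x = {y, z2 x}" "y \<noteq> z2 x" "y \<in> Q" using d2(9)[OF Xa(1,4)[OF x]] by blast
    have e: "(x, y) \<in> A" "(x, z2 x) \<in> A" using y(1) by blast+
    show False
    proof (cases "x \<in> G")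
      case True
      then have "x \<in> T1" using Xa(1)[OF x] TY(2) unfolding G_def by blast
      then obtain u where u: "(x, u) \<in> isolated_bad A" unfolding T1_def by (rule tailsE)
      have "y = u" by (rule isolated_badD(6)[OF u e(1)]) (use y(3) in \<open>simp add: Q_def\<close>)
      moreover have "z2 x = u" by (rule isolated_badD(6)[OF u e(2)]) (use zx in \<open>simp add: Q_def\<close>)
      ultimately show False using y(2) by simp
    next
      case False
      then have xY: "x \<in> Y" using Xa(3)[OF x] by blast
      have n5: "\<not> 5 \<le> card (outs A x)" by (rule Yn5[OF Xa(5)[OF x]])
      have "w1 x \<in> outs A x" using d1(1)[OF xY n5] by simp
      then have "w1 x \<in> Q" using y zx by auto
      then show False using d1(6)[OF xY n5] by simp
    qed
  qed
  define Zs where "Zs = w1 ` Ya \<union> w2 ` Xa"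
  have finZs: "finite Zs" unfolding Zs_def using finYs by simp
  have Zs: "w \<in> V \<and> w \<notin> P \<and> w \<notin> Q \<and> (\<exists>w'. (w, w') \<in> A \<and> (w', w) \<in> A)" if w: "w \<in> Zs" for w
  proof -
    consider y where "y \<in> Ya" "w = w1 y" | x where "x \<in> Xa" "w = w2 x" using w unfolding Zs_def by blast
    then show ?thesis
    proof cases
      case 1
      then show ?thesis using d1(5-8)[OF Ya(1,4)[OF 1(1)]] by blast
    next
      case 2
      then show ?thesis using d2(5-8)[OF Xa(1,4)[OF 2(1)]] by blast
    qed
  qed
  have slots: "card {y \<in> Ya. w1 y = w} + card {x \<in> Xa. w2 x = w} + 4 \<le> card (outs A w) + card (ins A w)"
    if w: "w \<in> Zs" for w
  proof -
    obtain w' where w': "(w, w') \<in> A" "(w', w) \<in> A" using Zs[OF w] by blast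
    have wPQ: "w \<in> V" "w \<notin> outdeg2 A" "w \<notin> outdeg2 (A\<inverse>)" using Zs[OF w] unfolding P_def Q_def by blast+
    show ?thesis
    proof (rule server_slots[OF wPQ w', of _ z1 _ z2])
      fix y assume "y \<in> {y \<in> Ya. w1 y = w}"
      then have y: "y \<in> Ya" "w1 y = w" by auto
      note d = d1[OF Ya(1,4)[OF y(1)]]
      show "(y, w) \<in> A \<and> (w, y) \<notin> A \<and> y \<in> outdeg2 (A\<inverse>)" using d(1,2) Ya(5)[OF y(1)] y(2) unfolding Q_def by simp
      show "(w, z1 y) \<in> A \<and> (z1 y, w) \<notin> A \<and> z1 y \<notin> outdeg2 A" using d(3,4) zP[OF y(1)] y(2) unfolding P_def by simp
    next
      fix x assume "x \<in> {x \<in> Xa. w2 x = w}"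
      then have x: "x \<in> Xa" "w2 x = w" by auto
      note d = d2[OF Xa(1,4)[OF x(1)]]
      show "(w, x) \<in> A \<and> (x, w) \<notin> A \<and> x \<in> outdeg2 A" using d(1,2) Xa(5)[OF x(1)] x(2) unfolding P_def by simp
      show "(z2 x, w) \<in> A \<and> (w, z2 x) \<notin> A \<and> z2 x \<notin> outdeg2 (A\<inverse>)" using d(3,4) zQ[OF x(1)] x(2) unfolding Q_def by simp
    qed
  qed
  define e1 where "e1 = (\<Sum>w \<in> Zs. card (outs A w) - 3)"
  define e2 where "e2 = (\<Sum>w \<in> Zs. card (ins A w) - 3)"
  have A2: "card Ya + card Xa \<le> e1 + e2 + 2 * card Zs"
  proof -
    have "(\<Sum>w \<in> Zs. card {y \<in> Ya. w1 y = w}) = card Ya"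
      by (rule sum_fibres) (use finYs finZs in \<open>auto simp: Zs_def\<close>)
    moreover have "(\<Sum>w \<in> Zs. card {x \<in> Xa. w2 x = w}) = card Xa"
      by (rule sum_fibres) (use finYs finZs in \<open>auto simp: Zs_def\<close>)
    moreover have "(\<Sum>w \<in> Zs. card {y \<in> Ya. w1 y = w} + card {x \<in> Xa. w2 x = w})
        \<le> (\<Sum>w \<in> Zs. (card (outs A w) - 3) + (card (ins A w) - 3) + 2)"
    proof (rule sum_mono)
      fix w assume w: "w \<in> Zs"
      have "3 \<le> card (outs A w)" "3 \<le> card (ins A w)" using deg3[of w] Zs[OF w] unfolding P_def Q_def by blast+
      then show "card {y \<in> Ya. w1 y = w} + card {x \<in> Xa. w2 x = w}
          \<le> (card (outs A w) - 3) + (card (ins A w) - 3) + 2" using slots[OF w] by linarith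
    qed
    moreover have "(\<Sum>w \<in> Zs. (card (outs A w) - 3) + (card (ins A w) - 3) + 2) = e1 + e2 + 2 * card Zs"
      unfolding e1_def e2_def by (simp only: sum.distrib) simp
    moreover have "(\<Sum>w \<in> Zs. card {y \<in> Ya. w1 y = w} + card {x \<in> Xa. w2 x = w}) =
        (\<Sum>w \<in> Zs. card {y \<in> Ya. w1 y = w}) + (\<Sum>w \<in> Zs. card {x \<in> Xa. w2 x = w})" by (rule sum.distrib)
    ultimately show ?thesis by linarith
  qed
  have A3: "card Y5 + e1 \<le> excess A"
    unfolding e1_def
  proof (rule excess_ge)
    show "Y5 \<subseteq> V" "\<And>y. y \<in> Y5 \<Longrightarrow> 5 \<le> card (outs A y)" using YQ PQV unfolding Y5_def by auto
    show "Zs \<subseteq> V" "\<And>w. w \<in> Zs \<Longrightarrow> w \<notin> outdeg2 A" using Zs unfolding P_def by blast+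
    show "Y5 \<inter> Zs = {}" using Zs YQ unfolding Y5_def by blast
  qed
  have A3': "card X5 + e2 \<le> excess (A\<inverse>)"
  proof -
    have "card X5 + (\<Sum>w \<in> Zs. card (outs (A\<inverse>) w) - 3) \<le> excess (A\<inverse>)"
    proof (rule counterexample.excess_ge[OF conv])
      show "X5 \<subseteq> Field (A\<inverse>)" "\<And>y. y \<in> X5 \<Longrightarrow> 5 \<le> card (outs (A\<inverse>) y)" using XP PQV unfolding X5_def by auto
      show "Zs \<subseteq> Field (A\<inverse>)" "\<And>w. w \<in> Zs \<Longrightarrow> w \<notin> outdeg2 (A\<inverse>)" using Zs unfolding Q_def by auto
      show "X5 \<inter> Zs = {}" using Zs XP unfolding X5_def by blast
    qed
    then show ?thesis unfolding e2_def .
  qed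
  \<comment> \<open>One-way arcs of \<open>rest A\<close> pay once for \<open>Yb\<close> and once
    for \<open>Xb\<close>; arcs of \<open>rest A\<close> in digons pay the two units still owed at a
    server. Both parts are thus used twice.\<close>
  define Rs where "Rs = {(u, v) \<in> rest A. (v, u) \<notin> A}"
  define Rd where "Rd = {(u, v) \<in> rest A. (v, u) \<in> A}"
  have finr: "finite (rest A)" using fin(1) by (auto simp: rest_def intro: finite_subset[of _ A])
  have finR: "finite Rs" "finite Rd" unfolding Rs_def Rd_def using finr by (auto intro: finite_subset[of _ "rest A"])
  have cR: "card Rs + card Rd \<le> card (rest A)"
  proof -
    have "card (Rs \<union> Rd) = card Rs + card Rd"
      by (rule card_Un_disjoint[OF finR]) (auto simp: Rs_def Rd_def)
    moreover have "card (Rs \<union> Rd) \<le> card (rest A)" by (rule card_mono[OF finr]) (auto simp: Rs_def Rd_def)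
    ultimately show ?thesis by simp
  qed
  have A4: "card Yb \<le> card Rs"
  proof (rule card_inj_on_le[of "\<lambda>y. (y, w1 y)", OF _ _ finR(1)])
    show "inj_on (\<lambda>y. (y, w1 y)) Yb" by (auto simp: inj_on_def)
    show "(\<lambda>y. (y, w1 y)) ` Yb \<subseteq> Rs"
    proof (rule image_subsetI)
      fix y assume "y \<in> Yb"
      then have y: "y \<in> Y" "\<not> 5 \<le> card (outs A y)" "y \<notin> P" unfolding Yb_def by auto
      show "(y, w1 y) \<in> Rs" using d1(1,2,6)[OF y(1,2)] y(3) unfolding Rs_def rest_def P_def Q_def by simp
    qed
  qed
  have A4': "card Xb \<le> card Rs"
  proof (rule card_inj_on_le[of "\<lambda>x. (w2 x, x)", OF _ _ finR(1)])
    show "inj_on (\<lambda>x. (w2 x, x)) Xb" by (auto simp: inj_on_def)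
    show "(\<lambda>x. (w2 x, x)) ` Xb \<subseteq> Rs"
    proof (rule image_subsetI)
      fix x assume "x \<in> Xb"
      then have x: "x \<in> X" "\<not> 5 \<le> card (ins A x)" "x \<notin> Q" unfolding Xb_def by auto
      show "(w2 x, x) \<in> Rs" using d2(1,2,5)[OF x(1,2)] x(3) unfolding Rs_def rest_def P_def Q_def by simp
    qed
  qed
  \<comment> \<open>A server in \<open>Z1\<close> has a digon to a vertex not of degree two on both
    sides, hence an arc of that digon in \<open>rest A\<close>; servers in \<open>Z\<close> have
    none and remain as a term of the inequality.\<close>
  define Z1 where "Z1 = {w \<in> Zs. \<exists>u. (w, u) \<in> A \<and> (u, w) \<in> A \<and> u \<notin> S}"
  define Z where "Z = {w \<in> Zs. \<forall>u. (w, u) \<in> A \<and> (u, w) \<in> A \<longrightarrow> u \<in> S}"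
  have finZ: "finite Z1" "finite Z" unfolding Z1_def Z_def using finZs by simp_all
  have cZ: "card Zs \<le> card Z1 + card Z"
  proof -
    have "Zs \<subseteq> Z1 \<union> Z" unfolding Z1_def Z_def by blast
    then have "card Zs \<le> card (Z1 \<union> Z)" by (rule card_mono[rotated]) (use finZ in simp)
    then show ?thesis using card_Un_le[of Z1 Z] by linarith
  qed
  have "\<forall>w \<in> Z1. \<exists>u. (w, u) \<in> A \<and> (u, w) \<in> A \<and> u \<notin> S" unfolding Z1_def by blast
  then obtain h where h: "\<forall>w \<in> Z1. (w, h w) \<in> A \<and> (h w, w) \<in> A \<and> h w \<notin> S" by (rule bchoice[THEN exE])
  have A5: "card Z1 \<le> card Rd"
  proof (rule card_inj_on_le[of "\<lambda>w. if h w \<notin> P then (h w, w) else (w, h w)", OF _ _ finR(2)])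
    have Z1P: "w \<notin> P" "w \<notin> Q" if "w \<in> Z1" for w using Zs[of w] that unfolding Z1_def by auto
    show "inj_on (\<lambda>w. if h w \<notin> P then (h w, w) else (w, h w)) Z1"
    proof (rule inj_onI)
      fix w v assume wv: "w \<in> Z1" "v \<in> Z1"
        "(if h w \<notin> P then (h w, w) else (w, h w)) = (if h v \<notin> P then (h v, v) else (v, h v))"
      show "w = v" using wv(3) Z1P(1)[OF wv(1)] Z1P(1)[OF wv(2)] by (auto split: if_splits)
    qed
    show "(\<lambda>w. if h w \<notin> P then (h w, w) else (w, h w)) ` Z1 \<subseteq> Rd"
    proof (rule image_subsetI)
      fix w assume w: "w \<in> Z1"
      have hw: "(w, h w) \<in> A" "(h w, w) \<in> A" "h w \<notin> P \<or> h w \<notin> Q" using h w unfolding S_def by blast+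
      show "(if h w \<notin> P then (h w, w) else (w, h w)) \<in> Rd"
        using hw Z1P[OF w] unfolding Rd_def rest_def P_def[symmetric] Q_def[symmetric] by auto
    qed
  qed
  have "\<forall>w \<in> Z. \<exists>u. (w, u) \<in> A \<and> (u, w) \<in> A" using Zs unfolding Z_def by blast
  then obtain c where c: "\<forall>w \<in> Z. (w, c w) \<in> A \<and> (c w, w) \<in> A" by (rule bchoice[THEN exE])
  have cV2: "c w \<in> V2" if w: "w \<in> Z" for w
  proof -
    have cw: "(w, c w) \<in> A" "(c w, w) \<in> A" using c w by blast+
    then have "c w \<in> S" using w unfolding Z_def by blast
    then have cS: "c w \<in> outdeg2 A" "c w \<in> outdeg2 (A\<inverse>)" unfolding S_def P_def Q_def by auto
    show ?thesis unfolding V2_def by (rule digon_in_S[OF cS cw])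
  qed
  have A6: "card (c ` Z) \<le> card V2"
    by (rule card_mono[OF finite_subset[OF V2S finYX(5)]]) (use cV2 in blast)
  have ineq: "2 * card (bad A) + card (c ` Z) \<le> card S + excess A + excess (A\<inverse>) + 2 * card (rest A) + 2 * card Z"
    using B1 B2 cY cX A1 A2 A3 A3' A4 A4' A5 A6 cR cZ by linarith
  have serv: "(\<exists>y z. y \<in> outdeg2 A \<and> dev_server A y z w) \<or> (\<exists>x z. x \<in> outdeg2 (A\<inverse>) \<and> dev_server (A\<inverse>) x z w)"
    if w: "w \<in> Z" for w
  proof -
    have "w \<in> Zs" using w unfolding Z_def by blast
    then consider y where "y \<in> Ya" "w = w1 y" | x where "x \<in> Xa" "w = w2 x" unfolding Zs_def by blast
    then show ?thesis
    proof cases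
      case 1
      then show ?thesis using s1[OF Ya(1,4)[OF 1(1)]] Ya(2)[OF 1(1)] unfolding P_def by blast
    next
      case 2
      then show ?thesis using s2[OF Xa(1,4)[OF 2(1)]] Xa(2)[OF 2(1)] unfolding Q_def by blast
    qed
  qed
  have ZP: "w \<notin> outdeg2 A" if "w \<in> Z" for w using Zs[of w] that unfolding Z_def P_def by blast
  show ?thesis
    by (rule exI[of _ Z], rule exI[of _ c])
      (use finZ(2) ineq cV2 c serv ZP in \<open>simp add: V2_def S_def P_def Q_def\<close>)
qed

end

section \<open>Excluding all digons\<close>

lemma matching_card_Field:
  assumes "finite M" "matching A M" "\<And>a. (a, a) \<notin> A"
  shows "card (Field M) = 2 * card M"
  using assms(1,2)
proof (induction M rule: finite_induct)
  case empty
  then show ?case by simp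
next
  case (insert e M)
  obtain a b where e: "e = (a, b)" by (cases e)
  have m: "matching A M" by (rule matching_sub[OF insert.prems]) blast
  have "(a, b) \<in> A" using insert.prems e unfolding matching_def by auto
  then have ab: "a \<noteq> b" using assms(3) by auto
  have n: "a \<notin> Field M \<and> b \<notin> Field M"
  proof -
    have "{fst e, snd e} \<inter> {fst e', snd e'} = {}" if "e' \<in> M" for e'
      using insert.prems insert.hyps(2) that unfolding matching_def by (metis insertCI)
    then have "{a, b} \<inter> {u, v} = {}" if "(u, v) \<in> M" for u v using that e by fastforce
    then show ?thesis unfolding Field_def by fastforce
  qed
  have "Field (insert e M) = insert a (insert b (Field M))" unfolding e Field_def by auto
  then show ?case using insert.IH[OF m] insert.hyps n ab by (simp add: finite_Field)
qed

text \<open>Eight digon arcs mean four vertices if \<open>k = 1\<close> and five if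
  \<open>k = -1\<close>. Then \<open>3 * card W + 2 * s\<close> is \<open>27\<close> or
  \<open>36\<close>, so \<open>3\<close> divides \<open>s\<close>, but
  \<open>1 \<le> s \<le> 2\<close>.\<close>

lemma special_digons:
  assumes k: "special k W" and d: "(u, v) \<in> W" "(v, u) \<in> W"
  shows "card (W \<inter> W\<inverse>) \<noteq> 8"
proof
  assume c8: "card (W \<inter> W\<inverse>) = 8"
  obtain s where s: "special_inv k W s" using special_ex_inv[OF k] by blast
  obtain M where M: "matching W M" "card M = s" "(u, v) \<in> M \<or> (v, u) \<in> M"
    using s d unfolding special_inv_def by blast
  have finM: "finite M" by (rule matching_finite[OF M(1) special_finite[OF k]])
  have s1: "1 \<le> s" using M(2,3) finM by (auto simp: Suc_le_eq card_gt_0_iff)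
  have "card (Field M) = 2 * s" using matching_card_Field[OF finM M(1) special_irrefl[OF k]] M(2) by simp
  moreover have "card (Field M) \<le> card (Field W)"
    by (rule card_mono[OF finite_Field[OF special_finite[OF k]] matching_Field[OF M(1)]])
  ultimately have sn: "2 * s \<le> card (Field W)" by simp
  have e1: "7 * int (card (Field W)) - 3 * int (card W) - 2 * int s = k"
    and e2: "int (card (W \<inter> W\<inverse>)) + 1 - k = 2 * int (card (Field W))"
    using s unfolding special_inv_def by blast+
  have "k = 1 \<or> k = -1" by (rule special_kind[OF k])
  then show False
  proof
    assume k1: "k = 1"
    then have n: "card (Field W) = 4" using e2 c8 by simp
    then have "27 = 3 * card W + 2 * s" using e1 k1 by simp
    then show False using sn s1 n by presburger
  next
    assume k1: "k = -1"
    then have n: "card (Field W) = 5" using e2 c8 by simp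
    then have "36 = 3 * card W + 2 * s" using e1 k1 by simp
    then show False using sn s1 n by presburger
  qed
qed

context counterexample
begin

lemma no_triangle:
  assumes "(a, b) \<in> A" "(b, a) \<in> A" "(b, d) \<in> A" "(d, b) \<in> A" "(a, d) \<in> A" "(d, a) \<in> A"
  shows False
proof -
  have dis: "distinct [a, b, d]" using assms irr by auto
  have "{(a, b), (b, a), (b, d), (d, b), (a, d), (d, a)} = A"
    by (rule not_sub[OF triangle_not_colourable[of a b _ d]]) (use assms in simp_all)
  then show False using special.triangle[OF dis] not_special by simp
qed

lemma two_digons:
  assumes small: "\<And>M. matching A M \<Longrightarrow> card M \<le> 1"
    and d: "(a, b) \<in> A" "(b, a) \<in> A" "(p, q) \<in> A" "(q, p) \<in> A"
  shows "p = a \<or> p = b \<or> q = a \<or> q = b"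
proof (rule ccontr)
  assume n: "\<not> (p = a \<or> p = b \<or> q = a \<or> q = b)"
  have m: "matching A {(p, q)}" by (rule matching_single[OF d(3,4)])
  have nF: "a \<notin> Field {(p, q)}" "b \<notin> Field {(p, q)}" using n by (auto simp: Field_def)
  have "matching A (insert (a, b) {(p, q)})" by (rule matching_insert[OF m d(1,2) nF])
  moreover have "card (insert (a, b) {(p, q)}) = 2" using n by auto
  ultimately show False using small by fastforce
qed

text \<open>The device would have exactly eight arcs in digons, which no exceptional digraph has.\<close>

lemma star_contradiction:
  assumes c: "outs A c = {w, v}" "ins A c = {w, v}" "w \<noteq> v"
    and small: "\<And>M. matching A M \<Longrightarrow> card M \<le> 1"
    and y: "card (outs A y) = 2" and dev: "dev_server A y z w"
  shows False
proof -
  obtain x y' W M w' where h: "outs A x = {y, y'}" "y \<noteq> y'" "ins A y = {x, z}" "x \<noteq> z"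
    and d: "device A x y z W M"
    and w': "(z, w) \<in> W" "(w, w') \<in> W" "(w', w) \<in> W" "w' \<noteq> z" "(w, w') \<in> A" "(w', w) \<in> A"
    using dev unfolding dev_server_def by blast
  note s = bad_simple[OF h]
  note D = deviceD[OF d h(3,4) s(1,2)]
  have irrW: "(a, a) \<notin> W" for a by (rule critical_irrefl[OF D(1)])
  have ca: "(c, w) \<in> A" "(w, c) \<in> A" "(c, v) \<in> A" "(v, c) \<in> A" using c by auto
  have cne: "c \<noteq> w" "c \<noteq> v" using ca irr by auto
  \<comment> \<open>Any digon meets both \<open>c w\<close> and \<open>c v\<close>, and a digon
    \<open>w v\<close> would close a bidirected triangle; so these two are the only digons of
    \<open>A\<close>.\<close>
  have digs: "p = c \<and> (q = w \<or> q = v) \<or> q = c \<and> (p = w \<or> p = v)" if pq: "(p, q) \<in> A" "(q, p) \<in> A" for p q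
  proof -
    have 1: "p = c \<or> p = w \<or> q = c \<or> q = w" and 2: "p = c \<or> p = v \<or> q = c \<or> q = v"
      using two_digons[OF small ca(1,2) pq] two_digons[OF small ca(3,4) pq] by blast+
    show ?thesis
    proof (cases "p = c \<or> q = c")
      case True
      then show ?thesis using c pq by auto
    next
      case False
      then have "(p = w \<and> q = v) \<or> (p = v \<and> q = w)" using 1 2 c(3) pq irr by auto
      then have "(w, v) \<in> A" "(v, w) \<in> A" using pq by auto
      then have False using no_triangle[of c w v] ca by blast
      then show ?thesis ..
    qed
  qed
  have w'c: "w' = c" using digs[OF w'(5,6)] c(3) cne by auto
  have cz: "c \<noteq> z" using w'(4) w'c by simp
  have cW: "(w, c) \<in> W" "(c, w) \<in> W" using w' w'c by auto
  have cF: "c \<in> Field W" using FieldI[OF cW(2)] by simp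
  have WA: "(p, q) \<in> A" if "(p, q) \<in> W" "p \<noteq> z" for p q using D(6) that by auto
  have wz: "w \<noteq> z" using w'(1) irrW by auto
  \<comment> \<open>\<open>c\<close> has degree two in \<open>A\<close>, needs at least two in
    \<open>W\<close>, and is not \<open>z\<close>; so its arcs in \<open>W\<close> are arcs of
    \<open>A\<close> and none may be missing.\<close>
  have cvW: "(c, v) \<in> W"
  proof (rule ccontr)
    assume n: "(c, v) \<notin> W"
    have "outs W c \<subseteq> {w}"
    proof
      fix q assume q: "q \<in> outs W c"
      then have "q \<in> outs A c" using WA[of c q] cz by simp
      then show "q \<in> {w}" using c n q by auto
    qed
    then have "card (outs W c) \<le> 1" using card_mono[of "{w}" "outs W c"] by simp
    then show False using critical_outdeg[OF D(1) cF] by simp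
  qed
  have nzc: "(z, c) \<notin> W"
  proof
    assume zc: "(z, c) \<in> W"
    then have "(c, z) \<in> A" using D(9)[of c] by simp
    then have "z \<in> outs A c" by simp
    then have "z = v" using c wz by auto
    then have "(z, c) \<in> A" using ca by simp
    moreover have "(z, c) \<notin> A" using d zc unfolding device_def by blast
    ultimately show False by simp
  qed
  have vcW: "(v, c) \<in> W"
  proof (rule ccontr)
    assume n: "(v, c) \<notin> W"
    have "ins W c \<subseteq> {w}"
    proof
      fix q assume q: "q \<in> ins W c"
      then have "q \<noteq> z" using nzc by auto
      then have "q \<in> ins A c" using WA[of q c] q by simp
      then show "q \<in> {w}" using c n q by auto
    qed
    then have "card (ins W c) \<le> 1" using card_mono[of "{w}" "ins W c"] by simp
    then show False using critical_indeg[OF D(1) cF] by simp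
  qed
  have vz: "v \<noteq> z" using vcW nzc by auto
  define N where "N = outs W z"
  have finN: "finite N" unfolding N_def using D(16) by auto
  have "card N \<le> card (outs A y)"
    unfolding N_def by (rule card_mono[OF _ D(7)]) (use fin in auto)
  then have N2: "card N = 2" using D(10) y unfolding N_def by simp
  have zN: "z \<notin> N" unfolding N_def using irrW by auto
  define K where "K = {(w, c), (c, w), (c, v), (v, c)}"
  have "W \<inter> W\<inverse> = K \<union> ({z} \<times> N \<union> N \<times> {z})"
  proof
    show "W \<inter> W\<inverse> \<subseteq> K \<union> ({z} \<times> N \<union> N \<times> {z})"
    proof
      fix e assume e: "e \<in> W \<inter> W\<inverse>"
      obtain p q where pq: "e = (p, q)" by (cases e)
      have W2: "(p, q) \<in> W" "(q, p) \<in> W" using e pq by auto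
      show "e \<in> K \<union> ({z} \<times> N \<union> N \<times> {z})"
      proof (cases "p = z \<or> q = z")
        case True
        then show ?thesis using W2 pq unfolding N_def by auto
      next
        case False
        then have "(p, q) \<in> A" "(q, p) \<in> A" using W2 WA by blast+
        then show ?thesis using digs[of p q] pq unfolding K_def by auto
      qed
    qed
    show "K \<union> ({z} \<times> N \<union> N \<times> {z}) \<subseteq> W \<inter> W\<inverse>"
      unfolding K_def N_def using cW cvW vcW D(9) by auto
  qed
  moreover have "card (K \<union> ({z} \<times> N \<union> N \<times> {z})) = card K + card ({z} \<times> N \<union> N \<times> {z})"
    by (rule card_Un_disjoint) (use finN cz wz vz in \<open>auto simp: K_def\<close>)
  moreover have "card ({z} \<times> N \<union> N \<times> {z}) = card ({z} \<times> N) + card (N \<times> {z})"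
    by (rule card_Un_disjoint) (use finN zN in auto)
  moreover have "card K = 4" unfolding K_def using cne c(3) by auto
  ultimately have "card (W \<inter> W\<inverse>) = 8" using N2 by (simp add: card_cartesian_product)
  moreover obtain k where "special k W" using d unfolding device_def by blast
  ultimately show False using special_digons[OF _ cW] by blast
qed

text \<open>Eliminating \<open>b\<close>, \<open>p\<close>, \<open>q\<close>, \<open>r\<close> and
  \<open>s\<close> from the counts gives
  \<open>3 (7 n - 3 m) + (5/2) (e1 + e2) + t \<le> 2 card Z\<close>, where \<open>t\<close> is the
  number of bidirected vertices chosen by \<open>c\<close>. Each of these is chosen by at most two
  elements of \<open>Z\<close>, and they yield a matching of size \<open>t\<close>, so that
  \<open>7 n - 3 m \<ge> 2 t - 1\<close>. Hence \<open>t \<le> 1\<close>; the case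
  \<open>t = 1\<close> leaves two digons at one vertex and falls to
  \<open>star_contradiction\<close>, and \<open>t = 0\<close> gives both claims.\<close>

lemma no_matching:
  shows "\<And>M. matching A M \<Longrightarrow> card M = 0" "excess A + excess (A\<inverse>) \<le> 1"
proof -
  note conv = counterexample_converse
  define n m b r p q s e1 e2 where "n = card V" and "m = card A" and "b = card (bad A)" and "r = card (rest A)"
    and "p = card (outdeg2 A)" and "q = card (outdeg2 (A\<inverse>))" and "s = card (outdeg2 A \<inter> outdeg2 (A\<inverse>))"
    and "e1 = excess A" and "e2 = excess (A\<inverse>)"
  have a1: "m + p = 3 * n + e1" using card_arcs unfolding m_def p_def n_def e1_def .
  have a2: "m + q = 3 * n + e2"
    using counterexample.card_arcs[OF conv] unfolding m_def q_def n_def e2_def by (simp add: card_converse)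
  have a3: "m + b = 2 * p + 2 * q + r" using card_arcs_split unfolding m_def b_def p_def q_def r_def .
  have sp: "s \<le> p" "s \<le> q" unfolding s_def p_def q_def by (simp_all add: card_mono outdeg2_finite)
  obtain Z c where Z: "finite Z" "2 * b + card (c ` Z) \<le> s + e1 + e2 + 2 * r + 2 * card Z"
    and cZ: "\<And>w. w \<in> Z \<Longrightarrow> c w \<in> bidirected2 A \<and> (w, c w) \<in> A \<and> (c w, w) \<in> A \<and> w \<notin> outdeg2 A \<and>
      ((\<exists>y z. y \<in> outdeg2 A \<and> dev_server A y z w) \<or> (\<exists>x z. x \<in> outdeg2 (A\<inverse>) \<and> dev_server (A\<inverse>) x z w))"
    using counting unfolding b_def s_def e1_def e2_def r_def by blast
  have ge: "2 * int (card M) - 1 \<le> 7 * int n - 3 * int m" if "matching A M" for M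
    using val_ge[OF that] unfolding val_def n_def m_def by simp
  define t where "t = card (c ` Z)"
  have outc: "card (outs A u) = 2" "outs A u = ins A u" "u \<in> outdeg2 A" if "u \<in> c ` Z" for u
    using that cZ outdeg2D(1) unfolding bidirected2_def by auto
  have Z2t: "card Z \<le> 2 * t"
  proof -
    have "card Z = (\<Sum>u \<in> c ` Z. card {w \<in> Z. c w = u})" by (rule sum_fibres[symmetric]) (use Z(1) in auto)
    also have "\<dots> \<le> (\<Sum>u \<in> c ` Z. 2)"
    proof (rule sum_mono)
      fix u assume u: "u \<in> c ` Z"
      have "{w \<in> Z. c w = u} \<subseteq> outs A u" using cZ by auto
      then have "card {w \<in> Z. c w = u} \<le> card (outs A u)" by (rule card_mono[rotated]) (use fin in auto)
      then show "card {w \<in> Z. c w = u} \<le> 2" using outc(1)[OF u] by simp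
    qed
    finally show ?thesis unfolding t_def by simp
  qed
  \<comment> \<open>One server is selected for each bidirected vertex; servers do not have
    out-degree two, so the edges are disjoint.\<close>
  obtain M where M: "matching A M" "card M = t"
  proof -
    define g where "g u = (SOME w. w \<in> Z \<and> c w = u)" for u
    have g: "g u \<in> Z \<and> c (g u) = u" if "u \<in> c ` Z" for u
      unfolding g_def by (rule someI_ex) (use that in blast)
    define M where "M = (\<lambda>u. (g u, u)) ` (c ` Z)"
    have "card M = t" unfolding M_def t_def by (rule card_image) (auto simp: inj_on_def)
    moreover have "matching A M"
    proof -
      have "M \<subseteq> A \<inter> A\<inverse>"
      proof
        fix e assume "e \<in> M"
        then obtain u where u: "u \<in> c ` Z" "e = (g u, u)" unfolding M_def by blast
        show "e \<in> A \<inter> A\<inverse>" using cZ[of "g u"] g[OF u(1)] u(2) by auto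
      qed
      moreover have "{fst e, snd e} \<inter> {fst e', snd e'} = {}" if ee: "e \<in> M" "e' \<in> M" "e \<noteq> e'" for e e'
      proof -
        obtain u u' where u: "u \<in> c ` Z" "e = (g u, u)" "u' \<in> c ` Z" "e' = (g u', u')" using ee unfolding M_def by blast
        have uu: "u \<noteq> u'" using ee u by auto
        have "g u \<noteq> g u'" using g[OF u(1)] g[OF u(3)] uu by metis
        moreover have "g u \<notin> outdeg2 A" "g u' \<notin> outdeg2 A" using cZ g[OF u(1)] g[OF u(3)] by blast+
        ultimately show ?thesis using uu u outc(3)[OF u(1)] outc(3)[OF u(3)] by auto
      qed
      ultimately show ?thesis unfolding matching_def by blast
    qed
    ultimately show thesis using that by blast
  qed
  have t0: "t = 0"
  proof (rule ccontr)
    assume "t \<noteq> 0"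
    \<comment> \<open>With \<open>card Z \<le> 2 t\<close> the inequality becomes
      \<open>3 t + (5/2) (e1 + e2) \<le> 3\<close>.\<close>
    have t1: "t = 1" and Zc: "card Z = 2" and nm: "7 * int n - 3 * int m \<le> 1"
      using ge[OF M(1)] M(2) Z(2) Z2t a1 a2 a3 sp \<open>t \<noteq> 0\<close> unfolding t_def[symmetric] by linarith+
    have small: "card M \<le> 1" if "matching A M" for M using ge[OF that] nm by linarith
    obtain w v where wv: "Z = {w, v}" "w \<noteq> v" using Zc by (meson card_2_iff)
    have "card (c ` Z) = 1" using t1 unfolding t_def .
    then obtain u where u: "c ` Z = {u}" by (rule card_1_singletonE)
    have cu: "c w = u" "c v = u" using u wv by auto
    have uZ: "u \<in> c ` Z" using u by simp
    have "{w, v} \<subseteq> outs A u" using cZ[of w] cZ[of v] wv cu by auto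
    then have o: "outs A u = {w, v}"
      using card_subset_eq[of "outs A u" "{w, v}"] outc(1)[OF uZ] wv(2) fin(1) by auto
    have i: "ins A u = {w, v}" using o outc(2)[OF uZ] by simp
    have "w \<in> Z" using wv by simp
    then consider y z where "y \<in> outdeg2 A" "dev_server A y z w" | x z where "x \<in> outdeg2 (A\<inverse>)" "dev_server (A\<inverse>) x z w"
      using cZ by blast
    then show False
    proof cases
      case 1
      show False by (rule star_contradiction[OF o i wv(2) small outdeg2D(1)[OF 1(1)] 1(2)])
    next
      case 2
      have smallc: "card M \<le> 1" if "matching (A\<inverse>) M" for M
        using small[of M] matching_converse[OF that] by simp
      have "card (outs (A\<inverse>) x) = 2" using outdeg2D(2)[OF 2(1)] .
      moreover have "ins (A\<inverse>) u = {w, v}" using o by simp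
      ultimately show False using counterexample.star_contradiction[OF conv i _ wv(2) smallc _ 2(2)] by blast
    qed
  qed
  have Z0: "card Z = 0" using t0 Z2t by simp
  show "card M = 0" if "matching A M" for M
    using ge[OF that] Z(2) Z0 a1 a2 a3 sp by linarith
  show "excess A + excess (A\<inverse>) \<le> 1"
    using ge[OF matching_empty] Z(2) Z0 a1 a2 a3 sp unfolding e1_def[symmetric] e2_def[symmetric] by simp
qed

end

text \<open>Along a closed walk a function that never decreases is constant.\<close>

lemma acyclic_level:
  fixes f :: "'a \<Rightarrow> nat"
  assumes mono: "\<And>u v. (u, v) \<in> S \<Longrightarrow> f u \<le> f v"
    and lev: "\<And>i. acyclic {(u, v) \<in> S. f u = i \<and> f v = i}"
  shows "acyclic S"
proof -
  have *: "f u \<le> f v \<and> (f u = f v \<longrightarrow> (u, v) \<in> {(a, b) \<in> S. f a = f u \<and> f b = f u}\<^sup>+)" if "(u, v) \<in> S\<^sup>+" for u v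
    using that
  proof (induction rule: trancl_induct)
    case (base y)
    then show ?case using mono by (auto intro!: r_into_trancl)
  next
    case (step y z)
    have yz: "f y \<le> f z" by (rule mono[OF step.hyps(2)])
    show ?case
    proof (intro conjI impI)
      show "f u \<le> f z" using step.IH yz by simp
      assume e: "f u = f z"
      then have uy: "f u = f y" using step.IH yz by simp
      have "(y, z) \<in> {(a, b) \<in> S. f a = f u \<and> f b = f u}" using step.hyps(2) e uy by simp
      then show "(u, z) \<in> {(a, b) \<in> S. f a = f u \<and> f b = f u}\<^sup>+"
        using step.IH uy by (auto intro: trancl_into_trancl)
    qed
  qed
  show ?thesis
    unfolding acyclic_def
  proof (intro allI notI)
    fix x assume "(x, x) \<in> S\<^sup>+"
    then have "(x, x) \<in> {(a, b) \<in> S. f a = f x \<and> f b = f x}\<^sup>+" using * by blast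
    then show False using lev[of "f x"] by (simp add: acyclic_def)
  qed
qed

lemma acyclic_small:
  assumes X: "finite X" "card X \<le> 2" and S: "\<And>a b. (a, b) \<in> S \<Longrightarrow> (b, a) \<notin> S"
  shows "acyclic (S \<inter> X \<times> X)"
proof -
  have irr: "(a, a) \<notin> S" for a using S by blast
  obtain a b where ab: "X \<subseteq> {a, b}"
  proof -
    consider "card X = 0" | "card X = 1" | "card X = 2" using X(2) by linarith
    then show thesis
    proof cases
      case 1
      then show ?thesis using that X(1) by simp
    next
      case 2
      then obtain a where "X = {a}" by (rule card_1_singletonE)
      then show ?thesis using that[of a a] by simp
    next
      case 3
      then obtain a b where "X = {a, b}" by (meson card_2_iff)
      then show ?thesis using that[of a b] by simp
    qed
  qed
  show ?thesis
  proof (cases "a = b")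
    case True
    then have "S \<inter> X \<times> X = {}" using ab irr by auto
    then show ?thesis by (simp add: acyclic_def)
  next
    case False
    have "S \<inter> X \<times> X \<subseteq> {(a, b)} \<or> S \<inter> X \<times> X \<subseteq> {(b, a)}"
    proof (cases "(a, b) \<in> S")
      case True
      then show ?thesis using S[OF True] ab irr by auto
    next
      case nab: False
      then show ?thesis using ab irr by auto
    qed
    then show ?thesis using acyclic_subset_arc[of _ a b] acyclic_subset_arc[of _ b a] False by blast
  qed
qed

lemma colour_split:
  assumes "acyclic (A \<inter> K \<times> K)" "acyclic (A \<inter> (- K) \<times> (- K))"
  shows "colourable A"
proof (rule colourableI)
  define f where "f v = (if v \<in> K then 1 else (0 :: nat))" for v
  show "acyclic (monochrom (\<lambda>v. v \<in> K) A)"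
  proof (rule acyclic_level[of _ f])
    show "f u \<le> f v" if "(u, v) \<in> monochrom (\<lambda>v. v \<in> K) A" for u v
      using that by (auto simp: monochrom_def f_def)
    show "acyclic {(u, v) \<in> monochrom (\<lambda>v. v \<in> K) A. f u = i \<and> f v = i}" for i
    proof (cases "i = 1")
      case True
      have "{(u, v) \<in> monochrom (\<lambda>v. v \<in> K) A. f u = i \<and> f v = i} \<subseteq> A \<inter> K \<times> K"
        using True by (auto simp: monochrom_def f_def split: if_splits)
      then show ?thesis using assms(1) acyclic_subset by blast
    next
      case False
      have "{(u, v) \<in> monochrom (\<lambda>v. v \<in> K) A. f u = i \<and> f v = i} \<subseteq> A \<inter> (- K) \<times> (- K)"
        using False by (auto simp: monochrom_def f_def split: if_splits)
      then show ?thesis using assms(2) acyclic_subset by blast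
    qed
  qed
qed

section \<open>Colouring the remaining digraphs\<close>

context counterexample
begin

lemma no_digon: "(a, b) \<in> A \<Longrightarrow> (b, a) \<notin> A"
proof
  assume "(a, b) \<in> A" "(b, a) \<in> A"
  then have "matching A {(a, b)}" by (rule matching_single)
  then have "card {(a, b)} = 0" by (rule no_matching(1))
  then show False by simp
qed

text \<open>A head would need excess at least two or a server lying in a digon.\<close>

lemma heads_empty: "heads A = {}"
proof -
  have False if y: "y \<in> heads A" for y
  proof -
    have yV: "y \<in> V" using y heads_outdeg2 outdeg2D(4) by blast
    from heads_cases[OF y] show False
    proof
      assume 5: "5 \<le> card (outs A y)"
      have nP: "y \<in> V - outdeg2 A" using yV 5 outdeg2D(1)[of y] by auto
      have "card (outs A y) - 3 \<le> excess A"
        unfolding excess_def by (rule member_le_sum[OF nP]) (use fin in auto)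
      then show False using no_matching(2) 5 by linarith
    next
      assume "\<exists>z w. dev_server A y z w"
      then show False using dev_serverD(8) no_digon by blast
    qed
  qed
  then show ?thesis by blast
qed

lemma bad_isolated_bad: "bad A = isolated_bad A"
proof -
  have "bad A - isolated_bad A = {}" using heads_empty by (simp add: heads_def)
  then show ?thesis using isolated_bad_subset by blast
qed

text \<open>As there are no heads in \<open>A\<close> or in its converse, every bad arc is isolated
  at both ends.\<close>

lemma bad_isolated:
  assumes "(u, v) \<in> A" "u \<in> outdeg2 A" "v \<in> outdeg2 (A\<inverse>)"
  shows "u \<in> outdeg2 (A\<inverse>)" "v \<in> outdeg2 A" "(v, w) \<in> A \<Longrightarrow> w \<notin> outdeg2 (A\<inverse>)"
proof -
  have b: "(u, v) \<in> bad A" using assms by (simp add: bad_def)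
  then have o: "(u, v) \<in> isolated_bad A" using bad_isolated_bad by simp
  have "(v, u) \<in> bad (A\<inverse>)" using b unfolding bad_converse by simp
  then have o': "(v, u) \<in> isolated_bad (A\<inverse>)" using counterexample.bad_isolated_bad[OF counterexample_converse] by simp
  show "u \<in> outdeg2 (A\<inverse>)" by (rule isolated_badD(2)[OF o])
  show "v \<in> outdeg2 A" using counterexample.isolated_badD(2)[OF counterexample_converse o'] by simp
  show "w \<notin> outdeg2 (A\<inverse>)" if "(v, w) \<in> A"
    by (rule counterexample.isolated_badD(5)[OF counterexample_converse o']) (use that in simp)
qed

text \<open>In the notation of the proof, tails and converse tails are disjoint subsets of
  \<open>P \<inter> Q\<close>, so \<open>2 * b \<le> s\<close>. The counts of arcs then give
  \<open>(7/2) (e1 + e2) + 2 r + (pd + qd) / 2 \<le> 3\<close>, which leaves no excess and makes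
  \<open>pd\<close> and \<open>qd\<close> equal.\<close>

lemma degenerate:
  "card (outdeg2 A - outdeg2 (A\<inverse>)) = card (outdeg2 (A\<inverse>) - outdeg2 A)" "2 * card (rest A) + card (outdeg2 A - outdeg2 (A\<inverse>)) \<le> 3"
proof -
  note conv = counterexample_converse
  define P Q where "P = outdeg2 A" and "Q = outdeg2 (A\<inverse>)"
  have f: "finite P" "finite Q" unfolding P_def Q_def by (rule outdeg2_finite)+
  define n m b r s pd qd e1 e2 where "n = card V" and "m = card A" and "b = card (bad A)" and "r = card (rest A)"
    and "s = card (P \<inter> Q)" and "pd = card (P - Q)" and "qd = card (Q - P)"
    and "e1 = excess A" and "e2 = excess (A\<inverse>)"
  have cp: "card P = s + pd"
    using card_Un_disjoint[of "P \<inter> Q" "P - Q"] f unfolding s_def pd_def by (simp add: Int_Diff_Un Int_Diff_disjoint)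
  have cq: "card Q = s + qd"
  proof -
    have e: "Q = (P \<inter> Q) \<union> (Q - P)" "(P \<inter> Q) \<inter> (Q - P) = {}" by blast+
    have "card ((P \<inter> Q) \<union> (Q - P)) = s + qd"
      unfolding s_def qd_def by (rule card_Un_disjoint[OF _ _ e(2)]) (use f in simp_all)
    then show ?thesis using e(1) by simp
  qed
  have a1: "m + card P = 3 * n + e1" using card_arcs unfolding m_def P_def n_def e1_def .
  have a2: "m + card Q = 3 * n + e2"
    using counterexample.card_arcs[OF conv] unfolding m_def Q_def n_def e2_def by (simp add: card_converse)
  have a3: "m + b = 2 * card P + 2 * card Q + r" using card_arcs_split unfolding m_def b_def P_def Q_def r_def .
  have ge: "-1 \<le> 7 * int n - 3 * int m" using val_ge[OF matching_empty] unfolding val_def n_def m_def by simp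
  have b2: "2 * b \<le> s"
  proof -
    have h': "heads (A\<inverse>) = {}" by (rule counterexample.heads_empty[OF conv])
    have "b = card (tails A)" unfolding b_def using bad_card heads_empty by simp
    moreover have "b = card (tails (A\<inverse>))"
      using counterexample.bad_card[OF conv] h' unfolding b_def bad_converse card_converse by simp
    moreover have sub: "tails A \<subseteq> P \<inter> Q" "tails (A\<inverse>) \<subseteq> P \<inter> Q"
      using tails_outdeg2 counterexample.tails_outdeg2[OF conv] unfolding P_def Q_def by auto
    moreover have "card (tails A \<union> tails (A\<inverse>)) = card (tails A) + card (tails (A\<inverse>))"
      by (rule card_Un_disjoint) (use sub f finite_subset[of _ "P \<inter> Q"] tails_tails in auto)
    moreover have "card (tails A \<union> tails (A\<inverse>)) \<le> s"
      unfolding s_def by (rule card_mono) (use sub f in auto)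
    ultimately show ?thesis by linarith
  qed
  have e0: "e1 + e2 \<le> 1" using no_matching(2) unfolding e1_def e2_def .
  have e: "e1 = 0" "e2 = 0" using a1 a2 a3 cp cq ge b2 e0 by linarith+
  have "pd = qd" using a1 a2 cp cq e by linarith
  moreover have "2 * r + pd \<le> 3" using a1 a2 a3 cp cq ge b2 e by linarith
  ultimately show "card (outdeg2 A - outdeg2 (A\<inverse>)) = card (outdeg2 (A\<inverse>) - outdeg2 A)" "2 * card (rest A) + card (outdeg2 A - outdeg2 (A\<inverse>)) \<le> 3"
    unfolding pd_def qd_def r_def P_def Q_def by auto
qed

text \<open>The levels are: only in-degree two, tails of bad arcs, the other vertices with both
  degrees two, only out-degree two. No arc goes down, because a bad arc runs from level
  \<open>1\<close> to level \<open>2\<close>. Only the first and the last level contain arcs, and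
  two vertices without digons carry no cycle.\<close>

lemma acyclic_low:
  assumes K: "K \<subseteq> outdeg2 A \<union> outdeg2 (A\<inverse>)" "card (K \<inter> (outdeg2 A - outdeg2 (A\<inverse>))) \<le> 2" "card (K \<inter> (outdeg2 (A\<inverse>) - outdeg2 A)) \<le> 2"
  shows "acyclic (A \<inter> K \<times> K)"
proof -
  define P Q where "P = outdeg2 A" and "Q = outdeg2 (A\<inverse>)"
  have f: "finite P" "finite Q" unfolding P_def Q_def by (rule outdeg2_finite)+
  define l :: "'a \<Rightarrow> nat" where
    "l v = (if v \<notin> P then 0 else if v \<notin> Q then 3 else if \<exists>w \<in> Q. (v, w) \<in> A then 1 else 2)" for v
  have arc: "l u \<le> l v \<and> (l u = l v \<longrightarrow> l u = 0 \<or> l u = 3)" if uv: "(u, v) \<in> A" "u \<in> P \<union> Q" "v \<in> P \<union> Q" for u v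
  proof -
    consider "u \<notin> P" | "u \<in> P" "v \<in> Q" | "u \<in> P" "v \<notin> Q" "v \<in> P" using uv by blast
    then show ?thesis
    proof cases
      case 1
      then show ?thesis by (simp add: l_def)
    next
      case 2
      have i: "u \<in> Q" "v \<in> P" "\<And>w. (v, w) \<in> A \<Longrightarrow> w \<notin> Q"
        using bad_isolated[of u v] uv(1) 2 unfolding P_def Q_def by blast+
      have "l u = 1" using 2 i(1) uv(1) by (auto simp: l_def)
      moreover have "l v = 2" using 2 i(2,3) by (auto simp: l_def)
      ultimately show ?thesis by simp
    next
      case 3
      then show ?thesis by (simp add: l_def)
    qed
  qed
  have KPQ: "v \<in> P \<union> Q" if "v \<in> K" for v using that K(1) unfolding P_def Q_def by blast
  show ?thesis
  proof (rule acyclic_level[of _ l])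
    show "l u \<le> l v" if "(u, v) \<in> A \<inter> K \<times> K" for u v using arc[of u v] that KPQ by blast
    show "acyclic {(u, v) \<in> A \<inter> K \<times> K. l u = i \<and> l v = i}" for i
    proof -
      have l0: "v \<in> Q - P" if "l v = 0" "v \<in> K" for v using that KPQ[of v] by (auto simp: l_def split: if_splits)
      have l3: "v \<in> P - Q" if "l v = 3" for v using that by (auto simp: l_def split: if_splits)
      consider "i = 0" | "i = 3" | "i \<noteq> 0" "i \<noteq> 3" by blast
      then show ?thesis
      proof cases
        case 1
        have "acyclic (A \<inter> (K \<inter> (Q - P)) \<times> (K \<inter> (Q - P)))"
          by (rule acyclic_small) (use f K no_digon in \<open>auto simp: P_def Q_def\<close>)
        moreover have "{(u, v) \<in> A \<inter> K \<times> K. l u = i \<and> l v = i} \<subseteq> A \<inter> (K \<inter> (Q - P)) \<times> (K \<inter> (Q - P))"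
        proof
          fix e assume "e \<in> {(u, v) \<in> A \<inter> K \<times> K. l u = i \<and> l v = i}"
          then obtain u v where "e = (u, v)" "(u, v) \<in> A" "u \<in> K" "v \<in> K" "l u = 0" "l v = 0" using 1 by auto
          then show "e \<in> A \<inter> (K \<inter> (Q - P)) \<times> (K \<inter> (Q - P))" using l0[of u] l0[of v] by simp
        qed
        ultimately show ?thesis using acyclic_subset by blast
      next
        case 2
        have "acyclic (A \<inter> (K \<inter> (P - Q)) \<times> (K \<inter> (P - Q)))"
          by (rule acyclic_small) (use f K no_digon in \<open>auto simp: P_def Q_def\<close>)
        moreover have "{(u, v) \<in> A \<inter> K \<times> K. l u = i \<and> l v = i} \<subseteq> A \<inter> (K \<inter> (P - Q)) \<times> (K \<inter> (P - Q))"
        proof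
          fix e assume "e \<in> {(u, v) \<in> A \<inter> K \<times> K. l u = i \<and> l v = i}"
          then obtain u v where "e = (u, v)" "(u, v) \<in> A" "u \<in> K" "v \<in> K" "l u = 3" "l v = 3" using 2 by auto
          then show "e \<in> A \<inter> (K \<inter> (P - Q)) \<times> (K \<inter> (P - Q))" using l3[of u] l3[of v] by simp
        qed
        ultimately show ?thesis using acyclic_subset by blast
      next
        case 3
        have "\<not> (l u = i \<and> l v = i)" if "(u, v) \<in> A \<inter> K \<times> K" for u v
          using arc[of u v] KPQ[of u] KPQ[of v] that 3 by auto
        then have e: "{(u, v) \<in> A \<inter> K \<times> K. l u = i \<and> l v = i} = {}" by auto
        show ?thesis unfolding e by (simp add: acyclic_def)
      qed
    qed
  qed
qed

text \<open>\<open>P \<union> Q\<close> is one class and the vertices outside form the other. If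
  \<open>P - Q\<close> has three vertices, one of them and one of \<open>Q - P\<close> change sides;
  since \<open>rest A\<close> is then empty, every arc of the second class starts at the former or
  ends at the latter.\<close>

lemma contradiction: False
proof -
  define P Q where "P = outdeg2 A" and "Q = outdeg2 (A\<inverse>)"
  have f: "finite P" "finite Q" unfolding P_def Q_def by (rule outdeg2_finite)+
  have d: "card (P - Q) = card (Q - P)" "2 * card (rest A) + card (P - Q) \<le> 3"
    unfolding P_def Q_def by (rule degenerate)+
  have finr: "finite (rest A)" using fin(1) by (auto simp: rest_def intro: finite_subset[of _ A])
  have restI: "(u, v) \<in> rest A" if "(u, v) \<in> A" "u \<notin> P" "v \<notin> Q" for u v
    using that unfolding rest_def P_def Q_def by simp
  have low: "acyclic (A \<inter> K \<times> K)" if "K \<subseteq> P \<union> Q" "card (K \<inter> (P - Q)) \<le> 2" "card (K \<inter> (Q - P)) \<le> 2" for K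
    by (rule acyclic_low) (use that in \<open>simp_all add: P_def Q_def\<close>)
  have "colourable A"
  proof (cases "card (P - Q) \<le> 2")
    case True
    have PQ: "(P \<union> Q) \<inter> (P - Q) = P - Q" "(P \<union> Q) \<inter> (Q - P) = Q - P" by blast+
    have "acyclic (A \<inter> (P \<union> Q) \<times> (P \<union> Q))"
      by (rule low) (use True d PQ in auto)
    moreover have "acyclic (A \<inter> (- (P \<union> Q)) \<times> (- (P \<union> Q)))"
    proof -
      have sub: "A \<inter> (- (P \<union> Q)) \<times> (- (P \<union> Q)) \<subseteq> rest A" using restI by auto
      have "card (rest A) \<le> 1" using d(2) by linarith
      then consider "card (rest A) = 0" | "card (rest A) = 1" by linarith
      then have "\<exists>a b. a \<noteq> b \<and> rest A \<subseteq> {(a, b)} \<or> rest A = {}"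
      proof cases
        case 1
        then show ?thesis using finr by simp
      next
        case 2
        then obtain e where e: "rest A = {e}" by (rule card_1_singletonE)
        obtain a b where ab: "e = (a, b)" by (cases e)
        have "(a, b) \<in> A" using e ab by (auto simp: rest_def)
        then have "a \<noteq> b" using irr by auto
        then show ?thesis using e ab by blast
      qed
      then obtain a b where "a \<noteq> b \<and> rest A \<subseteq> {(a, b)} \<or> rest A = {}" by blast
      then show ?thesis
      proof
        assume h: "a \<noteq> b \<and> rest A \<subseteq> {(a, b)}"
        then have "A \<inter> (- (P \<union> Q)) \<times> (- (P \<union> Q)) \<subseteq> {(a, b)}" using sub by blast
        then show ?thesis using h by (auto intro: acyclic_subset_arc)
      next
        assume "rest A = {}"
        then have "A \<inter> (- (P \<union> Q)) \<times> (- (P \<union> Q)) = {}" using sub by blast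
        then show ?thesis by (simp add: acyclic_def)
      qed
    qed
    ultimately show ?thesis by (rule colour_split)
  next
    case False
    then have 3: "card (P - Q) = 3" "card (Q - P) = 3" "card (rest A) = 0" using d by linarith+
    have r0: "rest A = {}" using 3 finr by simp
    obtain h where h: "h \<in> P - Q" using 3(1) by (metis card.empty equals0I numeral_neq_zero zero_neq_numeral)
    obtain g where g: "g \<in> Q - P" using 3(2) by (metis card.empty equals0I numeral_neq_zero zero_neq_numeral)
    define K where "K = P \<union> Q - {g, h}"
    have "acyclic (A \<inter> K \<times> K)"
    proof (rule low)
      have "K \<inter> (P - Q) = (P - Q) - {h}" "K \<inter> (Q - P) = (Q - P) - {g}" unfolding K_def using g h by blast+
      then show "card (K \<inter> (P - Q)) \<le> 2" "card (K \<inter> (Q - P)) \<le> 2" using 3 g h f by simp_all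
    qed (auto simp: K_def)
    moreover have "acyclic (A \<inter> (- K) \<times> (- K))"
    proof (rule acyclic_rank[of _ "\<lambda>v. if v = h then 2 else if v = g then 0 else 1"])
      fix u v assume "(u, v) \<in> A \<inter> (- K) \<times> (- K)"
      then have uv: "(u, v) \<in> A" "u \<notin> K" "v \<notin> K" by auto
      have ne: "u \<noteq> v" using uv irr by auto
      have gh: "g \<noteq> h" using g h by blast
      have "u \<in> P \<or> v \<in> Q" using restI[OF uv(1)] r0 by blast
      then have "u = h \<or> v = g" using uv g h unfolding K_def by blast
      then show "(if v = h then 2 else if v = g then 0 else 1) < (if u = h then 2 else if u = g then 0 else (1 :: nat))"
        using ne gh uv g h unfolding K_def by auto
    qed
    ultimately show ?thesis by (rule colour_split)
  qed
  then show False using critical_not_colourable[OF crit] by simp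
qed

end

theorem critical_good:
  fixes A :: "('a \<times> 'a) set"
  assumes "critical A"
  shows "good A"
  using assms
proof (induction "card (Field A)" arbitrary: A rule: less_induct)
  case less
  show ?case
  proof (rule ccontr)
    assume ng: "\<not> good A"
    have "counterexample A"
    proof
      show "critical A" by (rule less.prems)
      show "good B" if "critical B" "card (Field B) < card (Field A)" for B :: "('a \<times> 'a) set"
        by (rule less.hyps[OF that(2,1)])
      show "\<not> special k A" for k using ng unfolding good_def by blast
      show "-1 \<le> val (Field A) A M" if "matching A M" for M
        using ng that unfolding good_def val_def by force
    qed
    then show False by (rule counterexample.contradiction)
  qed
qed

lemma special_digon: "special k A \<Longrightarrow> \<exists>a b. (a, b) \<in> A \<and> (b, a) \<in> A"
proof (induction rule: special.induct)
  case (triangle a b c)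
  show ?case by (rule exI[of _ a], rule exI[of _ b]) simp
next
  case (wheel z a b c)
  show ?case by (rule exI[of _ z], rule exI[of _ a]) simp
next
  case (subdivide k A a b p q)
  show ?case by (rule exI[of _ p], rule exI[of _ q]) simp
qed

text \<open>Without digons there are neither exceptional digraphs nor matching edges.\<close>

theorem oriented_critical_bound:
  assumes "critical A" and o: "\<And>u v. (u, v) \<in> A \<Longrightarrow> (v, u) \<notin> A"
  shows "7 * int (card (Field A)) + 2 \<le> 3 * int (card A)"
  using critical_good[OF assms(1)]
proof (cases rule: good_cases)
  case (1 k)
  then show ?thesis using special_digon[OF 1] o by blast
next
  case (2 M)
  have "M = {}" using 2(1) o unfolding matching_def by auto
  then show ?thesis using 2(2) by (simp add: val_def)
qed

section \<open>Dicritical digraphs\<close>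

lemma acyclic_digraph_iff:
  assumes "wf_digraph G"
  shows "acyclic_digraph G \<longleftrightarrow> acyclic (arcs_ends G)"
proof -
  interpret wf_digraph G by (rule assms)
  have r: "(x, x) \<in> (arcs_ends G)\<^sup>+ \<longleftrightarrow> (\<exists>p. awalk x p x \<and> p \<noteq> [])" for x by (rule reachable1_awalk)
  show ?thesis
  proof
    assume a: "acyclic_digraph G"
    show "acyclic (arcs_ends G)"
      unfolding acyclic_def
    proof (intro allI notI)
      fix x assume "(x, x) \<in> (arcs_ends G)\<^sup>+"
      then obtain p where "awalk x p x" "p \<noteq> []" using r by blast
      then have "closed_w p" unfolding closed_w_def by auto
      then show False using closed_w_imp_cycle a unfolding acyclic_digraph_def by blast
    qed
  next
    assume a: "acyclic (arcs_ends G)"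
    show "acyclic_digraph G"
      unfolding acyclic_digraph_def
    proof
      assume "\<exists>p. cycle p"
      then obtain u p where "awalk u p u" "p \<noteq> []" unfolding cycle_def by blast
      then have "(u, u) \<in> (arcs_ends G)\<^sup>+" using r by blast
      then show False using a unfolding acyclic_def by blast
    qed
  qed
qed

lemma arcs_ends_induce: "arcs_ends (G \<restriction> X) = arcs_ends G \<inter> X \<times> X"
  by (auto simp: arcs_ends_conv)

lemma dicolouring_iff:
  assumes "wf_digraph G"
  shows "dicolouring k G c \<longleftrightarrow> (\<forall>v \<in> verts G. c v \<in> {1..k}) \<and>
    (\<forall>i \<in> {1..k}. acyclic (arcs_ends G \<inter> {v \<in> verts G. c v = i} \<times> {v \<in> verts G. c v = i}))"
proof -
  have wf: "wf_digraph (G \<restriction> X)" for X by (rule wf_digraph.wellformed_induce_subgraph[OF assms])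
  show ?thesis unfolding dicolouring_def acyclic_digraph_iff[OF wf] arcs_ends_induce by (rule refl)
qed

lemma Field_arcs_ends: "wf_digraph G \<Longrightarrow> (u, v) \<in> arcs_ends G \<Longrightarrow> u \<in> verts G \<and> v \<in> verts G"
  using wf_digraph.tail_in_verts wf_digraph.head_in_verts by (fastforce simp: arcs_ends_conv)

lemma colourable_if_dicolouring:
  assumes "wf_digraph G" "dicolouring k G c" "k \<le> 2"
  shows "colourable (arcs_ends G)"
proof (rule colourableI)
  have c: "c v \<in> {1..k}" if "v \<in> verts G" for v using assms(2) that unfolding dicolouring_def by blast
  have c12: "c v = 1 \<or> c v = 2" if "v \<in> verts G" for v using c[OF that] assms(3) by auto
  show "acyclic (monochrom (\<lambda>v. c v = 1) (arcs_ends G))"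
  proof (rule acyclic_level[of _ c])
    show "c u \<le> c v" if "(u, v) \<in> monochrom (\<lambda>v. c v = 1) (arcs_ends G)" for u v
    proof -
      have "(u, v) \<in> arcs_ends G" "(c u = 1) = (c v = 1)" using that by (auto simp: monochrom_def)
      then show ?thesis using Field_arcs_ends[OF assms(1)] c12[of u] c12[of v] by auto
    qed
    show "acyclic {(u, v) \<in> monochrom (\<lambda>v. c v = 1) (arcs_ends G). c u = i \<and> c v = i}" for i
    proof -
      have sub: "{(u, v) \<in> monochrom (\<lambda>v. c v = 1) (arcs_ends G). c u = i \<and> c v = i}
          \<subseteq> arcs_ends G \<inter> {v \<in> verts G. c v = i} \<times> {v \<in> verts G. c v = i}"
        using Field_arcs_ends[OF assms(1)] by (auto simp: monochrom_def)
      show ?thesis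
      proof (cases "i \<in> {1..k}")
        case True
        then show ?thesis using assms(2) sub acyclic_subset unfolding dicolouring_iff[OF assms(1)] by blast
      next
        case False
        then have X: "{v \<in> verts G. c v = i} = {}" using c by blast
        have e: "{(u, v) \<in> monochrom (\<lambda>v. c v = 1) (arcs_ends G). c u = i \<and> c v = i} = {}"
          using sub unfolding X by simp
        show ?thesis unfolding e by (simp add: acyclic_def)
      qed
    qed
  qed
qed

lemma dicolouring_if_colourable:
  assumes "wf_digraph G" "colourable (arcs_ends G)"
  shows "\<exists>c. dicolouring 2 G c"
proof -
  obtain b where b: "acyclic (monochrom b (arcs_ends G))" using assms(2) by (auto simp: colourable_def)
  define c where "c v = (if b v then 1 else (2 :: nat))" for v
  have "acyclic (arcs_ends G \<inter> {v \<in> verts G. c v = i} \<times> {v \<in> verts G. c v = i})" for i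
  proof (rule acyclic_subset[OF b])
    show "arcs_ends G \<inter> {v \<in> verts G. c v = i} \<times> {v \<in> verts G. c v = i} \<subseteq> monochrom b (arcs_ends G)"
      by (auto simp: monochrom_def c_def split: if_splits)
  qed
  then have "dicolouring 2 G c" unfolding dicolouring_iff[OF assms(1)] by (simp add: c_def)
  then show ?thesis by blast
qed

text \<open>Injective colourings exist, so the minimum defining \<open>dichromatic_number\<close> is
  attained.\<close>

lemma ex_dicolouring:
  assumes "fin_digraph G" "loopfree_digraph G"
  shows "\<exists>k c. dicolouring k G c"
proof -
  interpret fin_digraph G by (rule assms)
  obtain h where h: "bij_betw h (verts G) {0..<card (verts G)}"
    using ex_bij_betw_finite_nat[OF finite_verts] by blast
  define c where "c v = Suc (h v)" for v
  have "c v \<in> {1..card (verts G)}" if "v \<in> verts G" for v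
  proof -
    have "h v \<in> {0..<card (verts G)}" using bij_betwE[OF h] that by blast
    then show ?thesis by (simp add: c_def)
  qed
  moreover have "acyclic (arcs_ends G \<inter> {v \<in> verts G. c v = i} \<times> {v \<in> verts G. c v = i})" for i
  proof -
    have inj: "inj_on h (verts G)" using h by (rule bij_betw_imp_inj_on)
    have "(u, v) \<notin> arcs_ends G" if "u \<in> verts G" "v \<in> verts G" "c u = i" "c v = i" for u v
    proof -
      have "u = v" using inj_onD[OF inj] that by (simp add: c_def)
      then show ?thesis using loopfree_digraph.no_loops[OF assms(2)] by (auto simp: arcs_ends_conv)
    qed
    then have "arcs_ends G \<inter> {v \<in> verts G. c v = i} \<times> {v \<in> verts G. c v = i} = {}" by blast
    then show ?thesis by (simp add: acyclic_def)
  qed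
  ultimately have "dicolouring (card (verts G)) G c" unfolding dicolouring_iff[OF wf_digraph] by blast
  then show ?thesis by blast
qed

lemma dichromatic_le_2_iff:
  assumes "fin_digraph G" "loopfree_digraph G"
  shows "dichromatic_number G \<le> 2 \<longleftrightarrow> colourable (arcs_ends G)"
proof
  have wf: "wf_digraph G" using assms(1) by (simp add: fin_digraph_def)
  assume "dichromatic_number G \<le> 2"
  moreover have "\<exists>c. dicolouring (dichromatic_number G) G c"
    unfolding dichromatic_number_def by (rule LeastI_ex[OF ex_dicolouring[OF assms]])
  ultimately show "colourable (arcs_ends G)" using colourable_if_dicolouring[OF wf] by blast
next
  have wf: "wf_digraph G" using assms(1) by (simp add: fin_digraph_def)
  assume "colourable (arcs_ends G)"
  then show "dichromatic_number G \<le> 2"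
    unfolding dichromatic_number_def by (intro Least_le dicolouring_if_colourable[OF wf])
qed

context
  fixes D :: "('a, 'b) pre_digraph"
  assumes D: "digraph D" and crit: "dicritical 3 D"
begin

interpretation digraph D by (rule D)

lemma subdigraph_colourable:
  assumes V: "V \<subseteq> verts D" and E: "E \<subseteq> arcs D" and VE: "\<And>e. e \<in> E \<Longrightarrow> tail D e \<in> V \<and> head D e \<in> V"
    and ne: "V \<noteq> verts D \<or> E \<noteq> arcs D"
  shows "colourable (arc_to_ends D ` E)"
proof -
  define H where "H = D\<lparr>verts := V, arcs := E\<rparr>"
  have s: "verts H = V" "arcs H = E" "tail H = tail D" "head H = head D" by (simp_all add: H_def)
  have fH: "fin_digraph H"
    by unfold_locales
      (use VE finite_subset[OF V finite_verts] finite_subset[OF E finite_arcs] in \<open>auto simp: s\<close>)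
  have lH: "loopfree_digraph H"
    by unfold_locales (use VE E no_loops in \<open>auto simp: s\<close>)
  have "subgraph H D"
    unfolding subgraph_def compatible_def s using V E wf_digraph fH by (auto simp: fin_digraph_def)
  then have "proper_subdigraph H D" unfolding proper_subdigraph_def s using ne by blast
  then have "dichromatic_number H < 3" using crit unfolding dicritical_def by blast
  then have "colourable (arcs_ends H)" using dichromatic_le_2_iff[OF fH lH] by simp
  moreover have "arcs_ends H = arc_to_ends D ` E" unfolding arcs_ends_def by (auto simp: arc_to_ends_def s)
  ultimately show ?thesis by simp
qed

lemma dicritical_not_colourable: "\<not> colourable (arcs_ends D)"
proof
  assume "colourable (arcs_ends D)"
  then have "dichromatic_number D \<le> 2" using dichromatic_le_2_iff[of D] by (simp add: fin_digraph_axioms loopfree_digraph_axioms)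
  then show False using crit unfolding dicritical_def by simp
qed

lemma dicritical_critical: "critical (arcs_ends D)"
  unfolding critical_def
proof (intro conjI allI impI)
  show "finite (arcs_ends D)" unfolding arcs_ends_def by simp
  show "irrefl (arcs_ends D)" unfolding irrefl_def using no_loops by (auto simp: arcs_ends_conv)
  show "\<not> colourable (arcs_ends D)" by (rule dicritical_not_colourable)
  fix B assume B: "B \<subset> arcs_ends D"
  define E where "E = {e \<in> arcs D. arc_to_ends D e \<in> B}"
  have BE: "B = arc_to_ends D ` E" using B unfolding E_def arcs_ends_def by blast
  have "colourable (arc_to_ends D ` E)"
  proof (rule subdigraph_colourable[OF subset_refl])
    have "E \<noteq> arcs D" using B BE unfolding arcs_ends_def by blast
    then show "verts D \<noteq> verts D \<or> E \<noteq> arcs D" by simp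
  qed (auto simp: E_def)
  then show "colourable B" using BE by simp
qed

text \<open>Deleting an isolated vertex would leave the arcs, and with them non-colourability,
  unchanged.\<close>

lemma dicritical_verts: "verts D = Field (arcs_ends D)"
proof
  show "Field (arcs_ends D) \<subseteq> verts D" using Field_arcs_ends[OF wf_digraph] by (auto simp: Field_def)
  show "verts D \<subseteq> Field (arcs_ends D)"
  proof
    fix v assume v: "v \<in> verts D"
    show "v \<in> Field (arcs_ends D)"
    proof (rule ccontr)
      assume nv: "v \<notin> Field (arcs_ends D)"
      have ve: "tail D e \<in> verts D - {v} \<and> head D e \<in> verts D - {v}" if "e \<in> arcs D" for e
      proof -
        have "(tail D e, head D e) \<in> arcs_ends D" using that by (auto simp: arcs_ends_conv)
        then have "tail D e \<noteq> v" "head D e \<noteq> v" using nv FieldI by metis+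
        then show ?thesis using that by simp
      qed
      have "colourable (arc_to_ends D ` arcs D)"
        by (rule subdigraph_colourable[OF Diff_subset subset_refl ve]) (use v in auto)
      then show False using dicritical_not_colourable unfolding arcs_ends_def by simp
    qed
  qed
qed

end

theorem theorem1p3:
  fixes D :: "('a, 'b) pre_digraph"
  assumes "oriented_graph D"
    and "dicritical 3 D"
  shows "real (card (arcs D)) \<ge> (7 * real (card (verts D)) + 2) / 3"
proof -
  interpret oriented_graph D by (rule assms(1))
  have crit: "critical (arcs_ends D)" by (rule dicritical_critical[OF digraph_axioms assms(2)])
  have "card (arcs_ends D) = card (arcs D)" unfolding arcs_ends_def by (rule card_image[OF inj_on_arc_to_ends])
  moreover have "verts D = Field (arcs_ends D)" by (rule dicritical_verts[OF digraph_axioms assms(2)])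
  ultimately have "7 * int (card (verts D)) + 2 \<le> 3 * int (card (arcs D))"
    using oriented_critical_bound[OF crit no_opposite_arcs] by simp
  then have "7 * card (verts D) + 2 \<le> 3 * card (arcs D)" by linarith
  then have "real (7 * card (verts D) + 2) \<le> real (3 * card (arcs D))" by (rule of_nat_mono)
  then show ?thesis by simp
qed

end
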